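(* Let $\Sigma$ be a nondegenerate immersed hypersurface in an $(n+1)$-dimensional manifold $M$ equipped with a torsion-free affine connection $\hat\nabla$. (1) There is a unique line field $W$ transverse to $\Sigma$ such that the connection $\nabla$ induced on $\Sigma$ by $\hat\nabla$ and $W$ is aligned with respect to the metric $k$ induced on an open $U\subset\Sigma$ by any nonvanishing section of $W$ over $U$. (2) If $\Sigma$ is co-oriented and $\Psi$ is a volume form on $M$ preserved by $\hat\nabla$ then there is a unique co-oriented section $\mathsf W$ of $W$ such that the volume density $|\iota(\mathsf W)\Psi|$ equals the volume density $|\mathrm{vol}_k|$ of the metric $k$ induced by $\mathsf W$. (3) If $\Sigma$ is co-oriented and $\hat\nabla$ is projectively flat and preserves the volume form $\Psi$, then the connection $\nabla$ induced on $\Sigma$ by $\hat\nabla$ via the transversal $\mathsf W$ of (2) preserves the induced volume densities $|\iota(\mathsf W)\Psi|$ and $|\mathrm{vol}_k|$. (4) If $M=\mathbb{R}^{n+1}$ and $\hat\nabla$ and $\Psi$ are the standard flat affine connection and standard volume form then the transversal $\mathsf W$ of (2) is the equiaffine normal.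
   Context: A vector field $T$ transverse to $\Sigma$ determines on $\Sigma$ an induced connection $\nabla$, a symmetric covariant two-tensor $h$ (the induced "metric"), a shape operator $S$ and a one-form $\tau$ by $\hat\nabla_XY=\nabla_XY+h(X,Y)T$ and $\hat\nabla_XT=-S(X)+\tau(X)T$ for $X,Y$ tangent to $\Sigma$. $\Sigma$ is nondegenerate if $h$ is nondegenerate; this does not depend on $T$. Replacing $T$ by $aT$ with $a$ a nonvanishing function does not change $\nabla$ and multiplies $h$ by $a^{-1}$, so a transverse line field determines $\nabla$ and the conformal class of $h$ (up to sign). A torsion-free connection $\nabla$ on an $n$-manifold is aligned with respect to a pseudo-Riemannian metric $h$ (equivalently with respect to its conformal class) if $n\,h^{PQ}\nabla_Ph_{QI}=h^{PQ}\nabla_Ih_{PQ}$, where $h^{IJ}$ is the inverse of $h_{IJ}$. $\hat\nabla$ is projectively flat if locally there is a one-form $\gamma$ such that the connection $\hat\nabla_XY+\gamma(X)Y+\gamma(Y)X$ is flat. In $\mathbb{R}^{n+1}$, the equiaffine normal of a co-oriented nondegenerate hypersurface is the unique co-oriented transversal $\mathsf W$ such that $|\iota(\mathsf W)\Psi|$ equals the volume density of the corresponding $h$ and is parallel with respect to the corresponding induced connection.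
   Formalization: The formal theorem assumes n ≥ 2: for n = 1 the alignment condition is an identity, so every transverse line field is aligned and the uniqueness claimed in (1) fails. *)

theory Defs
  imports "HOL-Analysis.Analysis"
begin

section \<open>Smooth manifolds and tangent vectors\<close>

text \<open>\<open>smooth_on A f\<close> is meant for open sets \<open>A\<close> of a Euclidean space; it says that \<open>f\<close> is
  \<open>C\<^sup>\<infinity>\<close> on \<open>A\<close>: all iterated directional derivatives exist in the Frechet sense.\<close>

primrec times_differentiable_on ::
    "nat \<Rightarrow> 'a::euclidean_space set \<Rightarrow> ('a \<Rightarrow> 'b::real_normed_vector) \<Rightarrow> bool" where
  "times_differentiable_on 0 A f \<longleftrightarrow> continuous_on A f"
| "times_differentiable_on (Suc k) A f \<longleftrightarrow>
     (\<forall>x\<in>A. f differentiable (at x)) \<and>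
     (\<forall>v. times_differentiable_on k A (\<lambda>x. frechet_derivative f (at x) v))"

definition smooth_on :: "'a::euclidean_space set \<Rightarrow> ('a \<Rightarrow> 'b::real_normed_vector) \<Rightarrow> bool" where
  "smooth_on A f \<longleftrightarrow> (\<forall>k. times_differentiable_on k A f)"

type_synonym ('m, 'e) chart = "'m set \<times> ('m \<Rightarrow> 'e)"

record ('m, 'e) mfd =
  mtop :: "'m topology"
  atlas :: "('m, 'e) chart set"

abbreviation points :: "('m, 'e) mfd \<Rightarrow> 'm set" where
  "points M \<equiv> topspace (mtop M)"

definition chart_inv :: "('m, 'e) chart \<Rightarrow> 'e \<Rightarrow> 'm" where
  "chart_inv c = inv_into (fst c) (snd c)"

definition is_chart :: "'m topology \<Rightarrow> ('m, 'e::euclidean_space) chart \<Rightarrow> bool" where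
  "is_chart X c \<longleftrightarrow> openin X (fst c) \<and> open (snd c ` fst c) \<and>
     homeomorphic_map (subtopology X (fst c)) (top_of_set (snd c ` fst c)) (snd c)"

text \<open>The smooth structure is given by an arbitrary (not necessarily maximal) smooth atlas. The
  dimension of the manifold is the dimension of the model space \<open>'e\<close>.\<close>

definition smooth_manifold :: "('m, 'e::euclidean_space) mfd \<Rightarrow> bool" where
  "smooth_manifold M \<longleftrightarrow>
     Hausdorff_space (mtop M) \<and> second_countable (mtop M) \<and>
     (\<forall>c\<in>atlas M. is_chart (mtop M) c) \<and>
     (\<Union>c\<in>atlas M. fst c) = points M \<and>
     (\<forall>c\<in>atlas M. \<forall>d\<in>atlas M. smooth_on (snd c ` (fst c \<inter> fst d)) (snd d \<circ> chart_inv c))"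

definition chart_at :: "('m, 'e) mfd \<Rightarrow> 'm \<Rightarrow> ('m, 'e) chart" where
  "chart_at M p = (SOME c. c \<in> atlas M \<and> p \<in> fst c)"

text \<open>A tangent vector at \<open>p\<close> is the family of its components in all the charts around \<open>p\<close>; the
  components transform by the derivatives of the transition maps. The components with respect to
  charts that do not contain \<open>p\<close> are set to \<open>0\<close>, so that tangent vectors are equal iff they are
  equal as functions.\<close>

type_synonym ('m, 'e) tvec = "('m, 'e) chart \<Rightarrow> 'e"
type_synonym ('m, 'e) vfield = "'m \<Rightarrow> ('m, 'e) tvec"

definition tangent_space ::
    "('m, 'e::euclidean_space) mfd \<Rightarrow> 'm \<Rightarrow> ('m, 'e) tvec set" where
  "tangent_space M p =
     {v. (\<forall>c. \<not> (c \<in> atlas M \<and> p \<in> fst c) \<longrightarrow> v c = 0) \<and>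
         (\<forall>c\<in>atlas M. \<forall>d\<in>atlas M. p \<in> fst c \<and> p \<in> fst d \<longrightarrow>
            v d = frechet_derivative (snd d \<circ> chart_inv c) (at (snd c p)) (v c))}"

text \<open>\<open>dirderiv M p v f\<close> is the derivative at \<open>p\<close> along the tangent vector \<open>v\<close> of a
  vector-space valued function \<open>f\<close> on \<open>M\<close>, computed in some chart around \<open>p\<close>.\<close>

definition dirderiv ::
    "('m, 'e::euclidean_space) mfd \<Rightarrow> 'm \<Rightarrow> ('m, 'e) tvec \<Rightarrow> ('m \<Rightarrow> 'b::real_normed_vector) \<Rightarrow> 'b"
  where
  "dirderiv M p v f =
     frechet_derivative (f \<circ> chart_inv (chart_at M p)) (at (snd (chart_at M p) p))
       (v (chart_at M p))"

definition smooth_fun :: "('m, 'e::euclidean_space) mfd \<Rightarrow> 'm set \<Rightarrow> ('m \<Rightarrow> real) \<Rightarrow> bool" where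
  "smooth_fun M U f \<longleftrightarrow> (\<forall>c\<in>atlas M. smooth_on (snd c ` (U \<inter> fst c)) (f \<circ> chart_inv c))"

definition smooth_map ::
    "('s, 'a::euclidean_space) mfd \<Rightarrow> ('m, 'e::euclidean_space) mfd \<Rightarrow> ('s \<Rightarrow> 'm) \<Rightarrow> bool" where
  "smooth_map S M i \<longleftrightarrow> continuous_map (mtop S) (mtop M) i \<and>
     (\<forall>c\<in>atlas S. \<forall>d\<in>atlas M.
        smooth_on (snd c ` (fst c \<inter> i -` fst d)) (snd d \<circ> i \<circ> chart_inv c))"

definition differential ::
    "('s, 'a::euclidean_space) mfd \<Rightarrow> ('m, 'e::euclidean_space) mfd \<Rightarrow> ('s \<Rightarrow> 'm) \<Rightarrow>
     's \<Rightarrow> ('s, 'a) tvec \<Rightarrow> ('m, 'e) tvec" where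
  "differential S M i p v =
     (\<lambda>d. if d \<in> atlas M \<and> i p \<in> fst d then dirderiv S p v (snd d \<circ> i) else 0)"

definition immersion ::
    "('s, 'a::euclidean_space) mfd \<Rightarrow> ('m, 'e::euclidean_space) mfd \<Rightarrow> ('s \<Rightarrow> 'm) \<Rightarrow> bool" where
  "immersion S M i \<longleftrightarrow> smooth_map S M i \<and>
     (\<forall>p\<in>points S. inj_on (differential S M i p) (tangent_space S p))"

text \<open>Smooth vector fields along \<open>i\<close> over \<open>U\<close>, that is, smooth sections over \<open>U\<close> of the pullback of
  the tangent bundle of \<open>M\<close>. The values outside \<open>U\<close> are irrelevant.\<close>

definition vfields_along ::
    "('s, 'a::euclidean_space) mfd \<Rightarrow> ('m, 'e::euclidean_space) mfd \<Rightarrow> ('s \<Rightarrow> 'm) \<Rightarrow>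
     's set \<Rightarrow> ('s \<Rightarrow> ('m, 'e) tvec) set" where
  "vfields_along S M i U =
     {Y. (\<forall>p\<in>U. Y p \<in> tangent_space M (i p)) \<and>
         (\<forall>c\<in>atlas S. \<forall>d\<in>atlas M.
            smooth_on (snd c ` (U \<inter> fst c \<inter> i -` fst d)) (\<lambda>x. Y (chart_inv c x) d))}"

abbreviation vfields :: "('m, 'e::euclidean_space) mfd \<Rightarrow> 'm set \<Rightarrow> ('m, 'e) vfield set" where
  "vfields M U \<equiv> vfields_along M M id U"

definition lie_bracket ::
    "('m, 'e::euclidean_space) mfd \<Rightarrow> ('m, 'e) vfield \<Rightarrow> ('m, 'e) vfield \<Rightarrow> ('m, 'e) vfield" where
  "lie_bracket M X Y = (\<lambda>p c. if c \<in> atlas M \<and> p \<in> fst c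
     then dirderiv M p (X p) (\<lambda>q. Y q c) - dirderiv M p (Y p) (\<lambda>q. X q c) else 0)"

definition frame_at ::
    "('m, 'e::euclidean_space) mfd \<Rightarrow> 'm \<Rightarrow> ('k::finite \<Rightarrow> ('m, 'e) tvec) \<Rightarrow> bool" where
  "frame_at M p v \<longleftrightarrow> (\<forall>j. v j \<in> tangent_space M p) \<and>
     (\<forall>a. (\<forall>c. (\<Sum>j\<in>UNIV. a j *\<^sub>R v j c) = 0) \<longrightarrow> (\<forall>j. a j = 0))"

text \<open>Here \<open>real ^ 'k\<close> is the model space, so that a linearly independent family indexed by \<open>'k\<close> is
  a basis of the tangent space.\<close>

definition local_frame ::
    "('m, real ^ 'k) mfd \<Rightarrow> 'm set \<Rightarrow> ('k::finite \<Rightarrow> ('m, real ^ 'k) vfield) \<Rightarrow> bool" where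
  "local_frame M U E \<longleftrightarrow> (\<forall>j. E j \<in> vfields M U) \<and> (\<forall>p\<in>U. frame_at M p (\<lambda>j. E j p))"


section \<open>Affine connections\<close>

text \<open>A connection is an operator on locally defined vector fields. On an open set \<open>U\<close> its value
  depends only on the restrictions to \<open>U\<close> of the arguments, so that a single operator carries the
  covariant derivatives on all open sets and these commute with restriction.\<close>

type_synonym ('m, 'e) conn = "('m, 'e) vfield \<Rightarrow> ('m, 'e) vfield \<Rightarrow> ('m, 'e) vfield"

definition affine_connection ::
    "('m, 'e::euclidean_space) mfd \<Rightarrow> ('m, 'e) conn \<Rightarrow> bool" where
  "affine_connection M N \<longleftrightarrow>
     (\<forall>U. openin (mtop M) U \<longrightarrow> (\<forall>X\<in>vfields M U. \<forall>Y\<in>vfields M U.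
        N X Y \<in> vfields M U \<and>
        (\<forall>X'\<in>vfields M U. \<forall>Y'\<in>vfields M U. (\<forall>p\<in>U. X' p = X p \<and> Y' p = Y p) \<longrightarrow>
           (\<forall>p\<in>U. N X' Y' p = N X Y p)) \<and>
        (\<forall>Z\<in>vfields M U. \<forall>p\<in>U. \<forall>c.
           N (\<lambda>q b. X q b + Z q b) Y p c = N X Y p c + N Z Y p c \<and>
           N X (\<lambda>q b. Y q b + Z q b) p c = N X Y p c + N X Z p c) \<and>
        (\<forall>f. smooth_fun M U f \<longrightarrow> (\<forall>p\<in>U. \<forall>c.
           N (\<lambda>q b. f q *\<^sub>R X q b) Y p c = f p *\<^sub>R N X Y p c \<and>
           N X (\<lambda>q b. f q *\<^sub>R Y q b) p c =
             f p *\<^sub>R N X Y p c + dirderiv M p (X p) f *\<^sub>R Y p c))))"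

definition torsion_free ::
    "('m, 'e::euclidean_space) mfd \<Rightarrow> ('m, 'e) conn \<Rightarrow> bool" where
  "torsion_free M N \<longleftrightarrow>
     (\<forall>U. openin (mtop M) U \<longrightarrow> (\<forall>X\<in>vfields M U. \<forall>Y\<in>vfields M U. \<forall>p\<in>U. \<forall>c.
        N X Y p c - N Y X p c = lie_bracket M X Y p c))"

definition flat_on ::
    "('m, 'e::euclidean_space) mfd \<Rightarrow> 'm set \<Rightarrow> ('m, 'e) conn \<Rightarrow> bool" where
  "flat_on M U N \<longleftrightarrow>
     (\<forall>V. openin (mtop M) V \<and> V \<subseteq> U \<longrightarrow>
        (\<forall>X\<in>vfields M V. \<forall>Y\<in>vfields M V. \<forall>Z\<in>vfields M V. \<forall>p\<in>V. \<forall>c.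
           N X (N Y Z) p c - N Y (N X Z) p c - N (lie_bracket M X Y) Z p c = 0))"

definition one_form_on ::
    "('m, 'e::euclidean_space) mfd \<Rightarrow> 'm set \<Rightarrow> ('m \<Rightarrow> ('m, 'e) tvec \<Rightarrow> real) \<Rightarrow> bool" where
  "one_form_on M U \<gamma> \<longleftrightarrow>
     (\<forall>p\<in>U. \<forall>u\<in>tangent_space M p. \<forall>v\<in>tangent_space M p. \<forall>r.
        \<gamma> p (\<lambda>c. r *\<^sub>R u c + v c) = r * \<gamma> p u + \<gamma> p v) \<and>
     (\<forall>V. openin (mtop M) V \<and> V \<subseteq> U \<longrightarrow>
        (\<forall>X\<in>vfields M V. smooth_fun M V (\<lambda>p. \<gamma> p (X p))))"

definition projectively_flat ::
    "('m, 'e::euclidean_space) mfd \<Rightarrow> ('m, 'e) conn \<Rightarrow> bool" where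
  "projectively_flat M N \<longleftrightarrow>
     (\<forall>p\<in>points M. \<exists>U \<gamma>. openin (mtop M) U \<and> p \<in> U \<and> one_form_on M U \<gamma> \<and>
        flat_on M U (\<lambda>X Y q c. N X Y q c + \<gamma> q (X q) *\<^sub>R Y q c + \<gamma> q (Y q) *\<^sub>R X q c))"


section \<open>Volume forms and densities\<close>

text \<open>Forms of top degree and densities take their arguments as families indexed by the index type
  of the model space.\<close>

definition volume_form ::
    "('m, real ^ 'k) mfd \<Rightarrow> ('m \<Rightarrow> ('k::finite \<Rightarrow> ('m, real ^ 'k) tvec) \<Rightarrow> real) \<Rightarrow> bool" where
  "volume_form M \<Psi> \<longleftrightarrow>
     (\<forall>p\<in>points M. \<forall>v. (\<forall>j. v j \<in> tangent_space M p) \<longrightarrow>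
        (\<forall>j. \<forall>u\<in>tangent_space M p. \<forall>w\<in>tangent_space M p. \<forall>r.
           \<Psi> p (v(j := (\<lambda>c. r *\<^sub>R u c + w c))) = r * \<Psi> p (v(j := u)) + \<Psi> p (v(j := w))) \<and>
        (\<forall>j l. j \<noteq> l \<and> v j = v l \<longrightarrow> \<Psi> p v = 0)) \<and>
     (\<forall>p\<in>points M. \<exists>v. (\<forall>j. v j \<in> tangent_space M p) \<and> \<Psi> p v \<noteq> 0) \<and>
     (\<forall>U E. openin (mtop M) U \<and> (\<forall>j. E j \<in> vfields M U) \<longrightarrow>
        smooth_fun M U (\<lambda>p. \<Psi> p (\<lambda>j. E j p)))"

definition preserves_form ::
    "('m, real ^ 'k) mfd \<Rightarrow> ('m, real ^ 'k) conn \<Rightarrow>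
     ('m \<Rightarrow> ('k::finite \<Rightarrow> ('m, real ^ 'k) tvec) \<Rightarrow> real) \<Rightarrow> bool" where
  "preserves_form M N \<Psi> \<longleftrightarrow>
     (\<forall>U X E. openin (mtop M) U \<and> X \<in> vfields M U \<and> (\<forall>j. E j \<in> vfields M U) \<longrightarrow>
        (\<forall>p\<in>U. dirderiv M p (X p) (\<lambda>q. \<Psi> q (\<lambda>j. E j q)) =
           (\<Sum>j\<in>UNIV. \<Psi> p ((\<lambda>l. E l p)(j := N X (E j) p)))))"

text \<open>For a density \<open>\<mu>\<close> and a local frame \<open>E\<close> with \<open>\<nabla>\<^sub>X E\<^sub>j = \<Sum>\<^sub>i B\<^sub>i\<^sub>j E\<^sub>i\<close> one has
  \<open>(\<nabla>\<^sub>X \<mu>)(E) = X(\<mu>(E)) - tr(B) \<mu>(E)\<close>.\<close>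

definition preserves_density ::
    "('s, real ^ 'n) mfd \<Rightarrow> ('s, real ^ 'n) conn \<Rightarrow>
     ('s \<Rightarrow> ('n::finite \<Rightarrow> ('s, real ^ 'n) tvec) \<Rightarrow> real) \<Rightarrow> bool" where
  "preserves_density S N \<mu> \<longleftrightarrow>
     (\<forall>U X E. openin (mtop S) U \<and> X \<in> vfields S U \<and> local_frame S U E \<longrightarrow>
        (\<forall>p\<in>U. \<forall>B :: real ^ 'n ^ 'n.
           (\<forall>j c. N X (E j) p c = (\<Sum>i\<in>UNIV. (B $ i $ j) *\<^sub>R E i p c)) \<longrightarrow>
           dirderiv S p (X p) (\<lambda>q. \<mu> q (\<lambda>j. E j q)) = trace B * \<mu> p (\<lambda>j. E j p)))"

definition density_eq ::
    "('s, real ^ 'n) mfd \<Rightarrow>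
     ('s \<Rightarrow> ('n::finite \<Rightarrow> ('s, real ^ 'n) tvec) \<Rightarrow> real) \<Rightarrow>
     ('s \<Rightarrow> ('n \<Rightarrow> ('s, real ^ 'n) tvec) \<Rightarrow> real) \<Rightarrow> bool" where
  "density_eq S \<mu> \<nu> \<longleftrightarrow>
     (\<forall>p\<in>points S. \<forall>v. (\<forall>j. v j \<in> tangent_space S p) \<longrightarrow> \<mu> p v = \<nu> p v)"

definition metric_density ::
    "('s \<Rightarrow> ('s, real ^ 'n) tvec \<Rightarrow> ('s, real ^ 'n) tvec \<Rightarrow> real) \<Rightarrow>
     's \<Rightarrow> ('n::finite \<Rightarrow> ('s, real ^ 'n) tvec) \<Rightarrow> real" where
  "metric_density k p v = sqrt \<bar>det (\<chi> a b. k p (v a) (v b))\<bar>"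


section \<open>Structures induced on an immersed hypersurface\<close>

text \<open>In all that follows \<open>S\<close> is a manifold modelled on \<open>real ^ 'n\<close> and \<open>M\<close> one modelled on
  \<open>real ^ 'n option\<close>, so that \<open>i : S \<rightarrow> M\<close> has codimension one. The density \<open>|\<iota>(T)\<Psi>|\<close> on \<open>S\<close> is
  obtained by putting \<open>T\<close> into the argument \<open>None\<close>.\<close>

definition induced_density ::
    "('s, real ^ 'n) mfd \<Rightarrow> ('m, real ^ 'n option) mfd \<Rightarrow> ('s \<Rightarrow> 'm) \<Rightarrow>
     ('m \<Rightarrow> ('n::finite option \<Rightarrow> ('m, real ^ 'n option) tvec) \<Rightarrow> real) \<Rightarrow>
     ('s \<Rightarrow> ('m, real ^ 'n option) tvec) \<Rightarrow>
     's \<Rightarrow> ('n \<Rightarrow> ('s, real ^ 'n) tvec) \<Rightarrow> real" where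
  "induced_density S M i \<Psi> T p v =
     \<bar>\<Psi> (i p) (case_option (T p) (\<lambda>j. differential S M i p (v j)))\<bar>"

text \<open>The vector field \<open>coord_field M d u\<close> has constant components \<open>u\<close> in the chart \<open>d\<close>.\<close>

definition coord_field ::
    "('m, 'e::euclidean_space) mfd \<Rightarrow> ('m, 'e) chart \<Rightarrow> 'e \<Rightarrow> ('m, 'e) vfield" where
  "coord_field M d u = (\<lambda>q c. if q \<in> fst d \<and> c \<in> atlas M \<and> q \<in> fst c
     then frechet_derivative (snd c \<circ> chart_inv d) (at (snd d q)) u else 0)"

text \<open>The covariant derivative \<open>\<nabla>\<^sub>X Y\<close> of a vector field \<open>Y\<close> along \<open>i\<close> in the direction of a vector
  field \<open>X\<close> on \<open>S\<close>, that is, the pullback connection, which is determined by the Leibniz rule and by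
  \<open>\<nabla>\<^sub>X (E \<circ> i) = \<nabla>\<^bsub>di(X)\<^esub> E\<close> for vector fields \<open>E\<close> on \<open>M\<close>. The formula results from expanding
  \<open>Y\<close> in the coordinate fields of the chart \<open>d\<close>.\<close>

definition pullback_conn ::
    "('s, 'a::euclidean_space) mfd \<Rightarrow> ('m, 'e::euclidean_space) mfd \<Rightarrow> ('m, 'e) conn \<Rightarrow>
     ('s \<Rightarrow> 'm) \<Rightarrow> ('s, 'a) vfield \<Rightarrow> ('s \<Rightarrow> ('m, 'e) tvec) \<Rightarrow> 's \<Rightarrow> ('m, 'e) tvec" where
  "pullback_conn S M N i X Y p = (\<lambda>d. if d \<in> atlas M \<and> i p \<in> fst d
     then dirderiv S p (X p) (\<lambda>q. Y q d)
        + N (coord_field M d (differential S M i p (X p) d)) (coord_field M d (Y p d)) (i p) d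
     else 0)"

definition transverse_field ::
    "('s, 'a::euclidean_space) mfd \<Rightarrow> ('m, 'e::euclidean_space) mfd \<Rightarrow> ('s \<Rightarrow> 'm) \<Rightarrow>
     's set \<Rightarrow> ('s \<Rightarrow> ('m, 'e) tvec) \<Rightarrow> bool" where
  "transverse_field S M i U T \<longleftrightarrow> T \<in> vfields_along S M i U \<and>
     (\<forall>p\<in>U. T p \<notin> differential S M i p ` tangent_space S p)"

definition line_spanned :: "('s \<Rightarrow> ('m, 'e::real_vector) tvec) \<Rightarrow> 's \<Rightarrow> ('m, 'e) tvec set" where
  "line_spanned T p = {(\<lambda>d. r *\<^sub>R T p d) | r. True}"

definition transverse_line_field ::
    "('s, 'a::euclidean_space) mfd \<Rightarrow> ('m, 'e::euclidean_space) mfd \<Rightarrow> ('s \<Rightarrow> 'm) \<Rightarrow>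
     ('s \<Rightarrow> ('m, 'e) tvec set) \<Rightarrow> bool" where
  "transverse_line_field S M i W \<longleftrightarrow> W \<in> extensional (points S) \<and>
     (\<forall>p\<in>points S. \<exists>U T. openin (mtop S) U \<and> p \<in> U \<and> transverse_field S M i U T \<and>
        (\<forall>q\<in>U. W q = line_spanned T q))"

definition nonvanishing_section ::
    "('s, 'a::euclidean_space) mfd \<Rightarrow> ('m, 'e::euclidean_space) mfd \<Rightarrow> ('s \<Rightarrow> 'm) \<Rightarrow>
     ('s \<Rightarrow> ('m, 'e) tvec set) \<Rightarrow> 's set \<Rightarrow> ('s \<Rightarrow> ('m, 'e) tvec) \<Rightarrow> bool" where
  "nonvanishing_section S M i W U T \<longleftrightarrow> T \<in> vfields_along S M i U \<and>
     (\<forall>p\<in>U. T p \<in> W p \<and> T p \<noteq> (\<lambda>d. 0))"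

text \<open>The induced connection and the induced two-tensor are the components in the decomposition
  \<open>\<nabla>\<^sub>X (di(Y)) = di(\<nabla>\<^sub>X Y) + h(X,Y) T\<close>. The first one depends only on the line field spanned by
  \<open>T\<close>. For the second one \<open>h\<close> is evaluated at tangent vectors by extending them to local vector
  fields, the choice of which does not matter because \<open>h\<close> is tensorial.\<close>

definition induced_conn ::
    "('s, 'a::euclidean_space) mfd \<Rightarrow> ('m, 'e::euclidean_space) mfd \<Rightarrow> ('m, 'e) conn \<Rightarrow>
     ('s \<Rightarrow> 'm) \<Rightarrow> ('s \<Rightarrow> ('m, 'e) tvec set) \<Rightarrow> ('s, 'a) conn" where
  "induced_conn S M N i W X Y p = (THE w. w \<in> tangent_space S p \<and>
     (\<exists>t\<in>W p. \<forall>d. pullback_conn S M N i X (\<lambda>q. differential S M i q (Y q)) p d =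
        differential S M i p w d + t d))"

definition induced_metric ::
    "('s, 'a::euclidean_space) mfd \<Rightarrow> ('m, 'e::euclidean_space) mfd \<Rightarrow> ('m, 'e) conn \<Rightarrow>
     ('s \<Rightarrow> 'm) \<Rightarrow> ('s \<Rightarrow> ('m, 'e) tvec) \<Rightarrow> 's \<Rightarrow> ('s, 'a) tvec \<Rightarrow> ('s, 'a) tvec \<Rightarrow> real" where
  "induced_metric S M N i T p u v = (THE r. \<exists>V X Y. openin (mtop S) V \<and> p \<in> V \<and>
     X \<in> vfields S V \<and> Y \<in> vfields S V \<and> X p = u \<and> Y p = v \<and>
     (\<exists>w\<in>tangent_space S p.
        \<forall>d. pullback_conn S M N i X (\<lambda>q. differential S M i q (Y q)) p d =
          differential S M i p w d + r *\<^sub>R T p d))"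

definition nondegenerate_at ::
    "('s, 'a::euclidean_space) mfd \<Rightarrow> ('s \<Rightarrow> ('s, 'a) tvec \<Rightarrow> ('s, 'a) tvec \<Rightarrow> real) \<Rightarrow> 's \<Rightarrow> bool"
  where
  "nondegenerate_at S h p \<longleftrightarrow>
     (\<forall>u\<in>tangent_space S p. (\<forall>v\<in>tangent_space S p. h p u v = 0) \<longrightarrow> u = (\<lambda>c. 0))"

definition nondegenerate_hypersurface ::
    "('s, real ^ 'n) mfd \<Rightarrow> ('m, real ^ 'n::finite option) mfd \<Rightarrow>
     ('m, real ^ 'n option) conn \<Rightarrow> ('s \<Rightarrow> 'm) \<Rightarrow> bool" where
  "nondegenerate_hypersurface S M N i \<longleftrightarrow>
     smooth_manifold S \<and> smooth_manifold M \<and>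
     affine_connection M N \<and> torsion_free M N \<and> immersion S M i \<and>
     (\<forall>p\<in>points S. \<exists>U T. openin (mtop S) U \<and> p \<in> U \<and> transverse_field S M i U T \<and>
        (\<forall>q\<in>U. nondegenerate_at S (induced_metric S M N i T) q))"

definition cov_deriv_tensor ::
    "('s, 'a::euclidean_space) mfd \<Rightarrow> ('s, 'a) conn \<Rightarrow>
     ('s \<Rightarrow> ('s, 'a) tvec \<Rightarrow> ('s, 'a) tvec \<Rightarrow> real) \<Rightarrow>
     ('s, 'a) vfield \<Rightarrow> ('s, 'a) vfield \<Rightarrow> ('s, 'a) vfield \<Rightarrow> 's \<Rightarrow> real" where
  "cov_deriv_tensor S N h X Y Z p =
     dirderiv S p (X p) (\<lambda>q. h q (Y q) (Z q)) - h p (N X Y p) (Z p) - h p (Y p) (N X Z p)"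

text \<open>Alignment, \<open>n h\<^sup>P\<^sup>Q \<nabla>\<^sub>P h\<^sub>Q\<^sub>I = h\<^sup>P\<^sup>Q \<nabla>\<^sub>I h\<^sub>P\<^sub>Q\<close>, in components with respect to local frames.\<close>

definition aligned ::
    "('s, real ^ 'n::finite) mfd \<Rightarrow> 's set \<Rightarrow> ('s, real ^ 'n) conn \<Rightarrow>
     ('s \<Rightarrow> ('s, real ^ 'n) tvec \<Rightarrow> ('s, real ^ 'n) tvec \<Rightarrow> real) \<Rightarrow> bool" where
  "aligned S U N h \<longleftrightarrow>
     (\<forall>V E. openin (mtop S) V \<and> V \<subseteq> U \<and> local_frame S V E \<longrightarrow>
        (\<forall>p\<in>V. \<forall>I. let H = matrix_inv (\<chi> P Q. h p (E P p) (E Q p)) in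
           real CARD('n) *
             (\<Sum>P\<in>UNIV. \<Sum>Q\<in>UNIV. H $ P $ Q * cov_deriv_tensor S N h (E P) (E Q) (E I) p) =
           (\<Sum>P\<in>UNIV. \<Sum>Q\<in>UNIV. H $ P $ Q * cov_deriv_tensor S N h (E I) (E P) (E Q) p)))"

definition aligned_line_field ::
    "('s, real ^ 'n) mfd \<Rightarrow> ('m, real ^ 'n::finite option) mfd \<Rightarrow>
     ('m, real ^ 'n option) conn \<Rightarrow> ('s \<Rightarrow> 'm) \<Rightarrow>
     ('s \<Rightarrow> ('m, real ^ 'n option) tvec set) \<Rightarrow> bool" where
  "aligned_line_field S M N i W \<longleftrightarrow> transverse_line_field S M i W \<and>
     (\<forall>U T. openin (mtop S) U \<and> nonvanishing_section S M i W U T \<longrightarrow>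
        aligned S U (induced_conn S M N i W) (induced_metric S M N i T))"

text \<open>A co-orientation is a continuous choice of one of the two open half-spaces into which the
  tangent space of \<open>S\<close> divides the tangent space of \<open>M\<close>, equivalently, an orientation of the normal
  line bundle.\<close>

definition co_orientation ::
    "('s, 'a::euclidean_space) mfd \<Rightarrow> ('m, 'e::euclidean_space) mfd \<Rightarrow> ('s \<Rightarrow> 'm) \<Rightarrow>
     ('s \<Rightarrow> ('m, 'e) tvec set) \<Rightarrow> bool" where
  "co_orientation S M i C \<longleftrightarrow>
     (\<forall>p\<in>points S. \<exists>U T. openin (mtop S) U \<and> p \<in> U \<and> transverse_field S M i U T \<and>
        (\<forall>q\<in>U. C q = {(\<lambda>d. differential S M i q u d + t *\<^sub>R T q d) | u t.
           u \<in> tangent_space S q \<and> t > 0}))"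

definition co_oriented_transversal ::
    "('s, 'a::euclidean_space) mfd \<Rightarrow> ('m, 'e::euclidean_space) mfd \<Rightarrow> ('s \<Rightarrow> 'm) \<Rightarrow>
     ('s \<Rightarrow> ('m, 'e) tvec set) \<Rightarrow> ('s \<Rightarrow> ('m, 'e) tvec) \<Rightarrow> bool" where
  "co_oriented_transversal S M i C T \<longleftrightarrow> T \<in> extensional (points S) \<and>
     transverse_field S M i (points S) T \<and> (\<forall>p\<in>points S. T p \<in> C p)"

definition unimodular_transversal ::
    "('s, real ^ 'n) mfd \<Rightarrow> ('m, real ^ 'n::finite option) mfd \<Rightarrow>
     ('m, real ^ 'n option) conn \<Rightarrow> ('s \<Rightarrow> 'm) \<Rightarrow>
     ('m \<Rightarrow> ('n option \<Rightarrow> ('m, real ^ 'n option) tvec) \<Rightarrow> real) \<Rightarrow>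
     ('s \<Rightarrow> ('m, real ^ 'n option) tvec set) \<Rightarrow>
     ('s \<Rightarrow> ('m, real ^ 'n option) tvec) \<Rightarrow> bool" where
  "unimodular_transversal S M N i \<Psi> C T \<longleftrightarrow> co_oriented_transversal S M i C T \<and>
     density_eq S (induced_density S M i \<Psi> T) (metric_density (induced_metric S M N i T))"

definition unimodular_section ::
    "('s, real ^ 'n) mfd \<Rightarrow> ('m, real ^ 'n::finite option) mfd \<Rightarrow>
     ('m, real ^ 'n option) conn \<Rightarrow> ('s \<Rightarrow> 'm) \<Rightarrow>
     ('m \<Rightarrow> ('n option \<Rightarrow> ('m, real ^ 'n option) tvec) \<Rightarrow> real) \<Rightarrow>
     ('s \<Rightarrow> ('m, real ^ 'n option) tvec set) \<Rightarrow>
     ('s \<Rightarrow> ('m, real ^ 'n option) tvec set) \<Rightarrow>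
     ('s \<Rightarrow> ('m, real ^ 'n option) tvec) \<Rightarrow> bool" where
  "unimodular_section S M N i \<Psi> C W T \<longleftrightarrow>
     nonvanishing_section S M i W (points S) T \<and> unimodular_transversal S M N i \<Psi> C T"


section \<open>Flat affine space\<close>

definition std_chart :: "('e, 'e) chart" where
  "std_chart = (UNIV, id)"

definition affine_space :: "('e, 'e::euclidean_space) mfd" where
  "affine_space = \<lparr>mtop = euclidean, atlas = {std_chart}\<rparr>"

definition std_conn :: "('e, 'e::euclidean_space) conn" where
  "std_conn X Y = (\<lambda>p c. if c = std_chart
     then frechet_derivative (\<lambda>q. Y q std_chart) (at p) (X p std_chart) else 0)"

definition std_volume ::
    "real ^ 'k \<Rightarrow> ('k::finite \<Rightarrow> (real ^ 'k, real ^ 'k) tvec) \<Rightarrow> real" where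
  "std_volume p v = det (\<chi> a b. v b std_chart $ a)"

definition equiaffine_transversal ::
    "('s, real ^ 'n::finite) mfd \<Rightarrow> ('s \<Rightarrow> real ^ 'n option) \<Rightarrow>
     ('s \<Rightarrow> (real ^ 'n option, real ^ 'n option) tvec set) \<Rightarrow>
     ('s \<Rightarrow> (real ^ 'n option, real ^ 'n option) tvec) \<Rightarrow> bool" where
  "equiaffine_transversal S i C T \<longleftrightarrow>
     unimodular_transversal S affine_space std_conn i std_volume C T \<and>
     preserves_density S (induced_conn S affine_space std_conn i (line_spanned T))
       (induced_density S affine_space i std_volume T)"

definition is_equiaffine_normal ::
    "('s, real ^ 'n::finite) mfd \<Rightarrow> ('s \<Rightarrow> real ^ 'n option) \<Rightarrow>
     ('s \<Rightarrow> (real ^ 'n option, real ^ 'n option) tvec set) \<Rightarrow>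
     ('s \<Rightarrow> (real ^ 'n option, real ^ 'n option) tvec) \<Rightarrow> bool" where
  "is_equiaffine_normal S i C T \<longleftrightarrow> equiaffine_transversal S i C T \<and>
     (\<forall>T'. equiaffine_transversal S i C T' \<longrightarrow> T' = T)"

end

theory Submission
  imports Defs
begin

text \<open>In local coordinates let \<open>J\<close> be the derivative of the immersion. The ambient derivative
  \<open>Q(u, v)\<close> of \<open>J v\<close> along \<open>u\<close> splits with respect to a transversal \<open>T\<close> as
  \<open>J G(u, v) + h(u, v) T\<close>. Replacing \<open>T\<close> by \<open>a (T + J z)\<close> replaces \<open>G\<close> by \<open>G - h z\<close> and \<open>h\<close> by
  \<open>h / a\<close>, and the defect \<open>n h\<^sup>P\<^sup>Q \<nabla>\<^sub>P h\<^sub>Q\<^sub>I - h\<^sup>P\<^sup>Q \<nabla>\<^sub>I h\<^sub>P\<^sub>Q\<close> of alignment changes by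
  \<open>(n - 1) (n + 2) h(z, \<cdot>)\<close>, whatever \<open>a\<close> is. Hence the defect vanishes for exactly one line field, and
  on it the equality of the densities prescribes \<open>a\<^sup>n\<^sup>+\<^sup>2\<close>.

  If the ambient connection is projectively flat, its curvature \<open>R(u, v) w\<close> is a combination of \<open>u\<close>,
  \<open>v\<close> and \<open>w\<close>, so that \<open>\<nabla> h + \<tau> \<otimes> h\<close> is symmetric (Codazzi). If moreover the volume form is
  parallel, then the equality of the densities means \<open>h\<^sup>P\<^sup>Q \<nabla>\<^sub>I h\<^sub>P\<^sub>Q = 2 \<tau>\<^sub>I\<close>, and the trace of the Codazzi
  equation turns the defect into \<open>(n - 1) (n + 2) \<tau>\<close>. Thus a unimodular transversal is aligned if and
  only if \<open>\<tau> = 0\<close>, that is, if and only if the induced density is parallel.\<close>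

section \<open>Smooth maps between Euclidean spaces\<close>

text \<open>Everything is computed in a pair of charts, one around a point of \<open>S\<close> and
  one around its image. This is legitimate once the ambient derivative along \<open>i\<close> is
  known to transform as a tangent vector. The defect at a point depends on the transversal only
  through the line it spans there. Uniqueness is therefore pointwise, and the line field and its
  unimodular section are obtained by choosing a local solution at each point: the choices agree on
  overlaps.

  The factor n in the alignment equation removes the derivative of the scaling function a, since d
  log a enters the first trace once and the second trace n times. The coefficient (n - 1) (n + 2)
  vanishes for n = 1, where every line field is aligned; hence \<open>CARD('n) \<ge> 2\<close>.

  The relation \<open>h\<^sup>P\<^sup>Q \<nabla>\<^sub>I h\<^sub>P\<^sub>Q = 2
  \<tau>\<^sub>I\<close> compares two logarithmic derivatives. For parallel \<Psi> that of \<Psi> on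
  \<open>T\<close> and the coordinate frame is \<tau> + tr G, with G the induced Christoffel
  symbols, while that of det h is
  \<open>h\<^sup>P\<^sup>Q \<nabla>\<^sub>I h\<^sub>P\<^sub>Q\<close> + 2 tr G. Equality of the
  densities makes the second twice the first.\<close>

abbreviation der :: "('a::real_normed_vector \<Rightarrow> 'b::real_normed_vector) \<Rightarrow> 'a \<Rightarrow> 'a \<Rightarrow> 'b" where
  "der f x \<equiv> frechet_derivative f (at x)"

lemma der_eqI: "(f has_derivative f') (at x) \<Longrightarrow> der f x = f'"
  using frechet_derivative_at by metis

lemma has_derivative_der: "f differentiable (at x) \<Longrightarrow> (f has_derivative der f x) (at x)"
  by (simp add: frechet_derivative_works)

lemma differentiable_cong_open:
  assumes "open A" "x \<in> A" "\<And>y. y \<in> A \<Longrightarrow> f y = g y" "f differentiable (at x)"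
  shows "g differentiable (at x)"
  using assms has_derivative_transform_within_open[of f _ x UNIV A g]
  unfolding differentiable_def by auto

lemma der_cong_open:
  assumes "open A" "x \<in> A" "\<And>y. y \<in> A \<Longrightarrow> f y = g y"
  shows "der f x = der g x"
proof -
  have "(f has_derivative f') (at x) \<longleftrightarrow> (g has_derivative f') (at x)" for f'
    using assms has_derivative_transform_within_open[of f f' x UNIV A g]
      has_derivative_transform_within_open[of g f' x UNIV A f] by auto
  then show ?thesis unfolding frechet_derivative_def by simp
qed

text \<open>On an open set equality passes to derivatives, so \<open>f\<close> and \<open>g\<close>
  have to move along with \<open>k\<close> in the induction.\<close>

lemma times_differentiable_on_cong:
  assumes "open A" "\<And>x. x \<in> A \<Longrightarrow> f x = g x" "times_differentiable_on k A f"
  shows "times_differentiable_on k A g"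
  using assms(2,3)
proof (induction k arbitrary: f g)
  case 0
  then show ?case by (metis continuous_on_cong times_differentiable_on.simps(1))
next
  case (Suc k)
  have "times_differentiable_on k A (\<lambda>x. der g x v)" for v
  proof (rule Suc.IH[of "\<lambda>x. der f x v"])
    show "der f x v = der g x v" if "x \<in> A" for x
      using der_cong_open[OF assms(1) that Suc.prems(1)] by simp
  qed (use Suc.prems in simp)
  then show ?case using Suc.prems differentiable_cong_open[OF assms(1), of _ f g] by auto
qed

lemma times_differentiable_on_subset:
  "times_differentiable_on k A f \<Longrightarrow> B \<subseteq> A \<Longrightarrow> times_differentiable_on k B f"
  by (induction k arbitrary: f) (auto intro: continuous_on_subset)

lemma times_differentiable_on_continuous: "times_differentiable_on k A f \<Longrightarrow> continuous_on A f"
  by (cases k) (auto intro!: continuous_at_imp_continuous_on differentiable_imp_continuous_within)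

lemma times_differentiable_on_Suc:
  "times_differentiable_on (Suc k) A f \<Longrightarrow> times_differentiable_on k A f"
proof (induction k arbitrary: f)
  case 0
  then show ?case using times_differentiable_on_continuous[of "Suc 0"] by simp
next
  case (Suc k)
  then show ?case by (meson times_differentiable_on.simps(2))
qed

lemma times_differentiable_on_add:
  assumes "open A" "times_differentiable_on k A f" "times_differentiable_on k A g"
  shows "times_differentiable_on k A (\<lambda>x. f x + g x)"
  using assms(2,3)
proof (induction k arbitrary: f g)
  case 0
  then show ?case by (auto intro: continuous_intros)
next
  case (Suc k)
  have "times_differentiable_on k A (\<lambda>x. der (\<lambda>x. f x + g x) x v)" for v
  proof (rule times_differentiable_on_cong[OF assms(1)])
    show "der f x v + der g x v = der (\<lambda>x. f x + g x) x v" if "x \<in> A" for x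
      using that Suc.prems
      by (subst der_eqI[OF has_derivative_add[OF has_derivative_der has_derivative_der]]) auto
    show "times_differentiable_on k A (\<lambda>x. der f x v + der g x v)"
      using Suc by auto
  qed
  then show ?case using Suc.prems by (auto intro: differentiable_add)
qed

lemma times_differentiable_on_linear:
  assumes "open A" "bounded_linear L" "times_differentiable_on k A f"
  shows "times_differentiable_on k A (\<lambda>x. L (f x))"
  using assms(3)
proof (induction k arbitrary: f)
  case 0
  then show ?case using assms(2) by (auto intro: bounded_linear.continuous_on)
next
  case (Suc k)
  have *: "((\<lambda>x. L (f x)) has_derivative (\<lambda>v. L (der f x v))) (at x)" if "x \<in> A" for x
    using that Suc.prems by (intro bounded_linear.has_derivative[OF assms(2)] has_derivative_der) auto
  have "times_differentiable_on k A (\<lambda>x. der (\<lambda>x. L (f x)) x v)" for v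
    using times_differentiable_on_cong[OF assms(1), of "\<lambda>x. L (der f x v)"] der_eqI[OF *] Suc
    by auto
  then show ?case using * by (auto simp: differentiable_def)
qed

lemma times_differentiable_on_bilinear:
  assumes "open A" "bounded_bilinear P" "times_differentiable_on k A f" "times_differentiable_on k A g"
  shows "times_differentiable_on k A (\<lambda>x. P (f x) (g x))"
  using assms(3,4)
proof (induction k arbitrary: f g)
  case 0
  then show ?case using assms(2) by (auto intro: bounded_bilinear.continuous_on)
next
  case (Suc k)
  have *: "((\<lambda>x. P (f x) (g x)) has_derivative (\<lambda>v. P (f x) (der g x v) + P (der f x v) (g x))) (at x)"
    if "x \<in> A" for x
    using that Suc.prems by (intro bounded_bilinear.FDERIV[OF assms(2)] has_derivative_der) auto
  have "times_differentiable_on k A (\<lambda>x. der (\<lambda>x. P (f x) (g x)) x v)" for v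
  proof (rule times_differentiable_on_cong[OF assms(1)])
    show "P (f x) (der g x v) + P (der f x v) (g x) = der (\<lambda>x. P (f x) (g x)) x v" if "x \<in> A" for x
      using der_eqI[OF *[OF that]] by simp
    show "times_differentiable_on k A (\<lambda>x. P (f x) (der g x v) + P (der f x v) (g x))"
      using Suc times_differentiable_on_Suc[OF Suc.prems(1)] times_differentiable_on_Suc[OF Suc.prems(2)]
      by (intro times_differentiable_on_add assms(1) Suc.IH) auto
  qed
  then show ?case using * by (auto simp: differentiable_def)
qed

lemma times_differentiable_on_const: "times_differentiable_on k A (\<lambda>x. c)"
  by (induction k arbitrary: c) auto

lemma times_differentiable_on_sum:
  assumes "open A" "\<And>j. j \<in> J \<Longrightarrow> times_differentiable_on k A (f j)"
  shows "times_differentiable_on k A (\<lambda>x. \<Sum>j\<in>J. f j x)"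
  using assms(2)
  by (induction J rule: infinite_finite_induct)
    (auto simp: times_differentiable_on_const intro: times_differentiable_on_add assms(1))

lemma linear_lincombI:
  assumes "\<And>r u v. f (r *\<^sub>R u + v) = r *\<^sub>R f u + f v"
  shows "linear f"
proof (rule linearI)
  have "f 0 = 0" using assms[of 1 0 0] by simp
  then show "f (x + y) = f x + f y" "f (r *\<^sub>R x) = r *\<^sub>R f x" for x y r
    using assms[of 1 x y] assms[of r x 0] by simp_all
qed

lemma linear_euclidean_expand:
  fixes L :: "'a::euclidean_space \<Rightarrow> 'b::real_vector"
  assumes "linear L"
  shows "L v = (\<Sum>b\<in>Basis. (v \<bullet> b) *\<^sub>R L b)"
  by (metis (no_types, lifting) assms euclidean_representation linear_scale linear_sum sum.cong)

text \<open>The chain rule gives \<open>der f (g x) (der g x v)\<close>, where point and direction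
  both vary with \<open>x\<close>. Expanding the direction in \<open>Basis\<close> leaves scalar
  functions times \<open>der f (g x) b\<close> with \<open>b\<close> fixed, and to these the
  induction hypothesis, with \<open>f\<close> arbitrary, applies.\<close>

lemma times_differentiable_on_compose:
  fixes f :: "'b::euclidean_space \<Rightarrow> 'c::real_normed_vector" and g :: "'a::euclidean_space \<Rightarrow> 'b"
  assumes "open A" "g ` A \<subseteq> B" "times_differentiable_on k A g" "times_differentiable_on k B f"
  shows "times_differentiable_on k A (\<lambda>x. f (g x))"
  using assms(3,4)
proof (induction k arbitrary: f)
  case 0
  then show ?case using assms(2) by (auto intro: continuous_on_compose2)
next
  case (Suc k)
  have df: "f differentiable (at (g x))" if "x \<in> A" for x
    using that Suc.prems assms(2) by auto
  have *: "((\<lambda>x. f (g x)) has_derivative (\<lambda>v. der f (g x) (der g x v))) (at x)"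
    if "x \<in> A" for x
    using that Suc.prems has_derivative_compose[of g "der g x" x UNIV f, OF has_derivative_der has_derivative_der[OF df]] by auto
  have "times_differentiable_on k A (\<lambda>x. der (\<lambda>x. f (g x)) x v)" for v
  proof (rule times_differentiable_on_cong[OF assms(1)])
    show "(\<Sum>b\<in>Basis. (der g x v \<bullet> b) *\<^sub>R der f (g x) b) = der (\<lambda>x. f (g x)) x v" if "x \<in> A" for x
      unfolding der_eqI[OF *[OF that]]
      by (rule linear_euclidean_expand[OF linear_frechet_derivative[OF df[OF that]], symmetric])
    show "times_differentiable_on k A (\<lambda>x. \<Sum>b\<in>Basis. (der g x v \<bullet> b) *\<^sub>R der f (g x) b)"
      using Suc.prems
      by (intro times_differentiable_on_sum times_differentiable_on_bilinear[OF _ bounded_bilinear_scaleR]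
          times_differentiable_on_linear[OF _ bounded_linear_inner_left] Suc.IH assms(1)
          times_differentiable_on_Suc[of k A g]) auto
  qed
  then show ?case using * by (auto simp: differentiable_def)
qed

lemma times_differentiable_on_inverse:
  fixes f :: "'a::euclidean_space \<Rightarrow> real"
  assumes "open A" "\<And>x. x \<in> A \<Longrightarrow> f x \<noteq> 0" "times_differentiable_on k A f"
  shows "times_differentiable_on k A (\<lambda>x. inverse (f x))"
  using assms(3)
proof (induction k)
  case 0
  then show ?case using assms(2) by (auto intro: continuous_intros)
next
  case (Suc k)
  have *: "((\<lambda>x. inverse (f x)) has_derivative (\<lambda>v. - (inverse (f x) * der f x v * inverse (f x)))) (at x)"
    if "x \<in> A" for x
    using that Suc.prems assms(2) by (intro Deriv.has_derivative_inverse has_derivative_der) auto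
  have i: "times_differentiable_on k A (\<lambda>x. inverse (f x))"
    using Suc times_differentiable_on_Suc by blast
  have "times_differentiable_on k A (\<lambda>x. der (\<lambda>x. inverse (f x)) x v)" for v
  proof (rule times_differentiable_on_cong[OF assms(1)])
    show "- (inverse (f x) * der f x v * inverse (f x)) = der (\<lambda>x. inverse (f x)) x v" if "x \<in> A" for x
      using der_eqI[OF *[OF that]] by simp
    show "times_differentiable_on k A (\<lambda>x. - (inverse (f x) * der f x v * inverse (f x)))"
      using Suc.prems i
      by (intro times_differentiable_on_linear[OF assms(1) bounded_linear_minus[OF bounded_linear_ident]]
          times_differentiable_on_bilinear[OF assms(1) bounded_bilinear_mult]) auto
  qed
  then show ?case using * by (auto simp: differentiable_def)
qed

text \<open>Differentiation keeps the shape, with constant \<open>v * c * s\<close> and exponent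
  \<open>s - 1\<close>; hence both are generalised in the induction.\<close>

lemma times_differentiable_on_powr:
  "times_differentiable_on k {0<..} (\<lambda>x::real. c * x powr s)"
proof (induction k arbitrary: c s)
  case 0
  then show ?case by (auto intro!: continuous_intros)
next
  case (Suc k)
  have *: "((\<lambda>x. c * x powr s) has_derivative (\<lambda>v. (v * c * s) * x powr (s - 1))) (at x)" if "x \<in> {0<..}" for x
    using that by (auto intro!: derivative_eq_intros simp: powr_diff field_simps)
  have "times_differentiable_on k {0<..} (\<lambda>x. der (\<lambda>x. c * x powr s) x v)" for v
    by (rule times_differentiable_on_cong[OF _ _ Suc[of "v * c * s" "s - 1"]])
      (use der_eqI[OF *] in auto)
  then show ?case using * by (auto simp: differentiable_def)
qed

section \<open>Closure properties of smooth maps\<close>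

lemma smooth_on_cong:
  assumes "smooth_on A f" "open A" "\<And>x. x \<in> A \<Longrightarrow> f x = g x"
  shows "smooth_on A g"
  using assms times_differentiable_on_cong unfolding smooth_on_def by blast

lemma smooth_on_subset: "smooth_on A f \<Longrightarrow> B \<subseteq> A \<Longrightarrow> smooth_on B f"
  using times_differentiable_on_subset unfolding smooth_on_def by blast

text \<open>Used to deduce smoothness in one chart from smoothness in others that cover only a
  neighbourhood of each point.\<close>

lemma smooth_on_local:
  assumes "\<And>x. x \<in> A \<Longrightarrow> \<exists>B. open B \<and> x \<in> B \<and> smooth_on B f"
  shows "smooth_on A f"
proof -
  have *: "times_differentiable_on k A f" if "\<And>x. x \<in> A \<Longrightarrow> \<exists>B. open B \<and> x \<in> B \<and> times_differentiable_on k B f"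
    for k and f :: "'a \<Rightarrow> 'b"
    using that
  proof (induction k arbitrary: f)
    case 0
    then have "isCont f x" if "x \<in> A" for x
      using that continuous_on_eq_continuous_at by fastforce
    then show ?case by (simp add: continuous_at_imp_continuous_on)
  next
    case (Suc k)
    have "\<exists>B. open B \<and> x \<in> B \<and> times_differentiable_on k B (\<lambda>x. der f x v)" if "x \<in> A" for x v
      using Suc.prems[OF that] by auto
    then show ?case using Suc.prems by (auto intro!: Suc.IH)
  qed
  show ?thesis unfolding smooth_on_def
  proof (intro allI *)
    fix k x assume "x \<in> A"
    then show "\<exists>B. open B \<and> x \<in> B \<and> times_differentiable_on k B f"
      using assms[of x] unfolding smooth_on_def by auto
  qed
qed

lemma smooth_on_differentiable: "smooth_on A f \<Longrightarrow> x \<in> A \<Longrightarrow> f differentiable (at x)"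
  unfolding smooth_on_def by (metis times_differentiable_on.simps(2))

lemma smooth_on_has_derivative: "smooth_on A f \<Longrightarrow> x \<in> A \<Longrightarrow> (f has_derivative der f x) (at x)"
  by (simp add: has_derivative_der smooth_on_differentiable)

lemma smooth_on_linear_der: "smooth_on A f \<Longrightarrow> x \<in> A \<Longrightarrow> linear (der f x)"
  by (simp add: linear_frechet_derivative smooth_on_differentiable)

lemma smooth_on_continuous: "smooth_on A f \<Longrightarrow> continuous_on A f"
  unfolding smooth_on_def by (metis times_differentiable_on.simps(1))

lemma smooth_on_der: "smooth_on A f \<Longrightarrow> smooth_on A (\<lambda>x. der f x v)"
  unfolding smooth_on_def by (metis times_differentiable_on.simps(2))

lemma smooth_on_const: "smooth_on A (\<lambda>x. c)"
  by (simp add: smooth_on_def times_differentiable_on_const)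

lemma smooth_on_add: "open A \<Longrightarrow> smooth_on A f \<Longrightarrow> smooth_on A g \<Longrightarrow> smooth_on A (\<lambda>x. f x + g x)"
  by (simp add: smooth_on_def times_differentiable_on_add)

lemma smooth_on_sum:
  "open A \<Longrightarrow> (\<And>j. j \<in> J \<Longrightarrow> smooth_on A (f j)) \<Longrightarrow> smooth_on A (\<lambda>x. \<Sum>j\<in>J. f j x)"
  by (simp add: smooth_on_def times_differentiable_on_sum)

lemma smooth_on_linear: "open A \<Longrightarrow> bounded_linear L \<Longrightarrow> smooth_on A f \<Longrightarrow> smooth_on A (\<lambda>x. L (f x))"
  by (simp add: smooth_on_def times_differentiable_on_linear)

lemma smooth_on_minus: "open A \<Longrightarrow> smooth_on A f \<Longrightarrow> smooth_on A (\<lambda>x. - f x)"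
  by (rule smooth_on_linear[OF _ bounded_linear_minus[OF bounded_linear_ident]])

lemma smooth_on_diff: "open A \<Longrightarrow> smooth_on A f \<Longrightarrow> smooth_on A g \<Longrightarrow> smooth_on A (\<lambda>x. f x - g x)"
  using smooth_on_add[of A f "\<lambda>x. - g x"] smooth_on_minus[of A g] by simp

lemma smooth_on_bilinear:
  "open A \<Longrightarrow> bounded_bilinear P \<Longrightarrow> smooth_on A f \<Longrightarrow> smooth_on A g \<Longrightarrow> smooth_on A (\<lambda>x. P (f x) (g x))"
  by (simp add: smooth_on_def times_differentiable_on_bilinear)

lemmas smooth_on_scaleR = smooth_on_bilinear[OF _ bounded_bilinear_scaleR]
lemmas smooth_on_mult = smooth_on_bilinear[OF _ bounded_bilinear_mult]
lemmas smooth_on_vec_nth = smooth_on_linear[OF _ bounded_linear_vec_nth]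

lemma smooth_on_prod:
  fixes f :: "'j \<Rightarrow> 'a::euclidean_space \<Rightarrow> real"
  shows "open A \<Longrightarrow> (\<And>j. j \<in> J \<Longrightarrow> smooth_on A (f j)) \<Longrightarrow> smooth_on A (\<lambda>x. \<Prod>j\<in>J. f j x)"
  by (induction J rule: infinite_finite_induct) (auto intro: smooth_on_const smooth_on_mult)

lemma smooth_on_compose:
  fixes f :: "'b::euclidean_space \<Rightarrow> 'c::real_normed_vector" and g :: "'a::euclidean_space \<Rightarrow> 'b"
  shows "smooth_on B f \<Longrightarrow> open A \<Longrightarrow> smooth_on A g \<Longrightarrow> g ` A \<subseteq> B \<Longrightarrow> smooth_on A (\<lambda>x. f (g x))"
  unfolding smooth_on_def by (metis times_differentiable_on_compose)

lemma smooth_on_divide: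
  fixes f g :: "'a::euclidean_space \<Rightarrow> real"
  shows "open A \<Longrightarrow> smooth_on A f \<Longrightarrow> smooth_on A g \<Longrightarrow> (\<And>x. x \<in> A \<Longrightarrow> g x \<noteq> 0) \<Longrightarrow>
    smooth_on A (\<lambda>x. f x / g x)"
  unfolding divide_inverse
  by (intro smooth_on_mult) (auto simp: smooth_on_def times_differentiable_on_inverse)

lemma smooth_on_powr:
  fixes f :: "'a::euclidean_space \<Rightarrow> real"
  assumes "open A" "smooth_on A f" "\<And>x. x \<in> A \<Longrightarrow> f x > 0"
  shows "smooth_on A (\<lambda>x. f x powr s)"
proof (rule smooth_on_compose[OF _ assms(1,2)])
  show "smooth_on {0<..} (\<lambda>x::real. x powr s)"
    using times_differentiable_on_powr[of _ 1] by (simp add: smooth_on_def)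
qed (use assms in auto)

lemma smooth_on_vec:
  fixes f :: "'k::finite \<Rightarrow> 'a::euclidean_space \<Rightarrow> real"
  assumes "open A" "\<And>k. smooth_on A (f k)"
  shows "smooth_on A (\<lambda>x. \<chi> k. f k x)"
proof -
  have "(\<chi> k. f k x) = (\<Sum>k\<in>UNIV. f k x *\<^sub>R axis k 1)" for x
    by (simp add: vec_eq_iff axis_def if_distrib cong: if_cong)
  then show ?thesis
    by (simp add: assms smooth_on_sum smooth_on_scaleR smooth_on_const)
qed

section \<open>Determinants, matrix inverses and families of linear maps\<close>

lemma smooth_on_det:
  fixes f :: "'k::finite \<Rightarrow> 'k \<Rightarrow> 'a::euclidean_space \<Rightarrow> real"
  assumes "open A" "\<And>i j. smooth_on A (f i j)"
  shows "smooth_on A (\<lambda>x. det (\<chi> i j. f i j x))"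
  unfolding det_def by (simp add: assms smooth_on_sum smooth_on_mult smooth_on_const smooth_on_prod)

lemma matrix_inv_invertible:
  fixes A :: "'a::semiring_1 ^ 'n ^ 'm"
  assumes "invertible A"
  shows "A ** matrix_inv A = mat 1" "matrix_inv A ** A = mat 1"
  using assms someI_ex[of "\<lambda>A'. A ** A' = mat 1 \<and> A' ** A = mat 1"]
  unfolding matrix_inv_def invertible_def by auto

text \<open>By Cramer's rule the solution of a linear system is a quotient of determinants, hence
  smooth in the coefficients where the denominator does not vanish.\<close>

lemma smooth_on_matrix_inv_mult:
  fixes f :: "'k::finite \<Rightarrow> 'k \<Rightarrow> 'a::euclidean_space \<Rightarrow> real" and b :: "'a \<Rightarrow> real ^ 'k"
  assumes "open A" "\<And>i j. smooth_on A (f i j)" "smooth_on A b"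
    and inv: "\<And>x. x \<in> A \<Longrightarrow> invertible (\<chi> i j. f i j x)"
  shows "smooth_on A (\<lambda>x. matrix_inv (\<chi> i j. f i j x) *v b x)"
proof (rule smooth_on_cong[OF _ assms(1)])
  let ?F = "\<lambda>x. \<chi> i j. f i j x"
  show "(\<chi> k. det (\<chi> i j. if j = k then b x $ i else ?F x $ i $ j) / det (?F x)) =
      matrix_inv (?F x) *v b x" if "x \<in> A" for x
  proof -
    have "?F x *v (matrix_inv (?F x) *v b x) = b x"
      using inv[OF that] by (simp add: matrix_vector_mul_assoc matrix_inv_invertible)
    moreover have "det (?F x) \<noteq> 0"
      using inv[OF that] by (simp add: invertible_det_nz)
    ultimately show ?thesis
      using cramer[of "?F x" "matrix_inv (?F x) *v b x" "b x"] by (simp del: vec_lambda_beta)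
  qed
  have *: "smooth_on A (\<lambda>x. if j = k then b x $ i else ?F x $ i $ j)" for i j k
    using assms by (cases "j = k") (auto intro: smooth_on_vec_nth)
  have "det (?F x) \<noteq> 0" if "x \<in> A" for x
    using inv[OF that] by (simp add: invertible_det_nz)
  then show "smooth_on A (\<lambda>x. \<chi> k. det (\<chi> i j. if j = k then b x $ i else ?F x $ i $ j) / det (?F x))"
    by (intro smooth_on_vec smooth_on_divide smooth_on_det * assms)
qed

text \<open>A family of linear maps counts as smooth when its value on each fixed vector is; the
  expansion of \<open>\<eta> x\<close> in \<open>Basis\<close> reduces a moving argument to fixed
  ones.\<close>

lemma smooth_on_linear_family:
  fixes L :: "'a::euclidean_space \<Rightarrow> 'b::euclidean_space \<Rightarrow> 'c::real_normed_vector"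
  assumes "open A" "\<And>x. x \<in> A \<Longrightarrow> linear (L x)" "\<And>v. smooth_on A (\<lambda>x. L x v)" "smooth_on A \<eta>"
  shows "smooth_on A (\<lambda>x. L x (\<eta> x))"
proof -
  have 1: "(\<Sum>b\<in>Basis. (\<eta> x \<bullet> b) *\<^sub>R L x b) = L x (\<eta> x)" if "x \<in> A" for x
    by (rule linear_euclidean_expand[OF assms(2)[OF that], symmetric])
  have 2: "smooth_on A (\<lambda>x. \<eta> x \<bullet> b)" for b
    by (rule smooth_on_linear[OF assms(1) bounded_linear_inner_left assms(4)])
  have 2: "smooth_on A (\<lambda>x. \<Sum>b\<in>Basis. (\<eta> x \<bullet> b) *\<^sub>R L x b)"
    by (intro smooth_on_sum[OF assms(1)] smooth_on_scaleR[OF assms(1)] 2 assms(3))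
  show ?thesis
    by (rule smooth_on_cong[OF 2 assms(1) 1])
qed
lemma smooth_on_bilinear_family:
  fixes P :: "'a::euclidean_space \<Rightarrow> 'b::euclidean_space \<Rightarrow> 'd::euclidean_space \<Rightarrow> 'c::real_normed_vector"
  assumes "open A" "\<And>x. x \<in> A \<Longrightarrow> bilinear (P x)" "\<And>u v. smooth_on A (\<lambda>x. P x u v)"
    "smooth_on A \<eta>" "smooth_on A \<zeta>"
  shows "smooth_on A (\<lambda>x. P x (\<eta> x) (\<zeta> x))"
proof (rule smooth_on_linear_family[where L = "\<lambda>x u. P x u (\<zeta> x)", OF assms(1) _ _ assms(4)])
  show "linear (\<lambda>u. P x u (\<zeta> x))" if "x \<in> A" for x
    using assms(2)[OF that] by (simp add: bilinear_def)
  show "smooth_on A (\<lambda>x. P x v (\<zeta> x))" for v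
    using assms(2) by (intro smooth_on_linear_family[where L = "\<lambda>x. P x v", OF assms(1) _ assms(3,5)])
      (simp add: bilinear_def)
qed

text \<open>Product rule for a moving linear map applied to a moving vector; the
  \<open>Basis\<close> expansion turns it into the product rule for \<open>scaleR\<close>.
  Derivatives of \<open>jac\<close> and of transition maps applied to moving components are handled
  in this form.\<close>

lemma has_derivative_linear_family:
  fixes L :: "'a::real_normed_vector \<Rightarrow> 'b::euclidean_space \<Rightarrow> 'c::real_normed_vector"
  assumes "open A" "x \<in> A" "\<And>y. y \<in> A \<Longrightarrow> linear (L y)" "\<And>v. (\<lambda>y. L y v) differentiable (at x)"
    "(\<eta> has_derivative \<eta>') (at x)"
  shows "((\<lambda>y. L y (\<eta> y)) has_derivative (\<lambda>u. der (\<lambda>y. L y (\<eta> x)) x u + L x (\<eta>' u))) (at x)"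
proof -
  have eq: "L y v = (\<Sum>b\<in>Basis. (v \<bullet> b) *\<^sub>R L y b)" if "y \<in> A" for y v
    using linear_euclidean_expand[OF assms(3)[OF that]] .
  have "((\<lambda>y. \<Sum>b\<in>Basis. (\<eta> y \<bullet> b) *\<^sub>R L y b) has_derivative
     (\<lambda>u. \<Sum>b\<in>Basis. (\<eta> x \<bullet> b) *\<^sub>R der (\<lambda>y. L y b) x u + (\<eta>' u \<bullet> b) *\<^sub>R L x b)) (at x)"
    by (intro has_derivative_sum has_derivative_scaleR has_derivative_der assms
        bounded_linear.has_derivative[OF bounded_linear_inner_left])
  moreover have "der (\<lambda>y. L y (\<eta> x)) x = (\<lambda>u. \<Sum>b\<in>Basis. (\<eta> x \<bullet> b) *\<^sub>R der (\<lambda>y. L y b) x u)"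
  proof (rule trans[OF der_cong_open[OF assms(1,2) eq]])
    show "der (\<lambda>y. \<Sum>b\<in>Basis. (\<eta> x \<bullet> b) *\<^sub>R L y b) x = (\<lambda>u. \<Sum>b\<in>Basis. (\<eta> x \<bullet> b) *\<^sub>R der (\<lambda>y. L y b) x u)"
      by (intro der_eqI has_derivative_sum has_derivative_scaleR_right has_derivative_der assms)
  qed
  ultimately have "((\<lambda>y. \<Sum>b\<in>Basis. (\<eta> y \<bullet> b) *\<^sub>R L y b) has_derivative
     (\<lambda>u. der (\<lambda>y. L y (\<eta> x)) x u + L x (\<eta>' u))) (at x)"
    by (simp add: sum.distrib eq[OF assms(2), symmetric])
  then show ?thesis
    by (rule has_derivative_transform_within_open[OF _ assms(1,2)]) (simp add: eq[symmetric])
qed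

lemma has_derivative_bilinear_family:
  fixes P :: "'a::real_normed_vector \<Rightarrow> 'b::euclidean_space \<Rightarrow> 'd::euclidean_space \<Rightarrow> 'c::real_normed_vector"
  assumes "open A" "x \<in> A" "\<And>y. y \<in> A \<Longrightarrow> bilinear (P y)" "\<And>u v. (\<lambda>y. P y u v) differentiable (at x)"
    "(\<eta> has_derivative \<eta>') (at x)" "(\<zeta> has_derivative \<zeta>') (at x)"
  shows "((\<lambda>y. P y (\<eta> y) (\<zeta> y)) has_derivative
    (\<lambda>u. der (\<lambda>y. P y (\<eta> x) (\<zeta> x)) x u + P x (\<eta>' u) (\<zeta> x) + P x (\<eta> x) (\<zeta>' u))) (at x)"
proof -
  have 1: "((\<lambda>y. P y v (\<zeta> y)) has_derivative (\<lambda>u. der (\<lambda>y. P y v (\<zeta> x)) x u + P x v (\<zeta>' u))) (at x)" for v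
    using assms by (intro has_derivative_linear_family[where L = "\<lambda>y. P y v"]) (auto simp: bilinear_def)
  then have "((\<lambda>y. P y (\<eta> y) (\<zeta> y)) has_derivative
     (\<lambda>u. der (\<lambda>y. P y (\<eta> x) (\<zeta> y)) x u + P x (\<eta>' u) (\<zeta> x))) (at x)"
    using assms by (intro has_derivative_linear_family[where L = "\<lambda>y u. P y u (\<zeta> y)"])
        (auto simp: bilinear_def differentiable_def)
  then show ?thesis by (simp add: der_eqI[OF 1] algebra_simps)
qed

text \<open>The mean value theorem is applied twice: the second difference over a parallelogram is
  the increment in the direction \<open>u\<close> of a difference taken in the direction
  \<open>v\<close>. It first becomes a difference of first derivatives along \<open>u\<close> and
  then a mixed derivative.\<close>

lemma second_difference:
  fixes f :: "'a::euclidean_space \<Rightarrow> real"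
  assumes f: "smooth_on A f" and h: "h > 0"
    and A: "\<And>s t. 0 \<le> s \<Longrightarrow> s \<le> h \<Longrightarrow> 0 \<le> t \<Longrightarrow> t \<le> h \<Longrightarrow> x + s *\<^sub>R u + t *\<^sub>R v \<in> A"
  shows "\<exists>s t. 0 < s \<and> s < h \<and> 0 < t \<and> t < h \<and>
     f (x + h *\<^sub>R u + h *\<^sub>R v) - f (x + h *\<^sub>R u) - f (x + h *\<^sub>R v) + f x =
     h * h * der (\<lambda>y. der f y u) (x + s *\<^sub>R u + t *\<^sub>R v) v"
proof -
  have line: "((\<lambda>s. g (y + s *\<^sub>R w)) has_real_derivative der g (y + s *\<^sub>R w) w) (at s)"
    if "smooth_on A g" "y + s *\<^sub>R w \<in> A" for g :: "'a \<Rightarrow> real" and y w s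
  proof -
    have "((\<lambda>s. y + s *\<^sub>R w) has_derivative (\<lambda>r. r *\<^sub>R w)) (at s)"
      by (auto intro!: derivative_eq_intros)
    from has_derivative_compose[OF this smooth_on_has_derivative[OF that]]
    show ?thesis
      unfolding has_field_derivative_def using linear_scale[OF smooth_on_linear_der[OF that]]
      by (simp add: mult_commute_abs)
  qed
  have eqs: "x + s *\<^sub>R u + t *\<^sub>R v = x + t *\<^sub>R v + s *\<^sub>R u" for s t by simp
  let ?g = "\<lambda>s. f (x + h *\<^sub>R v + s *\<^sub>R u) - f (x + s *\<^sub>R u)"
  have "\<exists>s. 0 < s \<and> s < h \<and> ?g h - ?g 0 = (h - 0) * (der f (x + h *\<^sub>R v + s *\<^sub>R u) u - der f (x + s *\<^sub>R u) u)"
    using A[of _ h] A[of _ 0] h by (intro MVT2 DERIV_diff line f) (auto simp: eqs)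
  then obtain s where s: "0 < s" "s < h"
    "?g h - ?g 0 = h * (der f (x + h *\<^sub>R v + s *\<^sub>R u) u - der f (x + s *\<^sub>R u) u)" by auto
  let ?k = "\<lambda>t. der f (x + s *\<^sub>R u + t *\<^sub>R v) u"
  have "\<exists>t. 0 < t \<and> t < h \<and> ?k h - ?k 0 = (h - 0) * der (\<lambda>y. der f y u) (x + s *\<^sub>R u + t *\<^sub>R v) v"
    using A s h by (intro MVT2 line smooth_on_der f) auto
  then obtain t where t: "0 < t" "t < h" "?k h - ?k 0 = h * der (\<lambda>y. der f y u) (x + s *\<^sub>R u + t *\<^sub>R v) v"
    by auto
  have "?g h - ?g 0 = h * h * der (\<lambda>y. der f y u) (x + s *\<^sub>R u + t *\<^sub>R v) v"
    using s(3) t(3) by (simp add: eqs[of s h])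
  then show ?thesis using s t by (intro exI[of _ s] exI[of _ t]) (simp add: eqs)
qed

text \<open>Interchanging \<open>u\<close> and \<open>v\<close> leaves the second difference
  unchanged, so the two mixed derivatives, taken at two points close to \<open>x\<close>, have equal
  values. Continuity of both at \<open>x\<close> excludes a gap between them.\<close>

lemma second_derivative_symmetric_real:
  fixes f :: "'a::euclidean_space \<Rightarrow> real"
  assumes f: "smooth_on A f" and A: "open A" "x \<in> A"
  shows "der (\<lambda>y. der f y u) x v = der (\<lambda>y. der f y v) x u"
proof (rule ccontr)
  let ?P = "\<lambda>y. der (\<lambda>y. der f y u) y v" and ?Q = "\<lambda>y. der (\<lambda>y. der f y v) y u"
  assume ne: "?P x \<noteq> ?Q x"
  define e where "e = \<bar>?P x - ?Q x\<bar> / 2"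
  have e: "e > 0" using ne by (simp add: e_def)
  have "isCont ?P x" "isCont ?Q x"
    using A smooth_on_continuous[OF smooth_on_der[OF smooth_on_der[OF f]]] continuous_on_eq_continuous_at by blast+
  then obtain d1 d2 where d: "d1 > 0" "\<And>y. dist y x < d1 \<Longrightarrow> dist (?P y) (?P x) < e"
     "d2 > 0" "\<And>y. dist y x < d2 \<Longrightarrow> dist (?Q y) (?Q x) < e"
    using e unfolding continuous_at_eps_delta by metis
  obtain d3 where d3: "d3 > 0" "ball x d3 \<subseteq> A" using A openE by blast
  define d where "d = min d1 (min d2 d3)"
  have dpos: "d > 0" using d d3 by (simp add: d_def)
  \<comment> \<open>Small enough for the whole parallelogram to stay in the ball of radius
    \<open>d\<close>; the added 1 keeps the denominator positive when both vectors are zero.\<close>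
  define h where "h = d / (2 * (norm u + norm v + 1))"
  have pos: "norm u + norm v + 1 > 0" by (simp add: add_nonneg_pos)
  have h: "h > 0" unfolding h_def using dpos pos by simp
  have hd: "h * (norm u + norm v) < d"
  proof -
    have "h * (norm u + norm v) \<le> h * (norm u + norm v + 1)" using h by (simp add: algebra_simps)
    also have "\<dots> = d / 2"
    proof -
      show ?thesis unfolding h_def using pos by (simp add: field_simps)
    qed
    also have "\<dots> < d" using dpos by simp
    finally show ?thesis .
  qed
  have near: "dist (x + s *\<^sub>R u + t *\<^sub>R v) x < d" if "0 \<le> s" "s \<le> h" "0 \<le> t" "t \<le> h" for s t
  proof -
    have "norm (s *\<^sub>R u + t *\<^sub>R v) \<le> s * norm u + t * norm v"
      using that norm_triangle_ineq[of "s *\<^sub>R u" "t *\<^sub>R v"] by simp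
    also have "\<dots> \<le> h * norm u + h * norm v" using that by (intro add_mono mult_right_mono) auto
    finally show ?thesis using hd by (simp add: dist_norm algebra_simps)
  qed
  have inA: "x + s *\<^sub>R u + t *\<^sub>R v \<in> A" if "0 \<le> s" "s \<le> h" "0 \<le> t" "t \<le> h" for s t
    using near[OF that] d3 by (auto simp: d_def dist_commute)
  obtain s t where st: "0 < s" "s < h" "0 < t" "t < h"
     "f (x + h *\<^sub>R u + h *\<^sub>R v) - f (x + h *\<^sub>R u) - f (x + h *\<^sub>R v) + f x = h * h * ?P (x + s *\<^sub>R u + t *\<^sub>R v)"
    using second_difference[OF f h inA] by blast
  have "x + s *\<^sub>R v + t *\<^sub>R u \<in> A" if "0 \<le> s" "s \<le> h" "0 \<le> t" "t \<le> h" for s t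
    using inA[OF that(3,4,1,2)] by (simp add: add_ac)
  from second_difference[OF f h this]
  obtain s' t' where st': "0 < s'" "s' < h" "0 < t'" "t' < h"
     "f (x + h *\<^sub>R v + h *\<^sub>R u) - f (x + h *\<^sub>R v) - f (x + h *\<^sub>R u) + f x = h * h * ?Q (x + s' *\<^sub>R v + t' *\<^sub>R u)"
    by blast
  have "h * h * ?P (x + s *\<^sub>R u + t *\<^sub>R v) = h * h * ?Q (x + t' *\<^sub>R u + s' *\<^sub>R v)"
  proof -
    have e: "x + h *\<^sub>R v + h *\<^sub>R u = x + h *\<^sub>R u + h *\<^sub>R v"
      "x + t' *\<^sub>R u + s' *\<^sub>R v = x + s' *\<^sub>R v + t' *\<^sub>R u" by simp_all
    show ?thesis unfolding e(2) st(5)[symmetric] st'(5)[symmetric] unfolding e(1) by simp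
  qed
  then have eq: "?P (x + s *\<^sub>R u + t *\<^sub>R v) = ?Q (x + t' *\<^sub>R u + s' *\<^sub>R v)" using h by simp
  have "dist (?P (x + s *\<^sub>R u + t *\<^sub>R v)) (?P x) < e" "dist (?Q (x + t' *\<^sub>R u + s' *\<^sub>R v)) (?Q x) < e"
    using d(2,4) near st st' by (auto simp: d_def)
  then have "\<bar>?P x - ?Q x\<bar> < 2 * e" unfolding eq dist_real_def by linarith
  then show False by (simp add: e_def)
qed

lemma second_derivative_symmetric:
  fixes f :: "'a::euclidean_space \<Rightarrow> 'b::euclidean_space"
  assumes f: "smooth_on A f" and A: "open A" "x \<in> A"
  shows "der (\<lambda>y. der f y u) x v = der (\<lambda>y. der f y v) x u"
proof (rule euclidean_eqI)
  fix b :: 'b assume "b \<in> Basis"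
  have in1: "der (\<lambda>y. g y \<bullet> b) y w = der g y w \<bullet> b" if "smooth_on A g" "y \<in> A" for g :: "'a \<Rightarrow> 'b" and y w
    using der_eqI[OF bounded_linear.has_derivative[OF bounded_linear_inner_left smooth_on_has_derivative[OF that]], of b]
    by simp
  have in2: "der (\<lambda>y. der f y u) x v \<bullet> b = der (\<lambda>y. der (\<lambda>y. f y \<bullet> b) y u) x v" for u v
    using in1[OF smooth_on_der[OF f] A(2), of u v]
      der_cong_open[OF A, of "\<lambda>y. der (\<lambda>y. f y \<bullet> b) y u" "\<lambda>y. der f y u \<bullet> b"] in1[OF f] by simp
  show "der (\<lambda>y. der f y u) x v \<bullet> b = der (\<lambda>y. der f y v) x u \<bullet> b"
    unfolding in2
    by (rule second_derivative_symmetric_real[OF smooth_on_linear[OF A(1) bounded_linear_inner_left f] A])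
qed

section \<open>Manifolds and vector fields\<close>

locale manifold =
  fixes M :: "('m, 'e::euclidean_space) mfd"
  assumes smooth_manifold: "smooth_manifold M"
begin

lemma is_chart: "c \<in> atlas M \<Longrightarrow> is_chart (mtop M) c"
  using smooth_manifold by (simp add: smooth_manifold_def)

lemma openin_chart: "c \<in> atlas M \<Longrightarrow> openin (mtop M) (fst c)"
  using is_chart by (simp add: is_chart_def)

lemma chart_homeomorphic:
  "c \<in> atlas M \<Longrightarrow> homeomorphic_map (subtopology (mtop M) (fst c)) (top_of_set (snd c ` fst c)) (snd c)"
  using is_chart by (simp add: is_chart_def)

lemma inj_chart: "c \<in> atlas M \<Longrightarrow> inj_on (snd c) (fst c)"
  using homeomorphic_imp_injective_map[OF chart_homeomorphic] openin_subset[OF openin_chart]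
  by (simp add: topspace_subtopology inf_absorb2)

lemma chart_inv_chart: "c \<in> atlas M \<Longrightarrow> p \<in> fst c \<Longrightarrow> chart_inv c (snd c p) = p"
  by (simp add: chart_inv_def inj_chart)

lemma open_chart_image:
  assumes "c \<in> atlas M" "openin (mtop M) U" "U \<subseteq> fst c"
  shows "open (snd c ` U)"
proof -
  have "openin (top_of_set (snd c ` fst c)) (snd c ` U)"
    using homeomorphic_imp_open_map[OF chart_homeomorphic[OF assms(1)]] assms
    by (metis openin_chart openin_open_subtopology open_map_def)
  moreover have "open (snd c ` fst c)" using is_chart[OF assms(1)] by (simp add: is_chart_def)
  ultimately show ?thesis by (simp add: openin_open_eq)
qed

lemma ex_chart: "p \<in> points M \<Longrightarrow> \<exists>c\<in>atlas M. p \<in> fst c"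
  using smooth_manifold by (auto simp: smooth_manifold_def)

lemma chart_points: "c \<in> atlas M \<Longrightarrow> p \<in> fst c \<Longrightarrow> p \<in> points M"
  using openin_subset[OF openin_chart] by blast

lemma chart_at: "c \<in> atlas M \<Longrightarrow> p \<in> fst c \<Longrightarrow> chart_at M p \<in> atlas M \<and> p \<in> fst (chart_at M p)"
  unfolding chart_at_def by (rule someI2[of _ c]) auto

lemma smooth_on_transition:
  "c \<in> atlas M \<Longrightarrow> d \<in> atlas M \<Longrightarrow> smooth_on (snd c ` (fst c \<inter> fst d)) (snd d \<circ> chart_inv c)"
  using smooth_manifold by (simp add: smooth_manifold_def)

lemma open_chart_inter: "c \<in> atlas M \<Longrightarrow> d \<in> atlas M \<Longrightarrow> open (snd c ` (fst c \<inter> fst d))"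
  by (intro open_chart_image) (auto intro: openin_chart)

lemma transition_has_derivative:
  assumes "c \<in> atlas M" "d \<in> atlas M" "p \<in> fst c" "p \<in> fst d"
  shows "((snd d \<circ> chart_inv c) has_derivative der (snd d \<circ> chart_inv c) (snd c p)) (at (snd c p))"
  using assms by (intro smooth_on_has_derivative[OF smooth_on_transition]) auto

lemma linear_transition:
  assumes "c \<in> atlas M" "d \<in> atlas M" "p \<in> fst c" "p \<in> fst d"
  shows "linear (der (snd d \<circ> chart_inv c) (snd c p))"
  using transition_has_derivative[OF assms] has_derivative_linear by blast

lemma der_compose_transition:
  assumes "c \<in> atlas M" "d \<in> atlas M" "p \<in> fst c" "p \<in> fst d"
    and f: "(f \<circ> chart_inv d) differentiable (at (snd d p))"
  shows "((f \<circ> chart_inv c) has_derivative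
    (\<lambda>v. der (f \<circ> chart_inv d) (snd d p) (der (snd d \<circ> chart_inv c) (snd c p) v))) (at (snd c p))"
proof -
  have "(((f \<circ> chart_inv d) \<circ> (snd d \<circ> chart_inv c)) has_derivative
    (der (f \<circ> chart_inv d) (snd d p) \<circ> der (snd d \<circ> chart_inv c) (snd c p))) (at (snd c p))"
    using transition_has_derivative[OF assms(1-4)] has_derivative_der[OF f] assms
    by (intro diff_chain_at) (auto simp: chart_inv_chart)
  then have "((f \<circ> chart_inv c) has_derivative
    (der (f \<circ> chart_inv d) (snd d p) \<circ> der (snd d \<circ> chart_inv c) (snd c p))) (at (snd c p))"
    by (rule has_derivative_transform_within_open[OF _ open_chart_inter[OF assms(1,2)]])
      (use assms in \<open>auto simp: chart_inv_chart\<close>)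
  then show ?thesis by (simp add: comp_def)
qed

lemma transition_cocycle:
  assumes "c \<in> atlas M" "d \<in> atlas M" "e \<in> atlas M" "p \<in> fst c" "p \<in> fst d" "p \<in> fst e"
  shows "der (snd e \<circ> chart_inv d) (snd d p) (der (snd d \<circ> chart_inv c) (snd c p) v) =
    der (snd e \<circ> chart_inv c) (snd c p) v"
proof -
  have "(snd e \<circ> chart_inv d) differentiable (at (snd d p))"
    using transition_has_derivative[OF assms(2,3,5,6)] unfolding differentiable_def by blast
  from der_eqI[OF der_compose_transition[OF assms(1,2,4,5) this]] show ?thesis by simp
qed

lemma transition_self:
  assumes "c \<in> atlas M" "p \<in> fst c"
  shows "der (snd c \<circ> chart_inv c) (snd c p) v = v"
proof -
  have "((snd c \<circ> chart_inv c) has_derivative (\<lambda>v. v)) (at (snd c p))"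
    by (rule has_derivative_transform_within_open[OF has_derivative_ident open_chart_inter[OF assms(1,1)]])
      (use assms in \<open>auto simp: chart_inv_chart\<close>)
  then show ?thesis by (simp add: der_eqI)
qed

lemma tangent_transition:
  "v \<in> tangent_space M p \<Longrightarrow> c \<in> atlas M \<Longrightarrow> d \<in> atlas M \<Longrightarrow> p \<in> fst c \<Longrightarrow> p \<in> fst d \<Longrightarrow>
    v d = der (snd d \<circ> chart_inv c) (snd c p) (v c)"
  unfolding tangent_space_def by blast

lemma tangent_outside: "v \<in> tangent_space M p \<Longrightarrow> \<not> (c \<in> atlas M \<and> p \<in> fst c) \<Longrightarrow> v c = 0"
  unfolding tangent_space_def by blast

lemma tangentI:
  assumes "\<And>c. \<not> (c \<in> atlas M \<and> p \<in> fst c) \<Longrightarrow> v c = 0"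
    and "\<And>c d. c \<in> atlas M \<Longrightarrow> d \<in> atlas M \<Longrightarrow> p \<in> fst c \<Longrightarrow> p \<in> fst d \<Longrightarrow>
      v d = der (snd d \<circ> chart_inv c) (snd c p) (v c)"
  shows "v \<in> tangent_space M p"
  unfolding tangent_space_def using assms by blast

text \<open>The transition derivatives determine the components in all charts around
  \<open>p\<close>, and the remaining ones are zero by convention. This is what allows identities
  between tangent vectors to be checked in one chart.\<close>

lemma tangent_eqI:
  assumes "u \<in> tangent_space M p" "v \<in> tangent_space M p" "c \<in> atlas M" "p \<in> fst c" "u c = v c"
  shows "u = v"
proof
  fix d show "u d = v d"
  proof (cases "d \<in> atlas M \<and> p \<in> fst d")
    case True
    then show ?thesis
      by (metis assms tangent_transition)
  next
    case False
    then show ?thesis using assms tangent_outside by metis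
  qed
qed

lemma coord_field_tangent:
  "c \<in> atlas M \<Longrightarrow> p \<in> fst c \<Longrightarrow> coord_field M c x p \<in> tangent_space M p"
  by (rule tangentI) (auto simp: coord_field_def transition_cocycle)

lemma coord_field_self: "c \<in> atlas M \<Longrightarrow> p \<in> fst c \<Longrightarrow> coord_field M c x p c = x"
  by (simp add: coord_field_def transition_self)

lemma tangent_coord_field:
  "v \<in> tangent_space M p \<Longrightarrow> c \<in> atlas M \<Longrightarrow> p \<in> fst c \<Longrightarrow> coord_field M c (v c) p = v"
  by (rule tangent_eqI[OF coord_field_tangent]) (auto simp: coord_field_self)

lemma tangent_lincomb:
  assumes "u \<in> tangent_space M p" "v \<in> tangent_space M p"
  shows "(\<lambda>d. r *\<^sub>R u d + s *\<^sub>R v d) \<in> tangent_space M p"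
proof (rule tangentI)
  fix c d assume *: "c \<in> atlas M" "d \<in> atlas M" "p \<in> fst c" "p \<in> fst d"
  show "r *\<^sub>R u d + s *\<^sub>R v d = der (snd d \<circ> chart_inv c) (snd c p) (r *\<^sub>R u c + s *\<^sub>R v c)"
    unfolding linear_add[OF linear_transition[OF *]] linear_scale[OF linear_transition[OF *]]
      tangent_transition[OF assms(1) *, symmetric] tangent_transition[OF assms(2) *, symmetric] ..
qed (simp add: tangent_outside[OF assms(1)] tangent_outside[OF assms(2)])

lemma tangent_zero: "(\<lambda>d. 0) \<in> tangent_space M p"
  by (rule tangentI) (simp_all add: linear_0[OF linear_transition])

lemma tangent_sum:
  "(\<And>j. j \<in> J \<Longrightarrow> v j \<in> tangent_space M p) \<Longrightarrow> (\<lambda>d. \<Sum>j\<in>J. r j *\<^sub>R v j d) \<in> tangent_space M p"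
proof (induction J rule: infinite_finite_induct)
  case (insert j J)
  then show ?case
    using tangent_lincomb[of "v j" p "\<lambda>d. \<Sum>j\<in>J. r j *\<^sub>R v j d" "r j" 1] by simp
qed (auto simp: tangent_zero)

text \<open>The transition derivative produced by the chain rule is the one that relates the
  components of \<open>v\<close>, so the arbitrary choice in \<open>chart_at\<close>
  cancels.\<close>

lemma dirderiv_chart:
  assumes "v \<in> tangent_space M p" "c \<in> atlas M" "p \<in> fst c"
    and f: "((\<lambda>x. f (chart_inv c x)) has_derivative f') (at (snd c p))"
  shows "dirderiv M p v f = f' (v c)"
proof -
  let ?e = "chart_at M p"
  have e: "?e \<in> atlas M" "p \<in> fst ?e" using chart_at assms by blast+
  have "(f \<circ> chart_inv c) differentiable (at (snd c p))"
    using f by (auto simp: differentiable_def comp_def)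
  from der_eqI[OF der_compose_transition[OF e(1) assms(2) e(2) assms(3) this]]
  show ?thesis
    using tangent_transition[OF assms(1) e(1) assms(2) e(2) assms(3)] der_eqI[OF f]
    by (simp add: dirderiv_def comp_def)
qed

lemma smooth_funI:
  assumes "c \<in> atlas M" "V \<subseteq> fst c" "openin (mtop M) V" "smooth_on (snd c ` V) (\<lambda>x. f (chart_inv c x))"
  shows "smooth_fun M V f"
  unfolding smooth_fun_def
proof
  fix d assume d: "d \<in> atlas M"
  have op: "open (snd d ` (V \<inter> fst d))"
    using d assms by (intro open_chart_image) (auto intro: openin_chart)
  have "smooth_on (snd d ` (V \<inter> fst d)) (\<lambda>y. f (chart_inv c ((snd c \<circ> chart_inv d) y)))"
    by (rule smooth_on_compose[OF assms(4) op smooth_on_subset[OF smooth_on_transition[OF d assms(1)]]])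
      (use assms d in \<open>auto simp: chart_inv_chart\<close>)
  then show "smooth_on (snd d ` (V \<inter> fst d)) (f \<circ> chart_inv d)"
    by (rule smooth_on_cong[OF _ op]) (use assms d in \<open>auto simp: chart_inv_chart subset_iff\<close>)
qed

lemma smooth_funD:
  assumes "smooth_fun M V f" "c \<in> atlas M"
  shows "smooth_on (snd c ` (V \<inter> fst c)) (\<lambda>x. f (chart_inv c x))"
  using assms by (auto simp: smooth_fun_def comp_def)

end

section \<open>Vector fields along a smooth map\<close>

locale mfd_map = S: manifold S + M: manifold M
  for S :: "('s, 'a::euclidean_space) mfd" and M :: "('m, 'e::euclidean_space) mfd" +
  fixes i :: "'s \<Rightarrow> 'm"
  assumes smooth_map: "smooth_map S M i"
begin

lemma i_points: "p \<in> points S \<Longrightarrow> i p \<in> points M"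
  using smooth_map by (auto simp: smooth_map_def continuous_map_def)

lemma openin_chart_pair:
  assumes "c \<in> atlas S" "d \<in> atlas M"
  shows "openin (mtop S) (fst c \<inter> i -` fst d)"
proof -
  have "openin (mtop S) {p \<in> points S. i p \<in> fst d}"
    using smooth_map openin_continuous_map_preimage[OF _ M.openin_chart[OF assms(2)]]
    unfolding smooth_map_def by blast
  then have "openin (mtop S) (fst c \<inter> {p \<in> points S. i p \<in> fst d})"
    using S.openin_chart assms by blast
  moreover have "fst c \<inter> {p \<in> points S. i p \<in> fst d} = fst c \<inter> i -` fst d"
    using S.chart_points[OF assms(1)] by auto
  ultimately show ?thesis by simp
qed

lemma smooth_on_map:
  "c \<in> atlas S \<Longrightarrow> d \<in> atlas M \<Longrightarrow> smooth_on (snd c ` (fst c \<inter> i -` fst d)) (\<lambda>x. snd d (i (chart_inv c x)))"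
  using smooth_map by (auto simp: smooth_map_def comp_def)

lemma along_tangent: "Y \<in> vfields_along S M i V \<Longrightarrow> p \<in> V \<Longrightarrow> Y p \<in> tangent_space M (i p)"
  by (simp add: vfields_along_def)

lemma along_smooth:
  assumes "Y \<in> vfields_along S M i V" "c \<in> atlas S" "d \<in> atlas M" "U \<subseteq> V \<inter> fst c \<inter> i -` fst d"
  shows "smooth_on (snd c ` U) (\<lambda>x. Y (chart_inv c x) d)"
  by (rule smooth_on_subset[of "snd c ` (V \<inter> fst c \<inter> i -` fst d)"])
    (use assms in \<open>auto simp: vfields_along_def\<close>)

lemma along_subset:
  assumes "Y \<in> vfields_along S M i V" "U \<subseteq> V"
  shows "Y \<in> vfields_along S M i U"
proof -
  have "smooth_on (snd c ` (U \<inter> fst c \<inter> i -` fst d)) (\<lambda>x. Y (chart_inv c x) d)"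
    if "c \<in> atlas S" "d \<in> atlas M" for c d
    using assms(2) by (intro along_smooth[OF assms(1) that]) blast
  moreover have "\<forall>p\<in>U. Y p \<in> tangent_space M (i p)"
    using along_tangent[OF assms(1)] assms(2) by blast
  ultimately show ?thesis by (simp add: vfields_along_def[of _ _ _ U])
qed

text \<open>Smoothness near a point in one pair of charts carries over to every pair: the components
  in \<open>d'\<close> are the transition derivative from \<open>d\<close> to \<open>d'\<close>,
  taken along \<open>i\<close>, applied to the components in \<open>d\<close>.\<close>

lemma alongI:
  assumes tan: "\<And>p. p \<in> V \<Longrightarrow> Y p \<in> tangent_space M (i p)"
    and loc: "\<And>p. p \<in> V \<Longrightarrow> \<exists>c\<in>atlas S. \<exists>d\<in>atlas M. \<exists>U. openin (mtop S) U \<and> p \<in> U \<and>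
      U \<subseteq> V \<inter> fst c \<inter> i -` fst d \<and> smooth_on (snd c ` U) (\<lambda>x. Y (chart_inv c x) d)"
  shows "Y \<in> vfields_along S M i V"
proof -
  have "smooth_on (snd c' ` (V \<inter> fst c' \<inter> i -` fst d')) (\<lambda>x. Y (chart_inv c' x) d')"
    if c': "c' \<in> atlas S" and d': "d' \<in> atlas M" for c' d'
  proof (rule smooth_on_local)
    fix x assume "x \<in> snd c' ` (V \<inter> fst c' \<inter> i -` fst d')"
    then obtain p where p: "p \<in> V" "p \<in> fst c'" "i p \<in> fst d'" "x = snd c' p" by auto
    from loc[OF p(1)] obtain c d U where *: "c \<in> atlas S" "d \<in> atlas M" "openin (mtop S) U" "p \<in> U"
      "U \<subseteq> V \<inter> fst c \<inter> i -` fst d" "smooth_on (snd c ` U) (\<lambda>x. Y (chart_inv c x) d)" by blast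
    \<comment> \<open>The part of \<open>U\<close> on which the new charts \<open>c'\<close> and
      \<open>d'\<close> are defined as well.\<close>
    define U' where "U' = U \<inter> (fst c' \<inter> i -` fst d')"
    have U': "openin (mtop S) U'" unfolding U'_def
      using *(3) openin_chart_pair[OF c' d'] by blast
    have sub: "U' \<subseteq> fst c'" "U' \<subseteq> fst c" "U' \<subseteq> U" "U' \<subseteq> V" "U' \<subseteq> i -` fst d" "U' \<subseteq> i -` fst d'"
      using *(5) by (auto simp: U'_def)
    have op: "open (snd c' ` U')" using S.open_chart_image[OF c' U' sub(1)] .
    have 1: "smooth_on (snd c' ` U') (\<lambda>y. Y (chart_inv c ((snd c \<circ> chart_inv c') y)) d)"
      by (rule smooth_on_compose[OF *(6) op smooth_on_subset[OF S.smooth_on_transition[OF c' *(1)]]])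
        (use sub c' *(1) in \<open>auto simp: S.chart_inv_chart subset_iff\<close>)
    have 2: "smooth_on (snd c' ` U') (\<lambda>y. der (snd d' \<circ> chart_inv d) (snd d (i (chart_inv c' y))) v)" for v
      by (rule smooth_on_compose[OF smooth_on_der[OF M.smooth_on_transition[OF *(2) d']] op
            smooth_on_subset[OF smooth_on_map[OF c' *(2)]]])
        (use sub c' in \<open>auto simp: S.chart_inv_chart subset_iff\<close>)
    have "smooth_on (snd c' ` U') (\<lambda>y. der (snd d' \<circ> chart_inv d) (snd d (i (chart_inv c' y)))
       (Y (chart_inv c ((snd c \<circ> chart_inv c') y)) d))"
      by (rule smooth_on_linear_family[OF op _ 2 1])
        (use sub c' d' *(2) in \<open>auto intro!: M.linear_transition simp: S.chart_inv_chart subset_iff\<close>)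
    then have "smooth_on (snd c' ` U') (\<lambda>x. Y (chart_inv c' x) d')"
    proof (rule smooth_on_cong[OF _ op])
      fix y assume "y \<in> snd c' ` U'"
      then obtain q where q: "q \<in> U'" "y = snd c' q" by auto
      have "Y q d' = der (snd d' \<circ> chart_inv d) (snd d (i q)) (Y q d)"
        using q sub d' *(2) by (intro M.tangent_transition tan) auto
      moreover have "q \<in> fst c'" "q \<in> fst c" using q sub by auto
      ultimately show "der (snd d' \<circ> chart_inv d) (snd d (i (chart_inv c' y)))
           (Y (chart_inv c ((snd c \<circ> chart_inv c') y)) d) = Y (chart_inv c' y) d'"
        using q c' *(1) by (simp add: S.chart_inv_chart)
    qed
    then show "\<exists>B. open B \<and> x \<in> B \<and> smooth_on B (\<lambda>x. Y (chart_inv c' x) d')"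
      using op p * by (intro exI[of _ "snd c' ` U'"]) (auto simp: U'_def)
  qed
  then show ?thesis using tan by (simp add: vfields_along_def)
qed

lemma differential_chart:
  assumes "c \<in> atlas S" "d \<in> atlas M" "p \<in> fst c" "i p \<in> fst d" "v \<in> tangent_space S p"
  shows "differential S M i p v d = der (\<lambda>x. snd d (i (chart_inv c x))) (snd c p) (v c)"
proof -
  have "((\<lambda>x. (snd d \<circ> i) (chart_inv c x)) has_derivative der (\<lambda>x. snd d (i (chart_inv c x))) (snd c p)) (at (snd c p))"
    using smooth_on_has_derivative[OF smooth_on_map[OF assms(1,2)]] assms by auto
  from S.dirderiv_chart[OF assms(5,1,3) this] show ?thesis using assms by (simp add: differential_def comp_def)
qed

lemma differential_tangent:
  assumes "v \<in> tangent_space S p" "p \<in> points S"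
  shows "differential S M i p v \<in> tangent_space M (i p)"
proof -
  obtain c where c: "c \<in> atlas S" "p \<in> fst c" using S.ex_chart assms by blast
  have "differential S M i p v e = der (snd e \<circ> chart_inv d) (snd d (i p)) (differential S M i p v d)"
    if d: "d \<in> atlas M" "i p \<in> fst d" "e \<in> atlas M" "i p \<in> fst e" for d e
  proof -
    let ?U = "fst c \<inter> i -` fst d \<inter> (fst c \<inter> i -` fst e)"
    have U: "openin (mtop S) ?U" using openin_chart_pair[OF c(1)] d by blast
    have op: "open (snd c ` ?U)" by (intro S.open_chart_image c U) auto
    have "((snd e \<circ> chart_inv d) \<circ> (\<lambda>x. snd d (i (chart_inv c x))) has_derivative
       der (snd e \<circ> chart_inv d) (snd d (i p)) \<circ> der (\<lambda>x. snd d (i (chart_inv c x))) (snd c p)) (at (snd c p))"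
      using c d M.transition_has_derivative[OF d(1,3,2,4)]
      by (intro diff_chain_at smooth_on_has_derivative[OF smooth_on_map[OF c(1) d(1)]])
         (auto simp: S.chart_inv_chart)
    then have "((\<lambda>x. snd e (i (chart_inv c x))) has_derivative
       der (snd e \<circ> chart_inv d) (snd d (i p)) \<circ> der (\<lambda>x. snd d (i (chart_inv c x))) (snd c p)) (at (snd c p))"
      by (rule has_derivative_transform_within_open[OF _ op])
        (use c d in \<open>auto simp: S.chart_inv_chart M.chart_inv_chart\<close>)
    from der_eqI[OF this] show ?thesis
      using differential_chart[OF c(1) d(1) c(2) d(2) assms(1)] differential_chart[OF c(1) d(3) c(2) d(4) assms(1)]
      by simp
  qed
  then show ?thesis by (rule M.tangentI[rotated]) (auto simp: differential_def)
qed

lemma differential_lincomb: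
  assumes "u \<in> tangent_space S p" "v \<in> tangent_space S p" "p \<in> points S"
  shows "differential S M i p (\<lambda>c. r *\<^sub>R u c + s *\<^sub>R v c) =
    (\<lambda>d. r *\<^sub>R differential S M i p u d + s *\<^sub>R differential S M i p v d)"
proof
  obtain c where c: "c \<in> atlas S" "p \<in> fst c" using S.ex_chart assms by blast
  fix d show "differential S M i p (\<lambda>c. r *\<^sub>R u c + s *\<^sub>R v c) d =
    r *\<^sub>R differential S M i p u d + s *\<^sub>R differential S M i p v d"
  proof (cases "d \<in> atlas M \<and> i p \<in> fst d")
    case True
    have "linear (der (\<lambda>x. snd d (i (chart_inv c x))) (snd c p))"
      using smooth_on_linear_der[OF smooth_on_map[OF c(1)]] c True by auto
    then show ?thesis
      using assms True c by (simp add: differential_chart[OF c(1) _ c(2)] S.tangent_lincomb linear_add linear_scale)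
  qed (auto simp: differential_def)
qed

end

text \<open>Makes the vector fields of \<open>M\<close>, which are fields along \<open>id\<close>,
  an instance of the results on fields along a map.\<close>

lemma (in manifold) mfd_map_id: "mfd_map M M id"
proof unfold_locales
  show "smooth_map M M id"
    using smooth_on_transition by (auto simp: smooth_map_def)
qed

context manifold begin

lemmas vfields_tangent = mfd_map.along_tangent[OF mfd_map_id, simplified]
lemmas vfields_subset = mfd_map.along_subset[OF mfd_map_id]

lemma vfields_smooth:
  "X \<in> vfields M V \<Longrightarrow> c \<in> atlas M \<Longrightarrow> U \<subseteq> V \<Longrightarrow> U \<subseteq> fst c \<Longrightarrow> smooth_on (snd c ` U) (\<lambda>x. X (chart_inv c x) c)"
  by (rule mfd_map.along_smooth[OF mfd_map_id]) auto

lemma vfieldsI: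
  assumes "c \<in> atlas M" "openin (mtop M) V" "V \<subseteq> fst c" "\<And>p. p \<in> V \<Longrightarrow> X p \<in> tangent_space M p"
    "smooth_on (snd c ` V) (\<lambda>x. X (chart_inv c x) c)"
  shows "X \<in> vfields M V"
  using assms by (intro mfd_map.alongI[OF mfd_map_id] bexI[of _ c] exI[of _ V]) auto

lemma coord_field_vfieldsI:
  assumes "c \<in> atlas M" "openin (mtop M) V" "V \<subseteq> fst c" "smooth_on (snd c ` V) (\<lambda>x. \<xi> (chart_inv c x))"
  shows "(\<lambda>q. coord_field M c (\<xi> q) q) \<in> vfields M V"
proof (rule vfieldsI[OF assms(1-3)])
  show "coord_field M c (\<xi> p) p \<in> tangent_space M p" if "p \<in> V" for p
    using that assms by (intro coord_field_tangent) auto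
  show "smooth_on (snd c ` V) (\<lambda>x. coord_field M c (\<xi> (chart_inv c x)) (chart_inv c x) c)"
    by (rule smooth_on_cong[OF assms(4) open_chart_image[OF assms(1-3)]])
      (use assms in \<open>auto simp: chart_inv_chart coord_field_self subset_iff\<close>)
qed

lemma coord_field_vfields:
  "c \<in> atlas M \<Longrightarrow> openin (mtop M) V \<Longrightarrow> V \<subseteq> fst c \<Longrightarrow> coord_field M c u \<in> vfields M V"
  using coord_field_vfieldsI[of c V "\<lambda>_. u"] by (simp add: smooth_on_const)

lemma vfields_lincomb:
  assumes "c \<in> atlas M" "openin (mtop M) V" "V \<subseteq> fst c" "\<And>j. j \<in> J \<Longrightarrow> Y j \<in> vfields M V"
    "\<And>j. j \<in> J \<Longrightarrow> smooth_on (snd c ` V) (\<lambda>x. f j (chart_inv c x))"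
  shows "(\<lambda>q b. \<Sum>j\<in>J. f j q *\<^sub>R Y j q b) \<in> vfields M V"
proof (rule vfieldsI[OF assms(1-3)])
  show "(\<lambda>b. \<Sum>j\<in>J. f j p *\<^sub>R Y j p b) \<in> tangent_space M p" if "p \<in> V" for p
    using that assms(4) by (intro tangent_sum vfields_tangent)
  show "smooth_on (snd c ` V) (\<lambda>x. \<Sum>j\<in>J. f j (chart_inv c x) *\<^sub>R Y j (chart_inv c x) c)"
    using open_chart_image[OF assms(1-3)] assms
    by (intro smooth_on_sum smooth_on_scaleR vfields_smooth[of _ V]) auto
qed

lemma lie_bracket_coord_field:
  assumes "c \<in> atlas M" "q \<in> fst c"
  shows "lie_bracket M (coord_field M c u) (coord_field M c v) q c = 0"
proof -
  have "dirderiv M q (coord_field M c w q) (\<lambda>r. coord_field M c w' r c) = 0" for w w'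
  proof (rule dirderiv_chart[OF coord_field_tangent[OF assms] assms])
    show "((\<lambda>x. coord_field M c w' (chart_inv c x) c) has_derivative (\<lambda>x. 0)) (at (snd c q))"
      by (rule has_derivative_transform_within_open[OF has_derivative_const[of w'] open_chart_inter[OF assms(1,1)]])
        (use assms in \<open>auto simp: chart_inv_chart coord_field_self\<close>)
  qed
  then show ?thesis using assms by (simp add: lie_bracket_def)
qed

end

section \<open>Connections in coordinates\<close>

locale connection = manifold M for M :: "('m, 'e::euclidean_space) mfd" +
  fixes N :: "('m, 'e) conn"
  assumes affine_connection: "affine_connection M N"
begin

context
  fixes V X Y
  assumes V: "openin (mtop M) V" and X: "X \<in> vfields M V" and Y: "Y \<in> vfields M V"
begin

lemmas conn_axioms = affine_connection[unfolded affine_connection_def, rule_format, OF V X Y]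

lemma conn_vfields: "N X Y \<in> vfields M V"
  by (rule conn_axioms[THEN conjunct1])

lemma conn_local:
  "X' \<in> vfields M V \<Longrightarrow> Y' \<in> vfields M V \<Longrightarrow> (\<And>p. p \<in> V \<Longrightarrow> X' p = X p) \<Longrightarrow> (\<And>p. p \<in> V \<Longrightarrow> Y' p = Y p) \<Longrightarrow>
    p \<in> V \<Longrightarrow> N X' Y' p = N X Y p"
  by (rule conn_axioms[THEN conjunct2, THEN conjunct1, rule_format]) simp_all

lemma conn_add_left: "Z \<in> vfields M V \<Longrightarrow> p \<in> V \<Longrightarrow>
    N (\<lambda>q b. X q b + Z q b) Y p c = N X Y p c + N Z Y p c"
  using conn_axioms[THEN conjunct2, THEN conjunct2, THEN conjunct1, rule_format] by blast

lemma conn_add_right: "Z \<in> vfields M V \<Longrightarrow> p \<in> V \<Longrightarrow>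
    N X (\<lambda>q b. Y q b + Z q b) p c = N X Y p c + N X Z p c"
  using conn_axioms[THEN conjunct2, THEN conjunct2, THEN conjunct1, rule_format] by blast

lemma conn_scale_left: "smooth_fun M V f \<Longrightarrow> p \<in> V \<Longrightarrow>
    N (\<lambda>q b. f q *\<^sub>R X q b) Y p c = f p *\<^sub>R N X Y p c"
  using conn_axioms[THEN conjunct2, THEN conjunct2, THEN conjunct2, rule_format] by blast

lemma conn_scale_right: "smooth_fun M V f \<Longrightarrow> p \<in> V \<Longrightarrow>
    N X (\<lambda>q b. f q *\<^sub>R Y q b) p c = f p *\<^sub>R N X Y p c + dirderiv M p (X p) f *\<^sub>R Y p c"
  using conn_axioms[THEN conjunct2, THEN conjunct2, THEN conjunct2, rule_format] by blast

end

context
  fixes V c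
  assumes c: "c \<in> atlas M" and V: "openin (mtop M) V" "V \<subseteq> fst c"
begin

lemma zero_vfields: "(\<lambda>q b. 0) \<in> vfields M V"
  using vfields_lincomb[OF c V, of "{}"] by simp

lemma scale_vfields:
  assumes "Y \<in> vfields M V" "smooth_on (snd c ` V) (\<lambda>x. f (chart_inv c x))"
  shows "(\<lambda>q b. f q *\<^sub>R Y q b) \<in> vfields M V"
  using vfields_lincomb[OF c V, of "{()}" "\<lambda>_. Y" "\<lambda>_. f"] assms by simp

lemma conn_sum_left:
  assumes "finite J" "Y \<in> vfields M V" "p \<in> V" "\<And>j. j \<in> J \<Longrightarrow> X j \<in> vfields M V"
    "\<And>j. j \<in> J \<Longrightarrow> smooth_on (snd c ` V) (\<lambda>x. f j (chart_inv c x))"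
  shows "N (\<lambda>q b. \<Sum>j\<in>J. f j q *\<^sub>R X j q b) Y p b = (\<Sum>j\<in>J. f j p *\<^sub>R N (X j) Y p b)"
  using assms(1,4,5)
proof (induction J)
  case empty
  show ?case using conn_add_left[OF V(1) zero_vfields assms(2) zero_vfields assms(3), of b] by simp
next
  case (insert j J)
  have *: "X j \<in> vfields M V" "\<And>k. k \<in> J \<Longrightarrow> X k \<in> vfields M V"
    "smooth_on (snd c ` V) (\<lambda>x. f j (chart_inv c x))"
    "\<And>k. k \<in> J \<Longrightarrow> smooth_on (snd c ` V) (\<lambda>x. f k (chart_inv c x))"
    using insert.prems by blast+
  have "N (\<lambda>q b. f j q *\<^sub>R X j q b + (\<Sum>j\<in>J. f j q *\<^sub>R X j q b)) Y p b =
     N (\<lambda>q b. f j q *\<^sub>R X j q b) Y p b + N (\<lambda>q b. \<Sum>j\<in>J. f j q *\<^sub>R X j q b) Y p b"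
    by (intro conn_add_left[OF V(1) _ assms(2) _ assms(3)] scale_vfields vfields_lincomb[OF c V] *)
  also have "N (\<lambda>q b. f j q *\<^sub>R X j q b) Y p b = f j p *\<^sub>R N (X j) Y p b"
    by (intro conn_scale_left[OF V(1) _ assms(2) _ assms(3)] smooth_funI[OF c V(2,1)] *)
  finally show ?case using insert.IH[OF *(2,4)] insert.hyps by simp
qed

lemma conn_sum_right:
  assumes "finite J" "X \<in> vfields M V" "p \<in> V" "\<And>j. j \<in> J \<Longrightarrow> Y j \<in> vfields M V"
    "\<And>j. j \<in> J \<Longrightarrow> smooth_on (snd c ` V) (\<lambda>x. f j (chart_inv c x))"
  shows "N X (\<lambda>q b. \<Sum>j\<in>J. f j q *\<^sub>R Y j q b) p b =
    (\<Sum>j\<in>J. f j p *\<^sub>R N X (Y j) p b + dirderiv M p (X p) (f j) *\<^sub>R Y j p b)"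
  using assms(1,4,5)
proof (induction J)
  case empty
  show ?case using conn_add_right[OF V(1) assms(2) zero_vfields zero_vfields assms(3), of b] by simp
next
  case (insert j J)
  have *: "Y j \<in> vfields M V" "\<And>k. k \<in> J \<Longrightarrow> Y k \<in> vfields M V"
    "smooth_on (snd c ` V) (\<lambda>x. f j (chart_inv c x))"
    "\<And>k. k \<in> J \<Longrightarrow> smooth_on (snd c ` V) (\<lambda>x. f k (chart_inv c x))"
    using insert.prems by blast+
  have "N X (\<lambda>q b. f j q *\<^sub>R Y j q b + (\<Sum>j\<in>J. f j q *\<^sub>R Y j q b)) p b =
     N X (\<lambda>q b. f j q *\<^sub>R Y j q b) p b + N X (\<lambda>q b. \<Sum>j\<in>J. f j q *\<^sub>R Y j q b) p b"
    by (intro conn_add_right[OF V(1) assms(2) _ _ assms(3)] scale_vfields vfields_lincomb[OF c V] *)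
  also have "N X (\<lambda>q b. f j q *\<^sub>R Y j q b) p b = f j p *\<^sub>R N X (Y j) p b + dirderiv M p (X p) (f j) *\<^sub>R Y j p b"
    by (intro conn_scale_right[OF V(1) assms(2) _ _ assms(3)] smooth_funI[OF c V(2,1)] *)
  finally show ?case using insert.IH[OF *(2,4)] insert.hyps by simp
qed

end

text \<open>The Christoffel symbols of \<open>N\<close> in the chart \<open>d\<close>, as a map on
  pairs of component vectors.\<close>

definition christ :: "('m, 'e) chart \<Rightarrow> 'm \<Rightarrow> 'e \<Rightarrow> 'e \<Rightarrow> 'e" where
  "christ d q u v = N (coord_field M d u) (coord_field M d v) q d"

text \<open>Written as a sum over the two booleans so that \<open>conn_sum_left\<close> and
  \<open>conn_sum_right\<close> apply with constant coefficients.\<close>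

lemma coord_field_lincomb:
  assumes "d \<in> atlas M"
  shows "coord_field M d (r *\<^sub>R u + v) = (\<lambda>q b. \<Sum>j\<in>UNIV. (if j then r else 1) *\<^sub>R coord_field M d (if j then u else v) q b)"
  using linear_transition[OF assms]
  by (auto simp: coord_field_def fun_eq_iff UNIV_bool linear_add linear_scale)

lemma bilinear_christ:
  assumes "d \<in> atlas M" "q \<in> fst d"
  shows "bilinear (christ d q)"
proof -
  have V: "openin (mtop M) (fst d)" using openin_chart assms by blast
  have f: "coord_field M d u \<in> vfields M (fst d)" for u
    using coord_field_vfields[OF assms(1) V] by simp
  have "dirderiv M q (coord_field M d u q) (\<lambda>q. r) = 0" for u and r :: real
    by (rule dirderiv_chart[OF coord_field_tangent[OF assms] assms]) simp
  then have "christ d q w (r *\<^sub>R u + v) = r *\<^sub>R christ d q w u + christ d q w v" for r u v w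
    unfolding christ_def coord_field_lincomb[OF assms(1)]
    by (subst conn_sum_right[OF assms(1) V order.refl _ f assms(2)])
       (auto simp: f smooth_on_const UNIV_bool)
  moreover have "christ d q (r *\<^sub>R u + v) w = r *\<^sub>R christ d q u w + christ d q v w" for r u v w
    unfolding christ_def coord_field_lincomb[OF assms(1)]
    by (subst conn_sum_left[OF assms(1) V order.refl _ f assms(2)])
       (auto simp: f smooth_on_const UNIV_bool)
  ultimately show ?thesis unfolding bilinear_def by (intro conjI allI linear_lincombI)
qed

lemma smooth_on_christ:
  assumes "d \<in> atlas M"
  shows "smooth_on (snd d ` fst d) (\<lambda>x. christ d (chart_inv d x) u v)"
  unfolding christ_def
  using assms openin_chart[OF assms]
  by (intro vfields_smooth[of _ "fst d"] conn_vfields coord_field_vfields) auto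

lemma bilinear_euclidean_expand:
  fixes B :: "'a::euclidean_space \<Rightarrow> 'b::euclidean_space \<Rightarrow> 'c::real_vector"
  assumes "bilinear B"
  shows "B u v = (\<Sum>a\<in>Basis. (u \<bullet> a) *\<^sub>R (\<Sum>b\<in>Basis. (v \<bullet> b) *\<^sub>R B a b))"
proof -
  have 1: "linear (\<lambda>u. B u v)" and 2: "linear (B a)" for a
    using assms by (auto simp: bilinear_def)
  show ?thesis
    using linear_euclidean_expand[OF 1, of u] linear_euclidean_expand[OF 2, of _ v, symmetric]
    by simp
qed

text \<open>By locality \<open>X\<close> and \<open>Y\<close> may be replaced on the chart domain by
  their expansions in coordinate fields. Linearity over functions and the Leibniz rule then leave
  only the values of \<open>N\<close> on coordinate fields, which are \<open>christ\<close>.\<close>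

lemma conn_chart:
  assumes "openin (mtop M) V" "X \<in> vfields M V" "Y \<in> vfields M V" "q \<in> V" "d \<in> atlas M" "q \<in> fst d"
  shows "N X Y q d = der (\<lambda>x. Y (chart_inv d x) d) (snd d q) (X q d) + christ d q (X q d) (Y q d)"
proof -
  let ?V = "V \<inter> fst d"
  have V: "openin (mtop M) ?V" using assms openin_chart by blast
  note dV = assms(5) V Int_lower2
  have XY: "X \<in> vfields M ?V" "Y \<in> vfields M ?V"
    using assms vfields_subset by (meson inf_le1)+
  have q: "q \<in> ?V" using assms by simp
  have f: "coord_field M d u \<in> vfields M ?V" for u
    using coord_field_vfields[OF dV] by simp
  define E where "E Z = (\<lambda>r b. \<Sum>e\<in>Basis. (Z r d \<bullet> e) *\<^sub>R coord_field M d e r b)" for Z :: "('m, 'e) vfield"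
  have sm: "smooth_on (snd d ` ?V) (\<lambda>x. Z (chart_inv d x) d \<bullet> e)" if "Z \<in> vfields M ?V" for Z e
    using that open_chart_image[OF dV] assms
    by (intro smooth_on_linear[OF _ bounded_linear_inner_left] vfields_smooth) auto
  have E: "E Z \<in> vfields M ?V" if "Z \<in> vfields M ?V" for Z
    unfolding E_def using that by (intro vfields_lincomb[OF dV] f sm)
  have EZ: "E Z p = Z p" if "Z \<in> vfields M ?V" "p \<in> ?V" for Z p
  proof (rule tangent_eqI[OF vfields_tangent[OF E[OF that(1)]] vfields_tangent[OF that(1)] assms(5)])
    show "E Z p d = Z p d"
      using that assms by (simp add: E_def coord_field_self euclidean_representation)
  qed (use that in auto)
  have "N X Y q d = N (E X) (E Y) q d"
    using conn_local[OF V XY E[OF XY(1)] E[OF XY(2)] EZ[OF XY(1)] EZ[OF XY(2)] q] by simp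
  also have "\<dots> = (\<Sum>e\<in>Basis. (X q d \<bullet> e) *\<^sub>R N (coord_field M d e) (E Y) q d)"
    unfolding E_def[of X] by (rule conn_sum_left[OF dV finite_Basis E[OF XY(2)] q f sm[OF XY(1)]])
  also have "\<dots> = (\<Sum>e\<in>Basis. (X q d \<bullet> e) *\<^sub>R
      ((\<Sum>e'\<in>Basis. (Y q d \<bullet> e') *\<^sub>R christ d q e e') + der (\<lambda>x. Y (chart_inv d x) d) (snd d q) e))"
  proof (intro sum.cong refl)
    fix e :: 'e
    let ?D = "der (\<lambda>x. Y (chart_inv d x) d) (snd d q)"
    have "((\<lambda>x. Y (chart_inv d x) d) has_derivative ?D) (at (snd d q))"
      using q by (intro smooth_on_has_derivative[OF vfields_smooth[OF XY(2) assms(5), of ?V]]) auto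
    then have D: "dirderiv M q (coord_field M d e q) (\<lambda>r. Y r d \<bullet> e') = ?D e \<bullet> e'" for e'
      using dirderiv_chart[OF coord_field_tangent[OF assms(5,6)] assms(5,6)
          bounded_linear.has_derivative[OF bounded_linear_inner_left]] coord_field_self[OF assms(5,6)] by simp
    have "N (coord_field M d e) (E Y) q d =
      (\<Sum>e'\<in>Basis. (Y q d \<bullet> e') *\<^sub>R christ d q e e' + (?D e \<bullet> e') *\<^sub>R e')"
      unfolding E_def[of Y] christ_def
      by (subst conn_sum_right[OF dV finite_Basis f q f sm[OF XY(2)]])
         (simp add: D coord_field_self[OF assms(5,6)])
    then show "(X q d \<bullet> e) *\<^sub>R N (coord_field M d e) (E Y) q d =
      (X q d \<bullet> e) *\<^sub>R ((\<Sum>e'\<in>Basis. (Y q d \<bullet> e') *\<^sub>R christ d q e e') + ?D e)"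
      by (simp add: sum.distrib euclidean_representation)
  qed
  also have "\<dots> = christ d q (X q d) (Y q d) + der (\<lambda>x. Y (chart_inv d x) d) (snd d q) (X q d)"
  proof -
    have "linear (der (\<lambda>x. Y (chart_inv d x) d) (snd d q))"
      using q by (intro smooth_on_linear_der[OF vfields_smooth[OF XY(2) assms(5), of ?V]]) auto
    from linear_euclidean_expand[OF this, of "X q d"] show ?thesis
      using bilinear_euclidean_expand[OF bilinear_christ[OF assms(5,6)], of "X q d" "Y q d"]
      by (simp add: scaleR_add_right sum.distrib)
  qed
  finally show ?thesis by simp
qed

end

locale torsion_free_connection = connection M N
  for M :: "('m, 'e::euclidean_space) mfd" and N +
  assumes torsion_free: "torsion_free M N"
begin

text \<open>Coordinate fields of one chart commute, so the vanishing of the torsion becomes symmetry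
  of the Christoffel symbols.\<close>

lemma christ_commute:
  assumes "d \<in> atlas M" "q \<in> fst d"
  shows "christ d q u v = christ d q v u"
proof -
  have "coord_field M d u \<in> vfields M (fst d)" for u
    using coord_field_vfields openin_chart assms by blast
  then have "christ d q u v - christ d q v u = lie_bracket M (coord_field M d u) (coord_field M d v) q d"
    using torsion_free[unfolded torsion_free_def, rule_format, OF openin_chart[OF assms(1)]] assms(2)
    unfolding christ_def by simp
  then show ?thesis using lie_bracket_coord_field[OF assms] by simp
qed

text \<open>Used to see that the bracket takes values in the tangent spaces, which its definition by
  components does not show.\<close>

lemma lie_bracket_conn:
  assumes "openin (mtop M) V" "X \<in> vfields M V" "Y \<in> vfields M V" "q \<in> V"
  shows "lie_bracket M X Y q = (\<lambda>c. N X Y q c - N Y X q c)"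
proof
  fix c show "lie_bracket M X Y q c = N X Y q c - N Y X q c"
    using torsion_free[unfolded torsion_free_def, rule_format, OF assms] by simp
qed

end

section \<open>Traces and splittings\<close>

lemma matrix_inv_eqI:
  fixes A B :: "real ^ 'n ^ 'n"
  assumes "A ** B = mat 1"
  shows "matrix_inv A = B" "invertible A"
proof -
  show "invertible A" using assms by (auto simp: invertible_right_inverse)
  then have "matrix_inv A ** (A ** B) = B"
    by (simp add: matrix_mul_assoc matrix_inv_invertible)
  then show "matrix_inv A = B" using assms by simp
qed

definition gram :: "('n::finite \<Rightarrow> 'v) \<Rightarrow> ('v \<Rightarrow> 'v \<Rightarrow> real) \<Rightarrow> real ^ 'n ^ 'n" where
  "gram e h = (\<chi> a b. h (e a) (e b))"

text \<open>The metric contraction \<open>h\<^sup>P\<^sup>Q \<beta>\<^sub>P\<^sub>Q\<close> in the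
  frame \<open>e\<close>.\<close>

definition frame_trace :: "('n::finite \<Rightarrow> 'v) \<Rightarrow> ('v \<Rightarrow> 'v \<Rightarrow> real) \<Rightarrow> ('v \<Rightarrow> 'v \<Rightarrow> real) \<Rightarrow> real" where
  "frame_trace e h \<beta> = (\<Sum>a\<in>UNIV. \<Sum>b\<in>UNIV. matrix_inv (gram e h) $ a $ b * \<beta> (e a) (e b))"

abbreviation std :: "'n::finite \<Rightarrow> real ^ 'n" where
  "std a \<equiv> axis a 1"

lemma vec_expand: "(v :: real ^ 'n) = (\<Sum>a\<in>UNIV. v $ a *\<^sub>R std a)"
  by (simp add: vec_eq_iff axis_def if_distrib cong: if_cong)

lemma linear_vec_expand:
  fixes L :: "real ^ 'n \<Rightarrow> 'b::real_vector"
  assumes "linear L"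
  shows "L v = (\<Sum>a\<in>UNIV. v $ a *\<^sub>R L (std a))"
  using arg_cong[OF vec_expand[of v], of L] assms by (simp add: linear_sum linear_scale)

lemma bilinear_vec_expand:
  fixes B :: "real ^ 'n \<Rightarrow> real ^ 'm \<Rightarrow> 'b::real_vector"
  assumes "bilinear B"
  shows "B u v = (\<Sum>a\<in>UNIV. \<Sum>b\<in>UNIV. (u $ a * v $ b) *\<^sub>R B (std a) (std b))"
proof -
  have 1: "linear (\<lambda>u. B u v)" and 2: "linear (B a)" for a
    using assms by (auto simp: bilinear_def)
  show ?thesis
    using linear_vec_expand[OF 1, of u] linear_vec_expand[OF 2, of _ v]
    by (simp add: scaleR_sum_right)
qed

lemma gram_apply:
  assumes "bilinear h" "\<And>u v. h u v = h v u"
  shows "h u w = (gram std h *v u) \<bullet> w"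
  unfolding bilinear_vec_expand[OF assms(1), of u w] inner_vec_def
  by (subst sum.swap) (simp add: matrix_vector_mult_def gram_def sum_distrib_left sum_distrib_right ac_simps assms(2))

definition frame_matrix :: "('n::finite \<Rightarrow> real ^ 'n) \<Rightarrow> real ^ 'n ^ 'n" where
  "frame_matrix e = (\<chi> i j. e j $ i)"

lemma gram_frame:
  fixes e :: "'n::finite \<Rightarrow> real ^ 'n"
  assumes "bilinear h"
  shows "gram e h = transpose (frame_matrix e) ** gram std h ** frame_matrix e"
proof -
  have "h (e i) (e j) = (\<Sum>k\<in>UNIV. (\<Sum>a\<in>UNIV. e i $ a * h (std a) (std k)) * e j $ k)" for i j
    unfolding bilinear_vec_expand[OF assms, of "e i"] sum_distrib_right
    by (subst sum.swap) (simp add: algebra_simps)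
  then show ?thesis
    by (simp add: vec_eq_iff gram_def frame_matrix_def matrix_matrix_mult_def transpose_def)
qed

lemma frame_trace_trace: "frame_trace e h \<beta> = trace (matrix_inv (gram e h) ** transpose (gram e \<beta>))"
  by (simp add: frame_trace_def trace_def matrix_matrix_mult_def transpose_def gram_def)

text \<open>A frame with matrix A turns Gram matrices G into A^T G A, and the factors A and A^-1
  cancel under the trace. Hence the coordinate frame can stand for all frames in the alignment
  equation.\<close>

lemma frame_trace_frame:
  fixes e :: "'n::finite \<Rightarrow> real ^ 'n"
  assumes h: "bilinear h" "bilinear \<beta>" and inv: "invertible (frame_matrix e)" "invertible (gram std h)"
  shows "frame_trace e h \<beta> = frame_trace std h \<beta>"
proof -
  let ?A = "frame_matrix e" and ?G = "gram std h" and ?B = "gram std \<beta>"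
  let ?A' = "matrix_inv ?A" and ?G' = "matrix_inv ?G"
  note A = matrix_inv_invertible[OF inv(1)] and G = matrix_inv_invertible[OF inv(2)]
  have T: "transpose ?A ** transpose ?A' = mat 1" "transpose ?A' ** transpose ?A = mat 1"
    using A by (metis matrix_transpose_mul transpose_mat)+
  have "(transpose ?A ** ?G ** ?A) ** (?A' ** ?G' ** transpose ?A') =
    transpose ?A ** (?G ** (?A ** ?A') ** ?G') ** transpose ?A'"
    by (simp only: matrix_mul_assoc)
  also have "\<dots> = mat 1" by (simp add: A G T)
  finally have "matrix_inv (gram e h) = ?A' ** ?G' ** transpose ?A'"
    unfolding gram_frame[OF h(1), of e] by (rule matrix_inv_eqI)
  then have "frame_trace e h \<beta> = trace (?A' ** ?G' ** transpose ?A' ** transpose (transpose ?A ** ?B ** ?A))"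
    unfolding frame_trace_trace gram_frame[OF h(2), of e] by simp
  also have "?A' ** ?G' ** transpose ?A' ** transpose (transpose ?A ** ?B ** ?A) =
     ?A' ** (?G' ** (transpose ?A' ** transpose ?A) ** transpose ?B ** ?A)"
    by (simp only: matrix_mul_assoc matrix_transpose_mul transpose_transpose)
  also have "trace \<dots> = trace ((?G' ** (transpose ?A' ** transpose ?A) ** transpose ?B ** ?A) ** ?A')"
    by (rule trace_mul_sym)
  also have "\<dots> = trace (?G' ** transpose ?B ** (?A ** ?A'))"
    by (simp only: T matrix_mul_rid matrix_mul_assoc)
  also have "\<dots> = frame_trace std h \<beta>" by (simp add: A frame_trace_trace)
  finally show ?thesis .
qed

lemma frame_trace_add: "frame_trace e h (\<lambda>u v. \<beta> u v + \<gamma> u v) = frame_trace e h \<beta> + frame_trace e h \<gamma>"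
  by (simp add: frame_trace_def algebra_simps sum.distrib)

lemma frame_trace_diff: "frame_trace e h (\<lambda>u v. \<beta> u v - \<gamma> u v) = frame_trace e h \<beta> - frame_trace e h \<gamma>"
  by (simp add: frame_trace_def algebra_simps sum_subtractf)

lemma frame_trace_scale: "frame_trace e h (\<lambda>u v. r * \<beta> u v) = r * frame_trace e h \<beta>"
  by (simp add: frame_trace_def algebra_simps sum_distrib_left)

lemma matrix_inv_scale:
  fixes A :: "real ^ 'n ^ 'n"
  assumes "invertible A" "r \<noteq> 0"
  shows "matrix_inv (r *\<^sub>R A) = inverse r *\<^sub>R matrix_inv A" "invertible (r *\<^sub>R A)"
proof -
  have "(r *\<^sub>R A) ** (inverse r *\<^sub>R matrix_inv A) = A ** matrix_inv A"
    using assms(2) by (auto simp: matrix_matrix_mult_def vec_eq_iff intro!: sum.cong)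
  then have "(r *\<^sub>R A) ** (inverse r *\<^sub>R matrix_inv A) = mat 1"
    using matrix_inv_invertible(1)[OF assms(1)] by simp
  then show "matrix_inv (r *\<^sub>R A) = inverse r *\<^sub>R matrix_inv A" "invertible (r *\<^sub>R A)"
    by (rule matrix_inv_eqI)+
qed

lemma gram_scale: "gram e (\<lambda>u v. r * h u v) = r *\<^sub>R gram e h"
  by (simp add: gram_def vec_eq_iff)

lemma frame_trace_conformal:
  "invertible (gram e h) \<Longrightarrow> r \<noteq> 0 \<Longrightarrow> frame_trace e (\<lambda>u v. r * h u v) \<beta> = inverse r * frame_trace e h \<beta>"
  by (simp add: frame_trace_def gram_scale matrix_inv_scale sum_distrib_left algebra_simps)

lemma frame_trace_self:
  fixes e :: "'n::finite \<Rightarrow> 'v"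
  assumes "\<And>u v. h u v = h v u" "invertible (gram e h)"
  shows "frame_trace e h h = CARD('n)"
proof -
  have "transpose (gram e h) = gram e h" using assms(1) by (simp add: transpose_def gram_def vec_eq_iff)
  then show ?thesis
    using matrix_inv_invertible[OF assms(2)] by (simp add: frame_trace_trace trace_I)
qed

text \<open>Raising an index and lowering it again: the inverse Gram matrix cancels against the Gram
  matrix that the factor \<open>h\<close> contributes.\<close>

lemma frame_trace_contract:
  fixes h :: "real ^ 'n \<Rightarrow> real ^ 'n \<Rightarrow> real"
  assumes h: "bilinear h" "\<And>u v. h u v = h v u" "invertible (gram std h)" and f: "linear f"
  shows "frame_trace std h (\<lambda>u v. f u * h v w) = f w" "frame_trace std h (\<lambda>u v. h u w * f v) = f w"
proof -
  let ?H = "matrix_inv (gram std h)"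
  have lin: "linear (h u)" for u using h(1) by (simp add: bilinear_def)
  have "?H ** gram std h = mat 1" "gram std h ** ?H = mat 1" using matrix_inv_invertible[OF h(3)] by auto
  then have 1: "(\<Sum>b\<in>UNIV. ?H $ a $ b * h (std b) (std c)) = (if a = c then 1 else 0)"
     "(\<Sum>b\<in>UNIV. h (std a) (std b) * ?H $ b $ c) = (if a = c then 1 else 0)" for a c
    by (simp_all add: matrix_matrix_mult_def vec_eq_iff mat_def gram_def)
  have 2: "(\<Sum>b\<in>UNIV. ?H $ a $ b * h (std b) w) = w $ a" for a
  proof -
    have "(\<Sum>b\<in>UNIV. ?H $ a $ b * h (std b) w) = (\<Sum>c\<in>UNIV. w $ c * (\<Sum>b\<in>UNIV. ?H $ a $ b * h (std b) (std c)))"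
      unfolding linear_vec_expand[OF lin, of _ w] sum_distrib_left
      by (subst sum.swap) (simp add: algebra_simps)
    then show ?thesis by (simp add: 1 if_distrib cong: if_cong)
  qed
  have 3: "(\<Sum>a\<in>UNIV. ?H $ a $ b * h (std a) w) = w $ b" for b
  proof -
    have "(\<Sum>a\<in>UNIV. ?H $ a $ b * h (std a) w) = (\<Sum>c\<in>UNIV. w $ c * (\<Sum>a\<in>UNIV. h (std c) (std a) * ?H $ a $ b))"
      unfolding linear_vec_expand[OF lin, of _ w] sum_distrib_left
      by (subst sum.swap) (simp add: algebra_simps h(2))
    then show ?thesis by (simp add: 1 if_distrib cong: if_cong)
  qed
  have fw: "f w = (\<Sum>a\<in>UNIV. w $ a * f (std a))" using linear_vec_expand[OF f, of w] by simp
  have "frame_trace std h (\<lambda>u v. f u * h v w) = (\<Sum>a\<in>UNIV. (\<Sum>b\<in>UNIV. ?H $ a $ b * h (std b) w) * f (std a))"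
    by (simp add: frame_trace_def sum_distrib_left sum_distrib_right algebra_simps)
  then show "frame_trace std h (\<lambda>u v. f u * h v w) = f w" by (simp add: 2 fw)
  have "frame_trace std h (\<lambda>u v. h u w * f v) = (\<Sum>b\<in>UNIV. (\<Sum>a\<in>UNIV. ?H $ a $ b * h (std a) w) * f (std b))"
    unfolding frame_trace_def
    by (subst sum.swap) (simp add: sum_distrib_left sum_distrib_right algebra_simps)
  then show "frame_trace std h (\<lambda>u v. h u w * f v) = f w" by (simp add: 3 fw)
qed

lemma sum_UNIV_option: "(\<Sum>x\<in>UNIV. f x) = f None + (\<Sum>k\<in>UNIV. f (Some k))"
  for f :: "'n::finite option \<Rightarrow> 'a::comm_monoid_add"
  by (simp add: UNIV_option_conv sum.reindex comp_def)

text \<open>The columns of \<open>transversal_matrix J \<theta>\<close> are \<open>\<theta>\<close> and the images under \<open>J\<close> of the standard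
  basis vectors. Its inverse splits a vector into its component \<open>normal_part\<close> along \<open>\<theta>\<close> and a
  vector in the range of \<open>J\<close>.\<close>

definition transversal_matrix :: "(real ^ 'n \<Rightarrow> real ^ 'n::finite option) \<Rightarrow> real ^ 'n option \<Rightarrow> real ^ 'n option ^ 'n option" where
  "transversal_matrix J \<theta> = (\<chi> a b. (case b of None \<Rightarrow> \<theta> | Some k \<Rightarrow> J (std k)) $ a)"

definition normal_part :: "(real ^ 'n \<Rightarrow> real ^ 'n::finite option) \<Rightarrow> real ^ 'n option \<Rightarrow> real ^ 'n option \<Rightarrow> real" where
  "normal_part J \<theta> w = (matrix_inv (transversal_matrix J \<theta>) *v w) $ None"

definition tangent_part :: "(real ^ 'n \<Rightarrow> real ^ 'n::finite option) \<Rightarrow> real ^ 'n option \<Rightarrow> real ^ 'n option \<Rightarrow> real ^ 'n" where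
  "tangent_part J \<theta> w = (\<chi> k. (matrix_inv (transversal_matrix J \<theta>) *v w) $ Some k)"

lemma transversal_matrix_mult:
  assumes "linear J"
  shows "transversal_matrix J \<theta> *v y = J (\<chi> k. y $ Some k) + y $ None *\<^sub>R \<theta>"
  unfolding linear_vec_expand[OF assms, of "\<chi> k. y $ Some k"]
  by (simp add: vec_eq_iff transversal_matrix_def matrix_vector_mult_def sum_UNIV_option mult.commute)

context
  fixes J :: "real ^ 'n \<Rightarrow> real ^ 'n::finite option" and \<theta>
  assumes J: "linear J" "inj J" and \<theta>: "\<theta> \<notin> range J"
begin

text \<open>A kernel vector with nonzero entry at \<open>None\<close> would place \<theta> in the
  range of \<open>J\<close>; if that entry is zero, injectivity of \<open>J\<close> makes the rest
  vanish.\<close>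

lemma invertible_transversal_matrix: "invertible (transversal_matrix J \<theta>)"
proof -
  have "y = 0" if "transversal_matrix J \<theta> *v y = 0" for y
  proof -
    have *: "J (\<chi> k. y $ Some k) + y $ None *\<^sub>R \<theta> = 0"
      using that by (simp add: transversal_matrix_mult[OF J(1)])
    have "y $ None = 0"
    proof (rule ccontr)
      assume "y $ None \<noteq> 0"
      then have "\<theta> = inverse (y $ None) *\<^sub>R (y $ None *\<^sub>R \<theta>)" by simp
      also have "y $ None *\<^sub>R \<theta> = - J (\<chi> k. y $ Some k)" using * by (metis add_eq_0_iff)
      also have "inverse (y $ None) *\<^sub>R - J (\<chi> k. y $ Some k) = J (- inverse (y $ None) *\<^sub>R (\<chi> k. y $ Some k))"
        using J(1) by (simp add: linear_scale linear_neg)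
      finally show False using \<theta> by blast
    qed
    moreover from this have "(\<chi> k. y $ Some k) = 0"
      using * J linear_injective_0 by auto
    ultimately show "y = 0" by (simp add: vec_eq_iff split_option_all)
  qed
  then show ?thesis
    by (simp add: invertible_left_inverse matrix_left_invertible_ker)
qed

lemma decompose: "w = J (tangent_part J \<theta> w) + normal_part J \<theta> w *\<^sub>R \<theta>"
proof -
  have "w = transversal_matrix J \<theta> *v (matrix_inv (transversal_matrix J \<theta>) *v w)"
    by (simp add: matrix_vector_mul_assoc matrix_inv_invertible invertible_transversal_matrix)
  then show ?thesis
    unfolding transversal_matrix_mult[OF J(1)] normal_part_def tangent_part_def .
qed

lemma decompose_unique:
  assumes "w = J u + r *\<^sub>R \<theta>"
  shows "tangent_part J \<theta> w = u" "normal_part J \<theta> w = r"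
proof -
  define y :: "real ^ 'n option" where "y = (\<chi> k. case k of None \<Rightarrow> r | Some k \<Rightarrow> u $ k)"
  have "w = transversal_matrix J \<theta> *v y"
    unfolding transversal_matrix_mult[OF J(1)] using assms by (simp add: y_def)
  then have "matrix_inv (transversal_matrix J \<theta>) *v w = y"
    by (simp add: matrix_vector_mul_assoc matrix_inv_invertible invertible_transversal_matrix)
  then show "tangent_part J \<theta> w = u" "normal_part J \<theta> w = r"
    by (simp_all add: tangent_part_def normal_part_def y_def vec_eq_iff)
qed

end

lemma linear_normal_part: "linear (normal_part J \<theta>)"
  by (rule linearI) (simp_all add: normal_part_def matrix_vector_right_distrib matrix_vector_mult_scaleR)

lemma linear_tangent_part: "linear (tangent_part J \<theta>)"
  by (rule linearI) (simp_all add: tangent_part_def matrix_vector_right_distrib matrix_vector_mult_scaleR vec_eq_iff)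

lemma smooth_on_parts:
  fixes J :: "'a::euclidean_space \<Rightarrow> real ^ 'n \<Rightarrow> real ^ 'n::finite option"
  assumes "open A" "\<And>x. x \<in> A \<Longrightarrow> linear (J x)" "\<And>x. x \<in> A \<Longrightarrow> inj (J x)" "\<And>x. x \<in> A \<Longrightarrow> \<theta> x \<notin> range (J x)"
    "\<And>u. smooth_on A (\<lambda>x. J x u)" "smooth_on A \<theta>" "smooth_on A w"
  shows "smooth_on A (\<lambda>x. normal_part (J x) (\<theta> x) (w x))" "smooth_on A (\<lambda>x. tangent_part (J x) (\<theta> x) (w x))"
proof -
  have "smooth_on A (\<lambda>x. (case b of None \<Rightarrow> \<theta> x | Some k \<Rightarrow> J x (std k)) $ a)" for a b
    by (cases b) (auto intro!: smooth_on_vec_nth assms)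
  then have "smooth_on A (\<lambda>x. matrix_inv (transversal_matrix (J x) (\<theta> x)) *v w x)"
    using invertible_transversal_matrix[OF assms(2-4)] unfolding transversal_matrix_def
    by (intro smooth_on_matrix_inv_mult assms)
  then show "smooth_on A (\<lambda>x. normal_part (J x) (\<theta> x) (w x))" "smooth_on A (\<lambda>x. tangent_part (J x) (\<theta> x) (w x))"
    unfolding normal_part_def tangent_part_def by (auto intro!: smooth_on_vec smooth_on_vec_nth assms(1))
qed

section \<open>Change of the transversal in coordinates\<close>

text \<open>In local coordinates on the source and on the target, \<open>J\<close> is the derivative of the immersion,
  \<open>Q x u v\<close> is the derivative of \<open>J v\<close> in the direction \<open>u\<close> with respect to the ambient
  connection, and \<open>\<theta>\<close> is a transversal; \<open>hform\<close> and \<open>gconn\<close> are the induced metric and the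
  Christoffel symbols of the induced connection, \<open>ctens\<close> is the covariant derivative of the
  former with respect to the latter, and \<open>defect\<close> is the difference of the two sides of the equation
  of alignment.\<close>

definition hform ::
  "('x \<Rightarrow> real ^ 'n \<Rightarrow> real ^ 'n::finite option) \<Rightarrow> ('x \<Rightarrow> real ^ 'n \<Rightarrow> real ^ 'n \<Rightarrow> real ^ 'n option) \<Rightarrow>
   ('x \<Rightarrow> real ^ 'n option) \<Rightarrow> 'x \<Rightarrow> real ^ 'n \<Rightarrow> real ^ 'n \<Rightarrow> real" where
  "hform J Q \<theta> x u v = normal_part (J x) (\<theta> x) (Q x u v)"

definition gconn ::
  "('x \<Rightarrow> real ^ 'n \<Rightarrow> real ^ 'n::finite option) \<Rightarrow> ('x \<Rightarrow> real ^ 'n \<Rightarrow> real ^ 'n \<Rightarrow> real ^ 'n option) \<Rightarrow>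
   ('x \<Rightarrow> real ^ 'n option) \<Rightarrow> 'x \<Rightarrow> real ^ 'n \<Rightarrow> real ^ 'n \<Rightarrow> real ^ 'n" where
  "gconn J Q \<theta> x u v = tangent_part (J x) (\<theta> x) (Q x u v)"

definition ctens ::
  "(real ^ 'n \<Rightarrow> real ^ 'n \<Rightarrow> real ^ 'n::finite option) \<Rightarrow> (real ^ 'n \<Rightarrow> real ^ 'n \<Rightarrow> real ^ 'n \<Rightarrow> real ^ 'n option) \<Rightarrow>
   (real ^ 'n \<Rightarrow> real ^ 'n option) \<Rightarrow> real ^ 'n \<Rightarrow> real ^ 'n \<Rightarrow> real ^ 'n \<Rightarrow> real ^ 'n \<Rightarrow> real" where
  "ctens J Q \<theta> x u v w = der (\<lambda>y. hform J Q \<theta> y v w) x u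
     - hform J Q \<theta> x (gconn J Q \<theta> x u v) w - hform J Q \<theta> x v (gconn J Q \<theta> x u w)"

definition defect ::
  "(real ^ 'n \<Rightarrow> real ^ 'n \<Rightarrow> real ^ 'n::finite option) \<Rightarrow> (real ^ 'n \<Rightarrow> real ^ 'n \<Rightarrow> real ^ 'n \<Rightarrow> real ^ 'n option) \<Rightarrow>
   (real ^ 'n \<Rightarrow> real ^ 'n option) \<Rightarrow> real ^ 'n \<Rightarrow> real ^ 'n \<Rightarrow> real" where
  "defect J Q \<theta> x w =
     CARD('n) * frame_trace std (hform J Q \<theta> x) (\<lambda>u v. ctens J Q \<theta> x u v w)
     - frame_trace std (hform J Q \<theta> x) (\<lambda>u v. ctens J Q \<theta> x w u v)"

text \<open>Here \<open>J\<close> and \<open>Q\<close> are abstract data on an open set, which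
  separates the pointwise calculus from manifolds. Torsion-freeness and the equality of mixed
  derivatives enter it as the symmetry of \<open>Q x\<close>.\<close>

locale immersed_model =
  fixes A :: "(real ^ 'n) set" and J :: "real ^ 'n \<Rightarrow> real ^ 'n \<Rightarrow> real ^ 'n::finite option"
    and Q :: "real ^ 'n \<Rightarrow> real ^ 'n \<Rightarrow> real ^ 'n \<Rightarrow> real ^ 'n option"
  assumes A: "open A"
    and J: "x \<in> A \<Longrightarrow> linear (J x)" "x \<in> A \<Longrightarrow> inj (J x)" "smooth_on A (\<lambda>x. J x u)"
    and Q: "x \<in> A \<Longrightarrow> bilinear (Q x)" "x \<in> A \<Longrightarrow> Q x u v = Q x v u" "smooth_on A (\<lambda>x. Q x u v)"
begin

definition transversal :: "(real ^ 'n) set \<Rightarrow> (real ^ 'n \<Rightarrow> real ^ 'n option) \<Rightarrow> bool" where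
  "transversal B \<theta> \<longleftrightarrow> open B \<and> B \<subseteq> A \<and> smooth_on B \<theta> \<and> (\<forall>x\<in>B. \<theta> x \<notin> range (J x))"

text \<open>\<open>fac\<close> and \<open>shift\<close> are the \<open>a\<close> and the \<zeta> in
  \<theta>' = a (\<theta> + J \<zeta>), read off from the splitting of \<theta>' with respect to
  \<theta>.\<close>

definition "fac \<theta> \<theta>' x = normal_part (J x) (\<theta> x) (\<theta>' x)"

definition "shift \<theta> \<theta>' x = inverse (fac \<theta> \<theta>' x) *\<^sub>R tangent_part (J x) (\<theta> x) (\<theta>' x)"

lemma Q_linear: "x \<in> A \<Longrightarrow> linear (Q x u)" "x \<in> A \<Longrightarrow> linear (\<lambda>u. Q x u v)"
  using Q(1) by (auto simp: bilinear_def)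

lemma bilinear_hform: "x \<in> A \<Longrightarrow> bilinear (hform J Q \<theta> x)"
  unfolding bilinear_def hform_def
  using linear_compose[OF Q_linear(1) linear_normal_part] linear_compose[OF Q_linear(2) linear_normal_part]
  by (auto simp: comp_def)

lemma bilinear_gconn: "x \<in> A \<Longrightarrow> bilinear (gconn J Q \<theta> x)"
  unfolding bilinear_def gconn_def
  using linear_compose[OF Q_linear(1) linear_tangent_part] linear_compose[OF Q_linear(2) linear_tangent_part]
  by (auto simp: comp_def)

lemma hform_commute: "x \<in> A \<Longrightarrow> hform J Q \<theta> x u v = hform J Q \<theta> x v u"
  unfolding hform_def using Q(2) by metis

lemma gconn_commute: "x \<in> A \<Longrightarrow> gconn J Q \<theta> x u v = gconn J Q \<theta> x v u"
  unfolding gconn_def using Q(2) by metis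

context
  fixes B \<theta>
  assumes \<theta>: "transversal B \<theta>"
begin

lemma open_B: "open B" and subset_A: "x \<in> B \<Longrightarrow> x \<in> A" and smooth_\<theta>: "smooth_on B \<theta>"
  and transverse: "x \<in> B \<Longrightarrow> \<theta> x \<notin> range (J x)"
  using \<theta> by (auto simp: transversal_def)

lemma smooth_on_B: "smooth_on A f \<Longrightarrow> smooth_on B f"
  using smooth_on_subset subset_A by blast

lemma smooth_on_normal_part: "smooth_on B w \<Longrightarrow> smooth_on B (\<lambda>x. normal_part (J x) (\<theta> x) (w x))"
  by (rule smooth_on_parts(1)[OF open_B J(1)[OF subset_A] J(2)[OF subset_A] transverse smooth_on_B[OF J(3)] smooth_\<theta>])

lemma smooth_on_tangent_part: "smooth_on B w \<Longrightarrow> smooth_on B (\<lambda>x. tangent_part (J x) (\<theta> x) (w x))"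
  by (rule smooth_on_parts(2)[OF open_B J(1)[OF subset_A] J(2)[OF subset_A] transverse smooth_on_B[OF J(3)] smooth_\<theta>])

lemma smooth_on_hform: "smooth_on B (\<lambda>x. hform J Q \<theta> x u v)"
  unfolding hform_def by (intro smooth_on_normal_part smooth_on_B Q)

lemma smooth_on_gconn: "smooth_on B (\<lambda>x. gconn J Q \<theta> x u v)"
  unfolding gconn_def by (intro smooth_on_tangent_part smooth_on_B Q)

lemma decompose_Q: "x \<in> B \<Longrightarrow> Q x u v = J x (gconn J Q \<theta> x u v) + hform J Q \<theta> x u v *\<^sub>R \<theta> x"
  unfolding gconn_def hform_def by (intro decompose J subset_A transverse)

lemma hform_differentiable: "x \<in> B \<Longrightarrow> (\<lambda>y. hform J Q \<theta> y u v) differentiable (at x)"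
  using smooth_on_differentiable[OF smooth_on_hform] .

lemma has_derivative_hform:
  assumes "x \<in> B" "(\<eta> has_derivative \<eta>') (at x)" "(\<zeta> has_derivative \<zeta>') (at x)"
  shows "((\<lambda>y. hform J Q \<theta> y (\<eta> y) (\<zeta> y)) has_derivative
    (\<lambda>u. der (\<lambda>y. hform J Q \<theta> y (\<eta> x) (\<zeta> x)) x u + hform J Q \<theta> x (\<eta>' u) (\<zeta> x) + hform J Q \<theta> x (\<eta> x) (\<zeta>' u))) (at x)"
  by (rule has_derivative_bilinear_family[OF open_B assms(1) bilinear_hform[OF subset_A] hform_differentiable[OF assms(1)] assms(2,3)])

text \<open>\<open>hform\<close> is bilinear at all points near \<open>x\<close>, so its derivative
  is linear in the two vectors too, and the connection terms are built from bilinear maps. The last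
  slot is reduced to the second by symmetry.\<close>

lemma ctens_linear:
  assumes x: "x \<in> B"
  shows "linear (\<lambda>u. ctens J Q \<theta> x u v w)" "linear (\<lambda>v. ctens J Q \<theta> x u v w)" "linear (\<lambda>w. ctens J Q \<theta> x u v w)"
proof -
  note h = bilinear_hform[OF subset_A[OF x], of \<theta>] and g = bilinear_gconn[OF subset_A[OF x], of \<theta>]
  have d: "linear (der (\<lambda>y. hform J Q \<theta> y v w) x)" for v w
    by (rule linear_frechet_derivative[OF hform_differentiable[OF x]])
  have d1: "der (\<lambda>y. hform J Q \<theta> y (r *\<^sub>R v + v') w) x u =
      r * der (\<lambda>y. hform J Q \<theta> y v w) x u + der (\<lambda>y. hform J Q \<theta> y v' w) x u" for r v v' w u
  proof -
    have "((\<lambda>y. r * hform J Q \<theta> y v w + hform J Q \<theta> y v' w) has_derivative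
      (\<lambda>u. r * der (\<lambda>y. hform J Q \<theta> y v w) x u + der (\<lambda>y. hform J Q \<theta> y v' w) x u)) (at x)"
      by (intro has_derivative_add has_derivative_mult_right has_derivative_der hform_differentiable[OF x])
    from der_eqI[OF this] show ?thesis
      using der_cong_open[OF open_B x, of "\<lambda>y. hform J Q \<theta> y (r *\<^sub>R v + v') w" "\<lambda>y. r * hform J Q \<theta> y v w + hform J Q \<theta> y v' w"]
        bilinear_hform[OF subset_A, of _ \<theta>] by (simp add: bilinear_ladd bilinear_lmul)
  qed
  have d2: "der (\<lambda>y. hform J Q \<theta> y w v) x u = der (\<lambda>y. hform J Q \<theta> y v w) x u" for v w u
    using der_cong_open[OF open_B x, of "\<lambda>y. hform J Q \<theta> y w v" "\<lambda>y. hform J Q \<theta> y v w"] hform_commute[OF subset_A] by metis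
  note simps = ctens_def bilinear_ladd[OF h] bilinear_lmul[OF h] bilinear_radd[OF h] bilinear_rmul[OF h]
    bilinear_ladd[OF g] bilinear_lmul[OF g] bilinear_radd[OF g] bilinear_rmul[OF g]
  show "linear (\<lambda>u. ctens J Q \<theta> x u v w)"
    by (rule linear_lincombI) (unfold simps linear_add[OF d] linear_scale[OF d], simp add: algebra_simps)
  show lv: "linear (\<lambda>v. ctens J Q \<theta> x u v w)" for u w
    by (rule linear_lincombI) (unfold simps d1, simp add: algebra_simps)
  have "ctens J Q \<theta> x u v w = ctens J Q \<theta> x u w v" for u v w
    unfolding ctens_def d2[of w v u] using hform_commute[OF subset_A[OF x]] by simp
  then show "linear (\<lambda>w. ctens J Q \<theta> x u v w)" using lv[of u v] by presburger
qed

lemma linear_frame_trace: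
  fixes \<beta> :: "'x::real_vector \<Rightarrow> 'v \<Rightarrow> 'v \<Rightarrow> real"
  assumes "\<And>a b. linear (\<lambda>w. \<beta> w a b)"
  shows "linear (\<lambda>w. frame_trace e h (\<lambda>a b. \<beta> w a b))"
proof (rule linearI)
  show "frame_trace e h (\<lambda>a b. \<beta> (x + y) a b) = frame_trace e h (\<lambda>a b. \<beta> x a b) + frame_trace e h (\<lambda>a b. \<beta> y a b)" for x y
    unfolding linear_add[OF assms] frame_trace_add ..
  show "frame_trace e h (\<lambda>a b. \<beta> (r *\<^sub>R x) a b) = r *\<^sub>R frame_trace e h (\<lambda>a b. \<beta> x a b)" for r x
    unfolding linear_scale[OF assms] real_scaleR_def frame_trace_scale ..
qed

lemma linear_defect: "x \<in> B \<Longrightarrow> linear (defect J Q \<theta> x)"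
proof (rule linearI)
  assume x: "x \<in> B"
  note l = linear_frame_trace[OF ctens_linear(1)[OF x]] linear_frame_trace[OF ctens_linear(3)[OF x]]
  show "defect J Q \<theta> x (u + v) = defect J Q \<theta> x u + defect J Q \<theta> x v" for u v
    unfolding defect_def linear_add[OF l(1)] linear_add[OF l(2)] by (simp add: algebra_simps)
  show "defect J Q \<theta> x (r *\<^sub>R u) = r *\<^sub>R defect J Q \<theta> x u" for r u
    unfolding defect_def linear_scale[OF l(1)] linear_scale[OF l(2)] by (simp add: algebra_simps)
qed

text \<open>The effect of replacing \<open>\<theta>\<close> by \<open>\<theta>' = a (\<theta> + J \<zeta>)\<close>: the connection changes by
  \<open>- h(u, v) \<zeta>\<close> and the metric is divided by \<open>a\<close>.\<close>

context
  fixes \<theta>'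
  assumes \<theta>': "transversal B \<theta>'"
begin

lemma fac_nonzero: "x \<in> B \<Longrightarrow> fac \<theta> \<theta>' x \<noteq> 0"
proof
  assume x: "x \<in> B" and 0: "fac \<theta> \<theta>' x = 0"
  have "\<theta>' x = J x (tangent_part (J x) (\<theta> x) (\<theta>' x))"
    using decompose[OF J(1,2)[OF subset_A[OF x]] transverse[OF x], of "\<theta>' x"] 0 by (simp add: fac_def)
  then show False using x \<theta>' by (auto simp: transversal_def)
qed

lemma change: "x \<in> B \<Longrightarrow> \<theta>' x = fac \<theta> \<theta>' x *\<^sub>R (\<theta> x + J x (shift \<theta> \<theta>' x))"
  using decompose[OF J(1,2)[OF subset_A] transverse, of x "\<theta>' x"] fac_nonzero[of x]
  by (simp add: fac_def[symmetric] shift_def linear_scale[OF J(1)[OF subset_A]] scaleR_add_right add.commute)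

lemma smooth_fac: "smooth_on B (fac \<theta> \<theta>')"
  unfolding fac_def using \<theta>' by (intro smooth_on_normal_part) (simp add: transversal_def)

text \<open>\<open>Q\<close> does not depend on the transversal: the old one is expressed by the new
  one in its splitting, and the splitting is unique.\<close>

lemma change_hg:
  assumes x: "x \<in> B"
  shows "hform J Q \<theta>' x u v = inverse (fac \<theta> \<theta>' x) * hform J Q \<theta> x u v"
    "gconn J Q \<theta>' x u v = gconn J Q \<theta> x u v - hform J Q \<theta> x u v *\<^sub>R shift \<theta> \<theta>' x"
proof -
  have "Q x u v = J x (gconn J Q \<theta> x u v) + hform J Q \<theta> x u v *\<^sub>R \<theta> x" using decompose_Q[OF x] .
  also have "\<theta> x = inverse (fac \<theta> \<theta>' x) *\<^sub>R \<theta>' x - J x (shift \<theta> \<theta>' x)"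
    using change[OF x] fac_nonzero[OF x] by simp
  finally have "Q x u v = J x (gconn J Q \<theta> x u v - hform J Q \<theta> x u v *\<^sub>R shift \<theta> \<theta>' x)
      + (inverse (fac \<theta> \<theta>' x) * hform J Q \<theta> x u v) *\<^sub>R \<theta>' x"
    using J(1)[OF subset_A[OF x]] by (simp add: linear_diff linear_scale algebra_simps)
  from decompose_unique[OF J(1,2)[OF subset_A[OF x]] _ this] x \<theta>'
  show "hform J Q \<theta>' x u v = inverse (fac \<theta> \<theta>' x) * hform J Q \<theta> x u v"
    "gconn J Q \<theta>' x u v = gconn J Q \<theta> x u v - hform J Q \<theta> x u v *\<^sub>R shift \<theta> \<theta>' x"
    by (auto simp: hform_def gconn_def transversal_def)
qed

text \<open>Differentiating h / a produces the term with the derivative of \<open>fac\<close>. The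
  connection acts in both slots of h, and since it changes by - h(u, v) times \<open>shift\<close>,
  each slot contributes one product of two values of h.\<close>

lemma change_ctens:
  assumes x: "x \<in> B"
  shows "ctens J Q \<theta>' x u v w = inverse (fac \<theta> \<theta>' x) * (ctens J Q \<theta> x u v w
    + hform J Q \<theta> x (shift \<theta> \<theta>' x) w * hform J Q \<theta> x u v + hform J Q \<theta> x u w * hform J Q \<theta> x (shift \<theta> \<theta>' x) v
    - inverse (fac \<theta> \<theta>' x) * (der (fac \<theta> \<theta>') x u * hform J Q \<theta> x v w))"
proof -
  note h = bilinear_hform[OF subset_A[OF x], of \<theta>]
  have f: "((fac \<theta> \<theta>') has_derivative der (fac \<theta> \<theta>') x) (at x)" using smooth_on_has_derivative[OF smooth_fac x] .
  have "((\<lambda>y. inverse (fac \<theta> \<theta>' y) * hform J Q \<theta> y v w) has_derivative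
    (\<lambda>u. inverse (fac \<theta> \<theta>' x) * der (\<lambda>y. hform J Q \<theta> y v w) x u + - (inverse (fac \<theta> \<theta>' x) * der (fac \<theta> \<theta>') x u * inverse (fac \<theta> \<theta>' x)) * hform J Q \<theta> x v w)) (at x)"
    using fac_nonzero[OF x]
    by (intro has_derivative_mult Deriv.has_derivative_inverse f has_derivative_der hform_differentiable[OF x])
  from der_eqI[OF this] der_cong_open[OF open_B x, of "\<lambda>y. hform J Q \<theta>' y v w" "\<lambda>y. inverse (fac \<theta> \<theta>' y) * hform J Q \<theta> y v w"]
  have "der (\<lambda>y. hform J Q \<theta>' y v w) x u = inverse (fac \<theta> \<theta>' x) * der (\<lambda>y. hform J Q \<theta> y v w) x u
      + - (inverse (fac \<theta> \<theta>' x) * der (fac \<theta> \<theta>') x u * inverse (fac \<theta> \<theta>' x)) * hform J Q \<theta> x v w"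
    by (simp add: change_hg(1))
  note d = this
  let ?h = "hform J Q \<theta> x" and ?g = "gconn J Q \<theta> x" and ?s = "shift \<theta> \<theta>' x"
  have e1: "?h (?g u v - ?h u v *\<^sub>R ?s) w = ?h (?g u v) w - ?h ?s w * ?h u v"
    by (simp add: bilinear_lsub[OF h] bilinear_lmul[OF h])
  have e2: "?h v (?g u w - ?h u w *\<^sub>R ?s) = ?h v (?g u w) - ?h u w * ?h ?s v"
    using hform_commute[OF subset_A[OF x], of \<theta> v ?s] by (simp add: bilinear_rsub[OF h] bilinear_rmul[OF h])
  show ?thesis
    unfolding ctens_def change_hg[OF x] d e1 e2 by (simp only: ring_distribs mult_minus_left mult_minus_right) (simp add: ac_simps)
qed

text \<open>With z the shift and a the factor, the first trace grows by (n + 1) h(z, w) - d log a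
  (w) and the second by 2 h(z, w) - n d log a (w). Multiplying the first by n and subtracting
  cancels d log a and leaves n (n + 1) - 2 = (n - 1) (n + 2).\<close>

lemma change_defect:
  assumes x: "x \<in> B" and inv: "invertible (gram std (hform J Q \<theta> x))"
  shows "defect J Q \<theta>' x w = defect J Q \<theta> x w +
    (real CARD('n) - 1) * (real CARD('n) + 2) * hform J Q \<theta> x (shift \<theta> \<theta>' x) w"
proof -
  let ?h = "hform J Q \<theta> x" and ?n = "real CARD('n)" and ?f = "inverse (fac \<theta> \<theta>' x)"
  note h = bilinear_hform[OF subset_A[OF x], of \<theta>] and sym = hform_commute[OF subset_A[OF x], of \<theta>]
  have lin: "linear (?h (shift \<theta> \<theta>' x))" using h by (simp add: bilinear_def)
  have df: "linear (der (fac \<theta> \<theta>') x)" using smooth_on_linear_der[OF smooth_fac x] .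
  have fx: "?f \<noteq> 0" using fac_nonzero[OF x] by simp
  have "(\<lambda>u v. ?f * ?h u v) = hform J Q \<theta>' x" by (simp add: fun_eq_iff change_hg(1)[OF x])
  \<comment> \<open>The inverse of h / a carries a factor a, which cancels the common factor 1 / a
    in \<open>change_ctens\<close>; all traces can then be taken with the old h.\<close>
  then have conf: "frame_trace std (hform J Q \<theta>' x) (\<lambda>u v. ?f * \<beta> u v) = frame_trace std ?h \<beta>" for \<beta>
    using frame_trace_conformal[OF inv fx, of "\<lambda>u v. ?f * \<beta> u v"] fx by (simp add: frame_trace_scale)
  have 1: "frame_trace std (hform J Q \<theta>' x) (\<lambda>u v. ctens J Q \<theta>' x u v w) =
     frame_trace std ?h (\<lambda>u v. ctens J Q \<theta> x u v w) + ?n * ?h (shift \<theta> \<theta>' x) w + ?h (shift \<theta> \<theta>' x) w - ?f * der (fac \<theta> \<theta>') x w"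
  proof -
    have "frame_trace std (hform J Q \<theta>' x) (\<lambda>u v. ctens J Q \<theta>' x u v w) =
       frame_trace std ?h (\<lambda>u v. ctens J Q \<theta> x u v w) + frame_trace std ?h (\<lambda>u v. ?h (shift \<theta> \<theta>' x) w * ?h u v)
       + frame_trace std ?h (\<lambda>u v. ?h u w * ?h (shift \<theta> \<theta>' x) v) - ?f * frame_trace std ?h (\<lambda>u v. der (fac \<theta> \<theta>') x u * ?h v w)"
      unfolding change_ctens[OF x] conf unfolding frame_trace_add frame_trace_diff frame_trace_scale
      by (simp add: mult.commute)
    then show ?thesis
      using frame_trace_contract[OF h sym inv] lin df frame_trace_self[OF sym inv]
      by (simp add: frame_trace_scale)
  qed
  have 2: "frame_trace std (hform J Q \<theta>' x) (\<lambda>u v. ctens J Q \<theta>' x w u v) =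
     frame_trace std ?h (\<lambda>u v. ctens J Q \<theta> x w u v) + 2 * ?h (shift \<theta> \<theta>' x) w - ?f * der (fac \<theta> \<theta>') x w * ?n"
  proof -
    have "frame_trace std (hform J Q \<theta>' x) (\<lambda>u v. ctens J Q \<theta>' x w u v) =
       frame_trace std ?h (\<lambda>u v. ctens J Q \<theta> x w u v) + frame_trace std ?h (\<lambda>u v. ?h u w * ?h (shift \<theta> \<theta>' x) v)
       + frame_trace std ?h (\<lambda>u v. ?h (shift \<theta> \<theta>' x) u * ?h v w) - ?f * (der (fac \<theta> \<theta>') x w * frame_trace std ?h ?h)"
      unfolding change_ctens[OF x] conf unfolding frame_trace_add frame_trace_diff frame_trace_scale
      by (simp add: mult.commute sym[of w])
    then show ?thesis
      using frame_trace_contract[OF h sym inv] lin frame_trace_self[OF sym inv] by simp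
  qed
  show ?thesis unfolding defect_def 1 2 by (simp add: algebra_simps)
qed

end

lemma gram_hform_apply:
  assumes "x \<in> B"
  shows "hform J Q \<theta> x u w = (gram std (hform J Q \<theta> x) *v u) \<bullet> w"
  by (rule gram_apply[OF bilinear_hform[OF subset_A[OF assms]] hform_commute[OF subset_A[OF assms]]])

lemma smooth_on_defect:
  assumes inv: "\<And>x. x \<in> B \<Longrightarrow> invertible (gram std (hform J Q \<theta> x))"
  shows "smooth_on B (\<lambda>x. defect J Q \<theta> x w)"
proof -
  have H: "smooth_on B (\<lambda>x. matrix_inv (gram std (hform J Q \<theta> x)) $ a $ b)" for a b
  proof -
    have "smooth_on B (\<lambda>x. (matrix_inv (gram std (hform J Q \<theta> x)) *v std b) $ a)"
      using inv unfolding gram_def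
      by (intro smooth_on_vec_nth smooth_on_matrix_inv_mult open_B smooth_on_hform smooth_on_const)
    then show ?thesis by (simp add: matrix_vector_mult_basis column_def)
  qed
  have C: "smooth_on B (\<lambda>x. ctens J Q \<theta> x u v w)" for u v w
    unfolding ctens_def
    by (intro smooth_on_diff open_B smooth_on_der smooth_on_hform smooth_on_const smooth_on_gconn
        smooth_on_bilinear_family[OF open_B bilinear_hform[OF subset_A]])
  show ?thesis
    unfolding defect_def frame_trace_def
    by (intro smooth_on_diff smooth_on_mult smooth_on_sum open_B H C smooth_on_const)
qed

lemma aligned_exists:
  assumes n: "CARD('n) \<ge> 2" and inv: "\<And>x. x \<in> B \<Longrightarrow> invertible (gram std (hform J Q \<theta> x))"
  shows "\<exists>\<theta>'. transversal B \<theta>' \<and> (\<forall>x\<in>B. \<forall>w. defect J Q \<theta>' x w = 0)"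
proof -
  define k where "k = (real CARD('n) - 1) * (real CARD('n) + 2)"
  have k: "k \<noteq> 0" using n by (simp add: k_def)
  \<comment> \<open>Solves k h(\<zeta>, w) = - defect(w), which is what \<open>change_defect\<close>
    demands of the shift; the scaling factor is taken to be 1.\<close>
  define \<zeta> where "\<zeta> x = matrix_inv (gram std (hform J Q \<theta> x)) *v (\<chi> b. - (inverse k * defect J Q \<theta> x (std b)))" for x
  define \<theta>' where "\<theta>' x = \<theta> x + J x (\<zeta> x)" for x
  have v: "smooth_on B (\<lambda>x. \<chi> b. - (inverse k * defect J Q \<theta> x (std b)))"
    by (intro smooth_on_vec smooth_on_minus smooth_on_mult smooth_on_const open_B smooth_on_defect[OF inv])
  have s\<zeta>: "smooth_on B \<zeta>"
    using smooth_on_matrix_inv_mult[OF open_B smooth_on_hform v inv[unfolded gram_def]]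
    unfolding \<zeta>_def gram_def .
  have s: "smooth_on B \<theta>'" unfolding \<theta>'_def
    by (rule smooth_on_add[OF open_B smooth_\<theta> smooth_on_linear_family[OF open_B J(1)[OF subset_A] smooth_on_B[OF J(3)] s\<zeta>]])
  have t: "\<theta>' x \<notin> range (J x)" if x: "x \<in> B" for x
  proof
    assume "\<theta>' x \<in> range (J x)"
    then obtain v where "\<theta> x + J x (\<zeta> x) = J x v" by (auto simp: \<theta>'_def)
    then have "\<theta> x = J x (v - \<zeta> x)" using J(1)[OF subset_A[OF x]] by (simp add: linear_diff eq_diff_eq)
    then show False using transverse[OF x] by blast
  qed
  have tr: "transversal B \<theta>'" using \<theta> s t by (simp add: transversal_def)
  have "defect J Q \<theta>' x w = 0" if x: "x \<in> B" for x w
  proof -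
    have "\<theta>' x = J x (\<zeta> x) + 1 *\<^sub>R \<theta> x" by (simp add: \<theta>'_def)
    from decompose_unique[OF J(1,2)[OF subset_A[OF x]] transverse[OF x] this]
    have sh: "shift \<theta> \<theta>' x = \<zeta> x" by (simp add: shift_def fac_def)
    have "k * hform J Q \<theta> x (\<zeta> x) w = k * ((\<chi> b. - (inverse k * defect J Q \<theta> x (std b))) \<bullet> w)"
    proof -
      have "gram std (hform J Q \<theta> x) *v \<zeta> x = (\<chi> b. - (inverse k * defect J Q \<theta> x (std b)))"
        unfolding \<zeta>_def by (simp only: matrix_vector_mul_assoc matrix_inv_invertible[OF inv[OF x]] matrix_vector_mul_lid)
      then show ?thesis by (simp only: gram_hform_apply[OF x, of "\<zeta> x" w])
    qed
    also have "\<dots> = - (\<Sum>b\<in>UNIV. w $ b * defect J Q \<theta> x (std b))"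
      using k by (simp add: inner_vec_def sum_distrib_left sum_negf[symmetric] mult.assoc[symmetric])
        (simp add: mult.commute)
    also have "\<dots> = - defect J Q \<theta> x w"
      using linear_vec_expand[OF linear_defect[OF x], of w] by simp
    finally show ?thesis
      using change_defect[OF tr x inv[OF x], of w] by (simp add: sh k_def)
  qed
  then show ?thesis using tr by blast
qed

text \<open>If both defects vanish, \<open>change_defect\<close> gives h(z, w) = 0 for the shift z
  and all w, its coefficient being nonzero for n \<ge> 2; nondegeneracy yields z = 0.\<close>

lemma aligned_unique:
  assumes n: "CARD('n) \<ge> 2" and tr: "transversal B \<theta>'" and x: "x \<in> B"
    and inv: "invertible (gram std (hform J Q \<theta> x))"
    and d: "\<And>w. defect J Q \<theta> x w = 0" "\<And>w. defect J Q \<theta>' x w = 0"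
  shows "\<theta>' x = fac \<theta> \<theta>' x *\<^sub>R \<theta> x"
proof -
  have "hform J Q \<theta> x (shift \<theta> \<theta>' x) w = 0" for w
    using change_defect[OF tr x inv, of w] n unfolding d by simp
  then have "(gram std (hform J Q \<theta> x) *v shift \<theta> \<theta>' x) = 0"
    using gram_hform_apply[OF x, of "shift \<theta> \<theta>' x" "gram std (hform J Q \<theta> x) *v shift \<theta> \<theta>' x"] inner_eq_zero_iff
    by metis
  then have "matrix_inv (gram std (hform J Q \<theta> x)) *v (gram std (hform J Q \<theta> x) *v shift \<theta> \<theta>' x) = 0" by simp
  then have "shift \<theta> \<theta>' x = 0" by (simp only: matrix_vector_mul_assoc matrix_inv_invertible[OF inv] matrix_vector_mul_lid)
  then show ?thesis using change[OF tr x] J(1)[OF subset_A[OF x]] by (simp add: linear_0)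
qed

text \<open>In \<open>change_defect\<close> the new transversal enters only through the value of the
  shift at \<open>x\<close>. Proportionality at this single point is thus enough, although the
  defect contains derivatives.\<close>

lemma defect_conformal:
  assumes tr: "transversal B \<theta>'" and x: "x \<in> B" and inv: "invertible (gram std (hform J Q \<theta> x))"
    and a: "\<theta>' x = a *\<^sub>R \<theta> x"
  shows "defect J Q \<theta>' x w = defect J Q \<theta> x w"
proof -
  have "\<theta>' x = J x 0 + a *\<^sub>R \<theta> x" using a J(1)[OF subset_A[OF x]] by (simp add: linear_0)
  from decompose_unique[OF J(1,2)[OF subset_A[OF x]] transverse[OF x] this]
  have "shift \<theta> \<theta>' x = 0" by (simp add: shift_def)
  then show ?thesis
    using change_defect[OF tr x inv, of w] bilinear_lzero[OF bilinear_hform[OF subset_A[OF x]]] by simp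
qed

end

end

section \<open>Immersed hypersurfaces\<close>

locale hypersurface = mfd_map S M i + N: torsion_free_connection M N
  for S :: "('s, real ^ 'n::finite) mfd" and M :: "('m, real ^ 'n option) mfd"
    and i :: "'s \<Rightarrow> 'm" and N :: "('m, real ^ 'n option) conn" +
  assumes immersion: "immersion S M i"
begin

definition dom :: "('s, real ^ 'n) chart \<Rightarrow> ('m, real ^ 'n option) chart \<Rightarrow> 's set" where
  "dom c d = fst c \<inter> i -` fst d"

definition jac :: "('s, real ^ 'n) chart \<Rightarrow> ('m, real ^ 'n option) chart \<Rightarrow> real ^ 'n \<Rightarrow> real ^ 'n \<Rightarrow> real ^ 'n option" where
  "jac c d x = der (\<lambda>x. snd d (i (chart_inv c x))) x"

text \<open>The map \<open>Q\<close> of the local model: the ambient covariant derivative, in the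
  direction \<open>u\<close>, of the image under the immersion of the field with constant components
  \<open>v\<close>.\<close>

definition sec :: "('s, real ^ 'n) chart \<Rightarrow> ('m, real ^ 'n option) chart \<Rightarrow> real ^ 'n \<Rightarrow> real ^ 'n \<Rightarrow> real ^ 'n \<Rightarrow> real ^ 'n option" where
  "sec c d x u v = der (\<lambda>y. jac c d y v) x u + N.christ d (i (chart_inv c x)) (jac c d x u) (jac c d x v)"

definition rep :: "('s, real ^ 'n) chart \<Rightarrow> ('m, real ^ 'n option) chart \<Rightarrow> ('s \<Rightarrow> ('m, real ^ 'n option) tvec) \<Rightarrow> real ^ 'n \<Rightarrow> real ^ 'n option" where
  "rep c d T x = T (chart_inv c x) d"

abbreviation "met c d \<equiv> hform (jac c d) (sec c d)"
abbreviation "chr c d \<equiv> gconn (jac c d) (sec c d)"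
abbreviation "dmet c d \<equiv> ctens (jac c d) (sec c d)"
abbreviation "dft c d \<equiv> defect (jac c d) (sec c d)"

lemma ex_dom: "p \<in> points S \<Longrightarrow> \<exists>c\<in>atlas S. \<exists>d\<in>atlas M. p \<in> dom c d"
  using S.ex_chart M.ex_chart i_points by (fastforce simp: dom_def)

context
  fixes c d
  assumes c: "c \<in> atlas S" and d: "d \<in> atlas M"
begin

lemma openin_dom: "openin (mtop S) (dom c d)"
  unfolding dom_def by (rule openin_chart_pair[OF c d])

lemma dom_D: "q \<in> dom c d \<Longrightarrow> q \<in> fst c" "q \<in> dom c d \<Longrightarrow> i q \<in> fst d" "q \<in> dom c d \<Longrightarrow> q \<in> points S"
  "q \<in> dom c d \<Longrightarrow> chart_inv c (snd c q) = q"
  using c d S.chart_points[OF c] S.chart_inv_chart[OF c] by (auto simp: dom_def)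

lemma open_dom: "openin (mtop S) U \<Longrightarrow> open (snd c ` (U \<inter> dom c d))"
  by (intro S.open_chart_image[OF c] openin_Int openin_dom) (auto simp: dom_def)

lemma smooth_on_chart_map: "smooth_on (snd c ` dom c d) (\<lambda>x. snd d (i (chart_inv c x)))"
  unfolding dom_def by (rule smooth_on_map[OF c d])

lemma differential_jac: "q \<in> dom c d \<Longrightarrow> v \<in> tangent_space S q \<Longrightarrow> differential S M i q v d = jac c d (snd c q) (v c)"
  unfolding jac_def by (rule differential_chart[OF c d dom_D(1,2)])

lemma jac_inj:
  assumes q: "q \<in> dom c d"
  shows "inj (jac c d (snd c q))"
proof (rule injI)
  fix u v assume uv: "jac c d (snd c q) u = jac c d (snd c q) v"
  let ?t = "\<lambda>u. coord_field S c u q"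
  note t = S.coord_field_tangent[OF c dom_D(1)[OF q]] and ts = S.coord_field_self[OF c dom_D(1)[OF q]]
  have "differential S M i q (?t u) = differential S M i q (?t v)"
    by (rule M.tangent_eqI[OF differential_tangent[OF t dom_D(3)[OF q]] differential_tangent[OF t dom_D(3)[OF q]] d dom_D(2)[OF q]])
      (simp only: differential_jac[OF q t] ts uv)
  moreover have "inj_on (differential S M i q) (tangent_space S q)"
    using immersion dom_D(3)[OF q] by (simp add: immersion_def)
  ultimately have "?t u = ?t v" using t by (meson inj_onD)
  then show "u = v" using ts by metis
qed

text \<open>The symmetry of \<open>sec\<close> combines that of the second derivatives of the chart
  expression of \<open>i\<close> with that of the Christoffel symbols, where torsion-freeness
  enters.\<close>

lemma sec_model: "immersed_model (snd c ` dom c d) (jac c d) (sec c d)"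
proof (rule immersed_model.intro)
  have op: "open (snd c ` dom c d)"
    using open_dom[OF openin_dom] by simp
  show "open (snd c ` dom c d)" by (rule op)
  show lin: "linear (jac c d x)" if "x \<in> snd c ` dom c d" for x
    unfolding jac_def by (rule smooth_on_linear_der[OF smooth_on_chart_map that])
  show "inj (jac c d x)" if "x \<in> snd c ` dom c d" for x
    using that jac_inj by auto
  show sj: "smooth_on (snd c ` dom c d) (\<lambda>x. jac c d x u)" for u
    unfolding jac_def by (rule smooth_on_der[OF smooth_on_chart_map])
  have sym: "der (\<lambda>y. jac c d y v) x u = der (\<lambda>y. jac c d y u) x v" if "x \<in> snd c ` dom c d" for x u v
    unfolding jac_def by (rule second_derivative_symmetric[OF smooth_on_chart_map op that])
  have img: "i (chart_inv c x) \<in> fst d" if "x \<in> snd c ` dom c d" for x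
    using that dom_D by auto
  show "sec c d x u v = sec c d x v u" if "x \<in> snd c ` dom c d" for x u v
    unfolding sec_def sym[OF that, of v u] using N.christ_commute[OF d img[OF that]] by simp
  have l1: "linear (\<lambda>u. sec c d x u v)" if "x \<in> snd c ` dom c d" for x v
  proof -
    have "linear (\<lambda>u. N.christ d (i (chart_inv c x)) (jac c d x u) (jac c d x v))"
      using linear_compose[OF lin[OF that]] N.bilinear_christ[OF d img[OF that]] by (auto simp: bilinear_def comp_def)
    then show ?thesis unfolding sec_def
      by (intro linear_compose_add smooth_on_linear_der[OF sj that])
  qed
  show "bilinear (sec c d x)" if "x \<in> snd c ` dom c d" for x
    unfolding bilinear_def
  proof (intro conjI allI l1[OF that])
    fix u
    have "sec c d x u = (\<lambda>v. sec c d x v u)"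
      using N.christ_commute[OF d img[OF that]] sym[OF that] by (auto simp: sec_def fun_eq_iff)
    then show "linear (sec c d x u)" using l1[OF that] by simp
  qed
  show "smooth_on (snd c ` dom c d) (\<lambda>x. sec c d x u v)" for u v
  proof -
    have F: "(\<lambda>x. snd d (i (chart_inv c x))) ` snd c ` dom c d \<subseteq> snd d ` fst d" using img by auto
    have "smooth_on (snd c ` dom c d) (\<lambda>x. N.christ d (chart_inv d (snd d (i (chart_inv c x)))) u v)" for u v
      by (rule smooth_on_compose[OF N.smooth_on_christ[OF d] op smooth_on_chart_map F])
    then have cs: "smooth_on (snd c ` dom c d) (\<lambda>x. N.christ d (i (chart_inv c x)) u v)" for u v
      by (rule smooth_on_cong[OF _ op]) (simp add: M.chart_inv_chart[OF d img])
    have "smooth_on (snd c ` dom c d) (\<lambda>x. N.christ d (i (chart_inv c x)) (jac c d x u) (jac c d x v))"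
      by (rule smooth_on_bilinear_family[where P = "\<lambda>x. N.christ d (i (chart_inv c x))",
            OF op N.bilinear_christ[OF d img] cs sj sj])
    then show ?thesis unfolding sec_def by (rule smooth_on_add[OF op smooth_on_der[OF sj]])
  qed
qed

text \<open>A tangent vector is determined by its component in one chart, so transversality becomes
  a condition on \<open>jac\<close> in a single pair of charts.\<close>

lemma range_jac:
  assumes q: "q \<in> dom c d" and t: "t \<in> tangent_space M (i q)"
  shows "t \<in> differential S M i q ` tangent_space S q \<longleftrightarrow> t d \<in> range (jac c d (snd c q))"
proof
  assume "t \<in> differential S M i q ` tangent_space S q"
  then show "t d \<in> range (jac c d (snd c q))" using differential_jac[OF q] by auto
next
  assume "t d \<in> range (jac c d (snd c q))"
  then obtain u where u: "t d = jac c d (snd c q) u" by auto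
  note tf = S.coord_field_tangent[OF c dom_D(1)[OF q]]
  have "differential S M i q (coord_field S c u q) = t"
    by (rule M.tangent_eqI[OF differential_tangent[OF tf dom_D(3)[OF q]] t d dom_D(2)[OF q]])
      (simp add: differential_jac[OF q tf] S.coord_field_self[OF c dom_D(1)[OF q]] u)
  then show "t \<in> differential S M i q ` tangent_space S q" using tf by blast
qed

lemma pullback_chart:
  assumes "X \<in> vfields S V" "Y \<in> vfields_along S M i V" "q \<in> V" and q: "q \<in> dom c d"
  shows "pullback_conn S M N i X Y q d = der (rep c d Y) (snd c q) (X q c)
    + N.christ d (i q) (jac c d (snd c q) (X q c)) (Y q d)"
proof -
  have "smooth_on (snd c ` (V \<inter> dom c d)) (rep c d Y)"
    unfolding rep_def by (rule along_smooth[OF assms(2) c d]) (auto simp: dom_def)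
  then have "(rep c d Y has_derivative der (rep c d Y) (snd c q)) (at (snd c q))"
    using assms by (intro smooth_on_has_derivative) auto
  then have "dirderiv S q (X q) (\<lambda>q. Y q d) = der (rep c d Y) (snd c q) (X q c)"
    using S.dirderiv_chart[OF S.vfields_tangent[OF assms(1,3)] c dom_D(1)[OF q]] by (simp add: rep_def[abs_def])
  then show ?thesis
    using d dom_D[OF q] differential_jac[OF q S.vfields_tangent[OF assms(1,3)]]
    by (simp add: pullback_conn_def N.christ_def)
qed

end

text \<open>The second derivative of the transition map \<open>\<phi>\<close> that arises from differentiating the components of
  \<open>Y\<close> cancels against the one in the transformation law of the Christoffel symbols.\<close>

lemma pullback_tangent:
  assumes V: "openin (mtop S) V" and X: "X \<in> vfields S V" and Y: "Y \<in> vfields_along S M i V" and q: "q \<in> V"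
  shows "pullback_conn S M N i X Y q \<in> tangent_space M (i q)"
proof (rule M.tangentI)
  fix d e assume d: "d \<in> atlas M" "i q \<in> fst d" and e: "e \<in> atlas M" "i q \<in> fst e"
  have "q \<in> points S" using V q openin_subset by blast
  then obtain c where c: "c \<in> atlas S" "q \<in> fst c" using S.ex_chart by blast
  define \<phi> where "\<phi> = (\<lambda>y. der (snd e \<circ> chart_inv d) y)"
  define x where "x = snd c q"
  define y where "y = snd d (i q)"
  have q1: "q \<in> dom c d" "q \<in> dom c e" using c d e by (auto simp: dom_def)
  have x: "chart_inv c x = q" unfolding x_def using S.chart_inv_chart c by blast
  define u where "u = jac c d x (X q c)"
  define v where "v = Y q d"
  let ?B = "snd d ` (fst d \<inter> fst e)"
  have oB: "open ?B" by (rule M.open_chart_inter[OF d(1) e(1)])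
  have yB: "y \<in> ?B" using d e by (auto simp: y_def)
  have \<phi>lin: "linear (\<phi> z)" if "z \<in> ?B" for z
    unfolding \<phi>_def by (rule smooth_on_linear_der[OF M.smooth_on_transition[OF d(1) e(1)] that])
  have \<phi>sm: "smooth_on ?B (\<lambda>z. \<phi> z w)" for w
    unfolding \<phi>_def by (rule smooth_on_der[OF M.smooth_on_transition[OF d(1) e(1)]])
  define H where "H = der (\<lambda>z. \<phi> z v) y"
  have Y': "Y r e = \<phi> (snd d (i r)) (Y r d)" if "r \<in> V" "i r \<in> fst d" "i r \<in> fst e" for r
    unfolding \<phi>_def by (rule M.tangent_transition[OF along_tangent[OF Y that(1)] d(1) e(1) that(2,3)])
  have je: "jac c e x w = \<phi> y (jac c d x w)" for w
  proof -
    have t: "coord_field S c w q \<in> tangent_space S q" by (rule S.coord_field_tangent[OF c])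
    show ?thesis
      using M.tangent_transition[OF differential_tangent[OF t \<open>q \<in> points S\<close>] d(1) e(1) d(2) e(2)]
        differential_jac[OF c(1) d(1) q1(1) t] differential_jac[OF c(1) e(1) q1(2) t]
      by (simp add: S.coord_field_self[OF c] \<phi>_def x_def y_def)
  qed
  have 1: "der (rep c e Y) x (X q c) = H u + \<phi> y (der (rep c d Y) x (X q c))"
  proof -
    let ?A = "snd c ` (V \<inter> dom c e \<inter> dom c d)"
    have oA: "open ?A" using open_dom[OF c(1) d(1), of "V \<inter> dom c e"] V openin_dom[OF c(1) e(1)] by blast
    have xA: "x \<in> ?A" using q q1 by (auto simp: x_def)
    have D: "(rep c d Y has_derivative der (rep c d Y) x) (at x)"
      unfolding rep_def using xA
      by (intro smooth_on_has_derivative[OF along_smooth[OF Y c(1) d(1), of "V \<inter> dom c e \<inter> dom c d"]]) (auto simp: dom_def)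
    have F: "((\<lambda>x. snd d (i (chart_inv c x))) has_derivative jac c d x) (at x)"
      unfolding jac_def using q1 by (intro smooth_on_has_derivative[OF smooth_on_chart_map[OF c(1) d(1)]]) (auto simp: x_def)
    have G: "((\<lambda>x. \<phi> (snd d (i (chart_inv c x))) w) has_derivative (\<lambda>h. der (\<lambda>z. \<phi> z w) y (jac c d x h))) (at x)" for w
      using has_derivative_compose[OF F, of "\<lambda>z. \<phi> z w" "der (\<lambda>z. \<phi> z w) y"] smooth_on_has_derivative[OF \<phi>sm yB]
      by (simp add: x y_def)
    have inB: "snd d (i (chart_inv c z)) \<in> ?B" if "z \<in> ?A" for z
      using that dom_D[OF c(1) d(1)] dom_D[OF c(1) e(1)] by auto
    have "((\<lambda>x. \<phi> (snd d (i (chart_inv c x))) (rep c d Y x)) has_derivative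
       (\<lambda>h. der (\<lambda>x. \<phi> (snd d (i (chart_inv c x))) (rep c d Y x')) x h + \<phi> (snd d (i (chart_inv c x))) (der (rep c d Y) x h))) (at x)"
       if "x' = x" for x'
      unfolding that using G
      by (intro has_derivative_linear_family[OF oA xA \<phi>lin[OF inB] _ D]) (auto simp: differentiable_def)
    from this[OF refl]
    have "((\<lambda>x. \<phi> (snd d (i (chart_inv c x))) (rep c d Y x)) has_derivative
       (\<lambda>h. H (jac c d x h) + \<phi> y (der (rep c d Y) x h))) (at x)"
      by (simp add: der_eqI[OF G] H_def x y_def rep_def v_def)
    then have "(rep c e Y has_derivative (\<lambda>h. H (jac c d x h) + \<phi> y (der (rep c d Y) x h))) (at x)"
    proof (rule has_derivative_transform_within_open[OF _ oA xA])
      fix z assume "z \<in> ?A"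
      then obtain r where r: "r \<in> V" "r \<in> dom c d" "r \<in> dom c e" "z = snd c r" by auto
      then show "\<phi> (snd d (i (chart_inv c z))) (rep c d Y z) = rep c e Y z"
        using Y'[OF r(1) dom_D(2)[OF c(1) d(1) r(2)] dom_D(2)[OF c(1) e(1) r(3)]] dom_D(4)[OF c(1) d(1) r(2)]
        by (simp add: rep_def)
    qed
    then show ?thesis by (simp add: der_eqI u_def)
  qed
  have 2: "N.christ e (i q) (\<phi> y u) (\<phi> y v) = \<phi> y (N.christ d (i q) u v) - H u"
  proof -
    let ?V = "fst d \<inter> fst e"
    \<comment> \<open>The components in \<open>d\<close> of the coordinate field of \<open>e\<close>
      that has components \<open>v\<close> in \<open>d\<close> at \<open>i q\<close>. Applying
      \<phi> to them gives a constant, and differentiating this relation expresses \<open>H\<close>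
      through the derivative of \<psi>.\<close>
    define \<psi> where "\<psi> = (\<lambda>z. coord_field M e (\<phi> y v) (chart_inv d z) d)"
    have oV: "openin (mtop M) ?V" using M.openin_chart d e by blast
    have f: "coord_field M e w \<in> vfields M ?V" for w
      by (rule M.coord_field_vfields[OF e(1) oV]) auto
    have iq: "i q \<in> ?V" using d e by auto
    have bk: "coord_field M e (\<phi> y w) (i q) d = w" for w
      using M.transition_cocycle[OF d(1) e(1) d(1) d(2) e(2) d(2)] M.transition_self[OF d] d e
      by (simp add: coord_field_def \<phi>_def y_def)
    have "smooth_on ?B \<psi>" unfolding \<psi>_def by (rule M.vfields_smooth[OF f d(1)]) auto
    then have \<psi>: "(\<psi> has_derivative der \<psi> y) (at y)" by (rule smooth_on_has_derivative[OF _ yB])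
    have \<psi>y: "\<psi> y = v" using bk M.chart_inv_chart[OF d] by (simp add: \<psi>_def y_def)
    have "((\<lambda>z. \<phi> z (\<psi> z)) has_derivative (\<lambda>h. der (\<lambda>z. \<phi> z (\<psi> y)) y h + \<phi> y (der \<psi> y h))) (at y)"
      by (rule has_derivative_linear_family[OF oB yB \<phi>lin smooth_on_differentiable[OF \<phi>sm yB] \<psi>])
    then have const: "((\<lambda>z. \<phi> y v) has_derivative (\<lambda>h. H h + \<phi> y (der \<psi> y h))) (at y)"
      unfolding \<psi>y H_def[symmetric]
    proof (rule has_derivative_transform_within_open[OF _ oB yB])
      fix z assume "z \<in> ?B"
      then obtain p where p: "p \<in> fst d" "p \<in> fst e" "z = snd d p" by auto
      have "\<phi> z (\<psi> z) = coord_field M e (\<phi> y v) p e"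
        using M.tangent_transition[OF M.coord_field_tangent[OF e(1) p(2)] d(1) e(1) p(1,2)] M.chart_inv_chart[OF d(1) p(1)]
        by (simp add: \<phi>_def \<psi>_def p(3))
      then show "\<phi> z (\<psi> z) = \<phi> y v" by (simp add: M.coord_field_self[OF e(1) p(2)])
    qed
    have 0: "H h + \<phi> y (der \<psi> y h) = 0" for h
      using fun_cong[OF has_derivative_unique[OF const has_derivative_const], of h] by simp
    have "N (coord_field M e (\<phi> y u)) (coord_field M e (\<phi> y v)) (i q) d = der \<psi> y u + N.christ d (i q) u v"
      using N.conn_chart[OF oV f f iq d] by (simp add: bk \<psi>_def[symmetric] y_def[symmetric])
    then have "N.christ e (i q) (\<phi> y u) (\<phi> y v) = \<phi> y (der \<psi> y u + N.christ d (i q) u v)"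
      unfolding N.christ_def \<phi>_def y_def
      using M.tangent_transition[OF M.vfields_tangent[OF N.conn_vfields[OF oV f f] iq] d(1) e(1) d(2) e(2)] by simp
    then show ?thesis using 0[of u] linear_add[OF \<phi>lin[OF yB]] by (simp add: eq_diff_eq add.commute add.left_commute)
  qed
  have "pullback_conn S M N i X Y q e = H u + \<phi> y (der (rep c d Y) x (X q c)) + N.christ e (i q) (\<phi> y u) (\<phi> y v)"
    using pullback_chart[OF c(1) e(1) X Y q q1(2)] Y'[OF q d(2) e(2)] 1 je
    by (simp add: x_def[symmetric] u_def v_def y_def)
  also have "\<dots> = \<phi> y (pullback_conn S M N i X Y q d)"
    unfolding 2 pullback_chart[OF c(1) d(1) X Y q q1(1)] x_def[symmetric] u_def[symmetric] v_def[symmetric]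
      linear_add[OF \<phi>lin[OF yB]] by simp
  finally show "pullback_conn S M N i X Y q e = der (snd e \<circ> chart_inv d) (snd d (i q)) (pullback_conn S M N i X Y q d)"
    by (simp add: \<phi>_def y_def)
qed (auto simp: pullback_conn_def)

end

section \<open>The induced connection and metric in charts\<close>

context hypersurface begin

definition transverse_at :: "('s \<Rightarrow> ('m, real ^ 'n option) tvec) \<Rightarrow> 's \<Rightarrow> bool" where
  "transverse_at T q \<longleftrightarrow> q \<in> points S \<and> T q \<in> tangent_space M (i q) \<and> T q \<notin> differential S M i q ` tangent_space S q"

lemma transverse_field_at:
  "transverse_field S M i U T \<Longrightarrow> openin (mtop S) U \<Longrightarrow> q \<in> U \<Longrightarrow> transverse_at T q"
  using along_tangent openin_subset by (fastforce simp: transverse_field_def transverse_at_def)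

lemma transverse_at_scale:
  assumes "transverse_at T q" "a \<noteq> 0" "T' q = (\<lambda>e. a *\<^sub>R T q e)"
  shows "transverse_at T' q"
proof -
  note T = assms(1)[unfolded transverse_at_def]
  have "T' q \<notin> differential S M i q ` tangent_space S q"
  proof
    assume "T' q \<in> differential S M i q ` tangent_space S q"
    then obtain v where v: "v \<in> tangent_space S q" "T' q = differential S M i q v" by auto
    have "differential S M i q (\<lambda>c. inverse a *\<^sub>R v c + 0 *\<^sub>R v c) = T q"
      using T assms(2) differential_lincomb[OF v(1) v(1), of "inverse a" 0] by (simp add: v(2)[symmetric] assms(3))
    then show False
      using T imageI[OF S.tangent_lincomb[OF v(1) v(1), of "inverse a" 0], of "differential S M i q"] by simp
  qed
  moreover have "T' q \<in> tangent_space M (i q)"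
    using M.tangent_lincomb[of "T q" "i q" "T q" a 0] T by (simp add: assms(3))
  ultimately show ?thesis using T by (simp add: transverse_at_def)
qed

lemma transverse_at_nonzero:
  assumes "transverse_at T q"
  shows "T q \<noteq> (\<lambda>d. 0)"
proof
  assume "T q = (\<lambda>d. 0)"
  then have "T q = differential S M i q (\<lambda>c. 0)"
    using differential_lincomb[OF S.tangent_zero S.tangent_zero, of q 0 0] assms by (simp add: transverse_at_def)
  then show False using assms S.tangent_zero unfolding transverse_at_def by (metis image_eqI)
qed

context
  fixes c d
  assumes c: "c \<in> atlas S" and d: "d \<in> atlas M"
begin

interpretation E: immersed_model "snd c ` dom c d" "jac c d" "sec c d"
  by (rule sec_model[OF c d])

lemma rep_at: "q \<in> dom c d \<Longrightarrow> rep c d T (snd c q) = T q d"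
  by (simp add: rep_def dom_D[OF c d])

lemma transverse_range:
  "q \<in> dom c d \<Longrightarrow> transverse_at T q \<Longrightarrow> rep c d T (snd c q) \<notin> range (jac c d (snd c q))"
  using range_jac[OF c d, of q "T q"] by (simp add: transverse_at_def rep_at)

lemma differential_smooth:
  assumes "Y \<in> vfields S V" "openin (mtop S) V"
  shows "smooth_on (snd c ` (V \<inter> dom c d)) (rep c d (\<lambda>q. differential S M i q (Y q)))"
proof (rule smooth_on_cong[OF _ open_dom[OF c d assms(2)]])
  have sub: "snd c ` (V \<inter> dom c d) \<subseteq> snd c ` dom c d" by auto
  show "smooth_on (snd c ` (V \<inter> dom c d)) (\<lambda>x. jac c d x (Y (chart_inv c x) c))"
    by (rule smooth_on_linear_family[OF open_dom[OF c d assms(2)] E.J(1) smooth_on_subset[OF E.J(3) sub]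
          S.vfields_smooth[OF assms(1) c]]) (auto simp: dom_def)
  show "jac c d x (Y (chart_inv c x) c) = rep c d (\<lambda>q. differential S M i q (Y q)) x"
    if "x \<in> snd c ` (V \<inter> dom c d)" for x
  proof -
    from that obtain q where q: "q \<in> V" "q \<in> dom c d" "x = snd c q" by auto
    then show ?thesis
      using differential_jac[OF c d q(2) S.vfields_tangent[OF assms(1) q(1)]] by (simp add: rep_def dom_D[OF c d])
  qed
qed

end

lemma differential_along:
  assumes "Y \<in> vfields S V" "openin (mtop S) V"
  shows "(\<lambda>q. differential S M i q (Y q)) \<in> vfields_along S M i V"
proof (rule alongI)
  have pt: "p \<in> points S" if "p \<in> V" for p using that assms(2) openin_subset by blast
  show "differential S M i p (Y p) \<in> tangent_space M (i p)" if "p \<in> V" for p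
    by (rule differential_tangent[OF S.vfields_tangent[OF assms(1) that] pt[OF that]])
  fix p assume p: "p \<in> V"
  obtain c d where cd: "c \<in> atlas S" "d \<in> atlas M" "p \<in> dom c d" using ex_dom pt[OF p] by blast
  show "\<exists>c\<in>atlas S. \<exists>d\<in>atlas M. \<exists>U. openin (mtop S) U \<and> p \<in> U \<and> U \<subseteq> V \<inter> fst c \<inter> i -` fst d \<and>
    smooth_on (snd c ` U) (\<lambda>x. differential S M i (chart_inv c x) (Y (chart_inv c x)) d)"
    using p cd assms(2) openin_dom[OF cd(1,2)] differential_smooth[OF cd(1,2) assms]
    by (intro bexI[OF _ cd(1)] bexI[OF _ cd(2)] exI[of _ "V \<inter> dom c d"]) (auto simp: dom_def rep_def[abs_def])
qed

lemma pullback_differential_tangent: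
  assumes "openin (mtop S) V" "X \<in> vfields S V" "Y \<in> vfields S V" "q \<in> V"
  shows "pullback_conn S M N i X (\<lambda>q. differential S M i q (Y q)) q \<in> tangent_space M (i q)"
  by (rule pullback_tangent[OF assms(1,2) differential_along[OF assms(3,1)] assms(4)])

context
  fixes c d
  assumes c: "c \<in> atlas S" and d: "d \<in> atlas M"
begin

interpretation E: immersed_model "snd c ` dom c d" "jac c d" "sec c d"
  by (rule sec_model[OF c d])

context
  fixes V X Y q
  assumes V: "openin (mtop S) V" and X: "X \<in> vfields S V" and Y: "Y \<in> vfields S V" and q: "q \<in> V" "q \<in> dom c d"
begin

lemma pullback_differential_chart:
  "pullback_conn S M N i X (\<lambda>q. differential S M i q (Y q)) q d =
    jac c d (snd c q) (der (\<lambda>x. Y (chart_inv c x) c) (snd c q) (X q c)) + sec c d (snd c q) (X q c) (Y q c)"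
proof -
  let ?V = "snd c ` (V \<inter> dom c d)" and ?x = "snd c q"
  note oV = open_dom[OF c d V]
  have xV: "?x \<in> ?V" using q by auto
  have "smooth_on ?V (\<lambda>x. Y (chart_inv c x) c)" by (rule S.vfields_smooth[OF Y c]) (auto simp: dom_def)
  then have \<eta>: "((\<lambda>x. Y (chart_inv c x) c) has_derivative der (\<lambda>x. Y (chart_inv c x) c) ?x) (at ?x)"
    by (rule smooth_on_has_derivative[OF _ xV])
  have "((\<lambda>x. jac c d x (Y (chart_inv c x) c)) has_derivative
    (\<lambda>u. der (\<lambda>x. jac c d x (Y (chart_inv c ?x) c)) ?x u + jac c d ?x (der (\<lambda>x. Y (chart_inv c x) c) ?x u))) (at ?x)"
    by (rule has_derivative_linear_family[OF oV xV E.J(1) smooth_on_differentiable[OF E.J(3)] \<eta>]) (use xV in auto)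
  then have "(rep c d (\<lambda>q. differential S M i q (Y q)) has_derivative
    (\<lambda>u. der (\<lambda>x. jac c d x (Y q c)) ?x u + jac c d ?x (der (\<lambda>x. Y (chart_inv c x) c) ?x u))) (at ?x)"
    unfolding dom_D(4)[OF c d q(2)]
  proof (rule has_derivative_transform_within_open[OF _ oV xV])
    fix x assume "x \<in> ?V"
    then obtain r where r: "r \<in> V" "r \<in> dom c d" "x = snd c r" by auto
    then show "jac c d x (Y (chart_inv c x) c) = rep c d (\<lambda>q. differential S M i q (Y q)) x"
      using differential_jac[OF c d r(2) S.vfields_tangent[OF Y r(1)]] by (simp add: rep_def dom_D[OF c d])
  qed
  from der_eqI[OF this] show ?thesis
    using pullback_chart[OF c d X differential_along[OF Y V] q] differential_jac[OF c d q(2) S.vfields_tangent[OF Y q(1)]]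
    by (simp add: sec_def dom_D(4)[OF c d q(2)])
qed

text \<open>Both sides of the Gauss formula are tangent vectors of \<open>M\<close>, so it holds in
  all charts as soon as it holds in \<open>d\<close>, where uniqueness of the splitting identifies
  \<open>w\<close> and \<open>r\<close>. The derivative of the components of \<open>Y\<close> is
  tangential and joins \<open>chr\<close>.\<close>

lemma pullback_decompose:
  assumes T: "transverse_at T q" and w: "w \<in> tangent_space S q"
  shows "(\<forall>e. pullback_conn S M N i X (\<lambda>q. differential S M i q (Y q)) q e = differential S M i q w e + r *\<^sub>R T q e) \<longleftrightarrow>
    w c = der (\<lambda>x. Y (chart_inv c x) c) (snd c q) (X q c) + chr c d (rep c d T) (snd c q) (X q c) (Y q c) \<and>
    r = met c d (rep c d T) (snd c q) (X q c) (Y q c)"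
    (is "?L \<longleftrightarrow> w c = ?D + ?G \<and> r = ?H")
proof -
  let ?x = "snd c q" and ?P = "pullback_conn S M N i X (\<lambda>q. differential S M i q (Y q)) q"
  have x: "?x \<in> snd c ` dom c d" using q by auto
  note J = E.J(1,2)[OF x]
  note t = transverse_range[OF c d q(2) T]
  have Td: "T q d = rep c d T ?x" using q by (simp add: rep_at[OF c d])
  have tan: "(\<lambda>e. 1 *\<^sub>R differential S M i q w e + r *\<^sub>R T q e) \<in> tangent_space M (i q)"
    using T by (intro M.tangent_lincomb differential_tangent w dom_D(3)[OF c d q(2)]) (simp add: transverse_at_def)
  have "?L \<longleftrightarrow> ?P d = differential S M i q w d + r *\<^sub>R T q d"
  proof
    assume "?P d = differential S M i q w d + r *\<^sub>R T q d"
    then have "?P = (\<lambda>e. 1 *\<^sub>R differential S M i q w e + r *\<^sub>R T q e)"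
      by (intro M.tangent_eqI[OF pullback_differential_tangent[OF V X Y q(1)] tan d dom_D(2)[OF c d q(2)]]) simp
    then show ?L by simp
  qed blast
  also have "\<dots> \<longleftrightarrow> sec c d ?x (X q c) (Y q c) = jac c d ?x (w c - ?D) + r *\<^sub>R rep c d T ?x"
    unfolding pullback_differential_chart differential_jac[OF c d q(2) w] Td linear_diff[OF J(1)]
    by (auto simp: algebra_simps)
  also have "\<dots> \<longleftrightarrow> w c - ?D = ?G \<and> r = ?H"
  proof
    assume "sec c d ?x (X q c) (Y q c) = jac c d ?x (w c - ?D) + r *\<^sub>R rep c d T ?x"
    from decompose_unique[OF J t this] show "w c - ?D = ?G \<and> r = ?H" by (simp add: gconn_def hform_def)
  next
    assume "w c - ?D = ?G \<and> r = ?H"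
    then show "sec c d ?x (X q c) (Y q c) = jac c d ?x (w c - ?D) + r *\<^sub>R rep c d T ?x"
      using decompose[OF J t] by (simp add: gconn_def hform_def)
  qed
  finally show ?thesis by (auto simp: algebra_simps)
qed

text \<open>The transverse summand may be any multiple of \<open>T q\<close>, so
  \<open>pullback_decompose\<close> with an unspecified \<open>r\<close> determines the tangential
  one.\<close>

lemma induced_conn_chart:
  assumes T: "transverse_at T q" and W: "W q = line_spanned T q"
  shows "induced_conn S M N i W X Y q = coord_field S c (der (\<lambda>x. Y (chart_inv c x) c) (snd c q) (X q c) +
    chr c d (rep c d T) (snd c q) (X q c) (Y q c)) q"
  unfolding induced_conn_def
proof (rule the_equality)
  let ?w = "der (\<lambda>x. Y (chart_inv c x) c) (snd c q) (X q c) +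
    chr c d (rep c d T) (snd c q) (X q c) (Y q c)"
  note tf = S.coord_field_tangent[OF c dom_D(1)[OF c d q(2)]] S.coord_field_self[OF c dom_D(1)[OF c d q(2)]]
  have "\<forall>e. pullback_conn S M N i X (\<lambda>q. differential S M i q (Y q)) q e =
     differential S M i q (coord_field S c ?w q) e + met c d (rep c d T) (snd c q) (X q c) (Y q c) *\<^sub>R T q e"
    unfolding pullback_decompose[OF T tf(1)] by (simp add: tf)
  then show "coord_field S c ?w q \<in> tangent_space S q \<and> (\<exists>t\<in>W q. \<forall>e.
     pullback_conn S M N i X (\<lambda>q. differential S M i q (Y q)) q e = differential S M i q (coord_field S c ?w q) e + t e)"
    unfolding W line_spanned_def
    by (intro conjI tf(1) bexI[of _ "\<lambda>e. met c d (rep c d T) (snd c q) (X q c) (Y q c) *\<^sub>R T q e"]) blast+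
  fix w assume "w \<in> tangent_space S q \<and> (\<exists>t\<in>W q. \<forall>e.
     pullback_conn S M N i X (\<lambda>q. differential S M i q (Y q)) q e = differential S M i q w e + t e)"
  then obtain r where w: "w \<in> tangent_space S q"
    and "\<forall>e. pullback_conn S M N i X (\<lambda>q. differential S M i q (Y q)) q e = differential S M i q w e + r *\<^sub>R T q e"
    unfolding W line_spanned_def by blast
  then have "w c = ?w" unfolding pullback_decompose[OF T w] by blast
  then show "w = coord_field S c ?w q" using S.tangent_coord_field[OF w c dom_D(1)[OF c d q(2)]] by simp
qed

end

text \<open>Coordinate fields serve as extensions of \<open>u\<close> and \<open>v\<close>. Any
  other extensions give the same number, because the \<open>r\<close> in
  \<open>pullback_decompose\<close> depends on the fields only through their values at
  \<open>q\<close>; this is the tensoriality of h.\<close>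

lemma induced_metric_chart:
  assumes q: "q \<in> dom c d" and T: "transverse_at T q" and u: "u \<in> tangent_space S q" and v: "v \<in> tangent_space S q"
  shows "induced_metric S M N i T q u v = met c d (rep c d T) (snd c q) (u c) (v c)"
  unfolding induced_metric_def
proof (rule the_equality)
  note cq = c dom_D(1)[OF c d q]
  note tf = S.coord_field_tangent[OF cq] S.coord_field_self[OF cq]
  let ?V = "fst c" and ?X = "coord_field S c (u c)" and ?Y = "coord_field S c (v c)"
  have V: "openin (mtop S) ?V" using S.openin_chart c by blast
  have XY: "?X \<in> vfields S ?V" "?Y \<in> vfields S ?V" by (rule S.coord_field_vfields[OF c V order.refl])+
  let ?w = "coord_field S c (der (\<lambda>x. ?Y (chart_inv c x) c) (snd c q) (?X q c) + chr c d (rep c d T) (snd c q) (?X q c) (?Y q c)) q"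
  have "\<forall>e. pullback_conn S M N i ?X (\<lambda>q. differential S M i q (?Y q)) q e =
     differential S M i q ?w e + met c d (rep c d T) (snd c q) (u c) (v c) *\<^sub>R T q e"
    unfolding pullback_decompose[OF V XY dom_D(1)[OF c d q] q T tf(1)] by (simp add: tf)
  then show "\<exists>V X Y. openin (mtop S) V \<and> q \<in> V \<and> X \<in> vfields S V \<and> Y \<in> vfields S V \<and> X q = u \<and> Y q = v \<and>
    (\<exists>w\<in>tangent_space S q. \<forall>e. pullback_conn S M N i X (\<lambda>q. differential S M i q (Y q)) q e =
      differential S M i q w e + met c d (rep c d T) (snd c q) (u c) (v c) *\<^sub>R T q e)"
    using V XY cq(2) S.tangent_coord_field[OF u cq] S.tangent_coord_field[OF v cq] tf(1)
    by (intro exI[of _ ?V] exI[of _ ?X] exI[of _ ?Y]) blast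
  fix r assume "\<exists>V X Y. openin (mtop S) V \<and> q \<in> V \<and> X \<in> vfields S V \<and> Y \<in> vfields S V \<and> X q = u \<and> Y q = v \<and>
    (\<exists>w\<in>tangent_space S q. \<forall>e. pullback_conn S M N i X (\<lambda>q. differential S M i q (Y q)) q e =
      differential S M i q w e + r *\<^sub>R T q e)"
  then obtain V X Y w where *: "openin (mtop S) V" "q \<in> V" "X \<in> vfields S V" "Y \<in> vfields S V" "X q = u" "Y q = v"
    "w \<in> tangent_space S q" "\<forall>e. pullback_conn S M N i X (\<lambda>q. differential S M i q (Y q)) q e =
      differential S M i q w e + r *\<^sub>R T q e" by blast
  from *(8) show "r = met c d (rep c d T) (snd c q) (u c) (v c)"
    unfolding pullback_decompose[OF *(1,3,4,2) q T *(7)] *(5,6) by blast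
qed

lemma transversal_rep:
  assumes "transverse_field S M i U T" "openin (mtop S) U"
  shows "E.transversal (snd c ` (U \<inter> dom c d)) (rep c d T)"
proof -
  have "smooth_on (snd c ` (U \<inter> dom c d)) (rep c d T)"
    using assms(1) unfolding rep_def transverse_field_def
    by (intro along_smooth[OF _ c d, of _ U]) (auto simp: dom_def)
  then show ?thesis
    unfolding E.transversal_def
    using open_dom[OF c d assms(2)] transverse_range[OF c d _ transverse_field_at[OF assms]] by auto
qed

lemma nondegenerate_gram:
  assumes q: "q \<in> dom c d" and T: "transverse_at T q"
  shows "nondegenerate_at S (induced_metric S M N i T) q \<longleftrightarrow>
    invertible (gram std (met c d (rep c d T) (snd c q)))"
proof -
  let ?h = "met c d (rep c d T) (snd c q)"
  let ?G = "gram std ?h"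
  note cq = c dom_D(1)[OF c d q]
  note tf = S.coord_field_tangent[OF cq] S.coord_field_self[OF cq]
  have x: "snd c q \<in> snd c ` dom c d" using q by auto
  have h: "?h u w = (?G *v u) \<bullet> w" for u w
    by (rule gram_apply[OF E.bilinear_hform[OF x] E.hform_commute[OF x]])
  have 0: "(\<forall>v\<in>tangent_space S q. induced_metric S M N i T q u v = 0) \<longleftrightarrow> ?G *v (u c) = 0"
    if u: "u \<in> tangent_space S q" for u
  proof
    assume "\<forall>v\<in>tangent_space S q. induced_metric S M N i T q u v = 0"
    from this[rule_format, OF tf(1)[of "?G *v u c"]] show "?G *v (u c) = 0"
      by (simp add: induced_metric_chart[OF q T u tf(1)] tf(2) h)
  qed (simp add: induced_metric_chart[OF q T u] h)
  have "nondegenerate_at S (induced_metric S M N i T) q \<longleftrightarrow> (\<forall>u. ?G *v u = 0 \<longrightarrow> u = 0)"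
  proof
    assume nd: "nondegenerate_at S (induced_metric S M N i T) q"
    show "\<forall>u. ?G *v u = 0 \<longrightarrow> u = 0"
    proof (intro allI impI)
      fix u assume "?G *v u = 0"
      then have "coord_field S c u q = (\<lambda>c. 0)"
        using nd 0[OF tf(1)] tf unfolding nondegenerate_at_def by metis
      then show "u = 0" using fun_cong[of "coord_field S c u q" "\<lambda>c. 0" c] tf(2)[of u] by simp
    qed
  next
    assume *: "\<forall>u. ?G *v u = 0 \<longrightarrow> u = 0"
    show "nondegenerate_at S (induced_metric S M N i T) q"
      unfolding nondegenerate_at_def
    proof (intro ballI impI)
      fix u assume u: "u \<in> tangent_space S q" and z: "\<forall>v\<in>tangent_space S q. induced_metric S M N i T q u v = 0"
      then have "u c = 0" using 0 * by blast
      then show "u = (\<lambda>c. 0)" by (intro S.tangent_eqI[OF u S.tangent_zero cq])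
    qed
  qed
  then show ?thesis by (simp add: invertible_left_inverse matrix_left_invertible_ker)
qed

text \<open>The product rule yields derivatives of the components of \<open>Y\<close> and
  \<open>Z\<close>, and the induced connection contains the same ones; they cancel, leaving an
  expression in the values at \<open>q\<close> alone.\<close>

lemma cov_deriv_chart:
  assumes T: "transverse_field S M i U T" and U: "openin (mtop S) U" and V: "openin (mtop S) V" "V \<subseteq> U"
    and W: "W q = line_spanned T q"
    and X: "X \<in> vfields S V" and Y: "Y \<in> vfields S V" and Z: "Z \<in> vfields S V" and q: "q \<in> V" "q \<in> dom c d"
  shows "cov_deriv_tensor S (induced_conn S M N i W) (induced_metric S M N i T) X Y Z q =
    dmet c d (rep c d T) (snd c q) (X q c) (Y q c) (Z q c)"
proof -
  let ?V = "snd c ` (V \<inter> dom c d)" and ?x = "snd c q" and ?U = "snd c ` (U \<inter> dom c d)"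
  let ?h = "met c d (rep c d T)"
  note oV = open_dom[OF c d V(1)] and tr = transversal_rep[OF T U]
  note Tq = transverse_field_at[OF T U]
  have xV: "?x \<in> ?V" using q by auto
  have xU: "?x \<in> ?U" using q V by auto
  have D: "((\<lambda>x. Z (chart_inv c x) c) has_derivative der (\<lambda>x. Z (chart_inv c x) c) ?x) (at ?x)" if "Z \<in> vfields S V" for Z
  proof -
    have "smooth_on ?V (\<lambda>x. Z (chart_inv c x) c)" by (rule S.vfields_smooth[OF that c]) (auto simp: dom_def)
    then show ?thesis by (rule smooth_on_has_derivative[OF _ xV])
  qed
  from E.has_derivative_hform[OF tr xU D[OF Y] D[OF Z]]
  have "((\<lambda>x. induced_metric S M N i T (chart_inv c x) (Y (chart_inv c x)) (Z (chart_inv c x))) has_derivative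
    (\<lambda>u. der (\<lambda>y. ?h y (Y q c) (Z q c)) ?x u + ?h ?x (der (\<lambda>x. Y (chart_inv c x) c) ?x u) (Z q c)
      + ?h ?x (Y q c) (der (\<lambda>x. Z (chart_inv c x) c) ?x u))) (at ?x)"
    unfolding dom_D(4)[OF c d q(2)]
  proof (rule has_derivative_transform_within_open[OF _ oV xV])
    fix x assume "x \<in> ?V"
    then obtain r where r: "r \<in> V" "r \<in> dom c d" "x = snd c r" by auto
    then show "?h x (Y (chart_inv c x) c) (Z (chart_inv c x) c) =
      induced_metric S M N i T (chart_inv c x) (Y (chart_inv c x)) (Z (chart_inv c x))"
      using induced_metric_chart[OF r(2) Tq S.vfields_tangent[OF Y r(1)] S.vfields_tangent[OF Z r(1)]] V
      by (auto simp: dom_D[OF c d])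
  qed
  note 1 = S.dirderiv_chart[OF S.vfields_tangent[OF X q(1)] c dom_D(1)[OF c d q(2)] this]
  note cq = c dom_D(1)[OF c d q(2)]
  note tf = S.coord_field_tangent[OF cq] S.coord_field_self[OF cq]
  have Tq': "transverse_at T q" using Tq q V by auto
  have xA: "?x \<in> snd c ` dom c d" using q by auto
  note h = E.bilinear_hform[OF xA, of "rep c d T"]
  show ?thesis
    unfolding cov_deriv_tensor_def 1 induced_conn_chart[where W = W and q = q, OF V(1) X Y q Tq' W]
      induced_conn_chart[where W = W and q = q, OF V(1) X Z q Tq' W]
      induced_metric_chart[OF q(2) Tq' tf(1) S.vfields_tangent[OF Z q(1)]]
      induced_metric_chart[OF q(2) Tq' S.vfields_tangent[OF Y q(1)] tf(1)] tf(2) ctens_def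
      bilinear_ladd[OF h] bilinear_radd[OF h] by simp
qed

end

end

section \<open>Frames, and alignment as vanishing of the defect\<close>

lemma frame_matrix_mult: "frame_matrix e *v a = (\<Sum>j\<in>UNIV. a $ j *\<^sub>R e j)"
  by (simp add: frame_matrix_def matrix_vector_mult_def vec_eq_iff mult.commute)

lemma (in manifold) frame_at_chart:
  fixes v :: "'k::finite \<Rightarrow> ('m, 'e) tvec"
  assumes v: "\<And>j. v j \<in> tangent_space M q" and c: "c \<in> atlas M" "q \<in> fst c"
  shows "frame_at M q v \<longleftrightarrow> (\<forall>a. (\<Sum>j\<in>UNIV. a j *\<^sub>R v j c) = 0 \<longrightarrow> (\<forall>j. a j = 0))"
proof -
  have "(\<forall>b. (\<Sum>j\<in>UNIV. a j *\<^sub>R v j b) = 0) \<longleftrightarrow> (\<Sum>j\<in>UNIV. a j *\<^sub>R v j c) = 0" for a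
  proof
    assume "(\<Sum>j\<in>UNIV. a j *\<^sub>R v j c) = 0"
    then have "(\<lambda>b. \<Sum>j\<in>UNIV. a j *\<^sub>R v j b) = (\<lambda>b. 0)"
      by (intro tangent_eqI[OF tangent_sum tangent_zero c] v)
    then show "\<forall>b. (\<Sum>j\<in>UNIV. a j *\<^sub>R v j b) = 0" by meson
  qed blast
  then show ?thesis using v by (simp add: frame_at_def)
qed

lemma invertible_frame_matrix:
  fixes e :: "'n::finite \<Rightarrow> real ^ 'n"
  shows "invertible (frame_matrix e) \<longleftrightarrow> (\<forall>a. (\<Sum>j\<in>UNIV. a j *\<^sub>R e j) = 0 \<longrightarrow> (\<forall>j. a j = 0))"
proof -
  have "invertible (frame_matrix e) \<longleftrightarrow> (\<forall>a. (\<Sum>j\<in>UNIV. a $ j *\<^sub>R e j) = 0 \<longrightarrow> a = 0)"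
    by (simp add: invertible_left_inverse matrix_left_invertible_ker frame_matrix_mult)
  also have "\<dots> \<longleftrightarrow> (\<forall>a. (\<Sum>j\<in>UNIV. a j *\<^sub>R e j) = 0 \<longrightarrow> (\<forall>j. a j = 0))"
  proof
    assume *: "\<forall>a. (\<Sum>j\<in>UNIV. a $ j *\<^sub>R e j) = 0 \<longrightarrow> a = 0"
    show "\<forall>a. (\<Sum>j\<in>UNIV. a j *\<^sub>R e j) = 0 \<longrightarrow> (\<forall>j. a j = 0)"
    proof (intro allI impI)
      fix a j assume "(\<Sum>j\<in>UNIV. a j *\<^sub>R e j) = 0"
      then have "(\<Sum>j\<in>UNIV. (\<chi> j. a j) $ j *\<^sub>R e j) = 0" by simp
      then have "(\<chi> j. a j) = 0" by (rule *[THEN spec, THEN mp])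
      from arg_cong[OF this, of "\<lambda>v. v $ j"] show "a j = 0" by simp
    qed
  next
    assume *: "\<forall>a. (\<Sum>j\<in>UNIV. a j *\<^sub>R e j) = 0 \<longrightarrow> (\<forall>j. a j = 0)"
    show "\<forall>a. (\<Sum>j\<in>UNIV. a $ j *\<^sub>R e j) = 0 \<longrightarrow> a = 0"
    proof (intro allI impI)
      fix a :: "real ^ 'n" assume "(\<Sum>j\<in>UNIV. a $ j *\<^sub>R e j) = 0"
      then have "\<forall>j. a $ j = 0" by (rule *[THEN spec, THEN mp])
      then show "a = 0" by (simp add: vec_eq_iff)
    qed
  qed
  finally show ?thesis .
qed

lemma frame_matrix_std: "frame_matrix std = (mat 1 :: real ^ 'n ^ 'n)"
  by (auto simp: frame_matrix_def mat_def axis_def vec_eq_iff)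

context hypersurface begin

lemma local_frame_coord:
  assumes "c \<in> atlas S" "openin (mtop S) V" "V \<subseteq> fst c"
  shows "local_frame S V (\<lambda>j. coord_field S c (std j))"
  unfolding local_frame_def
proof (intro conjI allI ballI)
  show "coord_field S c (std j) \<in> vfields S V" for j :: 'n
    by (rule S.coord_field_vfields[OF assms])
  fix p assume p: "p \<in> V"
  then have cp: "c \<in> atlas S" "p \<in> fst c" using assms by auto
  have "invertible (frame_matrix (\<lambda>j. coord_field S c (std j) p c))"
    unfolding S.coord_field_self[OF cp] frame_matrix_std by (rule matrix_inv_eqI(2)[of _ "mat 1"]) simp
  then show "frame_at S p (\<lambda>j. coord_field S c (std j) p)"
    unfolding S.frame_at_chart[OF S.coord_field_tangent[OF cp] cp] invertible_frame_matrix .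
qed

context
  fixes U T W
  assumes T: "transverse_field S M i U T" and U: "openin (mtop S) U"
    and W: "\<And>q. q \<in> U \<Longrightarrow> W q = line_spanned T q"
begin

lemma gram_induced_metric:
  assumes "c \<in> atlas S" "d \<in> atlas M" "q \<in> U" "q \<in> dom c d" "\<And>j. v j \<in> tangent_space S q"
  shows "(\<chi> P Q. induced_metric S M N i T q (v P) (v Q)) =
    gram (\<lambda>j. v j c) (met c d (rep c d T) (snd c q))"
  by (simp add: gram_def induced_metric_chart[OF assms(1,2,4) transverse_field_at[OF T U assms(3)] assms(5) assms(5)])

text \<open>The coordinate frame is one of the frames over which \<open>aligned\<close> quantifies;
  it gives the vanishing on the standard basis, and linearity of the defect gives the rest.\<close>

lemma aligned_imp_defect:
  assumes al: "aligned S U (induced_conn S M N i W) (induced_metric S M N i T)"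
    and cd: "c \<in> atlas S" "d \<in> atlas M" and q: "q \<in> U" "q \<in> dom c d"
  shows "dft c d (rep c d T) (snd c q) w = 0"
proof -
  interpret E: immersed_model "snd c ` dom c d" "jac c d" "sec c d" by (rule sec_model[OF cd])
  let ?V = "U \<inter> dom c d"
  let ?E = "\<lambda>j::'n. coord_field S c (std j)"
  have V: "openin (mtop S) ?V" using U openin_dom[OF cd] by blast
  have sub: "?V \<subseteq> fst c" by (auto simp: dom_def)
  have qV: "q \<in> ?V" "q \<in> fst c" using q sub by auto
  note fr = local_frame_coord[OF cd(1) V sub]
  have Ev: "?E j \<in> vfields S ?V" for j by (rule S.coord_field_vfields[OF cd(1) V sub])
  have Eq: "?E j q c = std j" for j by (rule S.coord_field_self[OF cd(1) qV(2)])
  note cov = cov_deriv_chart[where W = W and q = q, OF cd T U V Int_lower1 W[OF q(1)] Ev Ev Ev qV(1) q(2), unfolded Eq]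
  note gm = gram_induced_metric[OF cd q, of "\<lambda>j. ?E j q", OF S.coord_field_tangent[OF cd(1) qV(2)], unfolded Eq]
  have "let H = matrix_inv (\<chi> P Q. induced_metric S M N i T q (?E P q) (?E Q q)) in
     real CARD('n) * (\<Sum>P\<in>UNIV. \<Sum>Q\<in>UNIV. H $ P $ Q * cov_deriv_tensor S (induced_conn S M N i W) (induced_metric S M N i T) (?E P) (?E Q) (?E I) q) =
     (\<Sum>P\<in>UNIV. \<Sum>Q\<in>UNIV. H $ P $ Q * cov_deriv_tensor S (induced_conn S M N i W) (induced_metric S M N i T) (?E I) (?E P) (?E Q) q)" for I
    using al[unfolded aligned_def, rule_format, of ?V ?E q I] V fr qV by blast
  then have "dft c d (rep c d T) (snd c q) (std I) = 0" for I
    unfolding Let_def cov gm defect_def frame_trace_def by simp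
  moreover have "linear (dft c d (rep c d T) (snd c q))"
    by (rule E.linear_defect[OF transversal_rep[OF cd T U]]) (use qV in auto)
  ultimately show ?thesis using linear_vec_expand[of "dft c d (rep c d T) (snd c q)" w] by simp
qed

text \<open>The frame in \<open>aligned\<close> is arbitrary, but the metric traces of the bilinear
  maps involved do not depend on it by \<open>frame_trace_frame\<close>. The charts may therefore be
  chosen anew at each point.\<close>

lemma defect_imp_aligned:
  assumes nd: "\<And>q. q \<in> U \<Longrightarrow> nondegenerate_at S (induced_metric S M N i T) q"
    and al: "\<And>q. q \<in> U \<Longrightarrow> \<exists>c\<in>atlas S. \<exists>d\<in>atlas M. q \<in> dom c d \<and> (\<forall>w. dft c d (rep c d T) (snd c q) w = 0)"
  shows "aligned S U (induced_conn S M N i W) (induced_metric S M N i T)"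
  unfolding aligned_def
proof (intro allI impI ballI)
  fix V E q I assume V: "openin (mtop S) V \<and> V \<subseteq> U \<and> local_frame S V E" and q: "q \<in> V"
  then have qU: "q \<in> U" by auto
  obtain c d where cd: "c \<in> atlas S" "d \<in> atlas M" and qd: "q \<in> dom c d"
    and 0: "\<And>w. dft c d (rep c d T) (snd c q) w = 0" using al[OF qU] by blast
  interpret E: immersed_model "snd c ` dom c d" "jac c d" "sec c d" by (rule sec_model[OF cd])
  have qc: "q \<in> fst c" using qd by (auto simp: dom_def)
  have Ev: "E j \<in> vfields S V" for j using V by (auto simp: local_frame_def)
  have Et: "E j q \<in> tangent_space S q" for j by (rule S.vfields_tangent[OF Ev q])
  define e where "e = (\<lambda>j. E j q c)"
  have "frame_at S q (\<lambda>j. E j q)" using V q by (auto simp: local_frame_def)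
  then have e: "invertible (frame_matrix e)"
    unfolding S.frame_at_chart[OF Et cd(1) qc] invertible_frame_matrix e_def .
  have x: "snd c q \<in> snd c ` (U \<inter> dom c d)" "snd c q \<in> snd c ` dom c d" using qU qd by auto
  let ?h = "met c d (rep c d T) (snd c q)" and ?C = "dmet c d (rep c d T) (snd c q)"
  have inv: "invertible (gram std ?h)"
    using nd[OF qU] nondegenerate_gram[OF cd qd transverse_field_at[OF T U qU]] by simp
  have V1: "openin (mtop S) V" "V \<subseteq> U" using V by auto
  note cov = cov_deriv_chart[where W = W and q = q, OF cd T U V1 W[OF qU] Ev Ev Ev q qd]
  note gm = gram_induced_metric[OF cd qU qd, of "\<lambda>j. E j q", OF Et, folded e_def]
  note h = E.bilinear_hform[OF x(2), of "rep c d T"]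
  note cl = E.ctens_linear[OF transversal_rep[OF cd T U] x(1)]
  have fr: "frame_trace e ?h (\<lambda>u v. ?C u v w) = frame_trace std ?h (\<lambda>u v. ?C u v w)"
    "frame_trace e ?h (\<lambda>u v. ?C w u v) = frame_trace std ?h (\<lambda>u v. ?C w u v)" for w
    using cl by (auto intro!: frame_trace_frame[OF h _ e inv] simp: bilinear_def)
  have "real CARD('n) * frame_trace e ?h (\<lambda>u v. ?C u v (e I)) = frame_trace e ?h (\<lambda>u v. ?C (e I) u v)"
    using 0[of "e I"] by (simp add: fr defect_def)
  then show "let H = matrix_inv (\<chi> P Q. induced_metric S M N i T q (E P q) (E Q q)) in
     real CARD('n) * (\<Sum>P\<in>UNIV. \<Sum>Q\<in>UNIV. H $ P $ Q * cov_deriv_tensor S (induced_conn S M N i W) (induced_metric S M N i T) (E P) (E Q) (E I) q) =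
     (\<Sum>P\<in>UNIV. \<Sum>Q\<in>UNIV. H $ P $ Q * cov_deriv_tensor S (induced_conn S M N i W) (induced_metric S M N i T) (E I) (E P) (E Q) q)"
    unfolding Let_def cov gm frame_trace_def e_def .
qed

end

end

section \<open>The aligned line field\<close>

locale nondegenerate = hypersurface S M i N
  for S :: "('s, real ^ 'n::finite) mfd" and M :: "('m, real ^ 'n option) mfd" and i N +
  assumes nondegenerate: "p \<in> points S \<Longrightarrow> \<exists>U T. openin (mtop S) U \<and> p \<in> U \<and> transverse_field S M i U T \<and>
      (\<forall>q\<in>U. nondegenerate_at S (induced_metric S M N i T) q)"
    and dim: "CARD('n) \<ge> 2"
begin

lemma transverse_field_subset:
  "transverse_field S M i U T \<Longrightarrow> V \<subseteq> U \<Longrightarrow> transverse_field S M i V T"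
  using along_subset by (fastforce simp: transverse_field_def)

text \<open>Nondegeneracy is given for one transversal near each point; a change of transversal
  multiplies h by a nonzero number, which keeps the Gram matrix invertible.\<close>

lemma transverse_nondegenerate:
  assumes T: "transverse_field S M i U T" "openin (mtop S) U" and q: "q \<in> U"
  shows "nondegenerate_at S (induced_metric S M N i T) q"
proof -
  have qS: "q \<in> points S" using T q openin_subset by blast
  obtain U' T' where T': "openin (mtop S) U'" "q \<in> U'" "transverse_field S M i U' T'"
    "nondegenerate_at S (induced_metric S M N i T') q" using nondegenerate[OF qS] by blast
  obtain c d where cd: "c \<in> atlas S" "d \<in> atlas M" "q \<in> dom c d" using ex_dom[OF qS] by blast
  interpret E: immersed_model "snd c ` dom c d" "jac c d" "sec c d" by (rule sec_model[OF cd(1,2)])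
  let ?U = "U \<inter> U'"
  have oU: "openin (mtop S) ?U" using T T' by blast
  have tr: "E.transversal (snd c ` (?U \<inter> dom c d)) (rep c d T)" "E.transversal (snd c ` (?U \<inter> dom c d)) (rep c d T')"
    using transverse_field_subset[OF T(1), of ?U] transverse_field_subset[OF T'(3), of ?U]
    by (auto intro!: transversal_rep[OF cd(1,2) _ oU])
  have x: "snd c q \<in> snd c ` (?U \<inter> dom c d)" using q T' cd by auto
  have inv: "invertible (gram std (met c d (rep c d T') (snd c q)))"
    using T'(4) nondegenerate_gram[OF cd transverse_field_at[OF T'(3,1,2)]] by simp
  have "met c d (rep c d T) (snd c q) =
     (\<lambda>u v. inverse (E.fac (rep c d T') (rep c d T) (snd c q)) * met c d (rep c d T') (snd c q) u v)"
    by (intro ext E.change_hg(1)[OF tr(2,1) x])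
  then have "invertible (gram std (met c d (rep c d T) (snd c q)))"
    using E.fac_nonzero[OF tr(2,1) x] by (simp add: gram_scale matrix_inv_scale(2)[OF inv])
  then show ?thesis using nondegenerate_gram[OF cd transverse_field_at[OF T q]] by simp
qed

definition aligned_field :: "'s set \<Rightarrow> ('s \<Rightarrow> ('m, real ^ 'n option) tvec) \<Rightarrow> bool" where
  "aligned_field U T \<longleftrightarrow> openin (mtop S) U \<and> transverse_field S M i U T \<and>
    aligned S U (induced_conn S M N i (line_spanned T)) (induced_metric S M N i T)"

lemma transversal_rep_inv:
  assumes "transverse_field S M i U T" "openin (mtop S) U" "q \<in> U" "c \<in> atlas S" "d \<in> atlas M" "q \<in> dom c d"
  shows "invertible (gram std (met c d (rep c d T) (snd c q)))"
  using nondegenerate_gram[OF assms(4-6) transverse_field_at[OF assms(1-3)]] transverse_nondegenerate[OF assms(1-3)] by simp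

lemma line_spanned_iff: "t \<in> line_spanned T q \<longleftrightarrow> (\<exists>r. t = (\<lambda>d. r *\<^sub>R T q d))"
  by (simp add: line_spanned_def)

lemma line_spanned_self: "T q \<in> line_spanned T q"
  unfolding line_spanned_iff by (rule exI[of _ 1]) simp

lemma line_spanned_scale:
  assumes "r \<noteq> 0" "T' q = (\<lambda>d. r *\<^sub>R T q d)"
  shows "line_spanned T' q = line_spanned T q"
proof (rule set_eqI)
  fix t
  have "(\<exists>s. t = (\<lambda>d. s *\<^sub>R T q d)) \<Longrightarrow> \<exists>s. t = (\<lambda>d. (s * r) *\<^sub>R T q d)"
    using assms(1) by (elim exE) (rule_tac x = "s / r" in exI, simp)
  then show "t \<in> line_spanned T' q \<longleftrightarrow> t \<in> line_spanned T q"
    unfolding line_spanned_iff assms(2) by auto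
qed

text \<open>The comparison of \<open>aligned_unique\<close> takes place at a single point of the
  overlap and is transported from the chart to tangent vectors. This is what makes gluing
  possible.\<close>

lemma aligned_field_unique:
  assumes T: "aligned_field U T" and T': "aligned_field U' T'" and q: "q \<in> U" "q \<in> U'"
  shows "line_spanned T' q = line_spanned T q"
proof -
  have qS: "q \<in> points S" using T q openin_subset unfolding aligned_field_def by blast
  obtain c d where cd: "c \<in> atlas S" "d \<in> atlas M" "q \<in> dom c d" using ex_dom[OF qS] by blast
  interpret E: immersed_model "snd c ` dom c d" "jac c d" "sec c d" by (rule sec_model[OF cd(1,2)])
  let ?U = "U \<inter> U'"
  note a = T[unfolded aligned_field_def] and a' = T'[unfolded aligned_field_def]
  have oU: "openin (mtop S) ?U" using a a' by blast
  have tr: "E.transversal (snd c ` (?U \<inter> dom c d)) (rep c d T)" "E.transversal (snd c ` (?U \<inter> dom c d)) (rep c d T')"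
    using transverse_field_subset[of U T ?U] transverse_field_subset[of U' T' ?U] a a'
    by (auto intro!: transversal_rep[OF cd(1,2) _ oU])
  have x: "snd c q \<in> snd c ` (?U \<inter> dom c d)" using q cd by auto
  have "rep c d T' (snd c q) = E.fac (rep c d T) (rep c d T') (snd c q) *\<^sub>R rep c d T (snd c q)"
    using a a' q cd
    by (intro E.aligned_unique[OF tr(1) dim tr(2) x transversal_rep_inv aligned_imp_defect[of U T "line_spanned T"]
          aligned_imp_defect[of U' T' "line_spanned T'"]]) auto
  then have "T' q d = E.fac (rep c d T) (rep c d T') (snd c q) *\<^sub>R T q d"
    by (simp add: rep_at[OF cd])
  moreover have "T q \<in> tangent_space M (i q)" "T' q \<in> tangent_space M (i q)"
    using a a' q transverse_field_at by (auto simp: transverse_at_def)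
  ultimately have "T' q = (\<lambda>e. E.fac (rep c d T) (rep c d T') (snd c q) *\<^sub>R T q e + 0 *\<^sub>R T q e)"
    by (intro M.tangent_eqI[OF _ M.tangent_lincomb cd(2) dom_D(2)[OF cd]]) auto
  then show ?thesis
    by (intro line_spanned_scale[OF E.fac_nonzero[OF tr x]]) simp
qed

text \<open>Passes alignment from local solutions to an arbitrary section of the same lines. By
  \<open>defect_conformal\<close> the comparison is made point by point, so the reference field may
  vary with the point.\<close>

lemma aligned_section:
  assumes T: "transverse_field S M i U T" "openin (mtop S) U" and W: "\<And>q. q \<in> U \<Longrightarrow> W q = line_spanned T q"
    and loc: "\<And>q. q \<in> U \<Longrightarrow> \<exists>U' T'. aligned_field U' T' \<and> q \<in> U' \<and> line_spanned T q = line_spanned T' q"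
  shows "aligned S U (induced_conn S M N i W) (induced_metric S M N i T)"
proof (rule defect_imp_aligned[OF T W transverse_nondegenerate[OF T]])
  fix q assume q: "q \<in> U"
  then have qS: "q \<in> points S" using T openin_subset by blast
  obtain c d where cd: "c \<in> atlas S" "d \<in> atlas M" "q \<in> dom c d" using ex_dom[OF qS] by blast
  obtain U' T' where T': "aligned_field U' T'" "q \<in> U'" "line_spanned T q = line_spanned T' q" using loc[OF q] by blast
  note a' = T'(1)[unfolded aligned_field_def]
  interpret E: immersed_model "snd c ` dom c d" "jac c d" "sec c d" by (rule sec_model[OF cd(1,2)])
  let ?U = "U \<inter> U'"
  have oU: "openin (mtop S) ?U" using T a' by blast
  have tr: "E.transversal (snd c ` (?U \<inter> dom c d)) (rep c d T)" "E.transversal (snd c ` (?U \<inter> dom c d)) (rep c d T')"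
    using transverse_field_subset[of U T ?U] transverse_field_subset[of U' T' ?U] T a'
    by (auto intro!: transversal_rep[OF cd(1,2) _ oU])
  have x: "snd c q \<in> snd c ` (?U \<inter> dom c d)" using q T' cd by auto
  obtain r where "T q = (\<lambda>d. r *\<^sub>R T' q d)"
    using line_spanned_self[of T q] unfolding T'(3) line_spanned_iff by (elim exE)
  then have r: "rep c d T (snd c q) = r *\<^sub>R rep c d T' (snd c q)" by (simp add: rep_at[OF cd])
  have inv: "invertible (gram std (met c d (rep c d T') (snd c q)))"
    using a' T' cd by (intro transversal_rep_inv[of U']) auto
  have "dft c d (rep c d T) (snd c q) w = 0" for w
    using E.defect_conformal[OF tr(2,1) x inv r, of w]
      aligned_imp_defect[of U' T' "line_spanned T'" c d q w] a' T'(2) cd by simp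
  then show "\<exists>c\<in>atlas S. \<exists>d\<in>atlas M. q \<in> dom c d \<and> (\<forall>w. dft c d (rep c d T) (snd c q) w = 0)"
    using cd by blast
qed auto

lemma aligned_field_exists:
  assumes p: "p \<in> points S"
  shows "\<exists>U T. p \<in> U \<and> aligned_field U T"
proof -
  obtain U0 T0 where T0: "openin (mtop S) U0" "p \<in> U0" "transverse_field S M i U0 T0" using nondegenerate[OF p] by blast
  obtain c d where cd: "c \<in> atlas S" "d \<in> atlas M" "p \<in> dom c d" using ex_dom[OF p] by blast
  interpret E: immersed_model "snd c ` dom c d" "jac c d" "sec c d" by (rule sec_model[OF cd(1,2)])
  define U where "U = U0 \<inter> dom c d"
  have oU: "openin (mtop S) U" unfolding U_def using T0 openin_dom[OF cd(1,2)] by blast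
  have UU: "U \<inter> dom c d = U" by (auto simp: U_def)
  have tr0: "E.transversal (snd c ` U) (rep c d T0)"
    using transversal_rep[OF cd(1,2) T0(3,1)] by (simp add: U_def)
  have inv: "invertible (gram std (met c d (rep c d T0) x))" if "x \<in> snd c ` U" for x
    using that transversal_rep_inv[OF T0(3,1) _ cd(1,2)] by (auto simp: U_def)
  obtain \<theta> where \<theta>: "E.transversal (snd c ` U) \<theta>" "\<And>x w. x \<in> snd c ` U \<Longrightarrow> dft c d \<theta> x w = 0"
    using E.aligned_exists[OF tr0 dim inv] by blast
  \<comment> \<open>Turns the solution in coordinates into a field along \<open>i\<close> with
    components \<theta> in the chart \<open>d\<close>.\<close>
  define T where "T = (\<lambda>q. coord_field M d (\<theta> (snd c q)) (i q))"
  have dU: "q \<in> dom c d" if "q \<in> U" for q using that by (simp add: U_def)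
  note D = dom_D[OF cd(1,2) dU]
  have Tt: "T q \<in> tangent_space M (i q)" if "q \<in> U" for q
    unfolding T_def by (rule M.coord_field_tangent[OF cd(2) D(2)[OF that]])
  have repT: "rep c d T x = \<theta> x" if "x \<in> snd c ` U" for x
    using that D M.coord_field_self[OF cd(2)] by (auto simp: rep_def T_def)
  have op: "open (snd c ` U)" using open_dom[OF cd(1,2) oU] by (simp add: UU)
  have "smooth_on (snd c ` U) (rep c d T)"
    by (rule smooth_on_cong[OF _ op]) (use \<theta>(1) repT in \<open>auto simp: E.transversal_def\<close>)
  then have "T \<in> vfields_along S M i U"
    using oU by (intro alongI[OF Tt] bexI[OF _ cd(1)] bexI[OF _ cd(2)] exI[of _ U])
      (auto simp: rep_def[abs_def] U_def dom_def)
  moreover have "T q \<notin> differential S M i q ` tangent_space S q" if "q \<in> U" for q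
    using \<theta>(1) repT[of "snd c q"] that
    by (auto simp: range_jac[OF cd(1,2) dU[OF that] Tt[OF that]] E.transversal_def rep_at[OF cd(1,2) dU[OF that]])
  ultimately have T: "transverse_field S M i U T" by (simp add: transverse_field_def)
  have tr: "E.transversal (snd c ` U) (rep c d T)"
    using transversal_rep[OF cd(1,2) T oU] by (simp add: UU)
  have "aligned S U (induced_conn S M N i (line_spanned T)) (induced_metric S M N i T)"
  proof (rule defect_imp_aligned[OF T oU refl transverse_nondegenerate[OF T oU]])
    fix q assume q: "q \<in> U"
    then have x: "snd c q \<in> snd c ` U" by simp
    \<comment> \<open>The two functions are known to agree on the chart image of \<open>U\<close>
      only, so their defects are compared through \<open>defect_conformal\<close> with factor
      1.\<close>
    have "\<theta> (snd c q) = 1 *\<^sub>R rep c d T (snd c q)" by (simp add: repT[OF x])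
    from E.defect_conformal[OF tr \<theta>(1) x transversal_rep_inv[OF T oU q cd(1,2) dU[OF q]] this]
    have "dft c d (rep c d T) (snd c q) w = 0" for w by (simp add: \<theta>(2)[OF x])
    then show "\<exists>c\<in>atlas S. \<exists>d\<in>atlas M. q \<in> dom c d \<and> (\<forall>w. dft c d (rep c d T) (snd c q) w = 0)"
      using cd dU[OF q] by blast
  qed auto
  then show ?thesis using T oU T0 cd by (intro exI[of _ U] exI[of _ T]) (auto simp: aligned_field_def U_def)
qed

lemma line_field_section:
  assumes W: "transverse_line_field S M i W" and T: "nonvanishing_section S M i W U T" and U: "openin (mtop S) U"
  shows "transverse_field S M i U T" "\<And>q. q \<in> U \<Longrightarrow> W q = line_spanned T q"
proof -
  have *: "T q \<notin> differential S M i q ` tangent_space S q \<and> W q = line_spanned T q" if q: "q \<in> U" for q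
  proof -
    have qS: "q \<in> points S" using U q openin_subset by blast
    then obtain V T' where V: "openin (mtop S) V" "q \<in> V" "transverse_field S M i V T'" "W q = line_spanned T' q"
      using W by (meson transverse_line_field_def)
    have "T q \<in> W q" "T q \<noteq> (\<lambda>d. 0)" using T q by (auto simp: nonvanishing_section_def)
    then obtain r where r: "T q = (\<lambda>d. r *\<^sub>R T' q d)" unfolding V(4) line_spanned_iff by (elim exE)
    then have r0: "r \<noteq> 0" using \<open>T q \<noteq> (\<lambda>d. 0)\<close> by (intro notI) simp
    have "transverse_at T q"
      by (rule transverse_at_scale[where T = T' and T' = T, OF transverse_field_at[OF V(3,1,2)] r0 r])
    then show ?thesis unfolding transverse_at_def using V(4) line_spanned_scale[where T = T' and T' = T and q = q, OF r0 r] by simp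
  qed
  then show "transverse_field S M i U T" using T by (simp add: transverse_field_def nonvanishing_section_def)
  show "\<And>q. q \<in> U \<Longrightarrow> W q = line_spanned T q" using * by blast
qed

lemma aligned_line_field_local:
  assumes W: "aligned_line_field S M N i W" and p: "p \<in> points S"
  shows "\<exists>U T. p \<in> U \<and> aligned_field U T \<and> (\<forall>q\<in>U. W q = line_spanned T q)"
proof -
  obtain U T where U: "openin (mtop S) U" "p \<in> U" "transverse_field S M i U T" "\<And>q. q \<in> U \<Longrightarrow> W q = line_spanned T q"
    using W p unfolding aligned_line_field_def transverse_line_field_def by metis
  have "nonvanishing_section S M i W U T"
    unfolding nonvanishing_section_def
  proof (intro conjI ballI)
    show "T \<in> vfields_along S M i U" using U(3) by (simp add: transverse_field_def)
    fix q assume q: "q \<in> U"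
    show "T q \<in> W q" unfolding U(4)[OF q] by (rule line_spanned_self)
    show "T q \<noteq> (\<lambda>d. 0)" by (rule transverse_at_nonzero[OF transverse_field_at[OF U(3,1) q]])
  qed
  then have al: "aligned S U (induced_conn S M N i W) (induced_metric S M N i T)"
    using W U(1) by (simp add: aligned_line_field_def)
  \<comment> \<open>\<open>W\<close> and \<open>line_spanned T\<close> agree on \<open>U\<close>
    only, so the induced connections are compared through the vanishing of the defect.\<close>
  have "aligned S U (induced_conn S M N i (line_spanned T)) (induced_metric S M N i T)"
  proof (rule defect_imp_aligned[OF U(3,1) refl transverse_nondegenerate[OF U(3,1)]])
    fix q assume q: "q \<in> U"
    then obtain c d where cd: "c \<in> atlas S" "d \<in> atlas M" "q \<in> dom c d"
      using ex_dom U(1) openin_subset by blast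
    then show "\<exists>c\<in>atlas S. \<exists>d\<in>atlas M. q \<in> dom c d \<and> (\<forall>w. dft c d (rep c d T) (snd c q) w = 0)"
      using aligned_imp_defect[OF U(3,1,4) al cd(1,2) q cd(3)] by blast
  qed auto
  then show ?thesis using U by (intro exI[of _ U] exI[of _ T]) (simp add: aligned_field_def)
qed

theorem aligned_line_field_ex1: "\<exists>!W. aligned_line_field S M N i W"
proof (rule ex_ex1I)
  obtain U T where UT: "\<And>p. p \<in> points S \<Longrightarrow> p \<in> U p \<and> aligned_field (U p) (T p)"
    using aligned_field_exists by metis
  \<comment> \<open>Picks the line of some local solution at each point. By
    \<open>aligned_field_unique\<close> it coincides over \<open>U p\<close> with the line spanned
    by the smooth field \<open>T p\<close>. The restriction to \<open>points S\<close> makes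
    uniqueness an equality of functions.\<close>
  define W where "W = (\<lambda>p\<in>points S. line_spanned (T p) p)"
  have sub: "q \<in> points S" if "q \<in> U p" "p \<in> points S" for p q
    using that UT[of p] openin_subset by (fastforce simp: aligned_field_def)
  have W: "W q = line_spanned (T p) q" if "p \<in> points S" "q \<in> U p" for p q
    using aligned_field_unique[of "U p" "T p" "U q" "T q" q] UT that sub[OF that(2,1)] by (simp add: W_def)
  have tl: "transverse_line_field S M i W"
    unfolding transverse_line_field_def
  proof (intro conjI ballI)
    fix p assume p: "p \<in> points S"
    show "\<exists>U T. openin (mtop S) U \<and> p \<in> U \<and> transverse_field S M i U T \<and> (\<forall>q\<in>U. W q = line_spanned T q)"
      using UT[OF p] W[OF p] by (intro exI[of _ "U p"] exI[of _ "T p"]) (auto simp: aligned_field_def)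
  qed (simp add: W_def)
  have "aligned S V (induced_conn S M N i W) (induced_metric S M N i Z)"
    if V: "openin (mtop S) V" and Z: "nonvanishing_section S M i W V Z" for V Z
  proof (rule aligned_section[OF line_field_section(1)[OF tl Z V] V line_field_section(2)[OF tl Z V]])
    fix q assume q: "q \<in> V"
    then have qS: "q \<in> points S" using V openin_subset by blast
    show "\<exists>U' T'. aligned_field U' T' \<and> q \<in> U' \<and> line_spanned Z q = line_spanned T' q"
      using UT[OF qS] W[OF qS] line_field_section(2)[OF tl Z V q] by (intro exI[of _ "U q"] exI[of _ "T q"]) auto
  qed
  then show "\<exists>W. aligned_line_field S M N i W" using tl by (auto simp: aligned_line_field_def)
  fix W W' assume W: "aligned_line_field S M N i W" "aligned_line_field S M N i W'"
  show "W = W'"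
  proof (rule extensionalityI[of _ "points S"])
    show "W \<in> extensional (points S)" "W' \<in> extensional (points S)"
      using W by (auto simp: aligned_line_field_def transverse_line_field_def)
    fix p assume p: "p \<in> points S"
    obtain U T U' T' where "p \<in> U" "aligned_field U T" "W p = line_spanned T p"
       "p \<in> U'" "aligned_field U' T'" "W' p = line_spanned T' p"
      using aligned_line_field_local[OF W(1) p] aligned_line_field_local[OF W(2) p] by metis
    then show "W p = W' p" using aligned_field_unique by metis
  qed
qed

end

section \<open>Volume forms and unimodular transversals\<close>

definition alternating :: "(('k \<Rightarrow> 'v::real_vector) \<Rightarrow> real) \<Rightarrow> bool" where
  "alternating f \<longleftrightarrow> (\<forall>w j r u v. f (w(j := r *\<^sub>R u + v)) = r * f (w(j := u)) + f (w(j := v))) \<and>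
     (\<forall>w j l. j \<noteq> l \<and> w j = w l \<longrightarrow> f w = 0)"

context
  fixes f :: "('k \<Rightarrow> 'v::real_vector) \<Rightarrow> real"
  assumes f: "alternating f"
begin

lemma alternating_lincomb: "f (w(j := r *\<^sub>R u + v)) = r * f (w(j := u)) + f (w(j := v))"
  using f by (simp add: alternating_def)

lemma alternating_eq: "j \<noteq> l \<Longrightarrow> w j = w l \<Longrightarrow> f w = 0"
  using f unfolding alternating_def by blast

lemma alternating_zero: "f (w(j := 0)) = 0"
  using alternating_lincomb[of w j 1 0 0] by simp

lemma alternating_add: "f (w(j := u + v)) = f (w(j := u)) + f (w(j := v))"
  using alternating_lincomb[of w j 1 u v] by simp

lemma alternating_scale: "f (w(j := r *\<^sub>R u)) = r * f (w(j := u))"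
  using alternating_lincomb[of w j r u 0] by (simp add: alternating_zero)

text \<open>Polarisation: both entries are set to \<open>w m + w n\<close>, and of the four terms of
  the expansion the two with equal entries vanish.\<close>

lemma alternating_swap:
  assumes "m \<noteq> n"
  shows "f (\<lambda>j. w (Transposition.transpose m n j)) = - f w"
proof -
  let ?g = "\<lambda>u v. f (w(m := u, n := v))"
  have "?g (w m + w n) (w m + w n) = 0" by (rule alternating_eq[OF assms]) (use assms in simp)
  moreover have "?g (w m + w n) (w m + w n) = ?g (w m + w n) (w m) + ?g (w m + w n) (w n)"
    by (rule alternating_add)
  moreover have "?g (u + v) x = ?g u x + ?g v x" for u v x
    using alternating_add[of "w(n := x)" m u v] assms by (simp add: fun_upd_twist)
  moreover have "?g u u = 0" for u by (rule alternating_eq[OF assms]) (use assms in simp)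
  moreover have "(\<lambda>j. w (Transposition.transpose m n j)) = w(m := w n, n := w m)"
    by (auto simp: fun_eq_iff Transposition.transpose_def)
  moreover have "w = w(m := w m, n := w n)" by simp
  ultimately show ?thesis by (smt (verit))
qed

lemma alternating_scale_all:
  assumes "finite K"
  shows "f (\<lambda>j. if j \<in> K then r j *\<^sub>R w j else w j) = (\<Prod>j\<in>K. r j) * f w"
  using assms
proof (induction K)
  case (insert k K)
  let ?w = "\<lambda>j. if j \<in> K then r j *\<^sub>R w j else w j"
  have "(\<lambda>j. if j \<in> insert k K then r j *\<^sub>R w j else w j) = ?w(k := r k *\<^sub>R w k)" by auto
  moreover have "?w(k := w k) = ?w" using insert.hyps by auto
  ultimately show ?case using insert alternating_scale[of ?w k "r k" "w k"] by simp
qed simp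

end

text \<open>Induction over elementary matrices: on each kind the effect on \<open>f\<close> matches
  the determinant.\<close>

lemma alternating_det_mult:
  fixes f :: "('k::finite \<Rightarrow> real ^ 'k) \<Rightarrow> real"
  assumes f: "alternating f"
  shows "f (\<lambda>j. (A ** B) $ j) = det A * f (\<lambda>j. B $ j)"
proof -
  have row: "(A ** B) $ i = (\<Sum>k\<in>UNIV. A $ i $ k *\<^sub>R B $ k)" for A B :: "real ^ 'k ^ 'k" and i
    by (simp add: vec_eq_iff matrix_matrix_mult_def)
  \<comment> \<open>The quantifier over \<open>B\<close> lets the factors of a product act one after
    another.\<close>
  have "\<forall>B. f (\<lambda>j. (A ** B) $ j) = det A * f (\<lambda>j. B $ j)"
  proof (rule induct_matrix_elementary[of "\<lambda>A. \<forall>B. f (\<lambda>j. (A ** B) $ j) = det A * f (\<lambda>j. B $ j)"])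
    fix A A' :: "real ^ 'k ^ 'k"
    assume "\<forall>B. f (\<lambda>j. (A ** B) $ j) = det A * f (\<lambda>j. B $ j)" "\<forall>B. f (\<lambda>j. (A' ** B) $ j) = det A' * f (\<lambda>j. B $ j)"
    then show "\<forall>B. f (\<lambda>j. ((A ** A') ** B) $ j) = det (A ** A') * f (\<lambda>j. B $ j)" by (simp add: det_mul matrix_mul_assoc[symmetric])
  next
    fix A :: "real ^ 'k ^ 'k" and i assume zero_row: "row i A = 0"
    have "(A ** B) $ i = 0" for B :: "real ^ 'k ^ 'k"
      unfolding row using zero_row by (simp add: row_def vec_eq_iff)
    then have "f (\<lambda>j. (A ** B) $ j) = 0" for B
      using alternating_zero[OF f, of "\<lambda>j. (A ** B) $ j" i] by (metis fun_upd_triv)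
    then show "\<forall>B. f (\<lambda>j. (A ** B) $ j) = det A * f (\<lambda>j. B $ j)" using zero_row by (simp add: det_zero_row)
  next
    fix A :: "real ^ 'k ^ 'k" assume diagonal: "\<And>i j. i \<noteq> j \<Longrightarrow> A $ i $ j = 0"
    have e: "A $ i $ k *\<^sub>R B $ k = (if i = k then A $ i $ i *\<^sub>R B $ i else 0)" for B :: "real ^ 'k ^ 'k" and i k
      using diagonal by auto
    have "(A ** B) $ i = A $ i $ i *\<^sub>R B $ i" for B :: "real ^ 'k ^ 'k" and i
      unfolding row sum.cong[OF refl e] by simp
    then show "\<forall>B. f (\<lambda>j. (A ** B) $ j) = det A * f (\<lambda>j. B $ j)"
      using alternating_scale_all[OF f finite[of UNIV], of "\<lambda>j. A $ j $ j"] det_diagonal[of A] diagonal by simp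
  next
    fix m n :: 'k assume swap1: "m \<noteq> n"
    let ?A = "(\<chi> i j. mat 1 $ i $ Transposition.transpose m n j) :: real ^ 'k ^ 'k"
    have "mat 1 $ i $ Transposition.transpose m n k *\<^sub>R B $ k =
       (if k = Transposition.transpose m n i then B $ k else 0)" for B :: "real ^ 'k ^ 'k" and i k
      by (auto simp: mat_def)
    then have "(?A ** B) $ i = B $ Transposition.transpose m n i" for B :: "real ^ 'k ^ 'k" and i
      by (simp add: row)
    moreover have "det ?A = - 1"
      using det_permute_columns[of "Transposition.transpose m n" "mat 1 :: real ^ 'k ^ 'k"] swap1
      by (simp add: permutes_swap_id sign_swap_id)
    ultimately show "\<forall>B. f (\<lambda>j. (?A ** B) $ j) = det ?A * f (\<lambda>j. B $ j)" using alternating_swap[OF f swap1, of "\<lambda>j. B $ j" for B] by simp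
  next
    fix m n :: 'k and c :: real assume idplus: "m \<noteq> n"
    let ?A = "(\<chi> i j. if i = m \<and> j = n then c else of_bool (i = j)) :: real ^ 'k ^ 'k"
    have "?A = (\<chi> k. if k = m then row m (mat 1) + c *s row n (mat 1) else row k (mat 1))"
      using idplus by (auto simp: vec_eq_iff row_def mat_def)
    then have "det ?A = 1" using det_row_operation[OF idplus, of "mat 1" c] by simp
    moreover have "f (\<lambda>j. (?A ** B) $ j) = f (\<lambda>j. B $ j)" for B :: "real ^ 'k ^ 'k"
    proof -
      have "(\<Sum>k\<in>UNIV. (if k = n then c else of_bool (m = k)) *\<^sub>R B $ k) = (\<Sum>k\<in>UNIV. (if k = n then c *\<^sub>R B $ n else 0) + (if m = k then B $ m else 0))"
        using idplus by (intro sum.cong) auto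
      then have "(?A ** B) $ m = c *\<^sub>R B $ n + B $ m" by (simp add: row sum.distrib)
      moreover have "(?A ** B) $ j = B $ j" if "j \<noteq> m" for j
      proof -
        have "of_bool (j = k) *\<^sub>R B $ k = (if j = k then B $ j else 0)" for k by simp
        then show ?thesis using that by (simp add: row)
      qed
      ultimately have eq: "(\<lambda>j. (?A ** B) $ j) = (\<lambda>j. B $ j)(m := c *\<^sub>R B $ n + B $ m)" by auto
      have 0: "f ((\<lambda>j. B $ j)(m := B $ n)) = 0"
        by (rule alternating_eq[OF f idplus]) (use idplus in simp)
      show ?thesis unfolding eq alternating_lincomb[OF f] 0 by simp
    qed
    ultimately show "\<forall>B. f (\<lambda>j. (?A ** B) $ j) = det ?A * f (\<lambda>j. B $ j)" by simp
  qed
  then show ?thesis by blast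
qed

text \<open>The case of \<open>alternating_det_mult\<close> with the identity as second factor; the
  vectors are rows there and columns in \<open>frame_matrix\<close>, hence the
  transposition.\<close>

lemma alternating_det:
  fixes f :: "('k::finite \<Rightarrow> real ^ 'k) \<Rightarrow> real"
  assumes f: "alternating f"
  shows "f w = det (frame_matrix w) * f std"
proof -
  have "(\<lambda>j. (mat 1 :: real ^ 'k ^ 'k) $ j) = std" by (auto simp: mat_def axis_def vec_eq_iff)
  moreover have "det (\<chi> j. w j) = det (frame_matrix w)"
    using det_transpose[of "frame_matrix w"] by (simp add: transpose_def frame_matrix_def vec_lambda_eta)
  ultimately show ?thesis
    using alternating_det_mult[OF f, of "\<chi> j. w j" "mat 1"] by simp
qed

locale volume = manifold M for M :: "('m, real ^ 'k) mfd" +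
  fixes \<Psi> :: "'m \<Rightarrow> ('k::finite \<Rightarrow> ('m, real ^ 'k) tvec) \<Rightarrow> real"
  assumes volume_form: "volume_form M \<Psi>"
begin

lemma volume_lincomb:
  assumes "p \<in> points M" "\<And>l. v l \<in> tangent_space M p" "u \<in> tangent_space M p" "w \<in> tangent_space M p"
  shows "\<Psi> p (v(j := (\<lambda>c. r *\<^sub>R u c + w c))) = r * \<Psi> p (v(j := u)) + \<Psi> p (v(j := w))"
  by (rule volume_form[unfolded volume_form_def, THEN conjunct1, THEN bspec, THEN spec, THEN mp, THEN conjunct1,
        THEN spec, THEN bspec, THEN bspec, THEN spec]) (use assms in simp_all)

lemma volume_eq:
  "p \<in> points M \<Longrightarrow> (\<And>l. v l \<in> tangent_space M p) \<Longrightarrow> j \<noteq> l \<Longrightarrow> v j = v l \<Longrightarrow> \<Psi> p v = 0"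
  by (rule volume_form[unfolded volume_form_def, THEN conjunct1, THEN bspec, THEN spec, THEN mp, THEN conjunct2,
        THEN spec[of _ j], THEN spec[of _ l], THEN mp]) simp_all

lemma volume_scale:
  assumes "p \<in> points M" "\<And>l. v l \<in> tangent_space M p" "u \<in> tangent_space M p"
  shows "\<Psi> p (v(j := (\<lambda>c. r *\<^sub>R u c))) = r * \<Psi> p (v(j := u))"
proof -
  have "\<Psi> p (v(j := (\<lambda>c. 0))) = 0"
    using volume_lincomb[where j = j and r = 1, OF assms(1,2) tangent_zero tangent_zero] by simp
  then show ?thesis using volume_lincomb[where j = j and r = r, OF assms tangent_zero] by simp
qed

text \<open>\<open>L\<close> inserts vectors of a model space into the slots \<open>g j\<close> of
  \<Psi>. It is applied with \<open>g = id\<close> to \<Psi> itself, and with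
  \<open>g = Some\<close> to \<Psi> with the transversal kept in the slot
  \<open>None\<close>.\<close>

lemma alternating_volume:
  fixes l :: "'v::real_vector \<Rightarrow> ('m, real ^ 'k) tvec" and L :: "('l \<Rightarrow> 'v) \<Rightarrow> 'k \<Rightarrow> ('m, real ^ 'k) tvec" and g :: "'l \<Rightarrow> 'k"
  assumes p: "p \<in> points M" and L: "\<And>w j. L w j \<in> tangent_space M p" and l: "\<And>x. l x \<in> tangent_space M p"
    and upd: "\<And>w j x. L (w(j := x)) = (L w)(g j := l x)"
    and lin: "\<And>r u v. l (r *\<^sub>R u + v) = (\<lambda>c. r *\<^sub>R l u c + l v c)"
    and g: "inj g"
  shows "alternating (\<lambda>w. \<Psi> p (L w))"
  unfolding alternating_def
proof (intro conjI allI impI)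
  show "\<Psi> p (L (w(j := r *\<^sub>R u + v))) = r * \<Psi> p (L (w(j := u))) + \<Psi> p (L (w(j := v)))" for w j r u v
    unfolding upd lin by (rule volume_lincomb[OF p L l l])
next
  fix w :: "'l \<Rightarrow> 'v" and j k assume *: "j \<noteq> k \<and> w j = w k"
  then have gjk: "g j \<noteq> g k" using g by (meson injD)
  have "L w (g j) = l (w j)" "L w (g k) = l (w k)"
    using upd[of w j "w j"] upd[of w k "w k"] by (metis fun_upd_same fun_upd_triv)+
  then show "\<Psi> p (L w) = 0" using * by (intro volume_eq[OF p L gjk]) simp
qed

text \<open>The coefficient of \<Psi> with respect to the coordinate volume form of the chart
  \<open>d\<close>.\<close>

definition vol_coeff :: "('m, real ^ 'k) chart \<Rightarrow> 'm \<Rightarrow> real" where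
  "vol_coeff d p = \<Psi> p (\<lambda>j. coord_field M d (std j) p)"

context
  fixes d assumes d: "d \<in> atlas M"
begin

lemma coord_field_lin:
  assumes "p \<in> fst d"
  shows "coord_field M d (r *\<^sub>R u + v) p = (\<lambda>c. r *\<^sub>R coord_field M d u p c + coord_field M d v p c)"
  using linear_transition[OF d] assms by (auto simp: coord_field_def fun_eq_iff linear_add linear_scale)

lemma volume_det:
  assumes p: "p \<in> fst d" and v: "\<And>j. v j \<in> tangent_space M p"
  shows "\<Psi> p v = vol_coeff d p * det (frame_matrix (\<lambda>j. v j d))"
proof -
  have "alternating (\<lambda>w. \<Psi> p (\<lambda>j. coord_field M d (w j) p))"
    by (rule alternating_volume[where g = id and l = "\<lambda>u. coord_field M d u p" and L = "\<lambda>w j. coord_field M d (w j) p"])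
      (simp_all add: chart_points[OF d p] coord_field_tangent[OF d p] coord_field_lin[OF p] fun_upd_def if_distrib[of "\<lambda>w. coord_field M d w p"])
  from alternating_det[OF this, of "\<lambda>j. v j d"] show ?thesis
    by (simp add: tangent_coord_field[OF v d p] vol_coeff_def)
qed

lemma vol_coeff_nonzero:
  assumes p: "p \<in> fst d"
  shows "vol_coeff d p \<noteq> 0"
proof -
  have "\<forall>p\<in>points M. \<exists>v. (\<forall>j. v j \<in> tangent_space M p) \<and> \<Psi> p v \<noteq> 0"
    using volume_form unfolding volume_form_def by (elim conjE)
  from bspec[OF this chart_points[OF d p]] obtain v where "\<forall>j. v j \<in> tangent_space M p" "\<Psi> p v \<noteq> 0"
    by (elim exE conjE)
  then show ?thesis using volume_det[OF p, of v] by auto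
qed

lemma smooth_on_vol_coeff: "smooth_on (snd d ` fst d) (\<lambda>x. vol_coeff d (chart_inv d x))"
proof -
  have "coord_field M d u \<in> vfields M (fst d)" for u
    using coord_field_vfields[OF d openin_chart[OF d]] by simp
  moreover have "\<forall>U E. openin (mtop M) U \<and> (\<forall>j. E j \<in> vfields M U) \<longrightarrow> smooth_fun M U (\<lambda>p. \<Psi> p (\<lambda>j. E j p))"
    using volume_form unfolding volume_form_def by (elim conjE)
  ultimately have "smooth_fun M (fst d) (\<lambda>p. \<Psi> p (\<lambda>j. coord_field M d (std j) p))"
    using openin_chart[OF d] by simp
  from smooth_funD[OF this d] show ?thesis by (simp add: vol_coeff_def)
qed

end

end

lemma det_scaleR: "det (r *\<^sub>R A) = r ^ CARD('n) * det (A :: real ^ 'n ^ 'n)"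
  using det_rows_mul[of "\<lambda>_. r" "\<lambda>i. A $ i"]
  by (simp add: scalar_mult_eq_scaleR scaleR_vec_def vec_lambda_eta)

context hypersurface begin

context
  fixes c d
  assumes c: "c \<in> atlas S" and d: "d \<in> atlas M"
begin

text \<open>\<open>normal_part\<close> sees only the value of the transversal at the point, so here,
  unlike in \<open>change_hg\<close>, the two fields are compared at \<open>q\<close> alone.\<close>

lemma hform_scale:
  assumes q: "q \<in> dom c d" and T: "transverse_at T q" and a: "a \<noteq> 0" "T' q = (\<lambda>e. a *\<^sub>R T q e)"
  shows "met c d (rep c d T') (snd c q) = (\<lambda>u v. inverse a * met c d (rep c d T) (snd c q) u v)"
proof (intro ext)
  fix u v
  interpret E: immersed_model "snd c ` dom c d" "jac c d" "sec c d" by (rule sec_model[OF c d])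
  have x: "snd c q \<in> snd c ` dom c d" using q by auto
  note J = E.J(1,2)[OF x]
  let ?w = "sec c d (snd c q) u v"
  have e: "inverse a * r * a = r" for r using a(1) by simp
  have "?w = jac c d (snd c q) (tangent_part (jac c d (snd c q)) (rep c d T (snd c q)) ?w) +
     (inverse a * normal_part (jac c d (snd c q)) (rep c d T (snd c q)) ?w) *\<^sub>R rep c d T' (snd c q)"
    using decompose[OF J transverse_range[OF c d q T], of ?w] a by (simp add: rep_at[OF c d q] e)
  from decompose_unique(2)[OF J transverse_range[OF c d q transverse_at_scale[where T = T and T' = T', OF T a]] this]
  show "met c d (rep c d T') (snd c q) u v = inverse a * met c d (rep c d T) (snd c q) u v"
    by (simp add: hform_def)
qed

lemma scale_transverse_field:
  assumes T: "transverse_field S M i U T" and U: "openin (mtop S) U" "U \<subseteq> dom c d"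
    and f: "smooth_on (snd c ` U) f" "\<And>q. q \<in> U \<Longrightarrow> f (snd c q) \<noteq> 0"
  shows "transverse_field S M i U (\<lambda>q e. f (snd c q) *\<^sub>R T q e)"
proof -
  have tr: "transverse_at (\<lambda>q e. f (snd c q) *\<^sub>R T q e) q" if "q \<in> U" for q
    by (rule transverse_at_scale[where T = T and T' = "\<lambda>q e. f (snd c q) *\<^sub>R T q e", OF transverse_field_at[OF T U(1) that] f(2)[OF that] refl])
  have sub: "U \<subseteq> fst c" "U \<subseteq> U \<inter> fst c \<inter> i -` fst d" using U by (auto simp: dom_def)
  have op: "open (snd c ` U)" by (rule S.open_chart_image[OF c U(1) sub(1)])
  have Tv: "T \<in> vfields_along S M i U" using T by (simp add: transverse_field_def)
  have "smooth_on (snd c ` U) (\<lambda>x. f x *\<^sub>R T (chart_inv c x) d)"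
    by (intro smooth_on_scaleR op f(1) along_smooth[OF Tv c d sub(2)])
  then have "smooth_on (snd c ` U) (\<lambda>x. f (snd c (chart_inv c x)) *\<^sub>R T (chart_inv c x) d)"
    by (rule smooth_on_cong[OF _ op]) (use S.chart_inv_chart[OF c] sub in auto)
  then have "(\<lambda>q e. f (snd c q) *\<^sub>R T q e) \<in> vfields_along S M i U"
    using U sub tr by (intro alongI bexI[OF _ c] bexI[OF _ d] exI[of _ U]) (auto simp: transverse_at_def)
  then show ?thesis using tr by (simp add: transverse_field_def transverse_at_def)
qed

text \<open>By \<open>gram_frame\<close> the Gram matrix is A^T G A, so the square root of the
  modulus of its determinant splits off |det A|.\<close>

lemma metric_density_chart:
  assumes q: "q \<in> dom c d" and T: "transverse_at T q" and v: "\<And>j. v j \<in> tangent_space S q"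
  shows "metric_density (induced_metric S M N i T) q v = \<bar>det (frame_matrix (\<lambda>j. v j c))\<bar> *
    sqrt \<bar>det (gram std (met c d (rep c d T) (snd c q)))\<bar>"
proof -
  interpret E: immersed_model "snd c ` dom c d" "jac c d" "sec c d" by (rule sec_model[OF c d])
  let ?h = "met c d (rep c d T) (snd c q)"
  have x: "snd c q \<in> snd c ` dom c d" using q by auto
  have "(\<chi> a b. induced_metric S M N i T q (v a) (v b)) = gram (\<lambda>j. v j c) ?h"
    by (simp add: gram_def induced_metric_chart[OF c d q T v v])
  then show ?thesis
    unfolding metric_density_def gram_frame[where e = "\<lambda>j. v j c", OF E.bilinear_hform[OF x]]
    by (simp add: det_mul abs_mult real_sqrt_mult ac_simps)
qed

end

lemma co_orientation_local:
  assumes C: "co_orientation S M i C" and p: "p \<in> points S"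
  obtains U TC where "openin (mtop S) U" "p \<in> U" "transverse_field S M i U TC"
    "\<forall>q\<in>U. C q = {(\<lambda>d. differential S M i q u d + t *\<^sub>R TC q d) | u t. u \<in> tangent_space S q \<and> t > 0}"
proof -
  from bspec[OF C[unfolded co_orientation_def] p] obtain U TC where
    *: "openin (mtop S) U" "p \<in> U" "transverse_field S M i U TC"
      "\<forall>q\<in>U. C q = {(\<lambda>d. differential S M i q u d + t *\<^sub>R TC q d) | u t. u \<in> tangent_space S q \<and> t > 0}"
    by (elim exE conjE)
  show thesis by (rule that[OF *])
qed

text \<open>Comparing the coefficients along the reference field \<open>TC\<close> gives t' = a t
  with t and t' positive.\<close>

lemma co_orientation_pos:
  assumes C: "co_orientation S M i C" and q: "q \<in> points S" and T: "T q \<in> C q" "T' q \<in> C q"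
    and a: "T' q = (\<lambda>e. a *\<^sub>R T q e)"
  shows "a > 0"
proof -
  obtain U TC where U: "openin (mtop S) U" "q \<in> U" "transverse_field S M i U TC"
    and Cq0: "\<forall>q\<in>U. C q = {(\<lambda>d. differential S M i q u d + t *\<^sub>R TC q d) | u t. u \<in> tangent_space S q \<and> t > 0}"
    using co_orientation_local[OF C q] .
  note Cq = bspec[OF Cq0]
  have TC: "transverse_at TC q" by (rule transverse_field_at[OF U(3,1,2)])
  from T[unfolded Cq[OF U(2)]] obtain u t u' t' where
    u: "u \<in> tangent_space S q" "t > 0" "T q = (\<lambda>d. differential S M i q u d + t *\<^sub>R TC q d)" and
    u': "u' \<in> tangent_space S q" "t' > 0" "T' q = (\<lambda>d. differential S M i q u' d + t' *\<^sub>R TC q d)"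
    by (elim CollectE exE conjE)
  obtain c d where cd: "c \<in> atlas S" "d \<in> atlas M" "q \<in> dom c d" using ex_dom[OF q] by blast
  interpret E: immersed_model "snd c ` dom c d" "jac c d" "sec c d" by (rule sec_model[OF cd(1,2)])
  have x: "snd c q \<in> snd c ` dom c d" using cd by auto
  note J = E.J(1,2)[OF x] and tr = transverse_range[OF cd TC]
  note du = differential_jac[OF cd]
  have "T' q d = jac c d (snd c q) (u' c) + t' *\<^sub>R rep c d TC (snd c q)"
    by (simp add: u'(3) du[OF u'(1)] rep_at[OF cd])
  moreover have "T' q d = jac c d (snd c q) (a *\<^sub>R u c) + (a * t) *\<^sub>R rep c d TC (snd c q)"
    by (simp add: a u(3) du[OF u(1)] rep_at[OF cd] linear_scale[OF J(1)] scaleR_add_right)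
  ultimately have "t' = a * t"
    using decompose_unique(2)[OF J tr] by metis
  then show ?thesis using u(2) u'(2) by (simp add: zero_less_mult_iff)
qed

end

section \<open>Densities in charts and unimodular sections\<close>

locale volume_hypersurface = nondegenerate S M i N + V: volume M \<Psi>
  for S :: "('s, real ^ 'n::finite) mfd" and M :: "('m, real ^ 'n option) mfd" and i N \<Psi>
begin

text \<open>The signed value of \<Psi> on \<open>T\<close> followed by the images of the coordinate
  frame of \<open>c\<close>, as \<open>volume_chart\<close> confirms; the sign keeps it
  smooth.\<close>

definition dens :: "('s, real ^ 'n) chart \<Rightarrow> ('m, real ^ 'n option) chart \<Rightarrow> ('s \<Rightarrow> ('m, real ^ 'n option) tvec) \<Rightarrow> real ^ 'n \<Rightarrow> real" where
  "dens c d T x = V.vol_coeff d (i (chart_inv c x)) * det (transversal_matrix (jac c d x) (rep c d T x))"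

definition mdet :: "('s, real ^ 'n) chart \<Rightarrow> ('m, real ^ 'n option) chart \<Rightarrow> ('s \<Rightarrow> ('m, real ^ 'n option) tvec) \<Rightarrow> real ^ 'n \<Rightarrow> real" where
  "mdet c d T x = det (gram std (met c d (rep c d T) x))"

definition unimod :: "('s \<Rightarrow> ('m, real ^ 'n option) tvec) \<Rightarrow> 's \<Rightarrow> bool" where
  "unimod T q \<longleftrightarrow> (\<forall>v. (\<forall>j. v j \<in> tangent_space S q) \<longrightarrow>
     induced_density S M i \<Psi> T q v = metric_density (induced_metric S M N i T) q v)"

lemma unimod_cong: "T q = T' q \<Longrightarrow> unimod T q \<longleftrightarrow> unimod T' q"
  unfolding unimod_def induced_density_def metric_density_def induced_metric_def by simp

context
  fixes c d
  assumes c: "c \<in> atlas S" and d: "d \<in> atlas M"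
begin

lemma volume_chart:
  assumes q: "q \<in> dom c d" and T: "T q \<in> tangent_space M (i q)" and v: "\<And>j. v j \<in> tangent_space S q"
  shows "\<Psi> (i q) (case_option (T q) (\<lambda>j. differential S M i q (v j))) = det (frame_matrix (\<lambda>j. v j c)) * dens c d T (snd c q)"
proof -
  note D = dom_D[OF c d q]
  note tf = S.coord_field_tangent[OF c D(1)] S.coord_field_self[OF c D(1)]
  let ?l = "\<lambda>u. differential S M i q (coord_field S c u q)"
  let ?L = "\<lambda>w. case_option (T q) (\<lambda>j. ?l (w j))"
  have lt: "?l u \<in> tangent_space M (i q)" for u by (rule differential_tangent[OF tf(1) D(3)])
  have Lt: "?L w j \<in> tangent_space M (i q)" for w j using T lt by (cases j) auto
  have "coord_field S c (r *\<^sub>R u + v) q = (\<lambda>e. r *\<^sub>R coord_field S c u q e + 1 *\<^sub>R coord_field S c v q e)" for r u v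
    by (rule S.tangent_eqI[OF tf(1) S.tangent_lincomb[OF tf(1) tf(1)] c D(1)]) (simp add: tf(2))
  then have lin: "?l (r *\<^sub>R u + v) = (\<lambda>e. r *\<^sub>R ?l u e + ?l v e)" for r u v
    using differential_lincomb[OF tf(1) tf(1) D(3), of r _ 1] by simp
  have "alternating (\<lambda>w. \<Psi> (i q) (?L w))"
    by (rule V.alternating_volume[where g = Some and l = ?l and L = ?L, OF M.chart_points[OF d D(2)] Lt lt _ lin])
      (auto simp: fun_eq_iff split: option.split)
  from alternating_det[OF this, of "\<lambda>j. v j c"]
  have "\<Psi> (i q) (case_option (T q) (\<lambda>j. differential S M i q (v j))) = det (frame_matrix (\<lambda>j. v j c)) * \<Psi> (i q) (?L std)"
    by (simp add: S.tangent_coord_field[OF v c D(1)])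
  also have "\<Psi> (i q) (?L std) = V.vol_coeff d (i q) * det (frame_matrix (\<lambda>j. ?L std j d))"
    by (rule V.volume_det[OF d D(2) Lt])
  also have "frame_matrix (\<lambda>j. ?L std j d) = transversal_matrix (jac c d (snd c q)) (rep c d T (snd c q))"
    by (auto simp: frame_matrix_def transversal_matrix_def vec_eq_iff rep_at[OF c d q]
        differential_jac[OF c d q tf(1)] tf(2) split: option.split)
  finally show ?thesis by (simp add: dens_def D(4))
qed

lemma induced_density_chart:
  assumes q: "q \<in> dom c d" and T: "T q \<in> tangent_space M (i q)" and v: "\<And>j. v j \<in> tangent_space S q"
  shows "induced_density S M i \<Psi> T q v = \<bar>det (frame_matrix (\<lambda>j. v j c))\<bar> * \<bar>dens c d T (snd c q)\<bar>"
  unfolding induced_density_def by (simp add: volume_chart[where T = T, OF assms] abs_mult)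

text \<open>On an arbitrary family both densities carry the same factor, the modulus of the
  determinant of the family, so equality need only be tested on the coordinate frame.\<close>

lemma unimod_iff:
  assumes q: "q \<in> dom c d" and T: "transverse_at T q"
  shows "unimod T q \<longleftrightarrow> \<bar>dens c d T (snd c q)\<bar> = sqrt \<bar>mdet c d T (snd c q)\<bar>"
proof -
  have T': "T q \<in> tangent_space M (i q)" using T by (simp add: transverse_at_def)
  note id = induced_density_chart[where T = T, OF q T'] and md = metric_density_chart[OF c d q T, folded mdet_def]
  show ?thesis
  proof
    assume u: "unimod T q"
    let ?v = "\<lambda>j. coord_field S c (std j) q"
    note tf = S.coord_field_tangent[OF c dom_D(1)[OF c d q]] S.coord_field_self[OF c dom_D(1)[OF c d q]]
    have "induced_density S M i \<Psi> T q ?v = metric_density (induced_metric S M N i T) q ?v"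
      using u tf(1) by (simp add: unimod_def)
    then show "\<bar>dens c d T (snd c q)\<bar> = sqrt \<bar>mdet c d T (snd c q)\<bar>"
      by (simp add: id[OF tf(1)] md[OF tf(1)] tf(2) frame_matrix_std)
  next
    assume "\<bar>dens c d T (snd c q)\<bar> = sqrt \<bar>mdet c d T (snd c q)\<bar>"
    then show "unimod T q" by (simp add: unimod_def id md)
  qed
qed

lemma dens_nonzero:
  assumes q: "q \<in> dom c d" and T: "transverse_at T q"
  shows "dens c d T (snd c q) \<noteq> 0"
proof -
  interpret E: immersed_model "snd c ` dom c d" "jac c d" "sec c d" by (rule sec_model[OF c d])
  have x: "snd c q \<in> snd c ` dom c d" using q by auto
  have "det (transversal_matrix (jac c d (snd c q)) (rep c d T (snd c q))) \<noteq> 0"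
    using invertible_transversal_matrix[OF E.J(1,2)[OF x] transverse_range[OF c d q T]] by (simp add: invertible_det_nz)
  then show ?thesis
    using V.vol_coeff_nonzero[OF d dom_D(2)[OF c d q]] by (simp add: dens_def dom_D(4)[OF c d q])
qed

lemma dens_scale:
  assumes q: "q \<in> dom c d" and T: "transverse_at T q" and a: "a \<noteq> 0" "T' q = (\<lambda>e. a *\<^sub>R T q e)"
  shows "dens c d T' (snd c q) = a * dens c d T (snd c q)"
proof -
  note D = dom_D[OF c d q]
  note tf = S.coord_field_tangent[OF c D(1)] S.coord_field_self[OF c D(1)]
  let ?F = "\<lambda>j::'n. differential S M i q (coord_field S c (std j) q)"
  have Tt: "T q \<in> tangent_space M (i q)" "T' q \<in> tangent_space M (i q)"
    using T transverse_at_scale[where T = T and T' = T', OF T a] by (auto simp: transverse_at_def)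
  have Lt: "case_option (T q) ?F j \<in> tangent_space M (i q)" for j
    using Tt differential_tangent[OF tf(1) D(3)] by (cases j) auto
  have v: "\<Psi> (i q) (case_option (X q) ?F) = dens c d X (snd c q)" if "X q \<in> tangent_space M (i q)" for X
    using volume_chart[where T = X, OF q that tf(1)] by (simp add: tf(2) frame_matrix_std)
  have "\<Psi> (i q) ((case_option (T q) ?F)(None := (\<lambda>e. a *\<^sub>R T q e))) = a * \<Psi> (i q) ((case_option (T q) ?F)(None := T q))"
    by (rule V.volume_scale[OF M.chart_points[OF d D(2)] Lt Tt(1)])
  moreover have "(case_option (T q) ?F)(None := X) = case_option X ?F" for X
    by (auto simp: fun_eq_iff split: option.split)
  ultimately show ?thesis using v[where X = T, OF Tt(1)] v[where X = T', OF Tt(2)] by (simp add: a(2))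
qed

text \<open>Scaling by a multiplies \<open>dens\<close> by a and divides \<open>mdet\<close> by a^n.
  The squared equality of densities thus reads a^2 D^2 = |g| / a^n, which is the origin of the
  exponent n + 2.\<close>

lemma unimod_scale:
  assumes q: "q \<in> dom c d" and T: "transverse_at T q" and a: "a > 0" "T' q = (\<lambda>e. a *\<^sub>R T q e)"
  shows "unimod T' q \<longleftrightarrow> a ^ (CARD('n) + 2) = \<bar>mdet c d T (snd c q)\<bar> / (dens c d T (snd c q))\<^sup>2"
proof -
  let ?D = "dens c d T (snd c q)" and ?g = "mdet c d T (snd c q)"
  have a0: "a \<noteq> 0" using a by simp
  note T' = transverse_at_scale[where T = T and T' = T', OF T a0 a(2)]
  have m: "mdet c d T' (snd c q) = inverse a ^ CARD('n) * ?g"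
    unfolding mdet_def hform_scale[where T = T and T' = T', OF c d q T a0 a(2)] gram_scale det_scaleR ..
  have D: "?D \<noteq> 0" by (rule dens_nonzero[OF q T])
  have "unimod T' q \<longleftrightarrow> \<bar>a * ?D\<bar> = sqrt \<bar>inverse a ^ CARD('n) * ?g\<bar>"
    unfolding unimod_iff[OF q T'] dens_scale[where T = T and T' = T', OF q T a0 a(2)] m ..
  also have "\<dots> \<longleftrightarrow> (a * ?D)\<^sup>2 = \<bar>inverse a ^ CARD('n) * ?g\<bar>"
    by (metis abs_ge_zero power2_abs real_sqrt_abs real_sqrt_pow2)
  also have "\<dots> \<longleftrightarrow> (a * ?D)\<^sup>2 = inverse a ^ CARD('n) * \<bar>?g\<bar>"
    using a by (simp add: abs_mult)
  also have "\<dots> \<longleftrightarrow> a ^ (CARD('n) + 2) = \<bar>?g\<bar> / ?D\<^sup>2"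
    using a D by (simp add: power_add power_mult_distrib field_simps power2_eq_square)
  finally show ?thesis .
qed

end

lemma unimod_unique:
  assumes T: "transverse_at T q" "unimod T q" "unimod T' q" and a: "a > 0" "T' q = (\<lambda>e. a *\<^sub>R T q e)"
  shows "a = 1"
proof -
  obtain c d where cd: "c \<in> atlas S" "d \<in> atlas M" "q \<in> dom c d"
    using ex_dom T(1) unfolding transverse_at_def by blast
  have "1 ^ (CARD('n) + 2) = \<bar>mdet c d T (snd c q)\<bar> / (dens c d T (snd c q))\<^sup>2"
    by (rule iffD1[OF unimod_scale[where T = T and T' = T and a = 1, OF cd T(1)] T(2)]) simp_all
  moreover have "a ^ (CARD('n) + 2) = \<bar>mdet c d T (snd c q)\<bar> / (dens c d T (snd c q))\<^sup>2"
    by (rule iffD1[OF unimod_scale[where T = T and T' = T', OF cd T(1) a] T(3)])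
  ultimately have "a ^ (CARD('n) + 2) = 1" by (simp only: power_one)
  then show ?thesis using a(1) power_eq_imp_eq_base[of a "CARD('n) + 2" 1] by simp
qed

lemma smooth_on_dens:
  assumes cd: "c \<in> atlas S" "d \<in> atlas M" and T: "transverse_field S M i U T" and U: "openin (mtop S) U" "U \<subseteq> dom c d"
  shows "smooth_on (snd c ` U) (dens c d T)" "smooth_on (snd c ` U) (mdet c d T)"
proof -
  interpret E: immersed_model "snd c ` dom c d" "jac c d" "sec c d" by (rule sec_model[OF cd])
  have UU: "U \<inter> dom c d = U" using U by blast
  have tr: "E.transversal (snd c ` U) (rep c d T)" using transversal_rep[OF cd T U(1)] by (simp add: UU)
  note op = E.open_B[OF tr]
  have sub: "snd c ` U \<subseteq> snd c ` dom c d" using U by auto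
  note D = dom_D[OF cd]
  have "smooth_on (snd c ` dom c d) (\<lambda>x. V.vol_coeff d (chart_inv d (snd d (i (chart_inv c x)))))"
    by (rule smooth_on_compose[OF V.smooth_on_vol_coeff[OF cd(2)] _ smooth_on_chart_map[OF cd]])
      (use E.A D in auto)
  then have "smooth_on (snd c ` dom c d) (\<lambda>x. V.vol_coeff d (i (chart_inv c x)))"
    by (rule smooth_on_cong[OF _ E.A]) (use D M.chart_inv_chart[OF cd(2)] in auto)
  then have v: "smooth_on (snd c ` U) (\<lambda>x. V.vol_coeff d (i (chart_inv c x)))"
    by (rule smooth_on_subset[OF _ sub])
  have "smooth_on (snd c ` U) (\<lambda>x. (case b of None \<Rightarrow> rep c d T x | Some k \<Rightarrow> jac c d x (std k)) $ a)" for a b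
    using E.smooth_\<theta>[OF tr] smooth_on_subset[OF E.J(3) sub] by (cases b) (auto intro!: smooth_on_vec_nth op)
  then show "smooth_on (snd c ` U) (dens c d T)"
    unfolding dens_def transversal_matrix_def by (intro smooth_on_mult v smooth_on_det op)
  show "smooth_on (snd c ` U) (mdet c d T)"
    unfolding mdet_def gram_def by (intro smooth_on_det op E.smooth_on_hform[OF tr])
qed

context
  fixes W C
  assumes W: "transverse_line_field S M i W" and C: "co_orientation S M i C"
begin

lemma co_oriented_section:
  assumes p: "p \<in> points S"
  shows "\<exists>U T c d. c \<in> atlas S \<and> d \<in> atlas M \<and> openin (mtop S) U \<and> p \<in> U \<and> U \<subseteq> dom c d \<and>
    transverse_field S M i U T \<and> (\<forall>q\<in>U. T q \<in> W q \<and> T q \<in> C q)"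
proof -
  obtain U0 T where U0: "openin (mtop S) U0" "p \<in> U0" "transverse_field S M i U0 T" "\<And>q. q \<in> U0 \<Longrightarrow> W q = line_spanned T q"
    using W p unfolding transverse_line_field_def by metis
  obtain U1 TC where U1: "openin (mtop S) U1" "p \<in> U1" "transverse_field S M i U1 TC"
    "\<forall>q\<in>U1. C q = {(\<lambda>d. differential S M i q u d + t *\<^sub>R TC q d) | u t. u \<in> tangent_space S q \<and> t > 0}"
    using co_orientation_local[OF C p] .
  obtain c d where cd: "c \<in> atlas S" "d \<in> atlas M" "p \<in> dom c d" using ex_dom[OF p] by blast
  interpret E: immersed_model "snd c ` dom c d" "jac c d" "sec c d" by (rule sec_model[OF cd(1,2)])
  define U where "U = U0 \<inter> U1 \<inter> dom c d"
  have U: "openin (mtop S) U" "p \<in> U" "U \<subseteq> dom c d" "U \<subseteq> U0" "U \<subseteq> U1" "U \<inter> dom c d = U"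
    using U0 U1 cd openin_dom[OF cd(1,2)] by (auto simp: U_def)
  have T: "transverse_field S M i U T" "transverse_field S M i U TC"
    using transverse_field_subset U0(3) U1(3) U(4,5) by blast+
  have tr: "E.transversal (snd c ` U) (rep c d T)" "E.transversal (snd c ` U) (rep c d TC)"
    using T[THEN transversal_rep[OF cd(1,2) _ U(1)]] by (simp_all add: U(6))
  \<comment> \<open>Dividing \<open>T\<close> by its coefficient along \<open>TC\<close> leaves
    \<open>TC\<close> plus a tangential vector, which lies in \<open>C\<close>; no argument about
    the sign of that coefficient being locally constant is required.\<close>
  let ?f = "\<lambda>x. 1 / E.fac (rep c d TC) (rep c d T) x"
  have x: "snd c q \<in> snd c ` U" if "q \<in> U" for q using that by auto
  note f0 = E.fac_nonzero[OF tr(2,1)]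
  have f: "smooth_on (snd c ` U) ?f"
    by (intro smooth_on_divide E.open_B[OF tr(1)] smooth_on_const E.smooth_fac[OF tr(2,1)] f0)
  define T1 where "T1 = (\<lambda>q e. ?f (snd c q) *\<^sub>R T q e)"
  have T1: "transverse_field S M i U T1"
    unfolding T1_def by (rule scale_transverse_field[OF cd(1,2) T(1) U(1,3) f]) (use f0 x in auto)
  moreover have "T1 q \<in> W q" if q: "q \<in> U" for q
    using U0(4)[of q] q U(4) by (auto simp: line_spanned_def T1_def)
  moreover have "T1 q \<in> C q" if q: "q \<in> U" for q
  proof -
    have qd: "q \<in> dom c d" using q U by auto
    note D = dom_D[OF cd(1,2) qd]
    note tf = S.coord_field_tangent[OF cd(1) D(1)] S.coord_field_self[OF cd(1) D(1)]
    let ?u = "E.shift (rep c d TC) (rep c d T) (snd c q)"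
    note t1 = transverse_field_at[OF T1 U(1) q, unfolded transverse_at_def]
      and tC = transverse_field_at[OF T(2) U(1) q, unfolded transverse_at_def]
    have "T1 q = (\<lambda>e. 1 *\<^sub>R differential S M i q (coord_field S c ?u q) e + 1 *\<^sub>R TC q e)"
    proof (rule M.tangent_eqI[OF _ M.tangent_lincomb cd(2) D(2)])
      show "T1 q d = 1 *\<^sub>R differential S M i q (coord_field S c ?u q) d + 1 *\<^sub>R TC q d"
        using E.change[OF tr(2,1) x[OF q]] f0[OF x[OF q]]
        by (simp add: T1_def differential_jac[OF cd(1,2) qd tf(1)] tf(2) rep_at[OF cd(1,2) qd] add.commute)
    qed (use t1 tC differential_tangent[OF tf(1) D(3)] in auto)
    moreover have "q \<in> U1" using q U by auto
    ultimately show ?thesis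
      unfolding bspec[OF U1(4) \<open>q \<in> U1\<close>] using tf(1)
      by (intro CollectI exI[of _ "coord_field S c ?u q"] exI[of _ 1]) simp
  qed
  ultimately show ?thesis using U cd by blast
qed

lemma unimod_section_local:
  assumes p: "p \<in> points S"
  shows "\<exists>U T. openin (mtop S) U \<and> p \<in> U \<and> transverse_field S M i U T \<and> (\<forall>q\<in>U. T q \<in> W q \<and> T q \<in> C q \<and> unimod T q)"
proof -
  obtain U T c d where cd: "c \<in> atlas S" "d \<in> atlas M" and U: "openin (mtop S) U" "p \<in> U" "U \<subseteq> dom c d"
    and T: "transverse_field S M i U T" and TW: "\<And>q. q \<in> U \<Longrightarrow> T q \<in> W q" and TC: "\<And>q. q \<in> U \<Longrightarrow> T q \<in> C q"
    using co_oriented_section[OF p] by (elim exE conjE) blast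
  have sub: "U \<subseteq> fst c" using U(3) by (auto simp: dom_def)
  have op: "open (snd c ` U)" by (rule S.open_chart_image[OF cd(1) U(1) sub])
  let ?n = "real (CARD('n) + 2)"
  let ?D = "dens c d T" and ?g = "mdet c d T"
  \<comment> \<open>The (n + 2)-nd root of |g| / D^2. With r = g / D^2 it is written as a power of r
    r, a smooth positive function, to keep the modulus out of the smoothness argument.\<close>
  define a where "a x = ((?g x / (?D x)\<^sup>2) * (?g x / (?D x)\<^sup>2)) powr (1 / (2 * ?n))" for x
  note Tq = transverse_field_at[OF T U(1)]
  have D0: "?D (snd c q) \<noteq> 0" if "q \<in> U" for q
    using dens_nonzero[OF cd _ Tq[OF that]] that U(3) by auto
  have g0: "?g (snd c q) \<noteq> 0" if "q \<in> U" for q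
    using transversal_rep_inv[OF T U(1) that cd] that U(3) by (auto simp: mdet_def invertible_det_nz)
  have apos: "a (snd c q) > 0" if "q \<in> U" for q
    using D0[OF that] g0[OF that] by (simp add: a_def)
  have "smooth_on (snd c ` U) (\<lambda>x. ?g x / (?D x)\<^sup>2)"
    unfolding power2_eq_square using D0
    by (intro smooth_on_divide op smooth_on_mult smooth_on_dens[OF cd T U(1,3)]) auto
  then have "smooth_on (snd c ` U) a"
    unfolding a_def
  proof (intro smooth_on_powr op smooth_on_mult)
    fix x assume "x \<in> snd c ` U"
    then have "?g x / (?D x)\<^sup>2 \<noteq> 0" using D0 g0 by auto
    then show "0 < ?g x / (?D x)\<^sup>2 * (?g x / (?D x)\<^sup>2)" using not_real_square_gt_zero by blast
  qed
  then have T1: "transverse_field S M i U (\<lambda>q e. a (snd c q) *\<^sub>R T q e)"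
    by (rule scale_transverse_field[OF cd T U(1,3)]) (use apos in force)
  have um: "unimod (\<lambda>q e. a (snd c q) *\<^sub>R T q e) q" if q: "q \<in> U" for q
  proof -
    have qd: "q \<in> dom c d" using q U by auto
    let ?r = "?g (snd c q) / (?D (snd c q))\<^sup>2"
    have "?r \<noteq> 0" using D0 g0 q by auto
    then have r: "?r * ?r > 0" using not_real_square_gt_zero by blast
    have e: "1 / (2 * ?n) * ?n = 1 / 2" by (simp add: field_simps)
    have "a (snd c q) ^ (CARD('n) + 2) = ((?r * ?r) powr (1 / (2 * ?n))) powr ?n"
      unfolding a_def using r by (intro powr_realpow[symmetric]) (simp only: powr_gt_zero)
    also have "\<dots> = sqrt (?r * ?r)"
      unfolding powr_powr e using r by (intro powr_half_sqrt) (rule less_imp_le)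
    also have "\<dots> = \<bar>?g (snd c q)\<bar> / (?D (snd c q))\<^sup>2"
      by (simp add: real_sqrt_mult_self abs_divide del: times_divide_times_eq times_divide_eq_left times_divide_eq_right)
    finally show ?thesis using unimod_scale[where T = T and T' = "\<lambda>q e. a (snd c q) *\<^sub>R T q e", OF cd qd Tq[OF q] apos[OF q] refl] by simp
  qed
  have W1: "(\<lambda>e. a (snd c q) *\<^sub>R T q e) \<in> W q" if q: "q \<in> U" for q
  proof -
    have qS: "q \<in> points S" using U(1) q openin_subset by blast
    then obtain T0 where "W q = line_spanned T0 q"
      using W unfolding transverse_line_field_def by metis
    then show ?thesis using TW[OF q] by (auto simp: line_spanned_def)
  qed
  have C1: "(\<lambda>e. a (snd c q) *\<^sub>R T q e) \<in> C q" if q: "q \<in> U" for q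
  proof -
    have qS: "q \<in> points S" using U(1) q openin_subset by blast
    obtain V TC where "q \<in> V"
      and Cq0: "\<forall>q\<in>V. C q = {(\<lambda>d. differential S M i q u d + t *\<^sub>R TC q d) | u t. u \<in> tangent_space S q \<and> t > 0}"
      using co_orientation_local[OF C qS] .
    note Cq = bspec[OF Cq0 \<open>q \<in> V\<close>]
    from TC[OF q] obtain u t where u: "u \<in> tangent_space S q" "t > 0" "T q = (\<lambda>d. differential S M i q u d + t *\<^sub>R TC q d)"
      unfolding Cq by (elim CollectE exE conjE)
    let ?a = "a (snd c q)"
    have "(\<lambda>e. ?a *\<^sub>R T q e) = (\<lambda>e. differential S M i q (\<lambda>c. ?a *\<^sub>R u c + 0 *\<^sub>R u c) e + (?a * t) *\<^sub>R TC q e)"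
      unfolding differential_lincomb[OF u(1) u(1) qS] u(3) by (simp add: scaleR_add_right)
    then show ?thesis
      unfolding Cq using S.tangent_lincomb[OF u(1) u(1), of ?a 0] u(2) apos[OF q]
      by (intro CollectI exI[of _ "\<lambda>c. ?a *\<^sub>R u c + 0 *\<^sub>R u c"] exI[of _ "?a * t"] conjI) auto
  qed
  show ?thesis using U T1 um W1 C1 by (intro exI[of _ U] exI[of _ "\<lambda>q e. a (snd c q) *\<^sub>R T q e"]) auto
qed

text \<open>Two vectors of one transverse line in the same half-space have a positive ratio, and
  \<open>unimod_unique\<close> forces it to be 1.\<close>

lemma unimod_section_unique:
  assumes T: "transverse_at T q" "T q \<in> W q" "T q \<in> C q" "unimod T q"
    and T': "transverse_at T' q" "T' q \<in> W q" "T' q \<in> C q" "unimod T' q"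
  shows "T' q = T q"
proof -
  have qS: "q \<in> points S" using T by (simp add: transverse_at_def)
  obtain T0 where W0: "W q = line_spanned T0 q" using W qS unfolding transverse_line_field_def by metis
  obtain r r' where r: "T q = (\<lambda>e. r *\<^sub>R T0 q e)" and r': "T' q = (\<lambda>e. r' *\<^sub>R T0 q e)"
    using T(2) T'(2) unfolding W0 line_spanned_iff by (elim exE)
  have "r \<noteq> 0" using transverse_at_nonzero[OF T(1)] r by (intro notI) simp
  then have a: "T' q = (\<lambda>e. (r' / r) *\<^sub>R T q e)" by (simp add: r r')
  have "r' / r = 1"
    by (rule unimod_unique[where T = T and T' = T', OF T(1,4) T'(4) co_orientation_pos[where T = T and T' = T', OF C qS T(3) T'(3) a] a])
  then show ?thesis using a by simp
qed

lemma unimodular_section_iff: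
  "unimodular_section S M N i \<Psi> C W T \<longleftrightarrow> T \<in> extensional (points S) \<and> transverse_field S M i (points S) T \<and>
    (\<forall>q\<in>points S. T q \<in> W q \<and> T q \<in> C q \<and> unimod T q)"
proof -
  have "T q \<noteq> (\<lambda>d. 0)" if "transverse_field S M i (points S) T" "q \<in> points S" for q
    by (rule transverse_at_nonzero[OF transverse_field_at[OF that(1) openin_topspace that(2)]])
  then show ?thesis
    by (auto simp: unimodular_section_def nonvanishing_section_def unimodular_transversal_def
        co_oriented_transversal_def density_eq_def unimod_def transverse_field_def)
qed

theorem unimodular_section_ex1: "\<exists>!T. unimodular_section S M N i \<Psi> C W T"
proof (rule ex_ex1I)
  obtain U T where UT: "\<And>p. p \<in> points S \<Longrightarrow> openin (mtop S) (U p) \<and> p \<in> U p \<and> transverse_field S M i (U p) (T p) \<and>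
      (\<forall>q\<in>U p. T p q \<in> W q \<and> T p q \<in> C q \<and> unimod (T p) q)"
    using unimod_section_local by metis
  \<comment> \<open>Glued from local sections: by \<open>unimod_section_unique\<close> they agree on
    overlaps, so on \<open>U p\<close> the result is the smooth field \<open>T p\<close>.\<close>
  define Z where "Z = (\<lambda>p\<in>points S. T p p)"
  have sub: "q \<in> points S" if "q \<in> U p" "p \<in> points S" for p q
    using that UT[OF that(2)] openin_subset by blast
  have Z: "Z q = T p q" if p: "p \<in> points S" "q \<in> U p" for p q
  proof -
    have q: "q \<in> points S" using sub p by blast
    have a: "transverse_at (T p) q" "T p q \<in> W q" "T p q \<in> C q" "unimod (T p) q"
      using UT[OF p(1)] p(2) transverse_field_at[of "U p" "T p" q] by auto
    have b: "transverse_at (T q) q" "T q q \<in> W q" "T q q \<in> C q" "unimod (T q) q"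
      using UT[OF q] transverse_field_at[of "U q" "T q" q] by auto
    have "T q q = T p q" by (rule unimod_section_unique[where T = "T p" and T' = "T q", OF a b])
    then show ?thesis using q by (simp add: Z_def)
  qed
  have tr: "transverse_at Z q \<and> Z q \<in> W q \<and> Z q \<in> C q \<and> unimod Z q" if q: "q \<in> points S" for q
  proof -
    have e: "Z q = T q q" using q by (simp add: Z_def)
    have "transverse_at (T q) q" using UT[OF q] transverse_field_at by blast
    then have "transverse_at Z q" using e by (simp add: transverse_at_def)
    then show ?thesis using UT[OF q] unimod_cong[where T = Z and T' = "T q", OF e] e by simp
  qed
  have "Z \<in> vfields_along S M i (points S)"
  proof (rule alongI)
    show "Z p \<in> tangent_space M (i p)" if "p \<in> points S" for p using tr[OF that] by (simp add: transverse_at_def)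
    fix p assume p: "p \<in> points S"
    obtain c d where cd: "c \<in> atlas S" "d \<in> atlas M" "p \<in> dom c d" using ex_dom[OF p] by blast
    let ?V = "U p \<inter> dom c d"
    have V: "openin (mtop S) ?V" using UT[OF p] openin_dom[OF cd(1,2)] by blast
    have "T p \<in> vfields_along S M i (U p)" using UT[OF p] by (simp add: transverse_field_def)
    from along_smooth[OF this cd(1,2), of ?V]
    have "smooth_on (snd c ` ?V) (\<lambda>x. T p (chart_inv c x) d)" by (auto simp: dom_def)
    then have "smooth_on (snd c ` ?V) (\<lambda>x. Z (chart_inv c x) d)"
    proof (rule smooth_on_cong[OF _ open_dom[OF cd(1,2)]])
      show "openin (mtop S) (U p)" using UT[OF p] by blast
      show "T p (chart_inv c x) d = Z (chart_inv c x) d" if "x \<in> snd c ` ?V" for x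
        using that Z[OF p] dom_D(4)[OF cd(1,2)] by auto
    qed
    then show "\<exists>c\<in>atlas S. \<exists>d\<in>atlas M. \<exists>U. openin (mtop S) U \<and> p \<in> U \<and> U \<subseteq> points S \<inter> fst c \<inter> i -` fst d \<and>
        smooth_on (snd c ` U) (\<lambda>x. Z (chart_inv c x) d)"
      using V UT[OF p] cd sub p by (intro bexI[OF _ cd(1)] bexI[OF _ cd(2)] exI[of _ ?V]) (auto simp: dom_def)
  qed
  then have "transverse_field S M i (points S) Z" using tr by (simp add: transverse_field_def transverse_at_def)
  then show "\<exists>T. unimodular_section S M N i \<Psi> C W T"
    unfolding unimodular_section_iff using tr by (intro exI[of _ Z]) (simp add: Z_def)
  fix T T' assume T: "unimodular_section S M N i \<Psi> C W T" "unimodular_section S M N i \<Psi> C W T'"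
  note T' = T[unfolded unimodular_section_iff]
  show "T = T'"
  proof (rule extensionalityI[of _ "points S"])
    fix q assume q: "q \<in> points S"
    have "transverse_at T q" "transverse_at T' q" using T' transverse_field_at[OF _ openin_topspace q] by auto
    then show "T q = T' q" using T' q by (intro unimod_section_unique[where T = T' and T' = T]) auto
  qed (use T' in auto)
qed

end

end

section \<open>Projective flatness and the Codazzi equation\<close>

lemma has_derivative_det_rows:
  fixes f :: "'k::finite \<Rightarrow> 'k \<Rightarrow> 'a::real_normed_vector \<Rightarrow> real"
  assumes f: "\<And>i j. (f i j has_derivative f' i j) (at x)"
  shows "((\<lambda>y. det (\<chi> i j. f i j y)) has_derivative
    (\<lambda>u. \<Sum>k\<in>UNIV. det (\<chi> i j. if i = k then f' i j u else f i j x))) (at x)"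
proof -
  let ?P = "{p. p permutes (UNIV :: 'k set)}"
  have "((\<lambda>y. \<Sum>p\<in>?P. of_int (sign p) * (\<Prod>i\<in>UNIV. f i (p i) y)) has_derivative
     (\<lambda>u. \<Sum>p\<in>?P. of_int (sign p) * (\<Sum>k\<in>UNIV. f' k (p k) u * (\<Prod>j\<in>UNIV - {k}. f j (p j) x)))) (at x)"
    by (intro has_derivative_sum has_derivative_mult_right has_derivative_prod f)
  moreover have "(\<Prod>i\<in>UNIV. if i = k then f' i (p i) u else f i (p i) x) = f' k (p k) u * (\<Prod>j\<in>UNIV - {k}. f j (p j) x)" for p k u
    by (simp add: prod.remove[of UNIV k])
  ultimately show ?thesis
    unfolding det_def by (simp add: sum_distrib_left) (subst sum.swap, simp)
qed

text \<open>The coordinate derivative of a frame V is its covariant derivative P minus the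
  connection matrix G applied to V; conjugation by V does not change the trace of G.\<close>

lemma trace_matrix_inv_diff:
  fixes V :: "real ^ 'k ^ 'k"
  assumes "invertible V"
  shows "trace (matrix_inv V ** (P - G ** V)) = trace (matrix_inv V ** P) - trace G"
proof -
  have "matrix_inv V ** (P - G ** V) = matrix_inv V ** P - matrix_inv V ** (G ** V)"
    by (simp add: matrix_matrix_mult_def[of "matrix_inv V"] vec_eq_iff algebra_simps sum_subtractf)
  moreover have "trace (matrix_inv V ** (G ** V)) = trace (G ** (V ** matrix_inv V))"
    by (subst trace_mul_sym) (simp only: matrix_mul_assoc)
  ultimately show ?thesis by (simp add: trace_sub matrix_inv_invertible[OF assms])
qed

lemma det_replace_column:
  "det (frame_matrix ((std :: 'k::finite \<Rightarrow> real ^ 'k)(j := w))) = w $ j"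
proof -
  have "frame_matrix (std(j := w)) = (\<chi> i k. if k = j then w $ i else (mat 1 :: real ^ 'k ^ 'k) $ i $ k)"
    by (auto simp: frame_matrix_def vec_eq_iff mat_def axis_def)
  then show ?thesis using cramer_lemma[of j "mat 1 :: real ^ 'k ^ 'k" w, unfolded matrix_vector_mul_lid] by simp
qed

text \<open>Replacing row k of the identity gives a matrix whose determinant is the k-th entry of
  the new row, so at the identity the determinant has the trace as derivative.\<close>

lemma has_derivative_det_mat_1:
  fixes f :: "'k::finite \<Rightarrow> 'k \<Rightarrow> 'a::real_normed_vector \<Rightarrow> real"
  assumes f: "\<And>i j. (f i j has_derivative f' i j) (at x)" and 1: "(\<chi> i j. f i j x) = mat 1"
  shows "((\<lambda>y. det (\<chi> i j. f i j y)) has_derivative (\<lambda>u. \<Sum>i\<in>UNIV. f' i i u)) (at x)"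
proof -
  have fx: "f i j x = (if i = j then 1 else 0)" for i j
    using arg_cong[OF 1, of "\<lambda>A. A $ i $ j"] by (simp add: mat_def)
  have d: "det (\<chi> i j. if i = k then f' i j u else f i j x) = f' k k u" for k u
  proof -
    have t: "transpose (\<chi> i j. if i = k then f' i j u else f i j x) = frame_matrix (std(k := (\<chi> j. f' k j u)))"
      by (auto simp: transpose_def frame_matrix_def vec_eq_iff fx axis_def)
    show ?thesis
      unfolding det_transpose[of "\<chi> i j. if i = k then f' i j u else f i j x", symmetric] t det_replace_column by simp
  qed
  show ?thesis using has_derivative_det_rows[of f f' x, OF f] unfolding d .
qed

text \<open>Jacobi's formula, reduced to the identity by multiplying the moving matrix with the
  fixed inverse of its value at \<open>x\<close>.\<close>

lemma has_derivative_det: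
  fixes f :: "'k::finite \<Rightarrow> 'k \<Rightarrow> 'a::real_normed_vector \<Rightarrow> real"
  assumes f: "\<And>i j. (f i j has_derivative f' i j) (at x)" and inv: "invertible (\<chi> i j. f i j x)"
  shows "((\<lambda>y. det (\<chi> i j. f i j y)) has_derivative
    (\<lambda>u. det (\<chi> i j. f i j x) * trace (matrix_inv (\<chi> i j. f i j x) ** (\<chi> i j. f' i j u)))) (at x)"
proof -
  let ?F = "\<lambda>y. \<chi> i j. f i j y" and ?I = "matrix_inv (\<chi> i j. f i j x)"
  have IF: "?I ** ?F y = (\<chi> i j. \<Sum>k\<in>UNIV. ?I $ i $ k * f k j y)" for y
    by (simp add: matrix_matrix_mult_def)
  have "((\<lambda>y. det (\<chi> i j. \<Sum>k\<in>UNIV. ?I $ i $ k * f k j y)) has_derivative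
    (\<lambda>u. \<Sum>i\<in>UNIV. \<Sum>k\<in>UNIV. ?I $ i $ k * f' k i u)) (at x)"
    by (rule has_derivative_det_mat_1)
      (auto simp: IF[symmetric] matrix_inv_invertible[OF inv] intro!: has_derivative_sum has_derivative_mult_right f)
  then have "((\<lambda>y. det (?F x) * det (?I ** ?F y)) has_derivative
    (\<lambda>u. det (?F x) * trace (?I ** (\<chi> i j. f' i j u)))) (at x)"
    unfolding IF trace_def by (intro has_derivative_mult_right) (simp add: matrix_matrix_mult_def)
  moreover have "det (?F x) * det (?I ** ?F y) = det (?F y)" for y
  proof -
    have "det (?F x) * det (?I ** ?F y) = det (?F x ** ?I ** ?F y)"
      by (simp only: det_mul mult.assoc)
    then show ?thesis by (simp only: matrix_inv_invertible[OF inv] matrix_mul_lid)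
  qed
  ultimately show ?thesis by simp
qed

section \<open>Curvature under projective flatness\<close>

context torsion_free_connection begin

text \<open>The curvature R(u, v) w on coordinate fields of the chart \<open>d\<close>; these
  commute, so no bracket term occurs.\<close>

definition riem :: "('m, 'e) chart \<Rightarrow> 'm \<Rightarrow> 'e \<Rightarrow> 'e \<Rightarrow> 'e \<Rightarrow> 'e" where
  "riem d q u v w =
     der (\<lambda>y. christ d (chart_inv d y) v w) (snd d q) u - der (\<lambda>y. christ d (chart_inv d y) u w) (snd d q) v
     + christ d q u (christ d q v w) - christ d q v (christ d q u w)"

text \<open>Flatness of the modified connection is evaluated on coordinate fields. The terms of the
  curvature of \<open>N\<close> separate, and what the one-form adds consists, after
  antisymmetrisation, of multiples of u, v and w. Only this shape is used later.\<close>

lemma riem_projectively_flat: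
  assumes pf: "projectively_flat M N" and d: "d \<in> atlas M" and q: "q \<in> fst d"
  shows "\<exists>\<alpha> \<beta> \<delta>. riem d q u v w = \<alpha> *\<^sub>R u + \<beta> *\<^sub>R v + \<delta> *\<^sub>R w"
proof -
  obtain U \<gamma> where U: "openin (mtop M) U" "q \<in> U" and \<gamma>: "one_form_on M U \<gamma>" and
    flat: "flat_on M U (\<lambda>X Y q c. N X Y q c + \<gamma> q (X q) *\<^sub>R Y q c + \<gamma> q (Y q) *\<^sub>R X q c)"
    using bspec[OF pf[unfolded projectively_flat_def] chart_points[OF d q]] by (elim exE conjE)
  let ?N = "\<lambda>X Y q c. N X Y q c + \<gamma> q (X q) *\<^sub>R Y q c + \<gamma> q (Y q) *\<^sub>R X q c"
  define V where "V = U \<inter> fst d"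
  have V: "openin (mtop M) V" "V \<subseteq> fst d" "q \<in> V" "V \<subseteq> U"
    using U q openin_chart[OF d] by (auto simp: V_def)
  note dV = d V(1,2)
  let ?B = "snd d ` V" and ?y = "snd d q"
  have oB: "open ?B" by (rule open_chart_image[OF dV])
  have yB: "?y \<in> ?B" using V by auto
  let ?c = "coord_field M d"
  have cf: "?c u \<in> vfields M V" for u by (rule coord_field_vfields[OF dV])
  have cs: "?c u p d = u" if "p \<in> V" for u p using coord_field_self[OF d] that V by auto
  define g where "g u y = \<gamma> (chart_inv d y) (?c u (chart_inv d y))" for u y
  have "smooth_fun M V (\<lambda>p. \<gamma> p (?c u p))" for u
    using \<gamma>[unfolded one_form_on_def, THEN conjunct2, rule_format, of V "?c u"] V cf by blast
  from smooth_funD[OF this d] have gs: "smooth_on ?B (g u)" for u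
    using V by (simp add: g_def[abs_def] Int_absorb2)
  have \<Gamma>s: "smooth_on ?B (\<lambda>y. christ d (chart_inv d y) u v)" for u v
    by (rule smooth_on_subset[OF smooth_on_christ[OF d]]) (use V in auto)
  have gq: "g u ?y = \<gamma> q (?c u q)" for u using chart_inv_chart[OF d q] by (simp add: g_def)
  have ci: "chart_inv d ?y = q" by (rule chart_inv_chart[OF d q])
  have NY_d: "?N (?c v) (?c w) p d = christ d p v w + g v (snd d p) *\<^sub>R w + g w (snd d p) *\<^sub>R v" if "p \<in> V" for v w p
    using that V chart_inv_chart[OF d] by (auto simp: cs christ_def g_def)
  have NY: "?N (?c v) (?c w) \<in> vfields M V" for v w
  proof (rule vfieldsI[OF dV])
    fix p assume p: "p \<in> V"
    have "(\<lambda>b. 1 *\<^sub>R N (?c v) (?c w) p b + \<gamma> p (?c v p) *\<^sub>R ?c w p b) \<in> tangent_space M p"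
      by (intro tangent_lincomb vfields_tangent[OF _ p] conn_vfields[OF V(1)] cf)
    from tangent_lincomb[OF this vfields_tangent[OF cf p], of 1 "\<gamma> p (?c w p)" v]
    show "?N (?c v) (?c w) p \<in> tangent_space M p" by simp
  next
    show "smooth_on ?B (\<lambda>x. ?N (?c v) (?c w) (chart_inv d x) d)"
    proof (rule smooth_on_cong[OF _ oB])
      show "smooth_on ?B (\<lambda>y. christ d (chart_inv d y) v w + g v y *\<^sub>R w + g w y *\<^sub>R v)"
        by (intro smooth_on_add oB \<Gamma>s smooth_on_scaleR gs smooth_on_const)
      show "christ d (chart_inv d y) v w + g v y *\<^sub>R w + g w y *\<^sub>R v = ?N (?c v) (?c w) (chart_inv d y) d"
        if "y \<in> ?B" for y
        using that V chart_inv_chart[OF d] NY_d[of "chart_inv d y"] by auto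
    qed
  qed
  \<comment> \<open>The last correction term is a multiple of \<open>u\<close>; its coefficient, the
    one-form on an iterated derivative, is hidden in r because it only changes \<alpha> or
    \<beta>.\<close>
  have NN: "\<exists>r. ?N (?c u) (?N (?c v) (?c w)) q d = der (\<lambda>y. christ d (chart_inv d y) v w) ?y u
      + der (g v) ?y u *\<^sub>R w + der (g w) ?y u *\<^sub>R v
      + (christ d q u (christ d q v w) + g v ?y *\<^sub>R christ d q u w + g w ?y *\<^sub>R christ d q u v)
      + g u ?y *\<^sub>R (christ d q v w + g v ?y *\<^sub>R w + g w ?y *\<^sub>R v) + r *\<^sub>R u" for u v w
  proof (rule exI[of _ "\<gamma> q (?N (?c v) (?c w) q)"])
    have "((\<lambda>y. christ d (chart_inv d y) v w + g v y *\<^sub>R w + g w y *\<^sub>R v) has_derivative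
       (\<lambda>u. der (\<lambda>y. christ d (chart_inv d y) v w) ?y u + der (g v) ?y u *\<^sub>R w + der (g w) ?y u *\<^sub>R v)) (at ?y)"
      by (intro has_derivative_add has_derivative_scaleR_left smooth_on_has_derivative[OF _ yB] \<Gamma>s gs)
    then have "((\<lambda>x. ?N (?c v) (?c w) (chart_inv d x) d) has_derivative
       (\<lambda>u. der (\<lambda>y. christ d (chart_inv d y) v w) ?y u + der (g v) ?y u *\<^sub>R w + der (g w) ?y u *\<^sub>R v)) (at ?y)"
      by (rule has_derivative_transform_within_open[OF _ oB yB])
        (use V chart_inv_chart[OF d] NY_d in auto)
    note D = der_eqI[OF this]
    have lin: "linear (christ d q u)" using bilinear_christ[OF d q] by (simp add: bilinear_def)
    have "N (?c u) (?N (?c v) (?c w)) q d = der (\<lambda>x. ?N (?c v) (?c w) (chart_inv d x) d) ?y u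
        + christ d q u (?N (?c v) (?c w) q d)"
      using conn_chart[OF V(1) cf NY V(3) d q, of u v w] by (simp only: cs[OF V(3)])
    then show "?N (?c u) (?N (?c v) (?c w)) q d = der (\<lambda>y. christ d (chart_inv d y) v w) ?y u
      + der (g v) ?y u *\<^sub>R w + der (g w) ?y u *\<^sub>R v
      + (christ d q u (christ d q v w) + g v ?y *\<^sub>R christ d q u w + g w ?y *\<^sub>R christ d q u v)
      + g u ?y *\<^sub>R (christ d q v w + g v ?y *\<^sub>R w + g w ?y *\<^sub>R v) + \<gamma> q (?N (?c v) (?c w) q) *\<^sub>R u"
      unfolding D by (simp only: christ_def[symmetric] cs[OF V(3)] gq linear_add[OF lin] linear_scale[OF lin])
  qed
  \<comment> \<open>The bracket is known to vanish on \<open>V\<close> only, so it is first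
    recognised as a vector field on \<open>V\<close> and the connection is then evaluated through
    its components.\<close>
  have lie: "?N (lie_bracket M (?c u) (?c v)) (?c w) q d = 0"
  proof -
    have z: "lie_bracket M (?c u) (?c v) p = (\<lambda>b. 0)" if p: "p \<in> V" for p
    proof (rule tangent_eqI[OF _ tangent_zero d])
      show "lie_bracket M (?c u) (?c v) p \<in> tangent_space M p"
        using tangent_lincomb[OF vfields_tangent[OF conn_vfields[OF V(1) cf cf] p] vfields_tangent[OF conn_vfields[OF V(1) cf cf] p], of 1 u v "- 1" v u]
        by (simp add: lie_bracket_conn[OF V(1) cf cf p])
    qed (use p V lie_bracket_coord_field[OF d] in auto)
    have "smooth_on ?B (\<lambda>x. lie_bracket M (?c u) (?c v) (chart_inv d x) d)"
      by (rule smooth_on_cong[OF smooth_on_const[of _ 0] oB]) (use z V chart_inv_chart[OF d] in auto)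
    then have L: "lie_bracket M (?c u) (?c v) \<in> vfields M V"
      by (intro vfieldsI[OF dV]) (simp_all add: z tangent_zero)
    have lin: "linear (der (\<lambda>x. ?c w (chart_inv d x) d) ?y)"
      by (rule smooth_on_linear_der[OF vfields_smooth[OF cf d order.refl V(2)] yB])
    have "N (lie_bracket M (?c u) (?c v)) (?c w) q d = 0"
      using conn_chart[OF V(1) L cf V(3) d q, of w]
      by (simp add: z[OF V(3)] linear_0[OF lin] bilinear_lzero[OF bilinear_christ[OF d q]])
    moreover have "\<gamma> q (\<lambda>b. 0) = 0"
      using \<gamma>[unfolded one_form_on_def, THEN conjunct1, THEN bspec, OF U(2), THEN bspec, OF tangent_zero, THEN bspec, OF tangent_zero, THEN spec[of _ 1]]
      by simp
    ultimately show ?thesis by (simp add: z[OF V(3)])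
  qed
  have "?N (?c u) (?N (?c v) (?c w)) q d - ?N (?c v) (?N (?c u) (?c w)) q d - ?N (lie_bracket M (?c u) (?c v)) (?c w) q d = 0"
    by (rule flat[unfolded flat_on_def, rule_format, of V "?c u" "?c v" "?c w" q d, OF conjI[OF V(1,4)] cf cf cf V(3)])
  then have eq: "?N (?c u) (?N (?c v) (?c w)) q d = ?N (?c v) (?N (?c u) (?c w)) q d" using lie by simp
  obtain r where r: "?N (?c u) (?N (?c v) (?c w)) q d = der (\<lambda>y. christ d (chart_inv d y) v w) ?y u
      + der (g v) ?y u *\<^sub>R w + der (g w) ?y u *\<^sub>R v
      + (christ d q u (christ d q v w) + g v ?y *\<^sub>R christ d q u w + g w ?y *\<^sub>R christ d q u v)
      + g u ?y *\<^sub>R (christ d q v w + g v ?y *\<^sub>R w + g w ?y *\<^sub>R v) + r *\<^sub>R u" using NN by blast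
  obtain s where s: "?N (?c v) (?N (?c u) (?c w)) q d = der (\<lambda>y. christ d (chart_inv d y) u w) ?y v
      + der (g u) ?y v *\<^sub>R w + der (g w) ?y v *\<^sub>R u
      + (christ d q v (christ d q u w) + g u ?y *\<^sub>R christ d q v w + g w ?y *\<^sub>R christ d q v u)
      + g v ?y *\<^sub>R (christ d q u w + g u ?y *\<^sub>R w + g w ?y *\<^sub>R u) + s *\<^sub>R v" using NN by blast
  have "riem d q u v w = (der (g w) ?y v + g v ?y * g w ?y - r) *\<^sub>R u
     + (s - der (g w) ?y u - g u ?y * g w ?y) *\<^sub>R v + (der (g u) ?y v - der (g v) ?y u) *\<^sub>R w"
    using eq unfolding r s riem_def christ_commute[OF d q, of v u]
    by (simp add: algebra_simps)
  then show ?thesis by blast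
qed

end

locale parallel_volume = volume M \<Psi> + torsion_free_connection M N
  for M :: "('m, real ^ 'k) mfd" and \<Psi> :: "'m \<Rightarrow> ('k::finite \<Rightarrow> ('m, real ^ 'k) tvec) \<Rightarrow> real" and N +
  assumes preserves: "preserves_form M N \<Psi>"
begin

text \<open>In \<nabla>\<Psi> = 0 each summand replaces one coordinate field by its covariant
  derivative, and the determinant then picks out one diagonal entry of the Christoffel matrix; the
  sum is its trace.\<close>

lemma has_derivative_vol_coeff:
  assumes d: "d \<in> atlas M" and q: "q \<in> fst d"
  shows "((\<lambda>y. vol_coeff d (chart_inv d y)) has_derivative
    (\<lambda>u. vol_coeff d q * (\<Sum>b\<in>UNIV. christ d q u (std b) $ b))) (at (snd d q))"
proof -
  have f: "coord_field M d u \<in> vfields M (fst d)" for u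
    using coord_field_vfields[OF d openin_chart[OF d]] by simp
  have D: "((\<lambda>y. vol_coeff d (chart_inv d y)) has_derivative der (\<lambda>y. vol_coeff d (chart_inv d y)) (snd d q)) (at (snd d q))"
    using q by (intro smooth_on_has_derivative[OF smooth_on_vol_coeff[OF d]]) auto
  have "der (\<lambda>y. vol_coeff d (chart_inv d y)) (snd d q) u = vol_coeff d q * (\<Sum>b\<in>UNIV. christ d q u (std b) $ b)" for u
  proof -
    note t = coord_field_tangent[OF d q] and s = coord_field_self[OF d q]
    have "dirderiv M q (coord_field M d u q) (\<lambda>q. \<Psi> q (\<lambda>j. coord_field M d (std j) q)) =
      (\<Sum>j\<in>UNIV. \<Psi> q ((\<lambda>l. coord_field M d (std l) q)(j := N (coord_field M d u) (coord_field M d (std j)) q)))"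
      using preserves[unfolded preserves_form_def, rule_format, of "fst d" "coord_field M d u" "\<lambda>j. coord_field M d (std j)" q]
        f q openin_chart[OF d] by simp
    moreover have "\<Psi> q ((\<lambda>l. coord_field M d (std l) q)(j := N (coord_field M d u) (coord_field M d (std j)) q)) =
       vol_coeff d q * christ d q u (std j) $ j" for j
    proof -
      let ?v = "(\<lambda>l. coord_field M d (std l) q)(j := N (coord_field M d u) (coord_field M d (std j)) q)"
      have "?v l \<in> tangent_space M q" for l
        using t vfields_tangent[OF conn_vfields[OF openin_chart[OF d] f f] q] by simp
      then have "\<Psi> q ?v = vol_coeff d q * det (frame_matrix (\<lambda>l. ?v l d))" by (rule volume_det[OF d q])
      also have "(\<lambda>l. ?v l d) = std(j := christ d q u (std j))" by (auto simp: s christ_def)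
      finally show ?thesis by (simp only: det_replace_column)
    qed
    ultimately show ?thesis
      using dirderiv_chart[OF t d q, of "vol_coeff d", OF D] by (simp add: s sum_distrib_left vol_coeff_def[abs_def])
  qed
  then show ?thesis using D by presburger
qed

end

lemma frame_trace_sum: "finite K \<Longrightarrow> frame_trace e h (\<lambda>u v. \<Sum>k\<in>K. \<beta> k u v) = (\<Sum>k\<in>K. frame_trace e h (\<beta> k))"
proof (induction K rule: finite_induct)
  case empty
  show ?case by (simp add: frame_trace_def)
next
  case (insert k K)
  then show ?case by (simp add: frame_trace_add)
qed

text \<open>Expanding \<open>L u\<close> in the standard basis turns each summand into the
  contraction of a linear form with \<open>h\<close>, which gives a diagonal entry of
  \<open>L\<close>.\<close>

lemma frame_trace_endomorphism:
  fixes h :: "real ^ 'n \<Rightarrow> real ^ 'n \<Rightarrow> real"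
  assumes h: "bilinear h" "\<And>u v. h u v = h v u" "invertible (gram std h)" and L: "linear L"
  shows "frame_trace std h (\<lambda>u v. h (L u) v) = (\<Sum>k\<in>UNIV. L (std k) $ k)"
    "frame_trace std h (\<lambda>u v. h u (L v)) = (\<Sum>k\<in>UNIV. L (std k) $ k)"
proof -
  have l: "linear (\<lambda>u. L u $ k)" for k
    using L by (intro linearI) (simp_all add: linear_add linear_scale)
  have e1: "h (L u) v = (\<Sum>k\<in>UNIV. L u $ k * h v (std k))" for u v
    unfolding h(2)[of v "std k" for k]
    using linear_vec_expand[of "\<lambda>u. h u v" "L u"] h(1) by (simp add: bilinear_def)
  have e2: "h u (L v) = (\<Sum>k\<in>UNIV. h u (std k) * L v $ k)" for u v
    using linear_vec_expand[of "\<lambda>v. h u v" "L v"] h(1) by (simp add: bilinear_def mult.commute)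
  show "frame_trace std h (\<lambda>u v. h (L u) v) = (\<Sum>k\<in>UNIV. L (std k) $ k)"
    unfolding e1 by (subst frame_trace_sum) (simp_all add: frame_trace_contract(1)[OF h l])
  show "frame_trace std h (\<lambda>u v. h u (L v)) = (\<Sum>k\<in>UNIV. L (std k) $ k)"
    unfolding e2 by (subst frame_trace_sum) (simp_all add: frame_trace_contract(2)[OF h l])
qed

section \<open>The Codazzi equation and logarithmic derivatives of densities\<close>

context hypersurface begin

text \<open>\<open>cov\<close> is the ambient covariant derivative of the transversal, \<open>tau\<close> the one-form \<open>\<tau>\<close>, and \<open>trG\<close> the
  trace of the endomorphism \<open>v \<mapsto> G(u, v)\<close>.\<close>

definition cov :: "('s, real ^ 'n) chart \<Rightarrow> ('m, real ^ 'n option) chart \<Rightarrow> ('s \<Rightarrow> ('m, real ^ 'n option) tvec) \<Rightarrow> real ^ 'n \<Rightarrow> real ^ 'n \<Rightarrow> real ^ 'n option" where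
  "cov c d T x u = der (rep c d T) x u + N.christ d (i (chart_inv c x)) (jac c d x u) (rep c d T x)"

definition tau :: "('s, real ^ 'n) chart \<Rightarrow> ('m, real ^ 'n option) chart \<Rightarrow> ('s \<Rightarrow> ('m, real ^ 'n option) tvec) \<Rightarrow> real ^ 'n \<Rightarrow> real ^ 'n \<Rightarrow> real" where
  "tau c d T x u = normal_part (jac c d x) (rep c d T x) (cov c d T x u)"

definition trG :: "('s, real ^ 'n) chart \<Rightarrow> ('m, real ^ 'n option) chart \<Rightarrow> ('s \<Rightarrow> ('m, real ^ 'n option) tvec) \<Rightarrow> real ^ 'n \<Rightarrow> real ^ 'n \<Rightarrow> real" where
  "trG c d T x u = (\<Sum>k\<in>UNIV. chr c d (rep c d T) x u (std k) $ k)"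

context
  fixes c d U T q
  assumes c: "c \<in> atlas S" and d: "d \<in> atlas M"
    and T: "transverse_field S M i U T" and U: "openin (mtop S) U" and q: "q \<in> U" "q \<in> dom c d"
begin

interpretation E: immersed_model "snd c ` dom c d" "jac c d" "sec c d"
  by (rule sec_model[OF c d])

lemma rep_transversal: "E.transversal (snd c ` (U \<inter> dom c d)) (rep c d T)"
  by (rule transversal_rep[OF c d T U])

lemma chart_image: "snd c q \<in> snd c ` (U \<inter> dom c d)" "snd c q \<in> snd c ` dom c d"
  using q by auto

lemma map_chart_inv: "i (chart_inv c (snd c q)) = i q"
  by (simp add: dom_D(4)[OF c d q(2)])

lemma map_in_chart: "i q \<in> fst d"
  by (rule dom_D(2)[OF c d q(2)])

lemma rep_has_derivative: "(rep c d T has_derivative der (rep c d T) (snd c q)) (at (snd c q))"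
  by (rule smooth_on_has_derivative[OF E.smooth_\<theta>[OF rep_transversal] chart_image(1)])

lemma jac_has_derivative: "((\<lambda>y. jac c d y v) has_derivative der (\<lambda>y. jac c d y v) (snd c q)) (at (snd c q))"
  by (rule smooth_on_has_derivative[OF E.J(3) chart_image(2)])

lemma coeff_along_has_derivative:
  assumes "smooth_on (snd d ` fst d) (\<lambda>y. f (chart_inv d y))"
  shows "((\<lambda>y. f (i (chart_inv c y))) has_derivative
     (\<lambda>u. der (\<lambda>y. f (chart_inv d y)) (snd d (i q)) (jac c d (snd c q) u))) (at (snd c q))"
proof -
  have F: "((\<lambda>x. snd d (i (chart_inv c x))) has_derivative jac c d (snd c q)) (at (snd c q))"
    unfolding jac_def by (rule smooth_on_has_derivative[OF smooth_on_chart_map[OF c d] chart_image(2)])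
  have "snd d (i q) \<in> snd d ` fst d" using map_in_chart by simp
  then have "((\<lambda>y. f (chart_inv d y)) has_derivative der (\<lambda>y. f (chart_inv d y)) (snd d (i q))) (at (snd d (i (chart_inv c (snd c q)))))"
    unfolding map_chart_inv by (rule smooth_on_has_derivative[OF assms])
  from has_derivative_compose[OF F this]
  show ?thesis
    by (rule has_derivative_transform_within_open[OF _ E.A chart_image(2)])
      (use M.chart_inv_chart[OF d] dom_D[OF c d] in auto)
qed

text \<open>In the antisymmetrised ambient derivative of \<open>sec\<close> the third derivatives of
  the immersion cancel by symmetry, and so do the mixed products of second derivatives with
  Christoffel symbols. What remains is the ambient curvature on tangential vectors.\<close>

lemma sec_curvature:
  "der (\<lambda>y. sec c d y v w) (snd c q) u + N.christ d (i q) (jac c d (snd c q) u) (sec c d (snd c q) v w)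
   - (der (\<lambda>y. sec c d y u w) (snd c q) v + N.christ d (i q) (jac c d (snd c q) v) (sec c d (snd c q) u w)) =
   N.riem d (i q) (jac c d (snd c q) u) (jac c d (snd c q) v) (jac c d (snd c q) w)"
proof -
  let ?x = "snd c q" and ?J = "jac c d (snd c q)" and ?\<Gamma> = "N.christ d (i q)"
  let ?P = "\<lambda>y. N.christ d (i (chart_inv c y))"
  let ?d2 = "\<lambda>u v. der (\<lambda>y. jac c d y v) ?x u"
  have P: "((\<lambda>y. ?P y a b) has_derivative (\<lambda>u. der (\<lambda>y. N.christ d (chart_inv d y) a b) (snd d (i q)) (?J u))) (at ?x)" for a b
    by (rule coeff_along_has_derivative[where f = "\<lambda>p. N.christ d p a b", OF N.smooth_on_christ[OF d]])
  have bP: "bilinear (?P y)" if "y \<in> snd c ` dom c d" for y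
    using that dom_D[OF c d] by (intro N.bilinear_christ[OF d]) auto
  have dP: "(\<lambda>y. ?P y a b) differentiable (at ?x)" for a b
    using P unfolding differentiable_def by blast
  have b\<Gamma>: "bilinear ?\<Gamma>" by (rule N.bilinear_christ[OF d map_in_chart])
  have S: "der (\<lambda>y. sec c d y v w) ?x u = der (\<lambda>y. der (\<lambda>z. jac c d z w) y v) ?x u +
     (der (\<lambda>y. N.christ d (chart_inv d y) (?J v) (?J w)) (snd d (i q)) (?J u) + ?\<Gamma> (?d2 u v) (?J w) + ?\<Gamma> (?J v) (?d2 u w))" for u v w
  proof -
    have "((\<lambda>y. ?P y (jac c d y v) (jac c d y w)) has_derivative
      (\<lambda>u. der (\<lambda>y. ?P y (?J v) (?J w)) ?x u + ?P ?x (?d2 u v) (?J w) + ?P ?x (?J v) (?d2 u w))) (at ?x)"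
      by (rule has_derivative_bilinear_family[OF E.A chart_image(2) bP dP jac_has_derivative jac_has_derivative])
    from has_derivative_add[OF smooth_on_has_derivative[OF smooth_on_der[OF E.J(3)] chart_image(2)] this]
    have "((\<lambda>y. sec c d y v w) has_derivative (\<lambda>u. der (\<lambda>y. der (\<lambda>z. jac c d z w) y v) ?x u +
      (der (\<lambda>y. ?P y (?J v) (?J w)) ?x u + ?P ?x (?d2 u v) (?J w) + ?P ?x (?J v) (?d2 u w)))) (at ?x)"
      unfolding sec_def .
    from fun_cong[OF der_eqI[OF this], of u] show ?thesis
      unfolding map_chart_inv der_eqI[OF P] .
  qed
  have sym: "?d2 u v = ?d2 v u" for u v
    unfolding jac_def by (rule second_derivative_symmetric[OF smooth_on_chart_map[OF c d] E.A chart_image(2)])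
  have sym3: "der (\<lambda>y. der (\<lambda>z. jac c d z w) y v) ?x u = der (\<lambda>y. der (\<lambda>z. jac c d z w) y u) ?x v"
    by (rule second_derivative_symmetric[OF E.J(3) E.A chart_image(2)])
  have s: "sec c d ?x u v = ?d2 u v + ?\<Gamma> (?J u) (?J v)" for u v by (simp add: sec_def map_chart_inv)
  show ?thesis
    unfolding S s N.riem_def sym3 bilinear_radd[OF b\<Gamma>] sym[of v u] by simp
qed

text \<open>The left side of \<open>sec_curvature\<close> computed from the splitting of
  \<open>sec\<close>: the derivative of \<open>jac\<close> together with its Christoffel term is
  \<open>sec\<close> again, and that of the transversal is \<open>cov\<close>.\<close>

lemma sec_decompose_der:
  defines "\<theta> \<equiv> rep c d T"
  shows "der (\<lambda>y. sec c d y v w) (snd c q) u + N.christ d (i q) (jac c d (snd c q) u) (sec c d (snd c q) v w) =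
    sec c d (snd c q) u (chr c d \<theta> (snd c q) v w)
    + jac c d (snd c q) (der (\<lambda>y. chr c d \<theta> y v w) (snd c q) u)
    + der (\<lambda>y. met c d \<theta> y v w) (snd c q) u *\<^sub>R \<theta> (snd c q)
    + met c d \<theta> (snd c q) v w *\<^sub>R cov c d T (snd c q) u"
proof -
  let ?x = "snd c q" and ?J = "jac c d (snd c q)" and ?\<Gamma> = "N.christ d (i q)"
  let ?G = "\<lambda>y. chr c d \<theta> y v w" and ?h = "\<lambda>y. met c d \<theta> y v w"
  note oB = E.open_B[OF rep_transversal] and t = rep_transversal[folded \<theta>_def]
  have JA: "linear (jac c d y)" if "y \<in> snd c ` (U \<inter> dom c d)" for y using E.J(1)[OF E.subset_A[OF rep_transversal that]] .
  have b\<Gamma>: "bilinear ?\<Gamma>" by (rule N.bilinear_christ[OF d map_in_chart])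
  have "((\<lambda>y. jac c d y (?G y) + ?h y *\<^sub>R \<theta> y) has_derivative
     (\<lambda>u. (der (\<lambda>y. jac c d y (?G ?x)) ?x u + ?J (der ?G ?x u)) + (?h ?x *\<^sub>R der \<theta> ?x u + der ?h ?x u *\<^sub>R \<theta> ?x))) (at ?x)"
    by (intro has_derivative_add has_derivative_scaleR rep_has_derivative[folded \<theta>_def]
        has_derivative_linear_family[OF oB chart_image(1) JA smooth_on_differentiable[OF E.J(3) chart_image(2)]]
        smooth_on_has_derivative[OF E.smooth_on_gconn[OF t] chart_image(1)]
        smooth_on_has_derivative[OF E.smooth_on_hform[OF t] chart_image(1)])
  then have "((\<lambda>y. sec c d y v w) has_derivative
     (\<lambda>u. (der (\<lambda>y. jac c d y (?G ?x)) ?x u + ?J (der ?G ?x u)) + (?h ?x *\<^sub>R der \<theta> ?x u + der ?h ?x u *\<^sub>R \<theta> ?x))) (at ?x)"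
    by (rule has_derivative_transform_within_open[OF _ oB chart_image(1)]) (rule E.decompose_Q[OF t, symmetric])
  note D = fun_cong[OF der_eqI[OF this], of u]
  have cov: "cov c d T ?x u = der \<theta> ?x u + ?\<Gamma> (?J u) (\<theta> ?x)" by (simp add: cov_def map_chart_inv \<theta>_def)
  have s: "sec c d ?x u g = der (\<lambda>y. jac c d y g) ?x u + ?\<Gamma> (?J u) (?J g)" for g by (simp add: sec_def map_chart_inv)
  have "?\<Gamma> (?J u) (sec c d ?x v w) = ?\<Gamma> (?J u) (?J (?G ?x)) + ?h ?x *\<^sub>R ?\<Gamma> (?J u) (\<theta> ?x)"
    unfolding E.decompose_Q[OF t chart_image(1), of v w] bilinear_radd[OF b\<Gamma>] bilinear_rmul[OF b\<Gamma>] ..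
  then show ?thesis unfolding D cov s by (simp add: algebra_simps)
qed

text \<open>The curvature is a combination of its three tangential arguments, so its normal part is
  zero. The normal part of the splitting then gives the equation, up to the terms h(G(u, v), w),
  which are symmetric in u and v.\<close>

lemma codazzi:
  assumes R: "\<And>u v w. \<exists>\<alpha> \<beta> \<delta>. N.riem d (i q) u v w = \<alpha> *\<^sub>R u + \<beta> *\<^sub>R v + \<delta> *\<^sub>R w"
  defines "\<theta> \<equiv> rep c d T"
  defines "h \<equiv> met c d \<theta> (snd c q)"
  shows "dmet c d \<theta> (snd c q) u v w + tau c d T (snd c q) u * h v w =
    dmet c d \<theta> (snd c q) v u w + tau c d T (snd c q) v * h u w"
proof -
  let ?x = "snd c q" and ?J = "jac c d (snd c q)" and ?g = "chr c d \<theta> (snd c q)"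
  let ?np = "normal_part ?J (\<theta> ?x)" and ?D = "\<lambda>u v w. der (\<lambda>y. met c d \<theta> y v w) (snd c q) u"
  note t = rep_transversal[folded \<theta>_def]
  note J = E.J(1,2)[OF chart_image(2)] and th = E.transverse[OF t chart_image(1)]
  note lin = linear_normal_part[of ?J "\<theta> ?x"]
  have nJ: "?np (?J a) = 0" for a
    using decompose_unique(2)[OF J th, of "?J a" a 0] by simp
  have n\<theta>: "?np (\<theta> ?x) = 1"
    using decompose_unique(2)[OF J th, of "\<theta> ?x" 0 1] by (simp add: linear_0[OF J(1)])
  obtain \<alpha> \<beta> \<delta> where r: "N.riem d (i q) (?J u) (?J v) (?J w) = \<alpha> *\<^sub>R ?J u + \<beta> *\<^sub>R ?J v + \<delta> *\<^sub>R ?J w"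
    using R by blast
  \<comment> \<open>The tangential summand has no normal part, the transversal has normal part 1,
    and the remaining two summands give h and \<tau> by definition.\<close>
  have n: "?np (sec c d ?x u g + ?J a + r *\<^sub>R \<theta> ?x + s *\<^sub>R cov c d T ?x u) = h u g + r + s * tau c d T ?x u" for u g a r s
    unfolding linear_add[OF lin] linear_scale[OF lin] nJ n\<theta> unfolding h_def hform_def tau_def \<theta>_def by simp
  have "?np (N.riem d (i q) (?J u) (?J v) (?J w)) = 0"
    unfolding r by (simp add: linear_add[OF lin] linear_scale[OF lin] nJ)
  then have "h u (?g v w) + ?D u v w + h v w * tau c d T ?x u = h v (?g u w) + ?D v u w + h u w * tau c d T ?x v"
    unfolding sec_curvature[symmetric] sec_decompose_der[folded \<theta>_def] linear_diff[OF lin] n h_def[symmetric] by simp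
  moreover have "?g u v = ?g v u" by (rule E.gconn_commute[OF chart_image(2)])
  ultimately show ?thesis
    unfolding ctens_def h_def[symmetric] by (simp add: algebra_simps)
qed

text \<open>The Codazzi equation exchanges the differentiating slot with the free slot
  \<open>w\<close>; contracting the other two turns \<tau> h into \<tau> on one side and into n
  \<tau> on the other.\<close>

lemma traced_codazzi:
  assumes R: "\<And>u v w. \<exists>\<alpha> \<beta> \<delta>. N.riem d (i q) u v w = \<alpha> *\<^sub>R u + \<beta> *\<^sub>R v + \<delta> *\<^sub>R w"
  defines "\<theta> \<equiv> rep c d T"
  defines "h \<equiv> met c d \<theta> (snd c q)" and "C \<equiv> dmet c d \<theta> (snd c q)"
  assumes inv: "invertible (gram std h)" and tau: "linear (tau c d T (snd c q))"
  shows "frame_trace std h (\<lambda>u v. C u v w) + tau c d T (snd c q) w =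
    frame_trace std h (\<lambda>u v. C w u v) + real CARD('n) * tau c d T (snd c q) w"
proof -
  let ?\<tau> = "tau c d T (snd c q)"
  note h = E.bilinear_hform[OF chart_image(2), of \<theta>, folded h_def] and sym = E.hform_commute[OF chart_image(2), of \<theta>, folded h_def]
  note t = rep_transversal[folded \<theta>_def]
  have Csym: "C u w v = C u v w" for u v w
    unfolding C_def ctens_def
    using sym der_cong_open[OF E.open_B[OF t] chart_image(1), of "\<lambda>y. met c d \<theta> y w v" "\<lambda>y. met c d \<theta> y v w"]
      E.hform_commute[OF E.subset_A[OF t]] by (simp add: h_def)
  have "C u v w + ?\<tau> u * h v w = C w u v + ?\<tau> w * h u v" for u v
    using codazzi[OF R, of u w v, folded \<theta>_def, folded h_def C_def] sym[of w v] by (simp add: Csym)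
  then have "frame_trace std h (\<lambda>u v. C u v w + ?\<tau> u * h v w) = frame_trace std h (\<lambda>u v. C w u v + ?\<tau> w * h u v)" by simp
  then show ?thesis
    unfolding frame_trace_add frame_trace_scale frame_trace_self[OF sym inv] frame_trace_contract(1)[OF h sym inv tau]
    by (simp add: mult.commute)
qed

lemma linear_tau: "linear (tau c d T (snd c q))"
proof -
  have J: "linear (jac c d (snd c q))" by (rule E.J(1)[OF chart_image(2)])
  have "linear (\<lambda>u. N.christ d (i q) u (rep c d T (snd c q)))"
    using N.bilinear_christ[OF d map_in_chart] by (simp add: bilinear_def)
  then have "linear (cov c d T (snd c q))"
    unfolding cov_def map_chart_inv
    using linear_compose_add[OF smooth_on_linear_der[OF E.smooth_\<theta>[OF rep_transversal] chart_image(1)] linear_compose[OF J]] by (simp add: comp_def)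
  from linear_compose[OF this linear_normal_part] show ?thesis by (simp add: tau_def[abs_def] comp_def)
qed

text \<open>Jacobi's formula gives the metric trace of the coordinate derivative of h, which is the
  covariant derivative plus one connection term for each slot; each of these terms traces to
  \<open>trG\<close>.\<close>

lemma gram_has_derivative:
  assumes inv: "invertible (gram std (met c d (rep c d T) (snd c q)))"
  shows "((\<lambda>y. det (gram std (met c d (rep c d T) y))) has_derivative
    (\<lambda>u. det (gram std (met c d (rep c d T) (snd c q))) *
      (frame_trace std (met c d (rep c d T) (snd c q)) (dmet c d (rep c d T) (snd c q) u)
       + 2 * trG c d T (snd c q) u))) (at (snd c q))"
proof -
  let ?x = "snd c q" and ?h = "met c d (rep c d T)"
  let ?g = "chr c d (rep c d T) ?x" and ?C = "dmet c d (rep c d T) ?x"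
  note h = E.bilinear_hform[OF chart_image(2), of "rep c d T"] and sym = E.hform_commute[OF chart_image(2), of "rep c d T"]
  have "((\<lambda>y. det (gram std (?h y))) has_derivative
    (\<lambda>u. det (gram std (?h ?x)) * trace (matrix_inv (gram std (?h ?x)) ** (\<chi> i j. der (\<lambda>y. ?h y (std i) (std j)) ?x u)))) (at ?x)"
    unfolding gram_def using inv
    by (intro has_derivative_det smooth_on_has_derivative[OF E.smooth_on_hform[OF rep_transversal] chart_image(1)]) (simp add: gram_def)
  moreover have "trace (matrix_inv (gram std (?h ?x)) ** (\<chi> i j. der (\<lambda>y. ?h y (std i) (std j)) ?x u)) =
     frame_trace std (?h ?x) (?C u) + 2 * trG c d T ?x u" for u
  proof -
    have lg: "linear (?g u)" using E.bilinear_gconn[OF chart_image(2)] by (simp add: bilinear_def)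
    have ds: "der (\<lambda>y. ?h y a b) ?x u = der (\<lambda>y. ?h y b a) ?x u" for a b
      using der_cong_open[OF E.open_B[OF rep_transversal] chart_image(1), of "\<lambda>y. ?h y a b" "\<lambda>y. ?h y b a"] E.hform_commute[OF E.subset_A[OF rep_transversal]] by simp
    have t: "trace (matrix_inv (gram std (?h ?x)) ** (\<chi> i j. der (\<lambda>y. ?h y (std i) (std j)) ?x u)) =
      frame_trace std (?h ?x) (\<lambda>a b. der (\<lambda>y. ?h y a b) ?x u)"
      unfolding frame_trace_def trace_def by (simp add: matrix_matrix_mult_def ds[of "std _" "std _"])
    have e: "(\<lambda>a b. der (\<lambda>y. ?h y a b) ?x u) = (\<lambda>a b. ?C u a b + ?h ?x (?g u a) b + ?h ?x a (?g u b))"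
      by (simp add: ctens_def)
    show ?thesis
      unfolding t e frame_trace_add frame_trace_endomorphism[OF h sym inv lg] by (simp add: trG_def)
  qed
  ultimately show ?thesis by simp
qed

end

end

locale parallel_hypersurface = volume_hypersurface S M i N \<Psi> + P: parallel_volume M \<Psi> N
  for S :: "('s, real ^ 'n::finite) mfd" and M :: "('m, real ^ 'n option) mfd" and i N \<Psi>
begin

text \<open>The trace of the ambient Christoffel symbols contributed by \<open>vol_coeff\<close>
  cancels against the one from passing to covariant derivatives of the columns of the transversal
  matrix. The remaining diagonal entries are \<tau> at \<open>None\<close> and those of G at
  \<open>Some k\<close>.\<close>

lemma dens_has_derivative:
  assumes c: "c \<in> atlas S" and d: "d \<in> atlas M"
    and T: "transverse_field S M i U T" and U: "openin (mtop S) U" and q: "q \<in> U" "q \<in> dom c d"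
  shows "(dens c d T has_derivative (\<lambda>u. dens c d T (snd c q) * (tau c d T (snd c q) u + trG c d T (snd c q) u))) (at (snd c q))"
proof -
  interpret E: immersed_model "snd c ` dom c d" "jac c d" "sec c d" by (rule sec_model[OF c d])
  note as = c d T U q
  note rep_transversal = rep_transversal[OF as] and chart_image = chart_image[OF as] and map_chart_inv = map_chart_inv[OF as] and map_in_chart = map_in_chart[OF as]
  let ?x = "snd c q" and ?J = "jac c d (snd c q)" and ?\<theta> = "rep c d T"
  let ?V = "\<lambda>y. transversal_matrix (jac c d y) (?\<theta> y)"
  let ?\<rho> = "\<lambda>y. V.vol_coeff d (i (chart_inv c y))"
  note J = E.J(1,2)[OF chart_image(2)] and th = E.transverse[OF rep_transversal chart_image(1)]
  have inv: "invertible (?V ?x)" by (rule invertible_transversal_matrix[OF J th])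
  define G where "G u = (\<chi> a b. N.christ d (i q) (?J u) (std b) $ a)" for u
  have G: "G u *v w = N.christ d (i q) (?J u) w" for u w
  proof -
    have "linear (N.christ d (i q) (?J u))" using N.bilinear_christ[OF d map_in_chart] by (simp add: bilinear_def)
    from linear_vec_expand[OF this, of w] show ?thesis
      by (simp add: G_def vec_eq_iff matrix_vector_mult_def mult.commute)
  qed
  \<comment> \<open>The covariant derivatives of the columns of the transversal matrix.\<close>
  define P where "P u = (\<chi> a b. (case b of None \<Rightarrow> cov c d T ?x u | Some k \<Rightarrow> sec c d ?x u (std k)) $ a)" for u
  have "((\<lambda>y. det (?V y)) has_derivative (\<lambda>u. det (?V ?x) * trace (matrix_inv (?V ?x) **
    (\<chi> a b. (case b of None \<Rightarrow> der ?\<theta> ?x u | Some k \<Rightarrow> der (\<lambda>y. jac c d y (std k)) ?x u) $ a)))) (at ?x)"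
    unfolding transversal_matrix_def
  proof (rule has_derivative_det)
    show "((\<lambda>y. (case b of None \<Rightarrow> ?\<theta> y | Some k \<Rightarrow> jac c d y (std k)) $ a) has_derivative
      (\<lambda>u. (case b of None \<Rightarrow> der ?\<theta> ?x u | Some k \<Rightarrow> der (\<lambda>y. jac c d y (std k)) ?x u) $ a)) (at ?x)" for a b
      by (cases b) (auto intro!: bounded_linear.has_derivative[OF bounded_linear_vec_nth]
          rep_has_derivative[OF as] jac_has_derivative[OF as])
  qed (use inv in \<open>simp add: transversal_matrix_def\<close>)
  moreover have "trace (matrix_inv (?V ?x) ** (\<chi> a b. (case b of None \<Rightarrow> der ?\<theta> ?x u | Some k \<Rightarrow> der (\<lambda>y. jac c d y (std k)) ?x u) $ a)) =
     tau c d T ?x u + trG c d T ?x u - (\<Sum>b\<in>UNIV. N.christ d (i q) (?J u) (std b) $ b)" for u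
  proof -
    have "(\<chi> a b. (case b of None \<Rightarrow> der ?\<theta> ?x u | Some k \<Rightarrow> der (\<lambda>y. jac c d y (std k)) ?x u) $ a) = P u - G u ** ?V ?x"
    proof -
      have "(G u ** ?V ?x) $ a $ b = N.christ d (i q) (?J u) (case b of None \<Rightarrow> ?\<theta> ?x | Some k \<Rightarrow> ?J (std k)) $ a" for a b
        unfolding G[symmetric] by (simp add: matrix_matrix_mult_def matrix_vector_mult_def transversal_matrix_def)
      then show ?thesis
        by (auto simp: vec_eq_iff P_def cov_def sec_def map_chart_inv split: option.split)
    qed
    moreover note trace_matrix_inv_diff[OF inv, of "P u" "G u"]
    moreover have "trace (matrix_inv (?V ?x) ** P u) = tau c d T ?x u + trG c d T ?x u"
    proof -
      have "(matrix_inv (?V ?x) ** P u) $ b $ b = (matrix_inv (?V ?x) *v (case b of None \<Rightarrow> cov c d T ?x u | Some k \<Rightarrow> sec c d ?x u (std k))) $ b" for b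
        by (simp add: matrix_matrix_mult_def matrix_vector_mult_def P_def)
      then show ?thesis
        by (simp add: trace_def sum_UNIV_option tau_def trG_def normal_part_def gconn_def tangent_part_def)
    qed
    ultimately show ?thesis by (simp add: trace_def G_def)
  qed
  ultimately have D: "((\<lambda>y. det (?V y)) has_derivative (\<lambda>u. det (?V ?x) *
     (tau c d T ?x u + trG c d T ?x u - (\<Sum>b\<in>UNIV. N.christ d (i q) (?J u) (std b) $ b)))) (at ?x)" by simp
  have "(?\<rho> has_derivative (\<lambda>u. V.vol_coeff d (i q) * (\<Sum>b\<in>UNIV. N.christ d (i q) (?J u) (std b) $ b))) (at ?x)"
    using coeff_along_has_derivative[OF as V.smooth_on_vol_coeff[OF d]]
    by (simp add: der_eqI[OF P.has_derivative_vol_coeff[OF d map_in_chart]])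
  from has_derivative_mult[OF this D]
  show ?thesis unfolding dens_def[abs_def] map_chart_inv by (simp add: algebra_simps)
qed

end

section \<open>Parallel densities\<close>

text \<open>The modulus is the square root of the square, hence differentiable away from zero; the
  logarithmic derivative k is the same for both signs.\<close>

lemma has_derivative_abs_nonzero:
  fixes m :: "'a::real_normed_vector \<Rightarrow> real"
  assumes "(m has_derivative (\<lambda>u. m x * k u)) (at x)" "m x \<noteq> 0"
  shows "((\<lambda>y. \<bar>m y\<bar>) has_derivative (\<lambda>u. \<bar>m x\<bar> * k u)) (at x)"
proof -
  have m2: "((\<lambda>y. m y * m y) has_derivative (\<lambda>u. m x * (m x * k u) + m x * k u * m x)) (at x)"
    by (rule has_derivative_mult[OF assms(1,1)])
  have pos: "m x * m x > 0" using assms(2) not_real_square_gt_zero by blast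
  have d: "((\<lambda>y. sqrt (m y * m y)) has_derivative
    (\<lambda>u. inverse (sqrt (m x * m x)) / 2 * (m x * (m x * k u) + m x * k u * m x))) (at x)"
    by (rule has_derivative_compose[OF m2 DERIV_real_sqrt[OF pos, unfolded has_field_derivative_def]])
  have r: "inverse (sqrt (m x * m x)) / 2 * (m x * (m x * k u) + m x * k u * m x) = \<bar>m x\<bar> * k u" for u
  proof -
    have e: "m x * (m x * k u) + m x * k u * m x = 2 * (\<bar>m x\<bar> * \<bar>m x\<bar>) * k u" by simp
    show ?thesis
      using assms(2) unfolding e real_sqrt_abs2 by (simp add: field_simps del: abs_mult_self_eq)
  qed
  show ?thesis by (rule d[unfolded r, unfolded real_sqrt_abs2])
qed

lemma (in manifold) dirderiv_cong:
  assumes "openin (mtop M) V" "p \<in> V" "\<And>q. q \<in> V \<Longrightarrow> f q = g q"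
  shows "dirderiv M p v f = dirderiv M p v g"
proof -
  have "p \<in> points M" using assms openin_subset by blast
  then have c: "chart_at M p \<in> atlas M" "p \<in> fst (chart_at M p)" using ex_chart chart_at by blast+
  let ?c = "chart_at M p"
  have "openin (mtop M) (V \<inter> fst ?c)" using assms(1) openin_chart[OF c(1)] by blast
  from open_chart_image[OF c(1) this] have "open (snd ?c ` (V \<inter> fst ?c))" by simp
  then have "der (f \<circ> chart_inv ?c) (snd ?c p) = der (g \<circ> chart_inv ?c) (snd ?c p)"
    by (rule der_cong_open) (use assms c chart_inv_chart[OF c(1)] in auto)
  then show ?thesis by (simp add: dirderiv_def)
qed

context parallel_hypersurface begin

text \<open>This says that the induced density \<mu> satisfies \<nabla>\<mu> = \<tau> \<mu>. The
  matrix F of the frame has derivative F B - G F, contributing tr B - tr G, and \<open>dens\<close>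
  contributes \<tau> + tr G. That \<mu> is nonzero on the frame allows \<tau> to be
  recovered.\<close>

lemma induced_density_derivative:
  fixes B :: "real ^ 'n ^ 'n"
  assumes c: "c \<in> atlas S" and d: "d \<in> atlas M"
    and T: "transverse_field S M i U T" and U: "openin (mtop S) U"
    and V: "openin (mtop S) V" "V \<subseteq> U" and p: "p \<in> V" "p \<in> dom c d"
    and X: "X \<in> vfields S V" and E: "local_frame S V E"
    and B: "\<And>j b. induced_conn S M N i (line_spanned T) X (E j) p b = (\<Sum>k\<in>UNIV. B $ k $ j *\<^sub>R E k p b)"
  shows "dirderiv S p (X p) (\<lambda>q. induced_density S M i \<Psi> T q (\<lambda>j. E j q)) =
    (trace B + tau c d T (snd c p) (X p c)) * induced_density S M i \<Psi> T p (\<lambda>j. E j p)"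
    "induced_density S M i \<Psi> T p (\<lambda>j. E j p) \<noteq> 0"
proof -
  interpret E: immersed_model "snd c ` dom c d" "jac c d" "sec c d" by (rule sec_model[OF c d])
  let ?x = "snd c p" and ?\<xi> = "X p c"
  have pU: "p \<in> U" using p V by auto
  note D = dom_D[OF c d p(2)]
  have Ev: "E j \<in> vfields S V" for j using E by (simp add: local_frame_def)
  have Et: "E j q \<in> tangent_space S q" if "q \<in> V" for j q by (rule S.vfields_tangent[OF Ev that])
  let ?O = "snd c ` (V \<inter> dom c d)"
  have oO: "open ?O" by (rule open_dom[OF c d V(1)])
  have xO: "?x \<in> ?O" using p by auto
  define e where "e j y = E j (chart_inv c y) c" for j y
  have ex: "e j ?x = E j p c" for j by (simp add: e_def D(4))
  have es: "(e j has_derivative der (e j) ?x) (at ?x)" for j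
    unfolding e_def by (rule smooth_on_has_derivative[OF S.vfields_smooth[OF Ev c] xO]) (auto simp: dom_def)
  have "frame_at S p (\<lambda>j. E j p)" using E p by (simp add: local_frame_def)
  then have inv: "invertible (frame_matrix (\<lambda>j. e j ?x))"
    unfolding ex S.frame_at_chart[OF Et[OF p(1)] c D(1)] invertible_frame_matrix .
  let ?F = "frame_matrix (\<lambda>j. e j ?x)" and ?g = "chr c d (rep c d T) ?x ?\<xi>"
  have lg: "linear ?g"
    using E.bilinear_gconn[of ?x "rep c d T"] p by (auto simp: bilinear_def)
  define G where "G = (\<chi> a b. ?g (std b) $ a)"
  have G: "G *v w = ?g w" for w
    using linear_vec_expand[OF lg, of w] by (simp add: G_def vec_eq_iff matrix_vector_mult_def mult.commute)
  have "der (e j) ?x ?\<xi> + ?g (e j ?x) = (\<Sum>k\<in>UNIV. B $ k $ j *\<^sub>R e k ?x)" for j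
    using B[of j c] S.coord_field_self[OF c D(1)]
    unfolding induced_conn_chart[where W = "line_spanned T" and q = p and T = T, OF c d V(1) X Ev p transverse_field_at[OF T U pU] refl]
    by (simp add: ex e_def[symmetric])
  then have e': "der (e j) ?x ?\<xi> = (\<Sum>k\<in>UNIV. B $ k $ j *\<^sub>R e k ?x) - ?g (e j ?x)" for j
    by (simp add: eq_diff_eq)
  have DF: "(\<chi> a b. der (e b) ?x ?\<xi> $ a) = ?F ** B - G ** ?F"
  proof -
    have "(G ** ?F) $ a $ b = ?g (e b ?x) $ a" for a b
      unfolding G[symmetric] by (simp add: matrix_matrix_mult_def matrix_vector_mult_def frame_matrix_def)
    moreover have "(?F ** B) $ a $ b = (\<Sum>k\<in>UNIV. B $ k $ b *\<^sub>R e k ?x) $ a" for a b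
      by (simp add: matrix_matrix_mult_def frame_matrix_def mult.commute)
    ultimately show ?thesis by (simp add: vec_eq_iff e')
  qed
  have "((\<lambda>y. det (\<chi> a b. e b y $ a)) has_derivative
     (\<lambda>u. det (\<chi> a b. e b ?x $ a) * trace (matrix_inv (\<chi> a b. e b ?x $ a) ** (\<chi> a b. der (e b) ?x u $ a)))) (at ?x)"
    using inv by (intro has_derivative_det bounded_linear.has_derivative[OF bounded_linear_vec_nth] es) (simp add: frame_matrix_def)
  from has_derivative_mult[OF this dens_has_derivative[OF c d T U pU p(2)]]
  have "((\<lambda>y. det (frame_matrix (\<lambda>j. e j y)) * dens c d T y) has_derivative
     (\<lambda>u. (det ?F * dens c d T ?x) * (trace (matrix_inv ?F ** (\<chi> a b. der (e b) ?x u $ a)) + tau c d T ?x u + trG c d T ?x u))) (at ?x)"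
    unfolding frame_matrix_def by (simp add: algebra_simps)
  moreover have nz: "det ?F * dens c d T ?x \<noteq> 0"
    using inv dens_nonzero[OF c d p(2) transverse_field_at[OF T U pU]] by (simp add: invertible_det_nz)
  ultimately have "((\<lambda>y. \<bar>det (frame_matrix (\<lambda>j. e j y)) * dens c d T y\<bar>) has_derivative
     (\<lambda>u. \<bar>det ?F * dens c d T ?x\<bar> * (trace (matrix_inv ?F ** (\<chi> a b. der (e b) ?x u $ a)) + tau c d T ?x u + trG c d T ?x u))) (at ?x)"
    by (rule has_derivative_abs_nonzero)
  then have "((\<lambda>y. induced_density S M i \<Psi> T (chart_inv c y) (\<lambda>j. E j (chart_inv c y))) has_derivative
     (\<lambda>u. \<bar>det ?F * dens c d T ?x\<bar> * (trace (matrix_inv ?F ** (\<chi> a b. der (e b) ?x u $ a)) + tau c d T ?x u + trG c d T ?x u))) (at ?x)"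
  proof (rule has_derivative_transform_within_open[OF _ oO xO])
    fix y assume "y \<in> ?O"
    then obtain r where r: "r \<in> V" "r \<in> dom c d" "y = snd c r" by auto
    have "T r \<in> tangent_space M (i r)"
      using transverse_field_at[OF T U] r V by (auto simp: transverse_at_def)
    from induced_density_chart[where T = T and v = "\<lambda>j. E j r", OF c d r(2) this Et[OF r(1)]]
    show "\<bar>det (frame_matrix (\<lambda>j. e j y)) * dens c d T y\<bar> = induced_density S M i \<Psi> T (chart_inv c y) (\<lambda>j. E j (chart_inv c y))"
      by (simp add: r(3) dom_D(4)[OF c d r(2)] e_def abs_mult)
  qed
  note 1 = S.dirderiv_chart[OF S.vfields_tangent[OF X p(1)] c D(1) this]
  have \<mu>: "induced_density S M i \<Psi> T p (\<lambda>j. E j p) = \<bar>det ?F * dens c d T ?x\<bar>"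
    using induced_density_chart[where T = T and v = "\<lambda>j. E j p", OF c d p(2) _ Et[OF p(1)]] transverse_field_at[OF T U pU]
    by (simp add: transverse_at_def ex abs_mult)
  show "induced_density S M i \<Psi> T p (\<lambda>j. E j p) \<noteq> 0" unfolding \<mu> using nz by simp
  have "trace (matrix_inv ?F ** (?F ** B - G ** ?F)) = trace B - trace G"
    by (simp add: trace_matrix_inv_diff[OF inv] matrix_mul_assoc matrix_inv_invertible[OF inv])
  then show "dirderiv S p (X p) (\<lambda>q. induced_density S M i \<Psi> T q (\<lambda>j. E j q)) =
    (trace B + tau c d T (snd c p) (X p c)) * induced_density S M i \<Psi> T p (\<lambda>j. E j p)"
    unfolding 1 \<mu> DF by (simp add: trace_def G_def trG_def)
qed

context
  fixes T
  assumes T: "transverse_field S M i (points S) T"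
begin

lemma preserves_density_iff:
  "preserves_density S (induced_conn S M N i (line_spanned T)) (induced_density S M i \<Psi> T) \<longleftrightarrow>
    (\<forall>c\<in>atlas S. \<forall>d\<in>atlas M. \<forall>p\<in>dom c d. \<forall>u. tau c d T (snd c p) u = 0)"
proof
  assume pd: "preserves_density S (induced_conn S M N i (line_spanned T)) (induced_density S M i \<Psi> T)"
  show "\<forall>c\<in>atlas S. \<forall>d\<in>atlas M. \<forall>p\<in>dom c d. \<forall>u. tau c d T (snd c p) u = 0"
  proof (intro ballI allI)
    fix c d p u assume c: "c \<in> atlas S" and d: "d \<in> atlas M" and p: "p \<in> dom c d"
    note V = openin_dom[OF c d]
    have sub: "dom c d \<subseteq> fst c" by (auto simp: dom_def)
    have VS: "dom c d \<subseteq> points S" using V openin_subset by blast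
    have cp: "c \<in> atlas S" "p \<in> fst c" using c p sub by auto
    let ?E = "\<lambda>j::'n. coord_field S c (std j)"
    note E = local_frame_coord[OF c V sub]
    have cv: "coord_field S c w \<in> vfields S (dom c d)" for w by (rule S.coord_field_vfields[OF c V sub])
    \<comment> \<open>The frame has constant components in \<open>c\<close>, so its connection
      matrix consists of the induced Christoffel symbols.\<close>
    define B where "B = (\<chi> k j. chr c d (rep c d T) (snd c p) u (std j) $ k)"
    have B: "induced_conn S M N i (line_spanned T) (coord_field S c u) (?E j) p b = (\<Sum>k\<in>UNIV. B $ k $ j *\<^sub>R ?E k p b)" for j b
    proof -
      let ?w = "chr c d (rep c d T) (snd c p) u (std j)"
      have op: "open (snd c ` dom c d)" using open_dom[OF c d V] by simp
      have "((\<lambda>x. ?E j (chart_inv c x) c) has_derivative (\<lambda>u. 0)) (at (snd c p))"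
        by (rule has_derivative_transform_within_open[OF has_derivative_const[of "std j"] op])
          (use p dom_D[OF c d] S.coord_field_self[OF c] in auto)
      from der_eqI[OF this] have "induced_conn S M N i (line_spanned T) (coord_field S c u) (?E j) p = coord_field S c ?w p"
        unfolding induced_conn_chart[where W = "line_spanned T" and q = p and T = T, OF c d V cv cv p p
          transverse_field_at[OF T openin_topspace subsetD[OF VS p]] refl]
        by (simp add: S.coord_field_self[OF cp])
      also have "\<dots> = (\<lambda>b. \<Sum>k\<in>UNIV. B $ k $ j *\<^sub>R ?E k p b)"
      proof (rule S.tangent_eqI[OF S.coord_field_tangent[OF cp] S.tangent_sum[OF S.coord_field_tangent[OF cp]] cp])
        show "coord_field S c ?w p c = (\<Sum>k\<in>UNIV. B $ k $ j *\<^sub>R ?E k p c)"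
          unfolding S.coord_field_self[OF cp] B_def by (simp add: vec_expand[of ?w, symmetric])
      qed
      finally show ?thesis by simp
    qed
    note idd = induced_density_derivative[OF c d T openin_topspace V VS p p cv E B]
    have "dirderiv S p (coord_field S c u p) (\<lambda>q. induced_density S M i \<Psi> T q (\<lambda>j. ?E j q)) =
      trace B * induced_density S M i \<Psi> T p (\<lambda>j. ?E j p)"
      using pd[unfolded preserves_density_def, rule_format, of "dom c d" "coord_field S c u" ?E p B] V cv E p B by blast
    then have "tau c d T (snd c p) (coord_field S c u p c) * induced_density S M i \<Psi> T p (\<lambda>j. ?E j p) = 0"
      unfolding idd(1) by (simp add: algebra_simps)
    then show "tau c d T (snd c p) u = 0" using idd(2) by (simp add: S.coord_field_self[OF cp])
  qed
next
  assume 0: "\<forall>c\<in>atlas S. \<forall>d\<in>atlas M. \<forall>p\<in>dom c d. \<forall>u. tau c d T (snd c p) u = 0"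
  show "preserves_density S (induced_conn S M N i (line_spanned T)) (induced_density S M i \<Psi> T)"
    unfolding preserves_density_def
  proof (intro allI impI ballI, elim conjE)
    fix V X E p and B :: "real ^ 'n ^ 'n"
    assume V: "openin (mtop S) V" and X: "X \<in> vfields S V" and E: "local_frame S V E" and p: "p \<in> V"
      and B: "\<forall>j b. induced_conn S M N i (line_spanned T) X (E j) p b = (\<Sum>k\<in>UNIV. B $ k $ j *\<^sub>R E k p b)"
    have VS: "V \<subseteq> points S" using V openin_subset by blast
    obtain c d where cd: "c \<in> atlas S" "d \<in> atlas M" "p \<in> dom c d" using ex_dom VS p by blast
    show "dirderiv S p (X p) (\<lambda>q. induced_density S M i \<Psi> T q (\<lambda>j. E j q)) = trace B * induced_density S M i \<Psi> T p (\<lambda>j. E j p)"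
      using induced_density_derivative(1)[OF cd(1,2) T openin_topspace V VS p cd(3) X E B[THEN spec, THEN spec]] 0 cd by simp
  qed
qed

context
  assumes um: "\<And>q. q \<in> points S \<Longrightarrow> unimod T q"
begin

lemma preserves_metric_density:
  assumes pd: "preserves_density S D (induced_density S M i \<Psi> T)"
  shows "preserves_density S D (metric_density (induced_metric S M N i T))"
  unfolding preserves_density_def
proof (intro allI impI ballI, elim conjE)
  fix V X E p and B :: "real ^ 'n ^ 'n"
  assume V: "openin (mtop S) V" and X: "X \<in> vfields S V" and E: "local_frame S V E" and p: "p \<in> V"
    and B: "\<forall>j b. D X (E j) p b = (\<Sum>k\<in>UNIV. B $ k $ j *\<^sub>R E k p b)"
  have eq: "induced_density S M i \<Psi> T q (\<lambda>j. E j q) = metric_density (induced_metric S M N i T) q (\<lambda>j. E j q)" if "q \<in> V" for q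
  proof -
    have "E j q \<in> tangent_space S q" for j using E S.vfields_tangent[OF _ that] by (simp add: local_frame_def)
    moreover have "q \<in> points S" using V that openin_subset by blast
    ultimately show ?thesis using um by (simp add: unimod_def)
  qed
  have "dirderiv S p (X p) (\<lambda>q. induced_density S M i \<Psi> T q (\<lambda>j. E j q)) = trace B * induced_density S M i \<Psi> T p (\<lambda>j. E j p)"
    using pd[unfolded preserves_density_def, rule_format, of V X E p B] V X E p B by blast
  moreover have "dirderiv S p (X p) (\<lambda>q. induced_density S M i \<Psi> T q (\<lambda>j. E j q)) =
      dirderiv S p (X p) (\<lambda>q. metric_density (induced_metric S M N i T) q (\<lambda>j. E j q))"
    by (rule S.dirderiv_cong[OF V p]) (rule eq)
  ultimately show "dirderiv S p (X p) (\<lambda>q. metric_density (induced_metric S M N i T) q (\<lambda>j. E j q)) = trace B * metric_density (induced_metric S M N i T) p (\<lambda>j. E j p)"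
    using eq[OF p] by simp
qed

text \<open>The logarithmic derivatives of the two densities are equal; as tr G enters both in the
  same way, it cancels and leaves the trace of \<nabla>h equal to 2 \<tau>.\<close>

lemma unimod_tau:
  assumes c: "c \<in> atlas S" and d: "d \<in> atlas M" and q: "q \<in> dom c d"
  shows "frame_trace std (met c d (rep c d T) (snd c q)) (dmet c d (rep c d T) (snd c q) u) =
    2 * tau c d T (snd c q) u"
proof -
  note D = dom_D[OF c d q]
  let ?x = "snd c q" and ?D = "dens c d T" and ?m = "mdet c d T"
  let ?t = "tau c d T ?x" and ?G = "trG c d T ?x" and ?B = "\<lambda>u. frame_trace std (met c d (rep c d T) ?x) (dmet c d (rep c d T) ?x u)"
  note pS = openin_topspace D(3)
  note inv = transversal_rep_inv[OF T pS c d q]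
  have 1: "(?D has_derivative (\<lambda>u. ?D ?x * (?t u + ?G u))) (at ?x)"
    by (rule dens_has_derivative[OF c d T pS q])
  have 2: "(?m has_derivative (\<lambda>u. ?m ?x * (?B u + 2 * ?G u))) (at ?x)"
    using gram_has_derivative[OF c d T pS q inv] by (simp add: mdet_def[abs_def])
  \<comment> \<open>The fourth power removes both the moduli and the square root, so that only
    powers of differentiable functions are differentiated.\<close>
  have eq: "?D y ^ 4 = ?m y ^ 2" if "y \<in> snd c ` dom c d" for y
  proof -
    from that obtain r where r: "r \<in> dom c d" "y = snd c r" by auto
    have rS: "r \<in> points S" by (rule dom_D(3)[OF c d r(1)])
    have "\<bar>?D y\<bar> = sqrt \<bar>?m y\<bar>"
      using um[OF rS] unimod_iff[OF c d r(1) transverse_field_at[OF T openin_topspace rS]] r(2) by simp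
    then have "\<bar>?D y\<bar>\<^sup>2 = \<bar>?m y\<bar>" by simp
    then have "(\<bar>?D y\<bar>\<^sup>2)\<^sup>2 = \<bar>?m y\<bar>\<^sup>2" by (simp only:)
    then show ?thesis by (simp flip: power_mult)
  qed
  have xA: "?x \<in> snd c ` dom c d" using q by simp
  have "((\<lambda>y. ?D y ^ 4) has_derivative (\<lambda>u. of_nat 4 * (?D ?x * (?t u + ?G u)) * ?D ?x ^ (4 - 1))) (at ?x)"
    by (rule has_derivative_power[OF 1])
  then have "((\<lambda>y. ?m y ^ 2) has_derivative (\<lambda>u. of_nat 4 * (?D ?x * (?t u + ?G u)) * ?D ?x ^ (4 - 1))) (at ?x)"
    by (rule has_derivative_transform_within_open[OF _ _ xA eq])
      (use open_dom[OF c d openin_dom[OF c d]] in simp)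
  from has_derivative_unique[OF this has_derivative_power[OF 2, of 2]]
  have F: "of_nat 4 * (?D ?x * (?t u + ?G u)) * ?D ?x ^ (4 - 1) = of_nat 2 * (?m ?x * (?B u + 2 * ?G u)) * ?m ?x ^ (2 - 1)"
    by (rule fun_cong)
  have k: "of_nat 4 * (D * a) * D ^ (4 - 1) = D ^ 4 * (4 * a)" "of_nat 2 * (D * a) * D ^ (2 - 1) = D ^ 2 * (2 * a)" for a D :: real
    by (simp_all add: eval_nat_numeral)
  have "?D ?x ^ 4 * (4 * (?t u + ?G u)) = ?m ?x ^ 2 * (2 * (?B u + 2 * ?G u))"
    by (rule F[unfolded k])
  moreover have "?D ?x ^ 4 \<noteq> 0"
    using dens_nonzero[OF c d q transverse_field_at[OF T pS]] by simp
  ultimately show ?thesis unfolding eq[OF xA, symmetric] by simp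
qed

text \<open>By the traced Codazzi equation the first trace is the second plus (n - 1) \<tau>, and
  the second is 2 \<tau>. The defect is therefore n (n + 1) \<tau> - 2 \<tau>.\<close>

lemma unimod_defect:
  assumes pf: "projectively_flat M N" and c: "c \<in> atlas S" and d: "d \<in> atlas M" and q: "q \<in> dom c d"
  shows "dft c d (rep c d T) (snd c q) w =
    (real CARD('n) - 1) * (real CARD('n) + 2) * tau c d T (snd c q) w"
proof -
  note D = dom_D[OF c d q]
  note pS = openin_topspace D(3)
  have R: "\<exists>\<alpha> \<beta> \<delta>. N.riem d (i q) u v w = \<alpha> *\<^sub>R u + \<beta> *\<^sub>R v + \<delta> *\<^sub>R w" for u v w
    by (rule N.riem_projectively_flat[OF pf d D(2)])
  note tc = traced_codazzi[OF c d T pS q R transversal_rep_inv[OF T pS c d q] linear_tau[OF c d T pS q], of w]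
  show ?thesis unfolding defect_def
    using tc unimod_tau[OF c d q, of w] by (simp add: algebra_simps)
qed

lemma preserves_iff_aligned:
  assumes pf: "projectively_flat M N"
  shows "preserves_density S (induced_conn S M N i (line_spanned T)) (induced_density S M i \<Psi> T) \<longleftrightarrow>
    aligned_field (points S) T"
proof -
  have k: "(real CARD('n) - 1) * (real CARD('n) + 2) \<noteq> 0" using dim by simp
  show ?thesis
  proof
    assume "preserves_density S (induced_conn S M N i (line_spanned T)) (induced_density S M i \<Psi> T)"
    then have 0: "tau c d T (snd c p) u = 0" if "c \<in> atlas S" "d \<in> atlas M" "p \<in> dom c d" for c d p u
      using that unfolding preserves_density_iff by blast
    have "aligned S (points S) (induced_conn S M N i (line_spanned T)) (induced_metric S M N i T)"
    proof (rule defect_imp_aligned[OF T openin_topspace refl transverse_nondegenerate[OF T openin_topspace]])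
      fix q assume "q \<in> points S"
      then obtain c d where cd: "c \<in> atlas S" "d \<in> atlas M" "q \<in> dom c d" using ex_dom by blast
      then show "\<exists>c\<in>atlas S. \<exists>d\<in>atlas M. q \<in> dom c d \<and> (\<forall>w. dft c d (rep c d T) (snd c q) w = 0)"
        using unimod_defect[OF pf cd] 0[OF cd] by auto
    qed auto
    then show "aligned_field (points S) T" using T by (simp add: aligned_field_def)
  next
    assume al: "aligned_field (points S) T"
    then have al: "aligned S (points S) (induced_conn S M N i (line_spanned T)) (induced_metric S M N i T)"
      by (simp add: aligned_field_def)
    show "preserves_density S (induced_conn S M N i (line_spanned T)) (induced_density S M i \<Psi> T)"
      unfolding preserves_density_iff
    proof (intro ballI allI)
      fix c d p u assume cd: "c \<in> atlas S" "d \<in> atlas M" "p \<in> dom c d"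
      show "tau c d T (snd c p) u = 0"
        using aligned_imp_defect[OF T openin_topspace refl al cd(1,2) dom_D(3)[OF cd] cd(3), of u] unimod_defect[OF pf cd, of u] k by simp
    qed
  qed
qed

end

end

lemma aligned_field_of_section:
  assumes W: "aligned_line_field S M N i W" and T: "transverse_field S M i (points S) T"
    and WT: "\<And>q. q \<in> points S \<Longrightarrow> T q \<in> W q"
  shows "aligned_field (points S) T"
proof -
  have tl: "transverse_line_field S M i W" using W by (simp add: aligned_line_field_def)
  have "T q \<noteq> (\<lambda>d. 0)" if "q \<in> points S" for q
    by (rule transverse_at_nonzero[OF transverse_field_at[OF T openin_topspace that]])
  then have ns: "nonvanishing_section S M i W (points S) T"
    using T WT by (simp add: nonvanishing_section_def transverse_field_def)
  note l = line_field_section(2)[OF tl ns openin_topspace]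
  have "aligned S (points S) (induced_conn S M N i (line_spanned T)) (induced_metric S M N i T)"
  proof (rule aligned_section[OF T openin_topspace refl])
    fix q assume q: "q \<in> points S"
    show "\<exists>U' T'. aligned_field U' T' \<and> q \<in> U' \<and> line_spanned T q = line_spanned T' q"
      using aligned_line_field_local[OF W q] l[OF q] by metis
  qed
  then show ?thesis using T by (simp add: aligned_field_def)
qed

theorem unimodular_section_preserves:
  assumes W: "aligned_line_field S M N i W" and C: "co_orientation S M i C" and pf: "projectively_flat M N"
    and T: "unimodular_section S M N i \<Psi> C W T"
  shows "preserves_density S (induced_conn S M N i (line_spanned T)) (induced_density S M i \<Psi> T)"
    "preserves_density S (induced_conn S M N i (line_spanned T)) (metric_density (induced_metric S M N i T))"
proof -
  have tl: "transverse_line_field S M i W" using W by (simp add: aligned_line_field_def)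
  note t = T[unfolded unimodular_section_iff[OF tl C]]
  have tf: "transverse_field S M i (points S) T" and um: "\<And>q. q \<in> points S \<Longrightarrow> unimod T q" using t by auto
  have "aligned_field (points S) T" using t by (intro aligned_field_of_section[OF W]) auto
  then show 1: "preserves_density S (induced_conn S M N i (line_spanned T)) (induced_density S M i \<Psi> T)"
    using preserves_iff_aligned[OF tf um pf] by simp
  show "preserves_density S (induced_conn S M N i (line_spanned T)) (metric_density (induced_metric S M N i T))"
    by (rule preserves_metric_density[OF tf um 1])
qed

text \<open>The converse direction of \<open>preserves_iff_aligned\<close>: a parallel induced
  density forces a unimodular transversal to span the aligned line at every point. It supplies the
  uniqueness of the equiaffine normal.\<close>

theorem parallel_unimodular_unique:
  assumes W: "aligned_line_field S M N i W" and C: "co_orientation S M i C" and pf: "projectively_flat M N"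
    and T: "unimodular_transversal S M N i \<Psi> C T"
    and pd: "preserves_density S (induced_conn S M N i (line_spanned T)) (induced_density S M i \<Psi> T)"
  shows "unimodular_section S M N i \<Psi> C W T"
proof -
  have tl: "transverse_line_field S M i W" using W by (simp add: aligned_line_field_def)
  have t: "T \<in> extensional (points S)" "transverse_field S M i (points S) T" "\<And>q. q \<in> points S \<Longrightarrow> T q \<in> C q"
    "\<And>q. q \<in> points S \<Longrightarrow> unimod T q"
    using T by (auto simp: unimodular_transversal_def co_oriented_transversal_def density_eq_def unimod_def)
  have al: "aligned_field (points S) T" using preserves_iff_aligned[OF t(2,4) pf] pd by simp
  have "T q \<in> W q" if q: "q \<in> points S" for q
  proof -
    obtain U T' where "q \<in> U" "aligned_field U T'" "W q = line_spanned T' q"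
      using aligned_line_field_local[OF W q] by blast
    then have "W q = line_spanned T q" using aligned_field_unique[OF al, of U T' q] q by simp
    then show ?thesis by (simp add: line_spanned_self)
  qed
  then show ?thesis unfolding unimodular_section_iff[OF tl C] using t by simp
qed

end

section \<open>Flat affine space\<close>

lemma chart_inv_std: "chart_inv (std_chart :: ('e, 'e) chart) = id"
  by (simp add: chart_inv_def std_chart_def fun_eq_iff inv_into_f_f)

lemma std_chart_simps: "fst (std_chart :: ('e, 'e) chart) = UNIV" "snd (std_chart :: ('e, 'e) chart) = id"
  by (simp_all add: std_chart_def)

lemma affine_space_simps:
  "mtop (affine_space :: ('e::euclidean_space, 'e) mfd) = euclidean"
  "atlas (affine_space :: ('e::euclidean_space, 'e) mfd) = {std_chart}"
  by (simp_all add: affine_space_def)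

lemma chart_at_affine: "chart_at (affine_space :: ('e::euclidean_space, 'e) mfd) p = std_chart"
  unfolding chart_at_def by (rule some_equality) (auto simp: affine_space_simps std_chart_simps)

lemma dirderiv_affine: "dirderiv (affine_space :: ('e::euclidean_space, 'e) mfd) p v f = der f p (v std_chart)"
  by (simp add: dirderiv_def chart_at_affine chart_inv_std std_chart_simps)

lemma tangent_affine: "v \<in> tangent_space (affine_space :: ('e::euclidean_space, 'e) mfd) p \<longleftrightarrow> (\<forall>c. c \<noteq> std_chart \<longrightarrow> v c = 0)"
proof -
  have "v std_chart = der (snd std_chart \<circ> chart_inv std_chart) (snd std_chart p) (v std_chart)"
    by (simp add: chart_inv_std std_chart_simps)
  then show ?thesis by (simp add: tangent_space_def affine_space_simps std_chart_simps)
qed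

lemma vfields_affine_smooth:
  assumes "X \<in> vfields (affine_space :: ('e::euclidean_space, 'e) mfd) V"
  shows "smooth_on V (\<lambda>x. X x std_chart)"
  using assms by (simp add: vfields_along_def affine_space_simps std_chart_simps chart_inv_std)

lemma volume_form_affine: "volume_form (affine_space :: (real ^ 'k::finite, real ^ 'k) mfd) std_volume"
proof -
  let ?M = "affine_space :: (real ^ 'k, real ^ 'k) mfd"
  have sv: "std_volume p v = det (\<chi> j. v j std_chart)" for p and v :: "'k \<Rightarrow> (real ^ 'k, real ^ 'k) tvec"
    using det_transpose[of "\<chi> j. v j std_chart"] by (simp add: std_volume_def transpose_def)
  have upd: "(\<chi> k. (v(j := x)) k std_chart) = (\<chi> k. if k = j then x std_chart else v k std_chart)" for v :: "'k \<Rightarrow> (real ^ 'k, real ^ 'k) tvec" and j x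
    by (simp add: vec_eq_iff)
  have lin: "std_volume p (v(j := (\<lambda>c. r *\<^sub>R u c + w c))) = r * std_volume p (v(j := u)) + std_volume p (v(j := w))"
    for p and v :: "'k \<Rightarrow> (real ^ 'k, real ^ 'k) tvec" and j r u w
    unfolding sv upd det_row_add by (simp add: det_row_mul[of j r "\<lambda>_. u std_chart" "\<lambda>k. v k std_chart", unfolded scalar_mult_eq_scaleR])
  have alt: "std_volume p v = 0" if "j \<noteq> l" "v j = v l" for p and v :: "'k \<Rightarrow> (real ^ 'k, real ^ 'k) tvec" and j l
    unfolding sv by (rule det_identical_rows[OF that(1)]) (simp add: row_def vec_eq_iff that(2))
  have nz: "\<exists>v. (\<forall>j. v j \<in> tangent_space ?M p) \<and> std_volume p v \<noteq> 0" for p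
  proof (intro exI conjI allI)
    let ?v = "\<lambda>j c. if c = std_chart then std j else 0"
    show "?v j \<in> tangent_space ?M p" for j by (simp add: tangent_affine)
    have "(\<chi> j. ?v j std_chart) = (mat 1 :: real ^ 'k ^ 'k)" by (auto simp: vec_eq_iff mat_def axis_def)
    then show "std_volume p ?v \<noteq> 0" unfolding sv by simp
  qed
  have sm: "smooth_fun ?M U (\<lambda>p. std_volume p (\<lambda>j. E j p))" if U: "openin (mtop ?M) U" and E: "\<And>j. E j \<in> vfields ?M U" for U E
  proof -
    have op: "open U" using U by (simp add: affine_space_simps)
    have "smooth_on U (\<lambda>p. det (\<chi> a b. E b p std_chart $ a))"
      by (intro smooth_on_det op smooth_on_vec_nth vfields_affine_smooth E)
    then show ?thesis
      by (simp add: smooth_fun_def affine_space_simps std_chart_simps chart_inv_std std_volume_def)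
  qed
  show ?thesis
    unfolding volume_form_def using lin alt nz sm by (intro conjI ballI allI impI) auto
qed

text \<open>\<open>std_conn\<close> differentiates components, so the claim is the product rule for
  the determinant, one vector at a time.\<close>

lemma preserves_form_affine: "preserves_form (affine_space :: (real ^ 'k::finite, real ^ 'k) mfd) std_conn std_volume"
  unfolding preserves_form_def
proof (intro allI impI ballI, elim conjE)
  fix U p and X :: "(real ^ 'k, real ^ 'k) vfield" and E :: "'k \<Rightarrow> (real ^ 'k, real ^ 'k) vfield"
  assume p: "p \<in> U" and E: "\<forall>j. E j \<in> vfields affine_space U"
  let ?X = "X p std_chart"
  have "((\<lambda>q. E j q std_chart) has_derivative der (\<lambda>q. E j q std_chart) p) (at p)" for j
    using E p by (intro smooth_on_has_derivative[OF vfields_affine_smooth]) auto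
  then have "((\<lambda>q. det (\<chi> i j. E i q std_chart $ j)) has_derivative
    (\<lambda>u. \<Sum>k\<in>UNIV. det (\<chi> i j. if i = k then der (\<lambda>q. E i q std_chart) p u $ j else E i p std_chart $ j))) (at p)"
    by (intro has_derivative_det_rows bounded_linear.has_derivative[OF bounded_linear_vec_nth])
  from der_eqI[OF this]
  have d: "der (\<lambda>q. det (\<chi> i j. E i q std_chart $ j)) p ?X =
    (\<Sum>k\<in>UNIV. det (\<chi> i j. if i = k then der (\<lambda>q. E i q std_chart) p ?X $ j else E i p std_chart $ j))" by simp
  have sv: "std_volume p v = det (\<chi> i j. v i std_chart $ j)" for p and v :: "'k \<Rightarrow> (real ^ 'k, real ^ 'k) tvec"
    using det_transpose[of "\<chi> i j. v i std_chart $ j"] by (simp add: std_volume_def transpose_def)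
  have "(\<chi> i j. ((\<lambda>l. E l p)(k := std_conn X (E k) p)) i std_chart $ j) =
    (\<chi> i j. if i = k then der (\<lambda>q. E i q std_chart) p ?X $ j else E i p std_chart $ j)" for k
    by (auto simp: vec_eq_iff std_conn_def)
  then show "dirderiv affine_space p (X p) (\<lambda>q. std_volume q (\<lambda>j. E j q)) =
    (\<Sum>j\<in>UNIV. std_volume p ((\<lambda>l. E l p)(j := std_conn X (E j) p)))"
    unfolding dirderiv_affine sv d by simp
qed

text \<open>With \<gamma> = 0 the claim is flatness: the second derivatives of \<open>Z\<close>
  cancel by symmetry, and the first-order terms combine to the derivative along the bracket.\<close>

lemma projectively_flat_affine: "projectively_flat (affine_space :: ('e::euclidean_space, 'e) mfd) std_conn"
proof -
  let ?M = "affine_space :: ('e, 'e) mfd"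
  have "std_conn X (std_conn Y Z) p c - std_conn Y (std_conn X Z) p c - std_conn (lie_bracket ?M X Y) Z p c = 0"
    if V: "openin (mtop ?M) V" and X: "X \<in> vfields ?M V" and Y: "Y \<in> vfields ?M V" and Z: "Z \<in> vfields ?M V" and p: "p \<in> V"
    for V X Y Z p c
  proof (cases "c = std_chart")
    case True
    let ?x = "\<lambda>q. X q std_chart" and ?y = "\<lambda>q. Y q std_chart" and ?z = "\<lambda>q. Z q std_chart"
    have op: "open V" using V by (simp add: affine_space_simps)
    note sm = vfields_affine_smooth[OF X] vfields_affine_smooth[OF Y] vfields_affine_smooth[OF Z]
    have D: "der (\<lambda>q. der ?z q (w q)) p u = der (\<lambda>q. der ?z q (w p)) p u + der ?z p (der w p u)" if w: "smooth_on V w" for w u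
      using der_eqI[OF has_derivative_linear_family[OF op p smooth_on_linear_der[OF sm(3)]
            smooth_on_differentiable[OF smooth_on_der[OF sm(3)] p] smooth_on_has_derivative[OF w p]]] by simp
    have lie: "lie_bracket ?M X Y p std_chart = der ?y p (?x p) - der ?x p (?y p)"
      by (simp add: lie_bracket_def dirderiv_affine affine_space_simps std_chart_simps)
    show ?thesis
      using second_derivative_symmetric[OF sm(3) op p, of "?y p" "?x p"]
      by (simp add: True std_conn_def lie D sm linear_diff[OF smooth_on_linear_der[OF sm(3) p]])
  qed (simp add: std_conn_def)
  then have "flat_on ?M UNIV (\<lambda>X Y q c. std_conn X Y q c + 0 *\<^sub>R Y q c + 0 *\<^sub>R X q c)"
    unfolding flat_on_def by simp
  moreover have "one_form_on ?M UNIV (\<lambda>p v. 0)"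
    by (simp add: one_form_on_def smooth_fun_def comp_def smooth_on_const)
  ultimately show ?thesis
    unfolding projectively_flat_def
    by (intro ballI exI[of _ UNIV] exI[of _ "\<lambda>p v. 0"]) (simp add: affine_space_simps)
qed

lemma nondegenerateI:
  fixes S :: "('s, real ^ 'n::finite) mfd"
  assumes "nondegenerate_hypersurface S M N i" "CARD('n) \<ge> 2"
  shows "nondegenerate S M i N"
  using assms unfolding nondegenerate_hypersurface_def
  by unfold_locales (auto simp: immersion_def)

theorem theorem2p14:
  fixes S :: "('s, real ^ 'n) mfd"
    and M :: "('m, real ^ 'n option) mfd"
    and N :: "('m, real ^ 'n option) conn"
    and i :: "'s \<Rightarrow> 'm"
    and j :: "'s \<Rightarrow> real ^ 'n option"
  assumes dim: "CARD('n::finite) \<ge> 2"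
  shows
    "(nondegenerate_hypersurface S M N i \<longrightarrow>
       (\<exists>!W. aligned_line_field S M N i W) \<and>
       (\<forall>W C \<Psi>. aligned_line_field S M N i W \<and> co_orientation S M i C \<and>
          volume_form M \<Psi> \<and> preserves_form M N \<Psi> \<longrightarrow>
          (\<exists>!T. unimodular_section S M N i \<Psi> C W T)) \<and>
       (\<forall>W C \<Psi> T. aligned_line_field S M N i W \<and> co_orientation S M i C \<and>
          volume_form M \<Psi> \<and> preserves_form M N \<Psi> \<and> projectively_flat M N \<and>
          unimodular_section S M N i \<Psi> C W T \<longrightarrow>
          preserves_density S (induced_conn S M N i (line_spanned T))
            (induced_density S M i \<Psi> T) \<and>
          preserves_density S (induced_conn S M N i (line_spanned T))
            (metric_density (induced_metric S M N i T)))) \<and>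
     (nondegenerate_hypersurface S affine_space std_conn j \<longrightarrow>
       (\<forall>W C T. aligned_line_field S affine_space std_conn j W \<and>
          co_orientation S affine_space j C \<and>
          unimodular_section S affine_space std_conn j std_volume C W T \<longrightarrow>
          is_equiaffine_normal S j C T))"
proof (intro conjI impI allI, goal_cases)
  case 1
  then interpret nondegenerate S M i N by (rule nondegenerateI[OF _ dim])
  show ?case by (rule aligned_line_field_ex1)
next
  case (2 W C \<Psi>)
  then interpret nondegenerate S M i N by (intro nondegenerateI[OF _ dim])
  interpret volume_hypersurface S M i N \<Psi>
    using 2 by unfold_locales simp
  show ?case using 2 by (intro unimodular_section_ex1) (auto simp: aligned_line_field_def)
next
  case (3 W C \<Psi> T)
  then interpret nondegenerate S M i N by (intro nondegenerateI[OF _ dim])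
  interpret parallel_hypersurface S M i N \<Psi>
    using 3 by unfold_locales simp_all
  show ?case by (rule unimodular_section_preserves(1)) (use 3 in auto)
next
  case (4 W C \<Psi> T)
  then interpret nondegenerate S M i N by (intro nondegenerateI[OF _ dim])
  interpret parallel_hypersurface S M i N \<Psi>
    using 4 by unfold_locales simp_all
  show ?case by (rule unimodular_section_preserves(2)) (use 4 in auto)
next
  case (5 W C T)
  then interpret nondegenerate S affine_space j std_conn by (intro nondegenerateI[OF _ dim])
  interpret parallel_hypersurface S affine_space j std_conn std_volume
    using volume_form_affine preserves_form_affine by unfold_locales
  have a: "aligned_line_field S affine_space std_conn j W" "co_orientation S affine_space j C"
    and T: "unimodular_section S affine_space std_conn j std_volume C W T" using 5 by auto
  have tl: "transverse_line_field S affine_space j W" using a by (simp add: aligned_line_field_def)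
  have "equiaffine_transversal S j C T"
    using unimodular_section_preserves(1)[OF a projectively_flat_affine T] T
    by (simp add: equiaffine_transversal_def unimodular_section_def)
  \<comment> \<open>A competing equiaffine transversal is a unimodular section of the same line
    field \<open>W\<close>, and such a section is unique.\<close>
  moreover have "\<forall>T'. equiaffine_transversal S j C T' \<longrightarrow> T' = T"
  proof (intro allI impI)
    fix T' assume T': "equiaffine_transversal S j C T'"
    have "unimodular_section S affine_space std_conn j std_volume C W T'"
      using T' by (intro parallel_unimodular_unique[OF a projectively_flat_affine]) (auto simp: equiaffine_transversal_def)
    then show "T' = T" using unimodular_section_ex1[OF tl a(2)] T by blast
  qed
  ultimately show ?case unfolding is_equiaffine_normal_def by (rule conjI)
qed

end
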